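(* Let $V$ be an even (real-valued) almost-periodic function on $\mathbb{R}$ or on $\mathbb{Z}$, let $\Omega$ be its hull, and for $\omega\in\Omega$ let $V_\omega$ be the corresponding potential and $H_\omega$ the corresponding operator, namely $$H_\omega=-\frac{d^2}{dx^2}+V_\omega(x)\ \text{ on } L^2(\mathbb{R})\quad(\mathbb{R}\text{ case}),\qquad (H_\omega u)(n)=u(n+1)+u(n-1)+V_\omega(n)u(n)\ \text{ on } \ell^2(\mathbb{Z})\quad(\mathbb{Z}\text{ case}).$$ Then: (a) There is a dense $G_\delta$ subset of $\Omega$ such that for every $\omega$ in it, $H_\omega$ has no point spectrum. (b) If for some point $\omega_0\in\Omega$ the operator $H_{\omega_0}$ has no absolutely continuous spectrum, then there is a dense $G_\delta$ subset of $\Omega$ such that for every $\omega$ in it, $H_\omega$ has purely singular continuous spectrum.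
   Context: Almost periodic is in the sense of Bohr (in the $\mathbb{R}$ case, $V$ is continuous): the set of translates of $V$ is relatively compact in the sup norm $\|\cdot\|_\infty$. The hull $\Omega$ of $V$ is the closure in $\|\cdot\|_\infty$ of the set of translates of $V$ (by elements of $\mathbb{R}$, respectively $\mathbb{Z}$); it is a compact metric space in this (Bohr) topology, and $V_\omega$ denotes the function that the point $\omega\in\Omega$ represents. Even means $V(-x)=V(x)$ for all $x$. "No point spectrum" means $H_\omega$ has no eigenvalues (with eigenvectors in $L^2(\mathbb{R})$, respectively $\ell^2(\mathbb{Z})$). For a self-adjoint operator $D$, $d\mu_D^\psi$ is the spectral measure given by $(\psi,e^{isD}\psi)=\int e^{isE}\,d\mu_D^\psi(E)$; $D$ has no absolutely continuous spectrum if no $d\mu_D^\psi$ has a nonzero absolutely continuous part, and has purely singular continuous spectrum if every $d\mu_D^\psi$ has neither a pure point part nor an absolutely continuous part. *)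

theory Defs
  imports "HOL-Probability.Probability"
begin

section \<open>Almost periodic functions and their hull\<close>

text \<open>
  The type \<open>'a \<Rightarrow>\<^sub>C real\<close> carries the sup metric. On \<open>int\<close> the topology is discrete, so
  continuity is vacuous there. Boundedness is no restriction: a function
  whose translates are relatively compact in the sup norm is bounded.
\<close>

definition translate ::
  "'a::topological_monoid_add \<Rightarrow> ('a \<Rightarrow>\<^sub>C real) \<Rightarrow> ('a \<Rightarrow>\<^sub>C real)" where
  "translate t V = Bcontfun (\<lambda>x. V (x + t))"

lemma translate_apply [simp]: "apply_bcontfun (translate t V) x = V (x + t)"
proof -
  have "continuous_on UNIV (\<lambda>x. V (x + t))"
    by (rule continuous_on_compose2[OF continuous_on_apply_bcontfun[of UNIV V]])
       (auto intro: continuous_on_add continuous_on_id continuous_on_const)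
  moreover have "bounded (range (\<lambda>x. V (x + t)))"
    by (rule bounded_subset[OF bounded_apply_bcontfun[of V]]) auto
  ultimately have "(\<lambda>x. V (x + t)) \<in> bcontfun"
    by (simp add: bcontfun_def)
  then show ?thesis
    by (simp add: translate_def Bcontfun_inverse)
qed

definition bohr_hull :: "('a::topological_monoid_add \<Rightarrow>\<^sub>C real) \<Rightarrow> ('a \<Rightarrow>\<^sub>C real) set" where
  "bohr_hull V = closure (range (\<lambda>t. translate t V))"

definition almost_periodic :: "('a::topological_monoid_add \<Rightarrow>\<^sub>C real) \<Rightarrow> bool" where
  "almost_periodic V \<longleftrightarrow> compact (closure (range (\<lambda>t. translate t V)))"

definition dense_gdelta_in :: "'b topology \<Rightarrow> 'b set \<Rightarrow> bool" where
  "dense_gdelta_in X G \<longleftrightarrow> gdelta_in X G \<and> X closure_of G = topspace X"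


section \<open>Operators on \<open>L\<^sup>2\<close>\<close>

text \<open>
  Elements of \<open>L\<^sup>2\<close> are represented by functions, identified when they agree almost everywhere;
  the sequence space over \<open>int\<close> is the case \<open>M = count_space UNIV\<close>, where this
  identification is equality.
\<close>

definition L2 :: "'a measure \<Rightarrow> ('a \<Rightarrow> complex) set" where
  "L2 M = {f \<in> borel_measurable M. integrable M (\<lambda>x. (cmod (f x))\<^sup>2)}"

definition L2_inner :: "'a measure \<Rightarrow> ('a \<Rightarrow> complex) \<Rightarrow> ('a \<Rightarrow> complex) \<Rightarrow> complex" where
  "L2_inner M f g = (LINT x|M. cnj (f x) * g x)"

definition L2_norm :: "'a measure \<Rightarrow> ('a \<Rightarrow> complex) \<Rightarrow> real" where
  "L2_norm M f = sqrt (LINT x|M. (cmod (f x))\<^sup>2)"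

text \<open>
  A possibly unbounded operator on \<open>L\<^sup>2\<close> is given by its graph, which is a set of pairs of
  representatives closed under almost everywhere equality in both components.
\<close>

type_synonym 'a operator = "(('a \<Rightarrow> complex) \<times> ('a \<Rightarrow> complex)) set"

definition no_point_spectrum :: "'a measure \<Rightarrow> 'a operator \<Rightarrow> bool" where
  "no_point_spectrum M D \<longleftrightarrow>
     \<not> (\<exists>(E::complex). \<exists>\<psi>\<in>L2 M. \<not> (AE x in M. \<psi> x = 0) \<and> (\<psi>, \<lambda>x. E * \<psi> x) \<in> D)"


section \<open>Spectral measures\<close>

text \<open>A linear isometric representation of the group of reals is automatically unitary.\<close>

definition unitary_group ::
  "'a measure \<Rightarrow> (real \<Rightarrow> ('a \<Rightarrow> complex) \<Rightarrow> ('a \<Rightarrow> complex)) \<Rightarrow> bool" where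
  "unitary_group M U \<longleftrightarrow>
     (\<forall>s. \<forall>f\<in>L2 M. U s f \<in> L2 M \<and> L2_norm M (U s f) = L2_norm M f) \<and>
     (\<forall>s. \<forall>f\<in>L2 M. \<forall>g\<in>L2 M. \<forall>a b.
        AE x in M. U s (\<lambda>y. a * f y + b * g y) x = a * U s f x + b * U s g x) \<and>
     (\<forall>f\<in>L2 M. AE x in M. U 0 f x = f x) \<and>
     (\<forall>s t. \<forall>f\<in>L2 M. AE x in M. U (s + t) f x = U s (U t f) x) \<and>
     (\<forall>f\<in>L2 M. ((\<lambda>s. L2_norm M (\<lambda>x. U s f x - f x)) \<longlongrightarrow> 0) (at 0))"

text \<open>
  For self-adjoint \<open>D\<close>, \<open>exp (i s D)\<close> is the unique strongly continuous unitary group with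
  infinitesimal generator \<open>i D\<close> (Stone's theorem).
\<close>

definition is_exp_group ::
  "'a measure \<Rightarrow> 'a operator \<Rightarrow> (real \<Rightarrow> ('a \<Rightarrow> complex) \<Rightarrow> ('a \<Rightarrow> complex)) \<Rightarrow> bool" where
  "is_exp_group M D U \<longleftrightarrow> unitary_group M U \<and>
     (\<forall>f g. (f, g) \<in> D \<longleftrightarrow> f \<in> L2 M \<and> g \<in> L2 M \<and>
        ((\<lambda>s. L2_norm M (\<lambda>x. (U s f x - f x) / complex_of_real s - \<i> * g x)) \<longlongrightarrow> 0) (at 0))"

text \<open>
  \<open>char \<mu> s\<close> is the integral of \<open>exp (i s E)\<close> with respect to \<open>\<mu>\<close>; it determines a finite Borel
  measure uniquely, and for self-adjoint \<open>D\<close> such a measure exists.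
\<close>

definition spectral_measure :: "'a measure \<Rightarrow> 'a operator \<Rightarrow> ('a \<Rightarrow> complex) \<Rightarrow> real measure" where
  "spectral_measure M D \<psi> = (THE \<mu>. finite_measure \<mu> \<and> sets \<mu> = sets borel \<and>
     (\<exists>U. is_exp_group M D U \<and> (\<forall>s. L2_inner M \<psi> (U s \<psi>) = char \<mu> s)))"

definition lebesgue_decomposition ::
  "real measure \<Rightarrow> real measure \<Rightarrow> real measure \<Rightarrow> real measure \<Rightarrow> bool" where
  "lebesgue_decomposition \<mu> ac sc pp \<longleftrightarrow>
     sets ac = sets borel \<and> sets sc = sets borel \<and> sets pp = sets borel \<and>
     (\<forall>A\<in>sets borel. emeasure \<mu> A = emeasure ac A + emeasure sc A + emeasure pp A) \<and>
     absolutely_continuous lborel ac \<and>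
     (\<exists>N\<in>null_sets lborel. emeasure sc (- N) = 0) \<and> (\<forall>x. emeasure sc {x} = 0) \<and>
     (\<exists>C. countable C \<and> emeasure pp (- C) = 0)"

definition has_ac_part :: "real measure \<Rightarrow> bool" where
  "has_ac_part \<mu> \<longleftrightarrow> (\<exists>ac sc pp. lebesgue_decomposition \<mu> ac sc pp \<and> emeasure ac UNIV \<noteq> 0)"

definition has_pp_part :: "real measure \<Rightarrow> bool" where
  "has_pp_part \<mu> \<longleftrightarrow> (\<exists>ac sc pp. lebesgue_decomposition \<mu> ac sc pp \<and> emeasure pp UNIV \<noteq> 0)"

definition no_ac_spectrum :: "'a measure \<Rightarrow> 'a operator \<Rightarrow> bool" where
  "no_ac_spectrum M D \<longleftrightarrow> (\<forall>\<psi>\<in>L2 M. \<not> has_ac_part (spectral_measure M D \<psi>))"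

definition purely_sc_spectrum :: "'a measure \<Rightarrow> 'a operator \<Rightarrow> bool" where
  "purely_sc_spectrum M D \<longleftrightarrow>
     (\<forall>\<psi>\<in>L2 M. \<not> has_pp_part (spectral_measure M D \<psi>) \<and>
                 \<not> has_ac_part (spectral_measure M D \<psi>))"


section \<open>Schroedinger operators\<close>

definition test_function :: "(real \<Rightarrow> real) \<Rightarrow> bool" where
  "test_function \<phi> \<longleftrightarrow>
     (\<forall>n x. (deriv ^^ n) \<phi> field_differentiable at x) \<and> compact (closure {x. \<phi> x \<noteq> 0})"

definition weak_derivative :: "(real \<Rightarrow> complex) \<Rightarrow> (real \<Rightarrow> complex) \<Rightarrow> bool" where
  "weak_derivative f f' \<longleftrightarrow> (\<forall>\<phi>. test_function \<phi> \<longrightarrow>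
     (LINT x|lborel. f x * complex_of_real (deriv \<phi> x)) =
       - (LINT x|lborel. f' x * complex_of_real (\<phi> x)))"

text \<open>
  \<open>- d\<^sup>2/dx\<^sup>2 + V\<close> is taken on the Sobolev space \<open>H\<^sup>2\<close> of the line, on which it is self-adjoint
  since \<open>V\<close> is bounded and real-valued.
\<close>

definition schroedinger_real :: "(real \<Rightarrow>\<^sub>C real) \<Rightarrow> real operator" where
  "schroedinger_real V = {(f, g). f \<in> L2 lborel \<and> g \<in> L2 lborel \<and>
     (\<exists>f'\<in>L2 lborel. \<exists>f''\<in>L2 lborel. weak_derivative f f' \<and> weak_derivative f' f'' \<and>
        (AE x in lborel. g x = - f'' x + complex_of_real (V x) * f x))}"

definition schroedinger_int :: "(int \<Rightarrow>\<^sub>C real) \<Rightarrow> int operator" where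
  "schroedinger_int V = {(u, v). u \<in> L2 (count_space UNIV) \<and>
     v = (\<lambda>n. u (n + 1) + u (n - 1) + complex_of_real (V n) * u n)}"

end

theory Submission
 imports Defs "HOL-Real_Asymp.Real_Asymp"
begin

text \<open>
 (a) Evenness makes the translate of \<open>V\<close> by \<open>s\<close> symmetric about \<open>-s\<close>, and by almost periodicity translates by
 arbitrarily large \<open>s\<close> are dense in the hull. By Baire's theorem a generic \<open>\<omega>\<close> is, for infinitely many centers \<open>t\<close>,
 symmetric about \<open>t\<close> up to an error \<open>exp (- t\<^sup>2)\<close>. If \<open>u\<close> were an eigenfunction, the Wronskian of \<open>u\<close> and its
 reflection would be tiny, so \<open>u\<close> or \<open>u'\<close> would be tiny at \<open>t\<close>; then \<open>u\<close> is nearly odd or even about \<open>t\<close> (Gronwall),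
 so \<open>u s\<close> is comparable to \<open>u (2 t - s)\<close>, which tends to 0, and \<open>u = 0\<close>.

 (b) For a fixed vector the spectral measure depends continuously on \<open>\<omega>\<close>, and being singular is a
 \<open>G\<^sub>\<delta>\<close> condition on a measure. It holds on the orbit of \<open>\<omega>\<^sub>0\<close>, which is dense, hence on a dense
 \<open>G\<^sub>\<delta>\<close> for all vectors of a countable total set, and the vectors with singular spectral measure
 form a closed subspace. Intersecting with the set from (a) removes the atoms as well.

 Stone's theorem is replaced by a generation theorem: \<open>\<i> D\<close> is a skew graph with surjective \<open>1 - h \<i> D\<close> on \<open>L\<^sup>2\<close> as a
 real Hilbert space, and powers of Cayley transforms converge to the group; Bochner's theorem gives
 the spectral measures.
\<close>

text \<open>\<open>spectral_measure\<close> is a definite description over all groups generated by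
  \<open>\<i> D\<close>. Nothing can be said about it before such a group is shown to exist and to
  be unique, and its matrix elements to be characteristic functions. With the real inner product,
  skewness is the single identity f . A f = 0; complex linearity returns because the group commutes
  with multiplication by scalars.

  The operators over the hull share one domain and differ by bounded multiplications, whose norm is
  at most the sup distance of the potentials. This gives continuity of the groups in
  \<open>\<omega>\<close> without any resolvent calculus.

  The error exp(-t^2) is chosen to beat exp(C t) for every C at once: the Gronwall rate C depends on
  the energy, while one generic set of potentials has to exclude all energies.

  In (b) the orbit of \<open>\<omega>\<^sub>0\<close> is dense because translation is an isometry of
  the sup norm, and the operators over it are unitarily equivalent to the one at
  \<open>\<omega>\<^sub>0\<close>.\<close>

notation (input) scaleR (infixr "*R" 75)

lemmas lint_cong = Bochner_Integration.integral_cong and lintegrable_bound = Bochner_Integration.integrable_bound and lint_add = Bochner_Integration.integral_add and lintegrable_add = Bochner_Integration.integrable_add and lint_sum = Bochner_Integration.integral_sum and lint_cnj = Bochner_Integration.integral_cnj and lint_diff = Bochner_Integration.integral_diff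

notation (input) tendsto (infixr "--->" 55)

abbreviation (input) seq_tendsto ("((_)/ ----> (_))" [60, 60] 60) where "X ----> L == (X ---> L) sequentially"

abbreviation cor :: "real => complex" where "cor \<equiv> complex_of_real"

section \<open>Skew operators and isometry groups\<close>

lemma norm_add3_le:
 fixes a b c :: "'h::real_normed_vector"
 shows "norm (a + b + c) <= norm a + norm b + norm c" using norm_triangle_ineq[of "a + b" c] norm_triangle_ineq[of a b] by linarith

lemma double_scaleR: "h *R q + h *R q = (2 * h) *R (q::'h::real_vector)" by (metis mult_2 scaleR_add_left)

lemma funpow_commute:
 assumes "!!x. X (Y x) = Y (X x)"
 shows "(X ^^ n) ((Y ^^ m) x) = (Y ^^ m) ((X ^^ n) x)"
proof -
 have 1: "X ((Y ^^ m) x) = (Y ^^ m) (X x)" for x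
  by (induction m arbitrary: x) (auto simp: assms)
 show ?thesis
  by (induction n arbitrary: x) (auto simp: 1)
qed

lemma funpow_comp_commute:
 assumes "!!x. X (Y x) = Y (X x)"
 shows "((%x. X (Y x)) ^^ n) x = (X ^^ n) ((Y ^^ n) x)"
proof (induction n arbitrary: x)
 case (Suc n)
 have "Y ((X ^^ n) y) = (X ^^ n) (Y y)" for y
  using funpow_commute[of X Y n 1 y, OF assms] by simp
 then show ?case using Suc by simp
qed simp

lemma linear_funpow:
 fixes T :: "'h::real_normed_vector => 'h"
 assumes "linear T" shows "linear (T ^^ n)"
proof (induction n)
 case 0
 then show ?case by (simp add: linear_ident)
next
 case (Suc n)
 then show ?case using linear_compose[OF Suc assms] by (simp add: comp_def)
qed

lemma norm_funpow:
 fixes T :: "'h::real_normed_vector => 'h"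
 assumes "!!x. norm (T x) = norm x" shows "norm ((T ^^ n) x) = norm x" by (induction n) (auto simp: assms)

text \<open>Telescoping: exchange one factor \<open>X\<close> for \<open>Y\<close> at a time. The
  remaining factors are isometries, so each exchange costs at most
  \<open>norm (X f - Y f)\<close>.\<close>

lemma norm_funpow_diff_le:
 fixes X Y :: "'h::real_normed_vector => 'h"
 assumes lX: "linear X" and lY: "linear Y"
  and nX: "!!x. norm (X x) = norm x" and nY: "!!x. norm (Y x) = norm x"
  and c: "!!x. X (Y x) = Y (X x)"
 shows "norm ((X ^^ n) f - (Y ^^ n) f) <= real n * norm (X f - Y f)"
proof (induction n)
 case (Suc n)
 have e1: "(X ^^ Suc n) f - (X ^^ n) (Y f) = (X ^^ n) (X f - Y f)" by (simp add: linear_diff[OF linear_funpow[OF lX]] funpow_swap1)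
 have e2: "(X ^^ n) (Y f) - (Y ^^ Suc n) f = Y ((X ^^ n) f - (Y ^^ n) f)" using funpow_commute[of X Y n 1 f, OF c] by (simp add: linear_diff[OF lY])
 have "norm ((X ^^ Suc n) f - (Y ^^ Suc n) f)
   <= norm ((X ^^ Suc n) f - (X ^^ n) (Y f)) + norm ((X ^^ n) (Y f) - (Y ^^ Suc n) f)"
  using dist_triangle[of "(X ^^ Suc n) f" "(Y ^^ Suc n) f" "(X ^^ n) (Y f)"] by (simp only: dist_norm)
 also have "... = norm (X f - Y f) + norm ((X ^^ n) f - (Y ^^ n) f)" unfolding e1 e2 by (simp add: norm_funpow nX nY)
 also have "... <= real (Suc n) * norm (X f - Y f)" using Suc by (simp add: algebra_simps)
 finally show ?case .
qed simp

text \<open>A uniform operator bound lets a strong limit be checked on a dense set, here mostly the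
  domain of a generator or of its square.\<close>

lemma tendsto_zero_dense:
 fixes T :: "'i => 'h::real_normed_vector => 'k::real_normed_vector"
 assumes lin: "!!i. linear (T i)" and bd: "!!i x. norm (T i x) <= B * norm x"
  and D: "closure D = UNIV" and conv: "!!x. x \<in> D ==> ((%i. T i x) ---> 0) F"
 shows "((%i. T i x) ---> 0) F"
proof (rule tendstoI)
 fix e :: real assume e: "e > 0"
 have "x \<in> closure D" using D by simp
 then obtain y where y: "y \<in> D" "dist y x < e / (2 * (\<bar>B\<bar> + 1))"
  using e unfolding closure_approachable by (metis abs_ge_zero add_nonneg_pos divide_pos_pos mult_pos_pos zero_less_numeral zero_less_one)
 have "\<forall>\<^sub>F i in F. dist (T i y) 0 < e / 2" using conv[OF y(1)] e by (intro tendstoD) auto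
 then show "\<forall>\<^sub>F i in F. dist (T i x) 0 < e"
 proof eventually_elim
  case (elim i)
  have "norm (T i x) <= norm (T i y) + norm (T i (x - y))" using norm_triangle_ineq[of "T i y" "T i (x - y)"] by (simp add: linear_diff[OF lin])
  also have "norm (T i (x - y)) <= (\<bar>B\<bar> + 1) * norm (x - y)" by (rule order_trans[OF bd]) (auto intro!: mult_right_mono)
  also have "... <= (\<bar>B\<bar> + 1) * (e / (2 * (\<bar>B\<bar> + 1)))"
   using y(2) by (intro mult_left_mono) (auto simp: dist_norm norm_minus_commute)
  also have "... = e / 2" by (simp add: field_simps)
  finally show ?case using elim by simp
 qed
qed

section \<open>Strongly continuous isometry groups and their generators\<close>

definition isometry_group :: "(real => 'h::real_inner => 'h) => bool" where
 "isometry_group U \<longleftrightarrow>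
   (ALL s. linear (U s)) & (ALL s f. norm (U s f) = norm f) & (ALL f. U 0 f = f) \<and>
   (ALL s t f. U (s + t) f = U s (U t f)) & (ALL f. ((%s. U s f) ---> f) (at 0))"

definition generator :: "(real => 'h::real_inner => 'h) => ('h \<times> 'h) set" where
 "generator U = {(f, g). ((%s. (U s f - f) /\<^sub>R s) ---> g) (at 0)}"

lemma isometry_groupD:
 assumes "isometry_group U"
 shows "linear (U s)" "norm (U s f) = norm f" "U 0 f = f" "U (s + t) f = U s (U t f)"
  "((%s. U s f) ---> f) (at 0)" using assms unfolding isometry_group_def by auto

text \<open>Polarization: over the reals the norms of \<open>f\<close>, \<open>g\<close> and
  \<open>f + g\<close> determine the inner product.\<close>

lemma isometry_group_inner:
 assumes "isometry_group U"
 shows "U s f \<bullet> U s g = f \<bullet> g"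
proof -
 have "norm (U s f + U s g) = norm (f + g)" by (metis assms isometry_groupD(1,2) linear_add)
 then show ?thesis
  using isometry_groupD(2)[OF assms] by (simp add: dot_norm)
qed

lemma isometry_group_continuous:
 assumes U: "isometry_group U"
 shows "isCont (%s. U s f) t"
proof -
 have "((%h. U t (U h f)) ---> U t f) (at 0)"
 proof -
  have "((%h. U t (U h f) - U t f) ---> 0) (at 0)"
  proof (rule Lim_null_comparison)
   show "\<forall>\<^sub>F h in at 0. norm (U t (U h f) - U t f) <= norm (U h f - f)"
    using isometry_groupD(2)[OF U] by (simp add: linear_diff[OF isometry_groupD(1)[OF U], symmetric])
   show "((%h. norm (U h f - f)) ---> 0) (at 0)" using isometry_groupD(5)[OF U] by (intro tendsto_norm_zero) (simp add: LIM_zero)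
  qed
  then show ?thesis by (simp add: LIM_zero_iff)
 qed
 then show ?thesis
  by (simp add: isCont_def LIM_offset_zero_iff[of t] isometry_groupD(4)[OF U, symmetric])
qed

lemma generator_subspace:
 assumes U: "isometry_group U"
 shows "subspace (generator U)"
proof (rule subspaceI)
 show "0 \<in> generator U" by (simp add: generator_def zero_prod_def linear_0[OF isometry_groupD(1)[OF U]])
 fix x y assume "x \<in> generator U" "y \<in> generator U"
 then obtain f g f' g' where "x = (f, g)" "y = (f', g')"
  "((%s. (U s f - f) /\<^sub>R s) ---> g) (at 0)" "((%s. (U s f' - f') /\<^sub>R s) ---> g') (at 0)" by (auto simp: generator_def)
 then show "x + y \<in> generator U" using tendsto_add[of "%s. (U s f - f) /\<^sub>R s" g "at 0" "%s. (U s f' - f') /\<^sub>R s" g']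
  by (simp add: generator_def linear_add[OF isometry_groupD(1)[OF U]] algebra_simps)
next
 fix c x assume "x \<in> generator U"
 then obtain f g where "x = (f, g)" "((%s. (U s f - f) /\<^sub>R s) ---> g) (at 0)" by (auto simp: generator_def)
 then show "c *R x \<in> generator U" using tendsto_scaleR[OF tendsto_const[of c], of "%s. (U s f - f) /\<^sub>R s" g "at 0"]
  by (simp add: generator_def linear_scale[OF isometry_groupD(1)[OF U]] algebra_simps)
qed

lemma generator_skew:
 assumes U: "isometry_group U" and fg: "(f, g) \<in> generator U"
 shows "f \<bullet> g = 0"
proof -
 have lim: "((%s. (U s f - f) /\<^sub>R s) ---> g) (at 0)" using fg by (simp add: generator_def)
 have "((%s. f \<bullet> ((U s f - f) /\<^sub>R s)) ---> f \<bullet> g) (at 0)" by (intro tendsto_intros lim)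
 \<comment> \<open>Expanding \<open>norm (U s f) = norm f\<close> shows that f . (U s f - f) is
   minus half the square of \<open>norm (U s f - f)\<close>. After division by \<open>s\<close> one
   factor still tends to 0 while the other tends to \<open>g\<close>.\<close>
 moreover have "((%s. - (1/2) * ((U s f - f) \<bullet> ((U s f - f) /\<^sub>R s))) ---> - (1/2) * (0 \<bullet> g)) (at 0)"
  using isometry_groupD(5)[OF U, of f] by (intro tendsto_intros lim) (simp add: LIM_zero)
 moreover have "f \<bullet> ((U s f - f) /\<^sub>R s) = - (1/2) * ((U s f - f) \<bullet> ((U s f - f) /\<^sub>R s))" for s
  using isometry_group_inner[OF U, of s f f] by (simp add: inner_diff inner_commute field_simps diff_divide_distrib add_divide_distrib)
 ultimately show ?thesis
  using tendsto_unique[OF at_neq_bot] by fastforce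
qed

lemma generator_invariant:
 assumes U: "isometry_group U" and fg: "(f, g) \<in> generator U"
 shows "(U t f, U t g) \<in> generator U"
proof -
 have lim: "((%s. (U s f - f) /\<^sub>R s) ---> g) (at 0)" using fg by (simp add: generator_def)
 have "((%s. U t ((U s f - f) /\<^sub>R s) - U t g) ---> 0) (at 0)"
 proof (rule Lim_null_comparison)
  show "\<forall>\<^sub>F s in at 0. norm (U t ((U s f - f) /\<^sub>R s) - U t g) <= norm ((U s f - f) /\<^sub>R s - g)"
   using isometry_groupD(2)[OF U] by (simp add: linear_diff[OF isometry_groupD(1)[OF U], symmetric])
  show "((%s. norm ((U s f - f) /\<^sub>R s - g)) ---> 0) (at 0)" using lim by (intro tendsto_norm_zero) (simp add: LIM_zero)
 qed
 then have "((%s. U t ((U s f - f) /\<^sub>R s)) ---> U t g) (at 0)" by (simp add: LIM_zero_iff)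
 moreover have "U t ((U s f - f) /\<^sub>R s) = (U s (U t f) - U t f) /\<^sub>R s" for s
  using isometry_groupD(4)[OF U, of s t f] isometry_groupD(4)[OF U, of t s f]
  by (simp add: linear_diff[OF isometry_groupD(1)[OF U]] linear_scale[OF isometry_groupD(1)[OF U]] add.commute)
 ultimately show ?thesis by (simp add: generator_def)
qed

lemma norm_quotient_diff:
 fixes x v :: "'h::real_normed_vector"
 assumes "s ~= 0" shows "norm (x /\<^sub>R s - v) = norm (x - s *R v) / \<bar>s\<bar>"
proof -
 have "x /\<^sub>R s - v = inverse s *R (x - s *R v)" using assms by (simp add: scaleR_diff_right)
 then show ?thesis by (simp add: divide_inverse mult.commute)
qed

lemma generator_has_vector_derivative:
 assumes U: "isometry_group U" and fg: "(f, g) \<in> generator U"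
 shows "((%s. U s f) has_vector_derivative U t g) (at t)"
proof -
 have "((%s. (U s (U t f) - U t f) /\<^sub>R s) ---> U t g) (at 0)" using generator_invariant[OF assms, of t] by (simp add: generator_def)
 then have "((%s. (U (t + s) f - U t f) /\<^sub>R s) ---> U t g) (at 0)" by (simp add: isometry_groupD(4)[OF U, symmetric] add.commute)
 then show ?thesis
  unfolding has_vector_derivative_def has_derivative_at
  apply (auto intro!: bounded_linear_scaleR_left)
  apply (rule tendsto_norm_zero_cancel)
  apply (drule LIM_zero)
  apply (drule tendsto_norm_zero)
  apply (erule Lim_transform_eventually)
  apply (auto simp: eventually_at_filter intro!: always_eventually)
  apply (simp add: norm_quotient_diff)
  done
qed

text \<open>The square norm of the difference of two groups has a derivative controlled by the difference
 of the generators, since the common skew part drops out.\<close>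

lemma isometry_group_diff_bound:
 assumes U: "isometry_group U" and U': "isometry_group U'"
  and dom: "!!f g. (f, g) \<in> generator U' ==> EX g'. (f, g') \<in> generator U"
  and diff: "!!f g g'. (f, g) \<in> generator U' ==> (f, g') \<in> generator U ==> norm (g - g') <= \<delta> * norm f"
  and fg: "(f, g) \<in> generator U'"
 shows "(norm (U s f - U' s f))\<^sup>2 <= 4 * \<delta> * \<bar>s\<bar> * (norm f)\<^sup>2"
proof -
 obtain g' where fg': "(f, g') \<in> generator U" using dom[OF fg] by blast
 define \<phi> where "\<phi> s = (U s f - U' s f) \<bullet> (U s f - U' s f)" for s
 define \<psi> where "\<psi> s = 2 * ((U s f - U' s f) \<bullet> (U s g' - U' s g))" for s
 have der: "(\<phi> has_real_derivative \<psi> s) (at s)" for s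
 proof -
  have 1: "((%s. U s f - U' s f) has_derivative (%h. h *R (U s g' - U' s g))) (at s)"
   using generator_has_vector_derivative[OF U fg', of s] generator_has_vector_derivative[OF U' fg, of s] unfolding has_vector_derivative_def
   by (auto intro!: derivative_eq_intros simp: scaleR_diff_right)
  show ?thesis
   unfolding \<phi>_def \<psi>_def has_field_derivative_def
   by (rule has_derivative_eq_rhs[OF has_derivative_inner[OF 1 1]]) (auto simp: inner_commute)
 qed
 have bound: "\<bar>\<psi> s\<bar> <= 4 * \<delta> * (norm f)\<^sup>2" for s
 proof -
  have a: "(U' s f, U' s g) \<in> generator U'" by (rule generator_invariant[OF U' fg])
  then obtain k where k: "(U' s f, k) \<in> generator U" using dom by blast
  have "(U s f - U' s f, U s g' - k) \<in> generator U" using subspace_diff[OF generator_subspace[OF U] generator_invariant[OF U fg', of s] k] by simp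
  then have z: "(U s f - U' s f) \<bullet> (U s g' - k) = 0" by (rule generator_skew[OF U])
  have "\<psi> s = 2 * ((U s f - U' s f) \<bullet> (k - U' s g))" using z by (simp add: \<psi>_def inner_diff algebra_simps)
  also have "\<bar>...\<bar> <= 2 * (norm (U s f - U' s f) * norm (k - U' s g))" using Cauchy_Schwarz_ineq2[of "U s f - U' s f" "k - U' s g"] by simp
  also have "... <= 2 * ((2 * norm f) * (\<delta> * norm f))"
  proof (intro mult_left_mono mult_mono)
   show "norm (U s f - U' s f) <= 2 * norm f"
    using norm_triangle_ineq4[of "U s f" "U' s f"] isometry_groupD(2)[OF U] isometry_groupD(2)[OF U'] by simp
   show "norm (k - U' s g) <= \<delta> * norm f" using diff[OF a k] isometry_groupD(2)[OF U'] by (simp add: norm_minus_commute)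
  qed auto
  finally show ?thesis by (simp add: power2_eq_square algebra_simps)
 qed
 have "norm (\<phi> s - \<phi> 0) <= 4 * \<delta> * (norm f)\<^sup>2 * norm (s - 0)" by (rule field_differentiable_bound[of UNIV \<phi> \<psi>])
    (auto simp: bound intro: DERIV_subset[OF der])
 moreover have "\<phi> 0 = 0" by (simp add: \<phi>_def isometry_groupD(3)[OF U] isometry_groupD(3)[OF U'])
 ultimately show ?thesis
  by (auto simp: \<phi>_def power2_norm_eq_inner algebra_simps abs_le_iff)
qed

text \<open>The case \<open>\<delta> = 0\<close> of the preceding estimate: the orbits agree on the
  domain, and isometries carry this to its closure.\<close>

lemma isometry_group_unique:
 assumes U: "isometry_group U" and U': "isometry_group U'"
  and eq: "generator U = generator U'" and dense: "closure (fst ` generator U) = UNIV"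
  and single: "!!f g g'. (f, g) \<in> generator U ==> (f, g') \<in> generator U ==> g = g'"
 shows "U s f = U' s f"
proof -
 have "((%i::nat. U s f - U' s f) ---> 0) sequentially"
 proof (rule tendsto_zero_dense[where T = "%i f. U s f - U' s f" and B = 2, OF _ _ dense])
  show "linear (%f. U s f - U' s f)" by (intro linear_compose_sub isometry_groupD(1) U U')
  show "norm (U s x - U' s x) <= 2 * norm x" for x
   using norm_triangle_ineq4[of "U s x" "U' s x"] isometry_groupD(2)[OF U] isometry_groupD(2)[OF U'] by simp
  fix x assume "x \<in> fst ` generator U"
  then obtain y where "(x, y) \<in> generator U'" using eq by auto
  then have "(norm (U s x - U' s x))\<^sup>2 <= 4 * 0 * \<bar>s\<bar> * (norm x)\<^sup>2"
   by (intro isometry_group_diff_bound[OF U U']) (use eq single in auto)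
  then show "((%i::nat. U s x - U' s x) ---> 0) sequentially" by simp
 qed
 then show ?thesis by (simp add: tendsto_const_iff)
qed


text \<open>Skew-adjointness as a condition on the graph. The assumption \<open>skew\<close> alone
  is only skew-symmetry; surjectivity of 1 - h A for both signs of \<open>h\<close> says that both
  deficiency spaces vanish.\<close>

locale skew_operator =
 fixes A :: "('h::{real_inner,complete_space} \<times> 'h) set"
 assumes subspace_graph: "subspace A"
  and skew: "(f, g) \<in> A ==> f \<bullet> g = 0"
  and surj: "h ~= 0 ==> EX f g. (f, g) \<in> A & v = f - h *R g"
  and dense: "closure (fst ` A) = UNIV"
begin

lemma graph_add: "(f, g) \<in> A ==> (f', g') \<in> A ==> (f + f', g + g') \<in> A"
 using subspace_add[OF subspace_graph, of "(f, g)" "(f', g')"] by simp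

lemma graph_diff: "(f, g) \<in> A ==> (f', g') \<in> A ==> (f - f', g - g') \<in> A"
 using subspace_diff[OF subspace_graph, of "(f, g)" "(f', g')"] by simp

lemma graph_scale: "(f, g) \<in> A ==> (c *R f, c *R g) \<in> A" using subspace_scale[OF subspace_graph, of "(f, g)" c] by simp

text \<open>Pythagoras, since \<open>f\<close> and \<open>h *R g\<close> are orthogonal. It makes
  the Cayley transform isometric and the resolvent a contraction.\<close>

lemma norm_graph:
 assumes "(f, g) \<in> A"
 shows "(norm (f + h *R g))\<^sup>2 = (norm f)\<^sup>2 + h\<^sup>2 * (norm g)\<^sup>2"
  "(norm (f - h *R g))\<^sup>2 = (norm f)\<^sup>2 + h\<^sup>2 * (norm g)\<^sup>2" using skew[OF assms] unfolding power2_norm_eq_inner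
 by (simp_all add: inner_add inner_diff inner_commute power2_eq_square)

lemma graph_unique:
 assumes "(f, g) \<in> A" "(f', g') \<in> A" "f - h *R g = f' - h *R g'" "h ~= 0"
 shows "f = f' & g = g'"
proof -
 have "(norm (f - f' - h *R (g - g')))\<^sup>2 = 0" using assms(3) by (simp add: algebra_simps)
 then have "(norm (f - f'))\<^sup>2 + h\<^sup>2 * (norm (g - g'))\<^sup>2 = 0" using norm_graph(2)[OF graph_diff[OF assms(1,2)], of h] by simp
 then show ?thesis using assms(4) by (simp add: add_nonneg_eq_0_iff)
qed

text \<open>Polarizing skewness of (0, g) + (f', g') leaves g . f' = 0, so \<open>g\<close> is
  orthogonal to the dense domain.\<close>

lemma graph_zero:
 assumes "(0, g) \<in> A" shows "g = 0"
proof -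
 have *: "g \<bullet> f' = 0" if "(f', g') \<in> A" for f' g'
  using skew[OF graph_add[OF assms that]] skew[OF that] by (simp add: inner_add inner_commute)
 have "((%i::nat. g \<bullet> g) ---> 0) sequentially"
 proof (rule tendsto_zero_dense[where T = "%i f. g \<bullet> f" and B = "norm g", OF _ _ dense])
  show "linear (%f. g \<bullet> f)" by (simp add: bounded_linear.linear bounded_linear_inner_right)
  show "norm (g \<bullet> x) <= norm g * norm x" for x
   by (simp add: Cauchy_Schwarz_ineq2)
 qed (use * in auto)
 then show ?thesis by (simp add: tendsto_const_iff)
qed

lemma graph_single: "(f, g) \<in> A ==> (f, g') \<in> A ==> g = g'" using graph_diff[of f g f g'] graph_zero[of "g - g'"] by simp

text \<open>The operator (1 + h A)(1 - h A)^-1, which approximates exp(2 h A). The value at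
  \<open>h = 0\<close> is set apart because \<open>surj\<close> provides the inverse only for
  \<open>h ~= 0\<close>.\<close>

definition cayley :: "real => 'h => 'h" where
 "cayley h v = (if h = 0 then v else (THE w. EX f g. (f, g) \<in> A & v = f - h *R g & w = f + h *R g))"

lemma cayley_0 [simp]: "cayley 0 v = v" by (simp add: cayley_def)

lemma cayley_eq:
 assumes "(f, g) \<in> A" shows "cayley h (f - h *R g) = f + h *R g"
proof (cases "h = 0")
 case False
 then show ?thesis
  unfolding cayley_def using graph_unique[OF assms _ _ False] by (simp, intro the_equality) (use assms in blast)+
qed (simp add: cayley_def)

lemma cayley_cases:
 obtains "h = 0" | f g where "h ~= 0" "(f, g) \<in> A" "v = f - h *R g" "cayley h v = f + h *R g" using surj[of h v] cayley_eq[of _ _ h] by metis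

lemma norm_cayley: "norm (cayley h v) = norm v"
proof (cases rule: cayley_cases[where h = h and v = v])
 case (2 f g)
 have "(norm (cayley h v))\<^sup>2 = (norm v)\<^sup>2" unfolding 2(4) unfolding 2(3) using norm_graph[OF 2(2), of h] by simp
 then show ?thesis by simp
qed simp

lemma linear_cayley: "linear (cayley h)"
proof (cases "h = 0")
 case False
 show ?thesis
 proof (rule linearI)
  fix v v' c
  obtain f g where fg: "(f, g) \<in> A" "v = f - h *R g" using surj[OF False] by blast
  obtain f' g' where fg': "(f', g') \<in> A" "v' = f' - h *R g'" using surj[OF False] by blast
  have "v + v' = (f + f') - h *R (g + g')" unfolding fg(2) fg'(2) by (simp add: algebra_simps)
  then show "cayley h (v + v') = cayley h v + cayley h v'"
   using cayley_eq[OF graph_add[OF fg(1) fg'(1)], of h] cayley_eq[OF fg(1), of h] cayley_eq[OF fg'(1), of h]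
   unfolding fg(2)[symmetric] fg'(2)[symmetric] by (simp add: scaleR_add_right)
  have "c *R v = c *R f - h *R (c *R g)" unfolding fg(2) by (simp add: algebra_simps)
  then show "cayley h (c *R v) = c *R cayley h v" using cayley_eq[OF graph_scale[OF fg(1), of c], of h] cayley_eq[OF fg(1), of h]
   unfolding fg(2)[symmetric] by (simp add: scaleR_add_right mult.commute)
 qed
qed (simp add: linear_iff)

text \<open>Here \<open>q\<close> is the resolvent (1 - h A)^-1 applied to \<open>g\<close>, and
  \<open>f + h *R q\<close> is the resolvent applied to \<open>f\<close>. The latter lies in the
  domain of A^2 and is close to \<open>f\<close> for small \<open>h\<close>.\<close>

lemma resolvent_graph:
 assumes "h ~= 0" "(f, g) \<in> A"
 obtains q q' where "(f + h *R q, q) \<in> A" "(q, q') \<in> A" "g = q - h *R q'" "norm q <= norm g"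
proof -
 obtain p q where pq: "(p, q) \<in> A" "f = p - h *R q" using surj[OF assms(1)] by blast
 have "(q, (q - g) /\<^sub>R h) \<in> A" using graph_scale[OF graph_diff[OF pq(1) assms(2)], of "inverse h"] pq(2) assms(1) by simp
 moreover have "norm q <= norm g"
 proof -
  have "(norm (q - h *R ((q - g) /\<^sub>R h)))\<^sup>2 >= (norm q)\<^sup>2" unfolding norm_graph(2)[OF calculation] by simp
  then show ?thesis using assms(1) by (simp add: power2_le_iff_abs_le)
 qed
 ultimately show thesis
  using that[of q "(q - g) /\<^sub>R h"] pq assms(1) by simp
qed

lemma cayley_graph_eq:
 assumes "h ~= 0" "(f, g) \<in> A"
 obtains q q' where "(f + h *R q, q) \<in> A" "(q, q') \<in> A" "g = q - h *R q'" "norm q <= norm g"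
  "cayley h f = f + (2 * h) *R q" "cayley h g = q + h *R q'"
proof -
 obtain q q' where q: "(f + h *R q, q) \<in> A" "(q, q') \<in> A" "g = q - h *R q'" "norm q <= norm g" by (rule resolvent_graph[OF assms])
 have "cayley h f = f + (2 * h) *R q" using cayley_eq[OF q(1), of h] double_scaleR[of h q] by (simp add: add.assoc)
 then show thesis using that q cayley_eq[OF q(2), of h] by blast
qed

lemma cayley_invariant:
 assumes "(f, g) \<in> A" shows "(cayley h f, cayley h g) \<in> A"
proof (cases "h = 0")
 case False
 obtain q q' where q: "(f + h *R q, q) \<in> A" "(q, q') \<in> A"
   "cayley h f = f + (2 * h) *R q" "cayley h g = q + h *R q'" using cayley_graph_eq[OF False assms] by blast
 have "cayley h f = (f + h *R q) + h *R q" by (simp only: q(3) add.assoc double_scaleR)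
 then show ?thesis using graph_add[OF q(1) graph_scale[OF q(2), of h]] q(4) by simp
qed (simp add: assms)

text \<open>\<open>cayley a\<close> maps the graph into itself, so it may be applied to both
  components of the pair that represents \<open>cayley b v\<close>.\<close>

lemma cayley_commute: "cayley a (cayley b v) = cayley b (cayley a v)"
proof (cases rule: cayley_cases[where h = b and v = v])
 case (2 f g)
 have "cayley a v = cayley a f - b *R cayley a g" unfolding 2(3) by (simp add: linear_diff[OF linear_cayley] linear_scale[OF linear_cayley])
 moreover have "cayley a (cayley b v) = cayley a f + b *R cayley a g"
  unfolding 2(4) by (simp add: linear_add[OF linear_cayley] linear_scale[OF linear_cayley])
 ultimately show ?thesis using cayley_eq[OF cayley_invariant[OF 2(2), of a], of b] by simp
qed simp

lemma cayley_lipschitz: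
 assumes "(f, g) \<in> A" shows "norm (cayley h f - f) <= 2 * \<bar>h\<bar> * norm g"
proof (cases "h = 0")
 case False
 then obtain q where "norm q <= norm g" "cayley h f = f + (2 * h) *R q" using cayley_graph_eq[OF False assms] by metis
 then show ?thesis by (simp add: abs_mult mult_left_mono)
qed simp

text \<open>Using the resolvent identity twice leaves the exact remainder
  \<open>(2 * h\<^sup>2) *R r\<close>, where \<open>r\<close> is the resolvent applied to
  \<open>k\<close>, that is to A^2 f.\<close>

lemma cayley_taylor:
 assumes "(f, g) \<in> A" "(g, k) \<in> A"
 shows "norm (cayley h f - f - (2 * h) *R g) <= 2 * h\<^sup>2 * norm k"
proof (cases "h = 0")
 case False
 obtain q q' where q: "(q, q') \<in> A" "g = q - h *R q'" "cayley h f = f + (2 * h) *R q" using cayley_graph_eq[OF False assms(1)] by metis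
 obtain r where r: "(g + h *R r, r) \<in> A" "norm r <= norm k" using resolvent_graph[OF False assms(2)] by metis
 have "q = g + h *R r" using graph_unique[OF q(1) r(1) _ False] q(2) by simp
 then have "cayley h f - f - (2 * h) *R g = (2 * h\<^sup>2) *R r" using q(3) by (simp add: algebra_simps power2_eq_square)
 then show ?thesis using r(2) by (simp add: mult_left_mono)
qed simp

lemma cayley_pow_lipschitz:
 assumes "(f, g) \<in> A" shows "norm ((cayley h ^^ m) f - f) <= 2 * (real m * \<bar>h\<bar>) * norm g"
proof (induction m)
 case (Suc m)
 have "(cayley h ^^ Suc m) f - f = cayley h ((cayley h ^^ m) f - f) + (cayley h f - f)" by (simp add: linear_diff[OF linear_cayley])
 then have "norm ((cayley h ^^ Suc m) f - f) <= norm ((cayley h ^^ m) f - f) + norm (cayley h f - f)"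
  using norm_triangle_ineq[of "cayley h ((cayley h ^^ m) f - f)" "cayley h f - f"] by (simp only: norm_cayley)
 also have "... <= 2 * (real (Suc m) * \<bar>h\<bar>) * norm g" using Suc cayley_lipschitz[OF assms, of h] by (simp add: algebra_simps)
 finally show ?case .
qed simp

lemma cayley_pow_taylor:
 assumes "(f, g) \<in> A" "(g, k) \<in> A"
 shows "norm ((cayley h ^^ m) f - f - (2 * (real m * h)) *R g) <= 2 * (real m * h)\<^sup>2 * norm k"
proof (induction m)
 case (Suc m)
 \<comment> \<open>The three pieces contribute m^2, 1 and 2 m times
   \<open>2 * h\<^sup>2 * norm k\<close>, which add up to the square of m + 1.\<close>
 have e: "(cayley h ^^ Suc m) f - f - (2 * (real (Suc m) * h)) *R g
   = ((cayley h ^^ m) f - f - (2 * (real m * h)) *R g)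
   + (cayley h ^^ m) (cayley h f - f - (2 * h) *R g)
   + (2 * h) *R ((cayley h ^^ m) g - g)"
  by (simp add: linear_diff[OF linear_funpow[OF linear_cayley]] linear_add[OF linear_funpow[OF linear_cayley]] linear_scale[OF linear_funpow[OF linear_cayley]]
    funpow_swap1 algebra_simps)
 have "norm ((cayley h ^^ Suc m) f - f - (2 * (real (Suc m) * h)) *R g)
   <= norm ((cayley h ^^ m) f - f - (2 * (real m * h)) *R g)
   + norm ((cayley h ^^ m) (cayley h f - f - (2 * h) *R g))
   + norm ((2 * h) *R ((cayley h ^^ m) g - g))" unfolding e by (rule norm_add3_le)
 also have "norm ((2 * h) *R ((cayley h ^^ m) g - g)) <= 2 * \<bar>h\<bar> * (2 * (real m * \<bar>h\<bar>) * norm k)"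
  using mult_left_mono[OF cayley_pow_lipschitz[OF assms(2), where h = h and m = m], of "2 * \<bar>h\<bar>"] by (simp add: abs_mult)
 also have "norm ((cayley h ^^ m) (cayley h f - f - (2 * h) *R g)) <= 2 * h\<^sup>2 * norm k"
  using cayley_taylor[OF assms] by (simp add: norm_funpow norm_cayley)
 also have "norm ((cayley h ^^ m) f - f - (2 * (real m * h)) *R g) <= 2 * (real m * h)\<^sup>2 * norm k" by (rule Suc)
 finally show ?case
  by (simp add: power2_eq_square algebra_simps flip: abs_mult)
qed simp

text \<open>One Cayley transform with parameter \<open>h\<close> advances time by 2 h; this is where
  the 2 in the denominator comes from.\<close>

definition cayley_step :: "nat => real => 'h => 'h" where
 "cayley_step n s = cayley (s / (2 * real n)) ^^ n"

lemma linear_cayley_step: "linear (cayley_step n s)" unfolding cayley_step_def by (rule linear_funpow[OF linear_cayley])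

lemma norm_cayley_step: "norm (cayley_step n s f) = norm f" unfolding cayley_step_def by (rule norm_funpow[OF norm_cayley])

definition dom2 :: "'h set" where "dom2 = {f. EX g k. (f, g) \<in> A & (g, k) \<in> A}"

text \<open>Two step numbers n and m have the common refinement n m, so this one comparison yields
  the Cauchy property. A coarse step and \<open>m\<close> fine ones share the first-order term; each
  has second-order error at most \<open>2 * h\<^sup>2 * norm k\<close>, and \<open>n\<close> such
  discrepancies add up to order 1/n.\<close>

lemma cayley_step_refine:
 assumes "(f, g) \<in> A" "(g, k) \<in> A" "n > 0" "m > 0"
 shows "norm (cayley_step n s f - cayley_step (n * m) s f) <= s\<^sup>2 * norm k / real n"
proof -
 define h where "h = s / (2 * real n)"
 have hm: "s / (2 * real (n * m)) = h / real m" using assms by (simp add: h_def)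
 define Y where "Y = cayley (h / real m) ^^ m"
 have c: "cayley h (Y x) = Y (cayley h x)" for x
  using funpow_commute[of "cayley h" "cayley (h / real m)" 1 m x, OF cayley_commute] by (simp add: Y_def)
 have "norm (cayley h f - Y f) <= norm (cayley h f - f - (2 * h) *R g) + norm (Y f - f - (2 * h) *R g)"
  using norm_triangle_ineq4[of "cayley h f - f - (2 * h) *R g" "Y f - f - (2 * h) *R g"] by simp
 also have "... <= 2 * h\<^sup>2 * norm k + 2 * h\<^sup>2 * norm k"
  using cayley_taylor[OF assms(1,2), of h] cayley_pow_taylor[OF assms(1,2), where h = "h / real m" and m = m] assms(4)
  by (intro add_mono) (auto simp: Y_def)
 finally have 1: "norm (cayley h f - Y f) <= 4 * h\<^sup>2 * norm k" by (simp add: mult_ac)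
 have "norm (cayley_step n s f - cayley_step (n * m) s f) = norm ((cayley h ^^ n) f - (Y ^^ n) f)"
  unfolding cayley_step_def hm unfolding h_def[symmetric] Y_def funpow_mult by (simp add: mult.commute)
 also have "... <= real n * norm (cayley h f - Y f)"
  by (rule norm_funpow_diff_le) (auto simp: Y_def linear_cayley linear_funpow norm_cayley norm_funpow c[unfolded Y_def])
 also have "... <= real n * (4 * h\<^sup>2 * norm k)" by (intro mult_left_mono 1) auto
 also have "... = s\<^sup>2 * norm k / real n" using assms(3) by (simp add: h_def power2_eq_square field_simps)
 finally show ?thesis .
qed

text \<open>For \<open>f\<close> in the domain, \<open>f + h *R q\<close> from
  \<open>resolvent_graph\<close> lies in \<open>dom2\<close>, at distance at most
  \<open>h * norm g\<close> from \<open>f\<close>.\<close>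

lemma dom2_dense: "closure dom2 = UNIV"
proof -
 have "fst ` A \<subseteq> closure dom2"
 proof
  fix f assume "f \<in> fst ` A"
  then obtain g where fg: "(f, g) \<in> A" by auto
  show "f \<in> closure dom2" unfolding closure_approachable
  proof (intro allI impI)
   fix e :: real assume e: "e > 0"
   define h where "h = e / (2 * (norm g + 1))"
   have "h > 0" using e by (simp add: h_def add_nonneg_pos)
   then obtain q q' where q: "(f + h *R q, q) \<in> A" "(q, q') \<in> A" "norm q <= norm g"
    using resolvent_graph[OF _ fg, of h] by (metis less_irrefl)
   have "norm (h *R q) <= h * norm g" using q \<open>h > 0\<close> by simp
   also have "... < e"
   proof -
    have "norm g + 1 > 0" by (simp add: add_nonneg_pos)
    then have "h * norm g = e / 2 * (norm g / (norm g + 1))" "norm g / (norm g + 1) < 1" by (auto simp: h_def)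
    then show ?thesis using e mult_strict_left_mono[of "norm g / (norm g + 1)" 1 "e / 2"] by linarith
   qed
   finally show "\<exists>y\<in>dom2. dist y f < e" using q by (intro bexI[of _ "f + h *R q"]) (auto simp: dist_norm dom2_def)
  qed
 qed
 then show ?thesis using dense by (metis closure_closure closure_mono top.extremum_uniqueI)
qed

lemma cayley_step_convergent: "convergent (%n. cayley_step (Suc n) s f)"
proof -
 have base: "EX N. \<forall>n\<ge>N. \<forall>m\<ge>N. dist (cayley_step (Suc n) s f) (cayley_step (Suc m) s f) < e"
  if f: "f \<in> dom2" and "e > 0" for f and e :: real
 proof -
  obtain g k where gk: "(f, g) \<in> A" "(g, k) \<in> A" using f unfolding dom2_def by blast
  define K where "K = s\<^sup>2 * norm k"
  have "K >= 0" by (simp add: K_def)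
  obtain N :: nat where N: "real N > 2 * K / e" using reals_Archimedean2 by blast
  have bd: "K / real (Suc n) < e / 2" if "n >= N" for n
  proof -
   have "2 * K / e < real (Suc n)" using N that by simp
   then show ?thesis using \<open>e > 0\<close> by (simp add: field_simps)
  qed
  have "dist (cayley_step (Suc n) s f) (cayley_step (Suc m) s f) < e" if "n >= N" "m >= N" for n m
  proof -
   have "norm (cayley_step (Suc n) s f - cayley_step (Suc m) s f)
     <= norm (cayley_step (Suc n) s f - cayley_step (Suc n * Suc m) s f)
     + norm (cayley_step (Suc m) s f - cayley_step (Suc m * Suc n) s f)"
    using dist_triangle2[of "cayley_step (Suc n) s f" "cayley_step (Suc m) s f" "cayley_step (Suc n * Suc m) s f"]
    by (simp only: dist_norm mult.commute[of "Suc m" "Suc n"])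
   also have "... <= K / real (Suc n) + K / real (Suc m)" unfolding K_def by (intro add_mono cayley_step_refine[OF gk]) auto
   finally show ?thesis using bd[OF that(1)] bd[OF that(2)] unfolding dist_norm by linarith
  qed
  then show ?thesis by blast
 qed
 have "Cauchy (%n. cayley_step (Suc n) s f)"
 proof (rule metric_CauchyI)
  fix e :: real assume e: "e > 0"
  have "f \<in> closure dom2" by (simp add: dom2_dense)
  then obtain y where y: "y \<in> dom2" "dist y f < e / 3" using e unfolding closure_approachable by (metis divide_pos_pos zero_less_numeral)
  have d: "dist (cayley_step n s f) (cayley_step n s y) < e / 3" for n
   using y(2) by (simp add: dist_norm norm_cayley_step norm_minus_commute flip: linear_diff[OF linear_cayley_step])
  obtain N where N: "!!n m. n >= N ==> m >= N ==> dist (cayley_step (Suc n) s y) (cayley_step (Suc m) s y) < e / 3"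
   using base[OF y(1), of "e / 3"] e by auto
  show "EX M. \<forall>m\<ge>M. \<forall>n\<ge>M. dist (cayley_step (Suc m) s f) (cayley_step (Suc n) s f) < e"
  proof (intro exI allI impI)
   fix m n assume "m >= N" "n >= N"
   then show "dist (cayley_step (Suc m) s f) (cayley_step (Suc n) s f) < e" using N[of m n] d[of "Suc m"] d[of "Suc n"]
     dist_triangle3[of "cayley_step (Suc m) s f" "cayley_step (Suc n) s f" "cayley_step (Suc m) s y"]
     dist_triangle[of "cayley_step (Suc m) s y" "cayley_step (Suc n) s f" "cayley_step (Suc n) s y"]
     dist_commute[of "cayley_step (Suc n) s f" "cayley_step (Suc n) s y"]
     dist_commute[of "cayley_step (Suc m) s f" "cayley_step (Suc m) s y"] by linarith
  qed
 qed
 then show ?thesis by (simp add: Cauchy_convergent_iff)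
qed

definition group :: "real => 'h => 'h" where
 "group s f = lim (%n. cayley_step (Suc n) s f)"

lemma group_lim: "(%n. cayley_step (Suc n) s f) ----> group s f" unfolding group_def using cayley_step_convergent by (simp add: convergent_LIMSEQ_iff)

lemma linear_group: "linear (group s)"
proof (rule linearI)
 show "group s (x + y) = group s x + group s y" for x y
  using tendsto_add[OF group_lim[of s x] group_lim[of s y]] group_lim[of s "x + y"] by (simp add: linear_add[OF linear_cayley_step] LIMSEQ_unique)
 show "group s (c *R x) = c *R group s x" for c x
  using tendsto_scaleR[OF tendsto_const group_lim[of s x], of c] group_lim[of s "c *R x"]
  by (simp add: linear_scale[OF linear_cayley_step] LIMSEQ_unique)
qed

lemma norm_group: "norm (group s f) = norm f" using tendsto_norm[OF group_lim[of s f]] by (simp add: norm_cayley_step tendsto_const_iff)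

lemma group_0: "group 0 f = f"
proof -
 have "cayley_step n 0 f = f" for n
 proof -
  have "cayley 0 = id" by auto
  then show ?thesis by (simp add: cayley_step_def)
 qed
 then show ?thesis using group_lim[of 0 f] by (simp add: tendsto_const_iff)
qed

text \<open>Cayley transforms do not obey the addition law, but composing those with parameters a
  and b differs from the one with a + b only to second order. With a and b of order 1/n, the n
  errors add up to order 1/n.\<close>

lemma cayley_step_add_tendsto:
 "(%n. cayley_step (Suc n) s (cayley_step (Suc n) t f) - cayley_step (Suc n) (s + t) f) ----> 0"
proof (rule tendsto_zero_dense[where B = 2, OF _ _ dom2_dense])
 show "linear (%f. cayley_step (Suc i) s (cayley_step (Suc i) t f) - cayley_step (Suc i) (s + t) f)" for i
  using linear_compose[OF linear_cayley_step[of "Suc i" t] linear_cayley_step[of "Suc i" s]]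
  by (intro linear_compose_sub linear_cayley_step) (simp add: comp_def)
 show "norm (cayley_step (Suc i) s (cayley_step (Suc i) t x) - cayley_step (Suc i) (s + t) x) <= 2 * norm x" for i x
  using norm_triangle_ineq4[of "cayley_step (Suc i) s (cayley_step (Suc i) t x)" "cayley_step (Suc i) (s + t) x"] by (simp add: norm_cayley_step)
 fix f assume "f \<in> dom2"
 then obtain g k where gk: "(f, g) \<in> A" "(g, k) \<in> A" unfolding dom2_def by blast
 define K where "K = (\<bar>s\<bar> + \<bar>t\<bar>)\<^sup>2 * norm k"
 have bd: "norm (cayley_step (Suc n) s (cayley_step (Suc n) t f) - cayley_step (Suc n) (s + t) f) <= K / real (Suc n)" for n
 proof -
  define a where "a = s / (2 * real (Suc n))"
  define b where "b = t / (2 * real (Suc n))"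
  have ab: "(s + t) / (2 * real (Suc n)) = a + b" by (simp add: a_def b_def add_divide_distrib)
  have "norm (cayley a (cayley b f) - f - (2 * (a + b)) *R g)
   <= norm (cayley a (cayley b f - f - (2 * b) *R g)) + norm (cayley a f - f - (2 * a) *R g)
    + norm ((2 * b) *R (cayley a g - g))"
  proof -
   have "cayley a (cayley b f) - f - (2 * (a + b)) *R g
    = cayley a (cayley b f - f - (2 * b) *R g) + (cayley a f - f - (2 * a) *R g) + (2 * b) *R (cayley a g - g)"
    by (simp add: linear_diff[OF linear_cayley] linear_add[OF linear_cayley] linear_scale[OF linear_cayley] algebra_simps)
   then show ?thesis by (simp only: norm_add3_le)
  qed
  also have "... <= 2 * b\<^sup>2 * norm k + 2 * a\<^sup>2 * norm k + 2 * \<bar>b\<bar> * (2 * \<bar>a\<bar> * norm k)"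
   using cayley_taylor[OF gk, of a] cayley_taylor[OF gk, of b]
    mult_left_mono[OF cayley_lipschitz[OF gk(2), of a], of "2 * \<bar>b\<bar>"] by (intro add_mono) (auto simp: norm_cayley abs_mult)
  also have "... = 2 * (\<bar>a\<bar> + \<bar>b\<bar>)\<^sup>2 * norm k" by (simp add: power2_sum algebra_simps)
  finally have 1: "norm (cayley a (cayley b f) - f - (2 * (a + b)) *R g) <= 2 * (\<bar>a\<bar> + \<bar>b\<bar>)\<^sup>2 * norm k" .
  have 2: "norm (cayley (a + b) f - f - (2 * (a + b)) *R g) <= 2 * (\<bar>a\<bar> + \<bar>b\<bar>)\<^sup>2 * norm k"
  proof -
   have "(a + b)\<^sup>2 <= (\<bar>a\<bar> + \<bar>b\<bar>)\<^sup>2" by (rule power2_le_iff_abs_le[THEN iffD2]) auto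
   then have "2 * (a + b)\<^sup>2 * norm k <= 2 * (\<bar>a\<bar> + \<bar>b\<bar>)\<^sup>2 * norm k" by (intro mult_right_mono) auto
   then show ?thesis using cayley_taylor[OF gk, of "a + b"] by linarith
  qed
  have 3: "norm (cayley a (cayley b f) - cayley (a + b) f) <= 4 * (\<bar>a\<bar> + \<bar>b\<bar>)\<^sup>2 * norm k"
   using norm_triangle_ineq4[of "cayley a (cayley b f) - f - (2 * (a + b)) *R g" "cayley (a + b) f - f - (2 * (a + b)) *R g"] 1 2
   by simp
  have "norm (cayley_step (Suc n) s (cayley_step (Suc n) t f) - cayley_step (Suc n) (s + t) f)
    = norm (((%x. cayley a (cayley b x)) ^^ Suc n) f - (cayley (a + b) ^^ Suc n) f)"
   unfolding cayley_step_def ab unfolding a_def[symmetric] b_def[symmetric]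
   using funpow_comp_commute[of "cayley a" "cayley b" "Suc n" f] cayley_commute by metis
  also have "... <= real (Suc n) * norm (cayley a (cayley b f) - cayley (a + b) f)" using linear_compose[OF linear_cayley[of b] linear_cayley[of a]]
   by (intro norm_funpow_diff_le)
     (auto simp: linear_cayley norm_cayley comp_def cayley_commute[of "a + b"])
  also have "... <= real (Suc n) * (4 * (\<bar>a\<bar> + \<bar>b\<bar>)\<^sup>2 * norm k)" by (intro mult_left_mono 3) auto
  also have "... = K / real (Suc n)"
  proof -
   have "\<bar>a\<bar> + \<bar>b\<bar> = (\<bar>s\<bar> + \<bar>t\<bar>) / (2 * real (Suc n))"
    by (simp add: a_def b_def abs_divide add_divide_distrib)
   moreover have "N * (4 * (T / (2 * N))\<^sup>2 * \<kappa>) = T\<^sup>2 * \<kappa> / N" if "N > 0" for N T \<kappa> :: real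
    using that by (simp add: power2_eq_square field_simps)
   ultimately show ?thesis by (simp add: K_def del: of_nat_Suc)
  qed
  finally show ?thesis .
 qed
 show "(%n. cayley_step (Suc n) s (cayley_step (Suc n) t f) - cayley_step (Suc n) (s + t) f) ----> 0"
  by (rule Lim_null_comparison[OF always_eventually LIMSEQ_Suc[OF lim_const_over_n[of K]]]) (use bd in auto)
qed

lemma group_add: "group (s + t) f = group s (group t f)"
proof -
 have 1: "(%n. cayley_step (Suc n) s (cayley_step (Suc n) t f - group t f)) ----> 0"
  by (rule Lim_null_comparison[OF always_eventually tendsto_norm_zero[OF LIM_zero[OF group_lim[of t f]]]])
    (simp add: norm_cayley_step)
 have "(%n. cayley_step (Suc n) (s + t) f + (cayley_step (Suc n) s (cayley_step (Suc n) t f) - cayley_step (Suc n) (s + t) f)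
   - cayley_step (Suc n) s (cayley_step (Suc n) t f - group t f)) ----> group (s + t) f + 0 - 0"
  by (intro tendsto_intros group_lim cayley_step_add_tendsto 1)
 then have "(%n. cayley_step (Suc n) s (group t f)) ----> group (s + t) f" by (simp add: linear_diff[OF linear_cayley_step])
 then show ?thesis using group_lim[of s "group t f"] by (rule LIMSEQ_unique)
qed

lemma group_lipschitz:
 assumes "(f, g) \<in> A" shows "norm (group s f - f) <= \<bar>s\<bar> * norm g"
proof (rule tendsto_upperbound)
 show "(%n. norm (cayley_step (Suc n) s f - f)) ----> norm (group s f - f)" by (intro tendsto_intros group_lim)
 show "\<forall>\<^sub>F n in sequentially. norm (cayley_step (Suc n) s f - f) <= \<bar>s\<bar> * norm g"
 proof (intro always_eventually allI)
  fix n show "norm (cayley_step (Suc n) s f - f) <= \<bar>s\<bar> * norm g"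
   using cayley_pow_lipschitz[OF assms, where h = "s / (2 * real (Suc n))" and m = "Suc n"]
   by (simp add: cayley_step_def abs_divide field_simps del: of_nat_Suc funpow.simps)
 qed
qed simp

lemma group_taylor:
 assumes "(f, g) \<in> A" "(g, k) \<in> A"
 shows "norm (group s f - f - s *R g) <= s\<^sup>2 / 2 * norm k"
proof (rule tendsto_upperbound)
 show "(%n. norm (cayley_step (Suc n) s f - f - s *R g)) ----> norm (group s f - f - s *R g)" by (intro tendsto_intros group_lim)
 show "\<forall>\<^sub>F n in sequentially. norm (cayley_step (Suc n) s f - f - s *R g) <= s\<^sup>2 / 2 * norm k"
 proof (intro always_eventually allI)
  fix n
  have *: "real (Suc n) * (s / (2 * real (Suc n))) = s / 2" by (simp del: of_nat_Suc)
  show "norm (cayley_step (Suc n) s f - f - s *R g) <= s\<^sup>2 / 2 * norm k"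
   using cayley_pow_taylor[OF assms, where m = "Suc n" and h = "s / (2 * real (Suc n))"]
   unfolding * by (simp add: cayley_step_def power_divide del: of_nat_Suc funpow.simps)
 qed
qed simp

lemma isometry_group_group: "isometry_group group" unfolding isometry_group_def
proof (intro conjI allI)
 fix f
 have "((%s. group s f - f) ---> 0) (at 0)"
 proof (rule tendsto_zero_dense[where T = "%s f. group s f - f" and B = 2, OF _ _ dense])
  show "linear (%f. group s f - f)" for s
   using linear_compose_sub[OF linear_group linear_ident] .
  show "norm (group s x - x) <= 2 * norm x" for s x
   using norm_triangle_ineq4[of "group s x" x] by (simp add: norm_group)
  fix f assume "f \<in> fst ` A"
  then obtain g where fg: "(f, g) \<in> A" by auto
  have lim: "((%s::real. \<bar>s\<bar> * norm g) ---> 0) (at 0)" by (rule tendsto_eq_rhs[of _ "\<bar>0\<bar> * norm g"]) (intro tendsto_intros, simp)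
  show "((%s. group s f - f) ---> 0) (at 0)" by (rule Lim_null_comparison[OF _ lim]) (simp add: group_lipschitz[OF fg])
 qed
 then show "((%s. group s f) ---> f) (at 0)" by (simp add: LIM_zero_iff)
qed (simp_all add: linear_group norm_group group_0 group_add)

text \<open>\<open>group_taylor\<close> needs a vector in the domain of A^2. A general
  \<open>f\<close> is replaced by p = f + h q with A p = q close to \<open>g\<close>; the rest
  \<open>f - p\<close> is controlled by \<open>group_lipschitz\<close> through
  \<open>norm (g - q)\<close>.\<close>

lemma graph_subset_generator: "A \<subseteq> generator group"
proof clarify
 fix f g assume fg: "(f, g) \<in> A"
 have "((%s. (group s f - f) /\<^sub>R s - g) ---> 0) (at 0)"
 proof (rule tendstoI)
  fix e :: real assume e: "e > 0"
  \<comment> \<open>That the resolvent applied to \<open>g\<close> is close to \<open>g\<close> is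
    seen by comparison with a \<open>y\<close> of the domain near \<open>g\<close>. Three terms of
    size \<open>e / 16\<close> arise; the choice of \<open>h\<close> bounds the one coming from
    \<open>h *R r\<close>.\<close>
  have "g \<in> closure (fst ` A)" using dense by simp
  then obtain y z where yz: "(y, z) \<in> A" "norm (y - g) < e / 16"
   unfolding closure_approachable using e by (force simp: dist_norm dest!: spec[of _ "e / 16"])
  define c where "c = norm z + 1"
  have c: "c > 0" by (simp add: c_def add_nonneg_pos)
  define h where "h = e / (16 * c)"
  have h: "h > 0" using e c by (simp add: h_def)
  obtain q q' where q: "(f + h *R q, q) \<in> A" "(q, q') \<in> A" "g = q - h *R q'" using resolvent_graph[OF _ fg, of h] h by (metis less_irrefl)
  obtain r r' where r: "(y + h *R r, r) \<in> A" "norm r <= norm z" using resolvent_graph[OF _ yz(1), of h] h by (metis less_irrefl)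
  have qg: "norm (q - g) <= e / 4"
  proof -
   have a: "(q - (y + h *R r), q' - r) \<in> A" by (rule graph_diff[OF q(2) r(1)])
   have "(norm (q - (y + h *R r)))\<^sup>2 <= (norm (q - (y + h *R r) - h *R (q' - r)))\<^sup>2" unfolding norm_graph(2)[OF a] by simp
   also have "q - (y + h *R r) - h *R (q' - r) = g - y" using q(3) by (simp add: algebra_simps)
   finally have "norm (q - (y + h *R r)) <= norm (g - y)" by (rule power2_le_imp_le) simp
   moreover have "norm (h *R r) <= e / 16"
   proof -
    have "norm (h *R r) <= h * c" using r(2) h by (simp add: c_def)
    also have "... = e / 16" using c by (simp add: h_def)
    finally show ?thesis .
   qed
   moreover have "norm (q - g) <= norm (q - (y + h *R r)) + (norm (y - g) + norm (h *R r))"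
    using norm_triangle_ineq[of "q - (y + h *R r)" "(y - g) + h *R r"] norm_triangle_ineq[of "y - g" "h *R r"] by (simp add: algebra_simps)
   ultimately show ?thesis using yz(2) e by (simp add: norm_minus_commute)
  qed
  define K where "K = norm q' + 1"
  have K: "K > 0" by (simp add: K_def add_nonneg_pos)
  have "\<forall>\<^sub>F s in at 0. dist s (0::real) < e / (4 * K) & s ~= 0" unfolding eventually_at_filter
   by (rule eventually_mono[OF eventually_nhds_ball[of "e / (4 * K)" 0]]) (use e K in "auto simp: dist_commute")
  then show "\<forall>\<^sub>F s in at 0. dist ((group s f - f) /\<^sub>R s - g) 0 < e"
  proof eventually_elim
   case (elim s)
   define p where "p = f + h *R q"
   have fp: "(f - p, g - q) \<in> A" using graph_diff[OF fg q(1)] by (simp add: p_def)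
   have "(group s f - f) /\<^sub>R s - g = (group s (f - p) - (f - p)) /\<^sub>R s + ((group s p - p - s *R q) /\<^sub>R s) + (q - g)"
    using elim by (simp add: linear_diff[OF linear_group] algebra_simps)
   then have "norm ((group s f - f) /\<^sub>R s - g) <= norm ((group s (f - p) - (f - p)) /\<^sub>R s)
     + norm ((group s p - p - s *R q) /\<^sub>R s) + norm (q - g)" by (simp only: norm_add3_le)
   also have "norm ((group s (f - p) - (f - p)) /\<^sub>R s) <= norm (g - q)"
   proof -
    have "norm ((group s (f - p) - (f - p)) /\<^sub>R s) = norm (group s (f - p) - (f - p)) / \<bar>s\<bar>"
     by (simp add: divide_inverse mult.commute)
    also have "... <= (\<bar>s\<bar> * norm (g - q)) / \<bar>s\<bar>" by (intro divide_right_mono group_lipschitz[OF fp]) auto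
    finally show ?thesis using elim by simp
   qed
   also have "norm ((group s p - p - s *R q) /\<^sub>R s) <= \<bar>s\<bar> / 2 * norm q'"
   proof -
    have "norm ((group s p - p - s *R q) /\<^sub>R s) = norm (group s p - p - s *R q) / \<bar>s\<bar>" by (simp add: divide_inverse mult.commute)
    also have "... <= (s\<^sup>2 / 2 * norm q') / \<bar>s\<bar>" using group_taylor[OF q(1,2), of s] by (intro divide_right_mono) (auto simp: p_def)
    also have "... = \<bar>s\<bar> / 2 * norm q'"
    proof -
     have "s\<^sup>2 = \<bar>s\<bar> * \<bar>s\<bar>" by (simp add: power2_eq_square)
     then show ?thesis using elim by (simp del: abs_mult_self_eq)
    qed
    finally show ?thesis .
   qed
   also have "\<bar>s\<bar> / 2 * norm q' <= (e / (4 * K)) * K"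
   proof (rule mult_mono)
    have "\<bar>s\<bar> / 2 <= \<bar>s\<bar>" by simp
    also have "\<bar>s\<bar> <= e / (4 * K)" using elim by (simp add: dist_norm)
    finally show "\<bar>s\<bar> / 2 <= e / (4 * K)" .
    show "norm q' <= K" by (simp add: K_def)
    show "0 <= e / (4 * K)" using e K by simp
   qed simp
   also have "... = e / 4" using K by simp
   finally show ?case using qg e by (simp add: dist_norm norm_minus_commute)
  qed
 qed
 then show "(f, g) \<in> generator group" by (simp add: generator_def LIM_zero_iff)
qed

text \<open>Maximality of \<open>A\<close>: as 1 - A is already onto, a pair of the generator
  differs from a pair of \<open>A\<close> by some (x, x), and skewness of the generator gives x . x
  = 0.\<close>

lemma generator_group: "generator group = A"
proof
 show "generator group \<subseteq> A"
 proof clarify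
  fix f g assume fg: "(f, g) \<in> generator group"
  obtain p q where pq: "(p, q) \<in> A" "f - g = p - 1 *R q" using surj[of 1 "f - g"] by auto
  have "(f - p, g - q) \<in> generator group"
   using subspace_diff[OF generator_subspace[OF isometry_group_group] fg, of "(p, q)"] graph_subset_generator pq(1) by auto
  then have "(f - p) \<bullet> (g - q) = 0" by (rule generator_skew[OF isometry_group_group])
  moreover have "f - p = g - q" using pq(2) by (simp add: algebra_simps)
  ultimately have "f = p" "g = q" by (metis inner_eq_zero_iff right_minus_eq)+
  then show "(f, g) \<in> A" using pq by simp
 qed
qed (rule graph_subset_generator)

text \<open>A bounded symmetry of the graph commutes with every Cayley transform, hence with the
  limit. Applied to multiplication by complex scalars it makes the group complex linear.\<close>

lemma group_commute:
 assumes J: "bounded_linear J" and c: "!!f g. (f, g) \<in> A ==> (J f, J g) \<in> A"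
 shows "group s (J f) = J (group s f)"
proof -
 have "cayley h (J v) = J (cayley h v)" for h v
 proof (cases rule: cayley_cases[where h = h and v = v])
  case (2 f g)
  have lJ: "linear J" using J by (simp add: bounded_linear.linear)
  have "J v = J f - h *R J g" by (simp add: 2(3) linear_diff[OF lJ] linear_scale[OF lJ])
  then show ?thesis using cayley_eq[OF c[OF 2(2)], of h] by (simp add: 2(4) linear_add[OF lJ] linear_scale[OF lJ])
 qed simp
 then have "(cayley h ^^ n) (J v) = J ((cayley h ^^ n) v)" for h n v
  by (induction n) auto
 then have "cayley_step n s (J f) = J (cayley_step n s f)" for n by (simp add: cayley_step_def)
 then have "(%n. cayley_step (Suc n) s (J f)) ----> J (group s f)" using bounded_linear.tendsto[OF J group_lim[of s f]] by simp
 then show ?thesis using group_lim[of s "J f"] LIMSEQ_unique by blast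
qed

end


subsection \<open>Perturbations\<close>

text \<open>The resolvent \<open>R\<close> is nonexpansive by Pythagoras, so \<open>R\<close> after
  \<open>\<Phi>\<close> is a contraction. This serves both to change the parameter \<open>h\<close>
  and to add a bounded operator.\<close>

lemma resolvent_fixpoint:
 fixes A :: "('h::{real_inner,complete_space} \<times> 'h) set"
 assumes sub: "subspace A" and skew: "!!f g. (f, g) \<in> A ==> f \<bullet> g = 0"
  and surj: "!!v. EX f g. (f, g) \<in> A & v = f - h *R g"
  and c: "0 <= c" "c < 1" and lip: "!!x y. norm (\<Phi> x - \<Phi> y) <= c * norm (x - y)"
 shows "EX f g. (f, g) \<in> A & \<Phi> f = f - h *R g"
proof -
 obtain R where R: "!!v. EX g. (R v, g) \<in> A & v = R v - h *R g" using surj by metis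
 have ne: "norm (R v - R w) <= norm (v - w)" for v w
 proof -
  obtain g g' where g: "(R v, g) \<in> A" "v = R v - h *R g" and g': "(R w, g') \<in> A" "w = R w - h *R g'" using R by metis
  have "(R v - R w, g - g') \<in> A" using subspace_diff[OF sub g(1) g'(1)] by simp
  then have z: "(R v - R w) \<bullet> (g - g') = 0" by (rule skew)
  have "v - w = (R v - R w) - h *R (g - g')" by (subst g(2), subst g'(2)) (simp add: algebra_simps)
  then have "(norm (v - w))\<^sup>2 = (norm (R v - R w))\<^sup>2 + h\<^sup>2 * (norm (g - g'))\<^sup>2" using z unfolding power2_norm_eq_inner
   by (simp add: inner_diff_left[of "R v - R w"] inner_diff_right[of _ "R v - R w"]
     inner_commute[of "g - g'" "R v - R w"] power2_eq_square)
  then have "(norm (R v - R w))\<^sup>2 <= (norm (v - w))\<^sup>2" by simp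
  then show ?thesis by (rule power2_le_imp_le) simp
 qed
 have "\<exists>!x. R (\<Phi> x) = x"
 proof (rule banach_fix_type)
  have "dist (R (\<Phi> x)) (R (\<Phi> y)) <= c * dist x y" for x y
   unfolding dist_norm using ne lip by (rule order_trans)
  then show "ALL x y. dist (R (\<Phi> x)) (R (\<Phi> y)) <= c * dist x y" by blast
 qed (use c in auto)
 then obtain x where "R (\<Phi> x) = x" by auto
 then show ?thesis using R[of "\<Phi> x"] by auto
qed

text \<open>Multiply v = f - h A f by \<open>\<theta> = h\<^sub>0 / h\<close> and move a multiple of
  \<open>f\<close> across: an equation with parameter \<open>h\<^sub>0\<close> remains, whose right
  side depends on \<open>f\<close> with Lipschitz constant
  \<open>\<bar>1 - \<theta>\<bar> < 1\<close>.\<close>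

lemma resolvent_extend:
 fixes A :: "('h::{real_inner,complete_space} \<times> 'h) set"
 assumes sub: "subspace A" and skew: "!!f g. (f, g) \<in> A ==> f \<bullet> g = 0"
  and surj: "!!v. EX f g. (f, g) \<in> A & v = f - h\<^sub>0 *R g"
  and h: "0 < h\<^sub>0 / h" "h\<^sub>0 / h < 2"
 shows "EX f g. (f, g) \<in> A & v = f - h *R g"
proof -
 define \<theta> where "\<theta> = h\<^sub>0 / h"
 have nz: "h ~= 0" "h\<^sub>0 ~= 0" "\<theta> ~= 0" using h by (auto simp: \<theta>_def)
 have "EX f g. (f, g) \<in> A & \<theta> *R v + (1 - \<theta>) *R f = f - h\<^sub>0 *R g"
 proof (rule resolvent_fixpoint[OF sub skew surj, where c = "\<bar>1 - \<theta>\<bar>"])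
  show "norm (\<theta> *R v + (1 - \<theta>) *R x - (\<theta> *R v + (1 - \<theta>) *R y)) <= \<bar>1 - \<theta>\<bar> * norm (x - y)" for x y
   by (simp flip: scaleR_diff_right norm_scaleR)
 qed (use h in \<open>auto simp: \<theta>_def\<close>)
 then obtain f g where fg: "(f, g) \<in> A" "\<theta> *R v + (1 - \<theta>) *R f = f - h\<^sub>0 *R g" by blast
 have "\<theta> *R v = \<theta> *R (f - h *R g)"
 proof -
  have "h\<^sub>0 = \<theta> * h" using nz by (simp add: \<theta>_def)
  then show ?thesis using fg(2) by (simp add: algebra_simps)
 qed
 then have "v = f - h *R g" using nz by simp
 then show ?thesis using fg by blast
qed

lemma skew_operatorI:
 fixes A :: "('h::{real_inner,complete_space} \<times> 'h) set"
 assumes sub: "subspace A" and skew: "!!f g. (f, g) \<in> A ==> f \<bullet> g = 0"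
  and dense: "closure (fst ` A) = UNIV" and h0: "h\<^sub>0 > 0"
  and surj1: "!!v. EX f g. (f, g) \<in> A & v = f - h\<^sub>0 *R g"
  and surj2: "!!v. EX f g. (f, g) \<in> A & v = f - (- h\<^sub>0) *R g"
 shows "skew_operator A"
proof
 fix h :: real and v :: 'h assume h: "h ~= 0"
 \<comment> \<open>For a fixed sign, parameters of modulus at least \<open>h\<^sub>0\<close> are
   reached by one extension. Below that, each extension lowers the modulus by the factor 3/4, which
   is admissible because 4/3 < 2.\<close>
 have ext: "ALL h v. 0 < h / k --> \<bar>h\<bar> >= h\<^sub>0 * (3/4) ^ n --> (EX f g. (f, g) \<in> A & v = f - h *R g)"
  if s: "!!v. EX f g. (f, g) \<in> A & v = f - k *R g" and k: "\<bar>k\<bar> = h\<^sub>0" for k n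
 proof (induction n)
  case 0
  show ?case
  proof (intro allI impI)
   fix h v assume "0 < h / k" "\<bar>h\<bar> >= h\<^sub>0 * (3/4) ^ 0"
   then show "EX f g. (f, g) \<in> A & v = f - h *R g"
    using k h0 by (intro resolvent_extend[OF sub skew s]) (auto simp: zero_less_divide_iff divide_less_eq split: if_splits)
  qed
 next
  case (Suc n)
  show ?case
  proof (intro allI impI)
   fix h v assume h: "0 < h / k" "\<bar>h\<bar> >= h\<^sub>0 * (3/4) ^ Suc n"
   have s': "!!v. EX f g. (f, g) \<in> A & v = f - (4/3 * h) *R g" using Suc h by (auto simp: zero_less_divide_iff zero_less_mult_iff abs_mult)
   show "EX f g. (f, g) \<in> A & v = f - h *R g"
   proof (rule resolvent_extend[OF sub skew s'])
    have "h ~= 0" using h(1) by auto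
    then show "0 < 4/3 * h / h" "4/3 * h / h < 2" by auto
   qed
  qed
 qed
 obtain n where n: "(3/4) ^ n < \<bar>h\<bar> / h\<^sub>0" using real_arch_pow_inv[of "\<bar>h\<bar> / h\<^sub>0" "3/4"] h h0 by auto
 then have n': "\<bar>h\<bar> >= h\<^sub>0 * (3/4) ^ n" using h0 by (simp add: field_simps)
 show "EX f g. (f, g) \<in> A & v = f - h *R g"
 proof (cases "h > 0")
  case True
  then show ?thesis using ext[OF surj1, of n] n' h0 by simp
 next
  case False
  then show ?thesis using ext[OF surj2, of n] n' h0 h by (simp add: divide_less_0_iff)
 qed
qed (use assms in auto)

text \<open>At modulus 1/(|b| + 1) of the parameter, h B has norm below 1, so the perturbed equation
  is solved by a contraction for either sign; \<open>skew_operatorI\<close> then reaches all other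
  parameters.\<close>

lemma skew_operator_perturb:
 fixes A :: "('h::{real_inner,complete_space} \<times> 'h) set"
 assumes A: "skew_operator A" and B: "linear B" "!!f. f \<bullet> B f = 0" "!!f. norm (B f) <= b * norm f"
 shows "skew_operator ((%(f, g). (f, g + B f)) ` A)"
proof -
 interpret A: skew_operator A by fact
 define b' where "b' = \<bar>b\<bar> + 1"
 have b': "b' > 0" "\<bar>b\<bar> / b' < 1" by (auto simp: b'_def)
 have bB: "norm (B f) <= \<bar>b\<bar> * norm f" for f
  using B(3)[of f] by (meson abs_ge_self mult_right_mono norm_ge_zero order_trans)
 have surj: "EX f g. (f, g) \<in> (%(f, g). (f, g + B f)) ` A & v = f - h *R g" if h: "h ~= 0" "\<bar>h\<bar> = 1 / b'" for h v
 proof -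
  have "EX f g. (f, g) \<in> A & v + h *R B f = f - h *R g"
  proof (rule resolvent_fixpoint[OF A.subspace_graph A.skew A.surj[OF h(1)], where c = "\<bar>b\<bar> / b'"])
   fix x y
   have "norm (v + h *R B x - (v + h *R B y)) = \<bar>h\<bar> * norm (B (x - y))" by (simp add: linear_diff[OF B(1)] flip: scaleR_diff_right)
   also have "... <= \<bar>h\<bar> * (\<bar>b\<bar> * norm (x - y))" by (intro mult_left_mono bB) auto
   finally show "norm (v + h *R B x - (v + h *R B y)) <= \<bar>b\<bar> / b' * norm (x - y)" using h by simp
  qed (use b' in auto)
  then obtain f g where "(f, g) \<in> A" "v = f - h *R (g + B f)" by (auto simp: algebra_simps)
  then show ?thesis by force
 qed
 show ?thesis
 proof (rule skew_operatorI[where h\<^sub>0 = "1 / b'"])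
  show "subspace ((%(f, g). (f, g + B f)) ` A)"
  proof (rule linear_subspace_image[OF _ A.subspace_graph])
   show "linear (%(f, g). (f, g + B f))" by (rule linearI) (auto simp: linear_add[OF B(1)] linear_scale[OF B(1)] scaleR_add_right split: prod.splits)
  qed
  show "f \<bullet> g = 0" if "(f, g) \<in> (%(f, g). (f, g + B f)) ` A" for f g
   using that A.skew B(2) by (auto simp: inner_add_right)
  have "fst ` (%(f, g). (f, g + B f)) ` A = fst ` A" by force
  then show "closure (fst ` (%(f, g). (f, g + B f)) ` A) = UNIV" by (simp add: A.dense)
  show "EX f g. (f, g) \<in> (%(f, g). (f, g + B f)) ` A & v = f - (1 / b') *R g" for v
   using b' by (intro surj) auto
  show "EX f g. (f, g) \<in> (%(f, g). (f, g + B f)) ` A & v = f - (- (1 / b')) *R g" for v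
   using b' by (intro surj) auto
 qed (use b' in auto)
qed

text \<open>The starting point on the lattice, where hopping and potential are both bounded
  perturbations of 0.\<close>

lemma skew_operator_zero: "skew_operator (range (%f :: 'h. (f, 0 :: 'h::{real_inner,complete_space})))"
proof
 show "subspace (range (%f :: 'h. (f, 0 :: 'h)))" by (auto simp: subspace_def zero_prod_def)
 have "fst ` range (%f :: 'h. (f, 0 :: 'h)) = UNIV" by (auto simp: image_image)
 then show "closure (fst ` range (%f :: 'h. (f, 0 :: 'h))) = UNIV" by simp
 fix h :: real and v :: "'h"
 show "EX f g. (f, g) \<in> range (%f :: 'h. (f, 0 :: 'h)) & v = f - h *R g" by (intro exI[of _ v] exI[of _ 0]) simp
qed auto

section \<open>The Hilbert space of square integrable functions\<close>

lemma L2_measurable [measurable_dest]: "f \<in> L2 M ==> f \<in> borel_measurable M" by (simp add: L2_def)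

lemma L2_integrable: "f \<in> L2 M ==> integrable M (%x. (cmod (f x))\<^sup>2)" by (simp add: L2_def)

lemma L2_iff_nn: "f \<in> L2 M \<longleftrightarrow> f \<in> borel_measurable M & (\<integral>\<^sup>+ x. ennreal ((cmod (f x))\<^sup>2) \<partial>M) < \<infinity>"
 unfolding L2_def by (auto simp: integrable_iff_bounded)

lemma L2_nn_norm: "f \<in> L2 M ==> (\<integral>\<^sup>+ x. ennreal ((cmod (f x))\<^sup>2) \<partial>M) = ennreal ((L2_norm M f)\<^sup>2)"
 unfolding L2_norm_def by (subst nn_integral_eq_integral) (auto simp: L2_def)

lemma L2_norm_power2: "(L2_norm M f)\<^sup>2 = (LINT x|M. (cmod (f x))\<^sup>2)" by (simp add: L2_norm_def)

lemma cmod_add_sq_le: "(cmod (a + b))\<^sup>2 <= 2 * (cmod a)\<^sup>2 + 2 * (cmod b)\<^sup>2"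
proof -
 have "(cmod (a + b))\<^sup>2 <= (cmod a + cmod b)\<^sup>2" by (intro power_mono norm_triangle_ineq) auto
 also have "... <= 2 * (cmod a)\<^sup>2 + 2 * (cmod b)\<^sup>2" using sum_squares_bound[of "cmod a" "cmod b"] by (simp add: power2_sum)
 finally show ?thesis .
qed

lemma L2_add: assumes "f \<in> L2 M" "g \<in> L2 M" shows "(%x. f x + g x) \<in> L2 M"
proof -
 have "integrable M (%x. 2 * (cmod (f x))\<^sup>2 + 2 * (cmod (g x))\<^sup>2)"
  using assms by (intro lintegrable_add integrable_mult_right L2_integrable)
 then have "integrable M (%x. (cmod (f x + g x))\<^sup>2)" by (rule lintegrable_bound) (use assms cmod_add_sq_le in "auto simp: L2_def")
 then show ?thesis using assms by (auto simp: L2_def)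
qed

lemma L2_cmult: assumes "f \<in> L2 M" shows "(%x. c * f x) \<in> L2 M" using assms by (auto simp: L2_def norm_mult power_mult_distrib)

lemma L2_uminus: "f \<in> L2 M ==> (%x. - f x) \<in> L2 M" using L2_cmult[of f M "-1"] by simp

lemma L2_diff: "f \<in> L2 M ==> g \<in> L2 M ==> (%x. f x - g x) \<in> L2 M" using L2_add[of f M "%x. - g x"] L2_uminus[of g M] by simp

lemma L2_zero [simp]: "(%x. 0) \<in> L2 M" by (simp add: L2_def)

lemma L2_sum: "(!!i. i \<in> I ==> f i \<in> L2 M) ==> (%x. \<Sum>i\<in>I. f i x) \<in> L2 M"
 by (induction I rule: infinite_finite_induct) (auto intro!: L2_add)

lemma L2_bound:
 assumes "f \<in> L2 M" "g \<in> borel_measurable M" "AE x in M. cmod (g x) <= B * cmod (f x)"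
 shows "g \<in> L2 M"
proof -
 have "integrable M (%x. B\<^sup>2 * (cmod (f x))\<^sup>2)" using assms by (intro integrable_mult_right L2_integrable)
 then have "integrable M (%x. (cmod (g x))\<^sup>2)"
 proof (rule lintegrable_bound)
  show "AE x in M. norm ((cmod (g x))\<^sup>2) <= norm (B\<^sup>2 * (cmod (f x))\<^sup>2)" using assms(3)
  proof eventually_elim
   case (elim x)
   then have "(cmod (g x))\<^sup>2 <= (B * cmod (f x))\<^sup>2" by (intro power_mono) auto
   then show ?case by (simp add: power_mult_distrib)
  qed
 qed (use assms in auto)
 then show ?thesis using assms by (simp add: L2_def)
qed

lemma L2_AE_cong: "f \<in> L2 M ==> g \<in> borel_measurable M ==> AE x in M. f x = g x ==> g \<in> L2 M" by (rule L2_bound[where B = 1]) auto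

lemma L2_mult_integrable:
 assumes "f \<in> L2 M" "g \<in> L2 M" shows "integrable M (%x. f x * g x)"
proof -
 have "integrable M (%x. (cmod (f x))\<^sup>2 + (cmod (g x))\<^sup>2)" using assms by (intro lintegrable_add L2_integrable)
 then show ?thesis
 proof (rule lintegrable_bound)
  show "AE x in M. norm (f x * g x) <= norm ((cmod (f x))\<^sup>2 + (cmod (g x))\<^sup>2)"
  proof (rule AE_I2)
   fix x
   have "2 * (cmod (f x) * cmod (g x)) <= (cmod (f x))\<^sup>2 + (cmod (g x))\<^sup>2"
    using sum_squares_bound[of "cmod (f x)" "cmod (g x)"] by (simp add: mult.assoc)
   moreover have "0 <= cmod (f x) * cmod (g x)" by simp
   ultimately have "cmod (f x) * cmod (g x) <= (cmod (f x))\<^sup>2 + (cmod (g x))\<^sup>2" by linarith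
   then show "norm (f x * g x) <= norm ((cmod (f x))\<^sup>2 + (cmod (g x))\<^sup>2)" by (simp add: norm_mult)
  qed
 qed (use assms in measurable)
qed

lemma borel_measurable_cnj: "cnj \<in> borel_measurable borel" by (intro borel_measurable_continuous_onI continuous_intros)

lemma L2_cnj: assumes "f \<in> L2 M" shows "(%x. cnj (f x)) \<in> L2 M"
 using measurable_compose[OF L2_measurable[OF assms] borel_measurable_cnj] L2_integrable[OF assms] by (simp add: L2_def)

lemma L2_inner_integrable: "f \<in> L2 M ==> g \<in> L2 M ==> integrable M (%x. cnj (f x) * g x)" by (intro L2_mult_integrable L2_cnj)

lemma L2_inner_self: "L2_inner M f f = cor ((L2_norm M f)\<^sup>2)"
proof -
 have "L2_inner M f f = (LINT x|M. cor ((cmod (f x))\<^sup>2))"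
  unfolding L2_inner_def by (intro lint_cong refl) (metis complex_norm_square mult.commute)
 also have "... = cor (LINT x|M. (cmod (f x))\<^sup>2)" by (rule integral_complex_of_real)
 finally show ?thesis by (simp add: L2_norm_power2)
qed

lemma L2_inner_commute: "L2_inner M f g = cnj (L2_inner M g f)"
proof -
 have "L2_inner M f g = (LINT x|M. cnj (cnj (g x) * f x))" unfolding L2_inner_def by (simp add: mult.commute)
 also have "... = cnj (LINT x|M. cnj (g x) * f x)" by (rule lint_cnj)
 finally show ?thesis unfolding L2_inner_def .
qed

lemma L2_inner_add_left:
 "f \<in> L2 M ==> g \<in> L2 M ==> h \<in> L2 M ==> L2_inner M (%x. f x + g x) h = L2_inner M f h + L2_inner M g h"
 unfolding L2_inner_def complex_cnj_add distrib_right
 by (rule lint_add) (auto intro: L2_inner_integrable)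

lemma L2_inner_cmult_left: "L2_inner M (%x. c * f x) h = cnj c * L2_inner M f h"
 unfolding L2_inner_def complex_cnj_mult mult.assoc by (rule integral_mult_right_zero)

lemma L2_norm_zero_iff: "f \<in> L2 M ==> L2_norm M f = 0 \<longleftrightarrow> (AE x in M. f x = 0)"
 unfolding L2_norm_def by (simp add: L2_def integral_nonneg_eq_0_iff_AE)

text \<open>Attaching the measure to the type makes the quotient by almost everywhere equality a
  type constructor, so that the Hilbert space structure can be given by type classes. The line and
  the lattice are its two instances.\<close>

class l2_space =
 fixes vol :: "'a measure"

definition l2_rel :: "('a::l2_space => complex) => ('a => complex) => bool" where
 "l2_rel f g \<longleftrightarrow> f \<in> L2 vol & g \<in> L2 vol & (AE x in vol. f x = g x)"

quotient_type (overloaded) 'a l2 = "'a::l2_space => complex" / partial: l2_rel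
proof (rule part_equivpI)
 show "\<exists>x::'a => complex. l2_rel x x" by (intro exI[of _ "%x. 0"]) (simp add: l2_rel_def)
 show "symp (l2_rel :: ('a => complex) => _)" by (auto simp: symp_def l2_rel_def elim: eventually_mono)
 show "transp (l2_rel :: ('a => complex) => _)" unfolding transp_def l2_rel_def by (auto elim: AE_mp)
qed

lemma l2_rel_refl: "l2_rel f f \<longleftrightarrow> f \<in> L2 vol" by (simp add: l2_rel_def)

lemma rep_L2 [simp]: "rep_l2 v \<in> L2 vol" using Quotient3_rel_rep[OF Quotient3_l2, of v v] l2_rel_def by blast

lemma abs_rep_l2 [simp]: "abs_l2 (rep_l2 v) = v" by (rule Quotient3_abs_rep[OF Quotient3_l2])

lemma abs_l2_eq_iff:
 "f \<in> L2 vol ==> g \<in> L2 vol ==> abs_l2 f = abs_l2 g \<longleftrightarrow> (AE x in vol. f x = g x)"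
 using Quotient3_rel[OF Quotient3_l2, of f g] by (auto simp: l2_rel_def)

lemma rep_abs_l2: "f \<in> L2 vol ==> AE x in vol. rep_l2 (abs_l2 f) x = f x" using abs_l2_eq_iff[of "rep_l2 (abs_l2 f)" f] by simp

lemma l2_cases [cases type: l2]: obtains f where "f \<in> L2 vol" "v = abs_l2 f" using that[of "rep_l2 v"] by simp

lemma l2_rel_eqI: "f \<in> L2 vol ==> f = g ==> l2_rel f g" by (simp add: l2_rel_def)

instantiation l2 :: (l2_space) real_vector
begin
lift_definition zero_l2 :: "'a l2" is "%x. 0" by (simp add: l2_rel_def)
lift_definition plus_l2 :: "'a l2 => 'a l2 => 'a l2" is "%f g x. f x + g x" by (auto simp: l2_rel_def intro: L2_add)
lift_definition minus_l2 :: "'a l2 => 'a l2 => 'a l2" is "%f g x. f x - g x" by (auto simp: l2_rel_def intro: L2_diff)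
lift_definition uminus_l2 :: "'a l2 => 'a l2" is "%f x. - f x" by (auto simp: l2_rel_def intro: L2_uminus)
lift_definition scaleR_l2 :: "real => 'a l2 => 'a l2" is "%c f x. cor c * f x" by (auto simp: l2_rel_def intro: L2_cmult)
instance
 by standard (transfer, rule l2_rel_eqI, simp add: l2_rel_refl L2_add L2_diff L2_uminus L2_cmult,
   simp add: fun_eq_iff algebra_simps)+
end

text \<open>The Hilbert space structure is taken over the reals, with the real part of
  \<open>cinner\<close> as inner product. Complex scalars and the complex product are carried along
  as additional operations.\<close>

lift_definition scaleC :: "complex => 'a::l2_space l2 => 'a l2" (infixr "*C" 75) is "%c f x. c * f x" by (auto simp: l2_rel_def intro: L2_cmult)

lift_definition cinner :: "'a::l2_space l2 => 'a l2 => complex" is "L2_inner vol" unfolding L2_inner_def l2_rel_def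
 by (intro Bochner_Integration.integral_cong_AE) (auto simp: L2_inner_integrable borel_measurable_integrable elim: AE_mp)

instantiation l2 :: (l2_space) real_inner
begin
lift_definition norm_l2 :: "'a l2 => real" is "L2_norm vol" unfolding L2_norm_def l2_rel_def
 by (rule arg_cong[where f = sqrt], intro Bochner_Integration.integral_cong_AE)
   (auto simp: L2_integrable borel_measurable_integrable)
definition inner_l2 :: "'a l2 => 'a l2 => real" where "inner_l2 f g = Re (cinner f g)"
definition dist_l2 :: "'a l2 => 'a l2 => real" where "dist_l2 f g = norm (f - g)"
definition sgn_l2 :: "'a l2 => 'a l2" where "sgn_l2 f = f /\<^sub>R norm f"
definition uniformity_l2 :: "('a l2 \<times> 'a l2) filter" where
 "uniformity_l2 = (INF e\<in>{0 <..}. principal {(x, y). dist x y < e})"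
definition open_l2 :: "'a l2 set => bool" where
 "open_l2 S = (\<forall>x\<in>S. \<forall>\<^sub>F (x', y) in uniformity. x' = x --> y \<in> S)"
instance
proof
 fix x y z :: "'a l2" and r :: real and S :: "'a l2 set"
 show "dist x y = norm (x - y)" by (simp add: dist_l2_def)
 show "sgn x = x /\<^sub>R norm x" by (simp add: sgn_l2_def)
 show "uniformity = (INF e\<in>{0 <..}. principal {(x, y::'a l2). dist x y < e})" by (simp add: uniformity_l2_def)
 show "open S = (\<forall>x\<in>S. \<forall>\<^sub>F (x', y) in uniformity. x' = x --> y \<in> S)" by (simp add: open_l2_def)
 show "inner x y = inner y x"
 proof -
  have "cinner x y = cnj (cinner y x)" by transfer (rule L2_inner_commute)
  then show ?thesis by (simp add: inner_l2_def)
 qed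
 show "inner (x + y) z = inner x z + inner y z"
 proof -
  have "cinner (x + y) z = cinner x z + cinner y z" by transfer (simp add: l2_rel_refl L2_inner_add_left)
  then show ?thesis by (simp add: inner_l2_def)
 qed
 show "inner (r *R x) y = r * inner x y"
 proof -
  have "cinner (r *R x) y = cor r * cinner x y" by transfer (simp add: L2_inner_cmult_left)
  then show ?thesis by (simp add: inner_l2_def)
 qed
 have cn: "cinner x x = cor ((norm x)\<^sup>2)" by transfer (auto simp: L2_inner_self)
 then show "0 <= inner x x" by (simp add: inner_l2_def)
 have nn: "norm x >= 0" by transfer (simp add: L2_norm_def)
 have "norm x = 0 \<longleftrightarrow> x = 0" by transfer (auto simp: l2_rel_def L2_norm_zero_iff)
 then show "(inner x x = 0) = (x = 0)" using cn by (simp add: inner_l2_def)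
 show "norm x = sqrt (inner x x)" using cn nn by (simp add: inner_l2_def)
qed
end

lemma abs_l2_zero: "abs_l2 (%x. 0) = 0" by (simp add: zero_l2.abs_eq)

lemma abs_l2_add: "f \<in> L2 vol ==> g \<in> L2 vol ==> abs_l2 f + abs_l2 g = abs_l2 (%x. f x + g x)"
 by (rule plus_l2.abs_eq) (simp_all add: l2_rel_refl)

lemma abs_l2_diff: "f \<in> L2 vol ==> g \<in> L2 vol ==> abs_l2 f - abs_l2 g = abs_l2 (%x. f x - g x)"
 by (rule minus_l2.abs_eq) (simp_all add: l2_rel_refl)

lemma abs_l2_uminus: "f \<in> L2 vol ==> - abs_l2 f = abs_l2 (%x. - f x)" by (rule uminus_l2.abs_eq) (simp add: l2_rel_refl)

lemma abs_l2_scaleC: "f \<in> L2 vol ==> c *C abs_l2 f = abs_l2 (%x. c * f x)" by (rule scaleC.abs_eq) (simp add: l2_rel_refl)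

lemma abs_l2_scaleR: "f \<in> L2 vol ==> c *R abs_l2 f = abs_l2 (%x. cor c * f x)" by (rule scaleR_l2.abs_eq) (simp add: l2_rel_refl)

lemma norm_abs_l2: "f \<in> L2 vol ==> norm (abs_l2 f) = L2_norm vol f" by (rule norm_l2.abs_eq) (simp add: l2_rel_refl)

lemma cinner_abs_l2: "f \<in> L2 vol ==> g \<in> L2 vol ==> cinner (abs_l2 f) (abs_l2 g) = L2_inner vol f g"
 by (rule cinner.abs_eq) (simp_all add: l2_rel_refl)

lemma norm_rep_l2: "L2_norm vol (rep_l2 v) = norm v" using norm_abs_l2[OF rep_L2, of v] by simp

lemma cinner_add_left: "cinner (x + y) z = cinner x z + cinner y z" by transfer (simp add: l2_rel_refl L2_inner_add_left)

lemma cinner_commute: "cinner x y = cnj (cinner y x)" by transfer (rule L2_inner_commute)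

lemma cinner_add_right: "cinner x (y + z) = cinner x y + cinner x z" by (subst (1 2 3) cinner_commute) (simp add: cinner_add_left)

lemma cinner_scaleC_left: "cinner (c *C x) y = cnj c * cinner x y" by transfer (simp add: L2_inner_cmult_left)

lemma cinner_scaleC_right: "cinner x (c *C y) = c * cinner x y" by (subst (1 2) cinner_commute) (simp add: cinner_scaleC_left)

lemma cinner_self: "cinner x x = cor ((norm x)\<^sup>2)" by transfer (auto simp: L2_inner_self)

lemma scaleC_of_real: "cor r *C x = r *R x" by transfer (rule l2_rel_eqI, simp_all add: l2_rel_refl L2_cmult)

lemma scaleC_add_right: "c *C (x + y) = c *C x + c *C y"
 by transfer (rule l2_rel_eqI, simp add: l2_rel_refl L2_add L2_cmult, simp add: fun_eq_iff algebra_simps)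

lemma scaleC_add_left: "(c + d) *C x = c *C x + d *C x"
 by transfer (rule l2_rel_eqI, simp add: l2_rel_refl L2_add L2_cmult, simp add: fun_eq_iff algebra_simps)

lemma scaleC_scaleC [simp]: "c *C d *C x = (c * d) *C x"
 by transfer (rule l2_rel_eqI, simp add: l2_rel_refl L2_cmult, simp add: fun_eq_iff algebra_simps)

lemma scaleC_one [simp]: "1 *C x = x" by transfer (auto simp: l2_rel_def)

lemma scaleC_scaleR: "c *C (r *R x) = r *R (c *C x)" unfolding scaleC_of_real[symmetric] scaleC_scaleC by (simp only: mult.commute)

lemma norm_scaleC [simp]: "norm (c *C x) = cmod c * norm x"
proof -
 have "cor ((norm (c *C x))\<^sup>2) = cor ((cmod c * norm x)\<^sup>2)"
  proof -
  have "cor ((norm (c *C x))\<^sup>2) = (c * cnj c) * cinner x x" unfolding cinner_self[symmetric] cinner_scaleC_left cinner_scaleC_right by simp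
  also have "... = cor ((cmod c)\<^sup>2 * (norm x)\<^sup>2)" unfolding complex_norm_square[symmetric] cinner_self of_real_mult ..
  finally show ?thesis by (simp only: power_mult_distrib)
 qed
 then have "(norm (c *C x))\<^sup>2 = (cmod c * norm x)\<^sup>2" unfolding of_real_eq_iff .
 then show ?thesis by (simp add: power2_eq_iff_nonneg)
qed

lemma bounded_linear_scaleC: "bounded_linear (scaleC c)"
 by (rule bounded_linear_intro[where K = "cmod c"]) (simp_all add: scaleC_add_right scaleC_scaleR mult.commute)

lemma inner_scaleC_ii: "x \<bullet> (\<i> *C y) = - Im (cinner x y)" "(\<i> *C x) \<bullet> y = Im (cinner x y)"
 by (simp_all add: inner_l2_def cinner_scaleC_left cinner_scaleC_right)

lemma cinner_eq: "cinner x y = Complex (x \<bullet> y) ((\<i> *C x) \<bullet> y)" unfolding inner_scaleC_ii by (simp add: complex_eq_iff inner_l2_def)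

lemma cinner_zero [simp]: "cinner 0 y = 0" "cinner y 0 = 0" using cinner_add_left[of 0 0 y] cinner_add_right[of y 0 0] by simp_all

lemma cinner_diff_left: "cinner (x - y) z = cinner x z - cinner y z" using cinner_add_left[of "x - y" y z] by simp

lemma cinner_diff_right: "cinner x (y - z) = cinner x y - cinner x z" using cinner_add_right[of x "y - z" z] by simp

lemma cinner_sum_left: "cinner (\<Sum>i\<in>I. f i) y = (\<Sum>i\<in>I. cinner (f i) y)"
 by (induction I rule: infinite_finite_induct) (auto simp: cinner_add_left)

lemma cinner_sum_right: "cinner y (\<Sum>i\<in>I. f i) = (\<Sum>i\<in>I. cinner y (f i))"
 by (induction I rule: infinite_finite_induct) (auto simp: cinner_add_right)

lemma scaleC_zero [simp]: "0 *C x = 0" "c *C 0 = 0" using norm_scaleC[of 0 x] norm_scaleC[of c 0] by (simp_all del: norm_scaleC add: norm_eq_zero)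

lemma scaleC_minus [simp]: "(- c) *C x = - (c *C x)" "c *C (- x) = - (c *C x)"
 using scaleC_add_left[of "-c" c x] scaleC_add_right[of c "-x" x] by (simp_all add: eq_neg_iff_add_eq_0)

lemma scaleC_diff_right: "c *C (x - y) = c *C x - c *C y" using scaleC_add_right[of c "x" "- y"] by simp

lemma scaleC_diff_left: "(c - d) *C x = c *C x - d *C x" using scaleC_add_left[of c "- d" x] by simp

lemma tendsto_cinner:
 assumes "(f ---> a) F" "(g ---> b) F" shows "((%x. cinner (f x) (g x)) ---> cinner a b) F" unfolding cinner_eq
 by (intro tendsto_Complex tendsto_inner assms bounded_linear.tendsto[OF bounded_linear_scaleC])

lemma half_pow_sq: "((1/2::real) ^ k)\<^sup>2 = (1/4) ^ k" by (induction k) (auto simp: power2_eq_square)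

lemma pow2_mult_quarter: "(2::real) ^ k * (1/4) ^ k = (1/2) ^ k" by (induction k) (auto simp: power_divide field_simps)

text \<open>The Riesz-Fischer theorem: a rapidly convergent subsequence converges almost everywhere,
  and Fatou's lemma shows that the pointwise limit is the limit in norm.\<close>

instance l2 :: (l2_space) complete_space
proof
 fix X :: "nat => 'a l2" assume "Cauchy X"
 let ?M = "vol :: 'a measure"
 have "ALL k. EX N. \<forall>m\<ge>N. \<forall>n\<ge>N. norm (X m - X n) < (1/2) ^ k" using CauchyD[OF \<open>Cauchy X\<close>] by simp
 then obtain N where N: "!!k m n. m >= N k ==> n >= N k ==> norm (X m - X n) < (1/2) ^ k" by metis
 \<comment> \<open>Partial sums are nondecreasing, so \<open>r m\<close> is beyond
   \<open>N k\<close> for every \<open>m >= k\<close>.\<close>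
 define r where "r k = (\<Sum>j\<le>k. N j)" for k
 have r: "r m >= N k" if "k <= m" for k m
  unfolding r_def using that by (intro member_le_sum) auto
 define g where "g k = rep_l2 (X (r k))" for k
 have gL: "g k \<in> L2 ?M" for k by (simp add: g_def)
 have gm [measurable]: "g k \<in> borel_measurable ?M" for k using gL by (rule L2_measurable)
 have diff: "(\<integral>\<^sup>+ x. ennreal ((cmod (g m x - g k x))\<^sup>2) \<partial>?M) <= ennreal ((1/4) ^ k)" if "k <= m" for k m
 proof -
  have "(\<integral>\<^sup>+ x. ennreal ((cmod (g m x - g k x))\<^sup>2) \<partial>?M) = ennreal ((norm (X (r m) - X (r k)))\<^sup>2)"
   using L2_nn_norm[OF L2_diff[OF gL gL], of m k] norm_abs_l2[OF L2_diff[OF gL gL], of m k]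
    abs_l2_diff[OF gL gL, of m k] by (simp add: g_def)
  also have "... <= ennreal (((1/2) ^ k)\<^sup>2)" using N[OF r[OF that] r[OF order_refl]] by (intro ennreal_leI power_mono) auto
  finally show ?thesis unfolding half_pow_sq .

 qed
 \<comment> \<open>The weights \<open>2 ^ k\<close> are still summable against the bounds
   \<open>(1/4) ^ k\<close> on the integrals. Where \<open>S\<close> is finite, they force
   increments of size at most \<open>sqrt C * (sqrt (1/2)) ^ k\<close>, which are summable.\<close>
 define S where "S x = (\<Sum>k. ennreal (2 ^ k * (cmod (g (Suc k) x - g k x))\<^sup>2))" for x
 have "(\<integral>\<^sup>+ x. S x \<partial>?M) = (\<Sum>k. \<integral>\<^sup>+ x. ennreal (2 ^ k * (cmod (g (Suc k) x - g k x))\<^sup>2) \<partial>?M)"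
  unfolding S_def by (rule nn_integral_suminf) measurable
 also have "... <= (\<Sum>k. ennreal ((1/2) ^ k))"
 proof (rule suminf_le)
  fix k
  have "(\<integral>\<^sup>+ x. ennreal (2 ^ k * (cmod (g (Suc k) x - g k x))\<^sup>2) \<partial>?M)
    = ennreal (2 ^ k) * (\<integral>\<^sup>+ x. ennreal ((cmod (g (Suc k) x - g k x))\<^sup>2) \<partial>?M)"
   by (subst nn_integral_cmult[symmetric]) (auto simp: ennreal_mult)
  also have "... <= ennreal (2 ^ k) * ennreal ((1/4) ^ k)" by (intro mult_left_mono diff) auto
  also have "... = ennreal ((1/2) ^ k)" by (subst ennreal_mult[symmetric]) (simp_all only: pow2_mult_quarter zero_le_power zero_le_numeral zero_le_divide_1_iff)
  finally show "(\<integral>\<^sup>+ x. ennreal (2 ^ k * (cmod (g (Suc k) x - g k x))\<^sup>2) \<partial>?M) <= ennreal ((1/2) ^ k)" .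
 qed auto
 also have "... = ennreal (\<Sum>k. (1/2) ^ k)" by (rule suminf_ennreal2) (auto intro: summable_geometric)
 also have "... < \<infinity>" by simp
 finally have fin: "(\<integral>\<^sup>+ x. S x \<partial>?M) ~= \<infinity>" by simp
 have Sm [measurable]: "S \<in> borel_measurable ?M" unfolding S_def by measurable
 have "AE x in ?M. S x ~= \<infinity>" by (rule nn_integral_PInf_AE[OF Sm fin])
 then have conv: "AE x in ?M. convergent (%k. g k x)"
 proof eventually_elim
  case (elim x)
  define C where "C = enn2real (S x)"
  have C: "S x = ennreal C" using elim by (simp add: C_def less_top)
  have C0: "C >= 0" by (simp add: C_def)
  have le: "2 ^ k * (cmod (g (Suc k) x - g k x))\<^sup>2 <= C" for k
  proof -
   have "ennreal (2 ^ k * (cmod (g (Suc k) x - g k x))\<^sup>2) <= S x"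
   proof -
    have "(\<Sum>j\<in>{k}. ennreal (2 ^ j * (cmod (g (Suc j) x - g j x))\<^sup>2)) <= S x"
     unfolding S_def by (rule sum_le_suminf) (rule summableI, rule finite.intros(2), rule finite.intros(1), rule zero_le)
    then show ?thesis by (simp only: sum.insert[OF finite.emptyI] empty_iff not_False_eq_True sum.empty add_0_right)
   qed
   then show ?thesis unfolding C using ennreal_le_iff[OF C0] by blast
  qed
  have "norm (g (Suc k) x - g k x) <= sqrt C * (sqrt (1/2)) ^ k" for k
  proof (rule power2_le_imp_le)
   have "(cmod (g (Suc k) x - g k x))\<^sup>2 <= C * (1/2) ^ k" using le[of k] by (simp add: power_divide field_simps)
   also have "... = (sqrt C * (sqrt (1/2)) ^ k)\<^sup>2"
   proof -
    have "((sqrt (1/2)) ^ k)\<^sup>2 = (1/2) ^ k" by (induction k) (simp_all only: power_0 power_one power_Suc power_mult_distrib, simp)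
    then show ?thesis using C0 by (simp only: power_mult_distrib real_sqrt_pow2)
   qed
   finally show "(norm (g (Suc k) x - g k x))\<^sup>2 <= (sqrt C * (sqrt (1/2)) ^ k)\<^sup>2" .
  qed (use C0 in auto)
  moreover have "summable (%k. sqrt C * (sqrt (1/2)) ^ k)" by (intro summable_mult summable_geometric) (simp add: real_sqrt_divide)
  ultimately have "summable (%k. g (Suc k) x - g k x)"
   using summable_comparison_test[of "%k. g (Suc k) x - g k x" "%k. sqrt C * (sqrt (1/2)) ^ k"] by blast
  then have "convergent (%n. \<Sum>k<n. g (Suc k) x - g k x)" by (simp add: summable_iff_convergent)
  then have "convergent (%n. g n x - g 0 x)" by (simp only: sum_lessThan_telescope[of "%k. g k x"])
  then show ?case using convergent_add_const_right_iff[of "%n. g n x" "- g 0 x"] by simp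
 qed
 define G where "G x = lim (%k. g k x)" for x
 have Gm [measurable]: "G \<in> borel_measurable ?M" unfolding G_def by measurable
 have lim: "AE x in ?M. (%k. g k x) ----> G x" using conv by eventually_elim (simp add: G_def convergent_LIMSEQ_iff)
 have Gk: "(\<integral>\<^sup>+ x. ennreal ((cmod (G x - g k x))\<^sup>2) \<partial>?M) <= ennreal ((1/4) ^ k)" for k
 proof -
  have "(\<integral>\<^sup>+ x. ennreal ((cmod (G x - g k x))\<^sup>2) \<partial>?M)
    = (\<integral>\<^sup>+ x. liminf (%m. ennreal ((cmod (g m x - g k x))\<^sup>2)) \<partial>?M)"
  proof (rule nn_integral_cong_AE)
   show "AE x in ?M. ennreal ((cmod (G x - g k x))\<^sup>2) = liminf (%m. ennreal ((cmod (g m x - g k x))\<^sup>2))" using lim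
   proof eventually_elim
    case (elim x)
    have "(%m. ennreal ((cmod (g m x - g k x))\<^sup>2)) ----> ennreal ((cmod (G x - g k x))\<^sup>2)" by (intro tendsto_intros elim)
    then show ?case by (rule lim_imp_Liminf[OF sequentially_bot, symmetric])
   qed
  qed
  also have "... <= liminf (%m. \<integral>\<^sup>+ x. ennreal ((cmod (g m x - g k x))\<^sup>2) \<partial>?M)" by (rule nn_integral_liminf) measurable
  also have "... <= ennreal ((1/4) ^ k)" by (rule Liminf_le) (auto intro!: diff simp: eventually_sequentially intro: exI[of _ k])
  finally show ?thesis .
 qed
 have Gd: "(%x. G x - g k x) \<in> L2 ?M" for k
  using Gk[of k] by (auto simp: L2_iff_nn intro: le_less_trans)
 have GL: "G \<in> L2 ?M" using L2_add[OF Gd[of 0] gL[of 0]] by simp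
 have Gn: "norm (abs_l2 G - X (r k)) <= (1/2) ^ k" for k
 proof (rule power2_le_imp_le)
  have "abs_l2 G - X (r k) = abs_l2 (%x. G x - g k x)" using abs_l2_diff[OF GL gL, of k] by (simp add: g_def)
  then have "ennreal ((norm (abs_l2 G - X (r k)))\<^sup>2) <= ennreal ((1/4) ^ k)"
   using Gk[of k] L2_nn_norm[OF Gd, of k] norm_abs_l2[OF Gd, of k] by simp
  then have "(norm (abs_l2 G - X (r k)))\<^sup>2 <= (1/4) ^ k" by (subst (asm) ennreal_le_iff) auto
  then show "(norm (abs_l2 G - X (r k)))\<^sup>2 <= ((1/2) ^ k)\<^sup>2" unfolding half_pow_sq .
 qed simp
 have "X ----> abs_l2 G"
 proof (rule LIMSEQ_I)
  fix e :: real assume e: "e > 0"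
  obtain k where k: "(1/2) ^ k < e / 2" using real_arch_pow_inv[of "e / 2" "1/2"] e by auto
  have "norm (X n - abs_l2 G) < e" if "n >= N k" for n
  proof -
   have "norm (X n - abs_l2 G) <= norm (X n - X (r k)) + norm (abs_l2 G - X (r k))"
    using norm_triangle_ineq4[of "X n - X (r k)" "abs_l2 G - X (r k)"] by simp
   then show ?thesis using N[OF that r[OF order_refl]] Gn[of k] k by linarith
  qed
  then show "EX no. \<forall>n\<ge>no. norm (X n - abs_l2 G) < e" by blast
 qed
 then show "convergent X" by (rule convergentI)
qed

section \<open>Bochner's theorem\<close>

definition positive_definite :: "(real => complex) => bool" where
 "positive_definite \<phi> \<longleftrightarrow> (\<forall>(n::nat) t c. \<exists>r\<ge>0.
   (\<Sum>j<n. \<Sum>k<n. cnj (c j) * c k * \<phi> (t k - t j)) = cor r)"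

text \<open>The Fejer mean of the Fourier series with coefficients \<open>\<phi> (h * l)\<close>:
  grouping by l = k - j yields the weights (N - |l|)/N. As a double sum it is, up to the factor 1/N,
  the quadratic form of \<open>\<phi>\<close> at the points h j with coefficients
  \<open>cis (- (h * j * x))\<close>, hence nonnegative.\<close>

definition fejer :: "(real => complex) => nat => real => real => complex" where
 "fejer \<phi> N h x =
   (\<Sum>j<N. \<Sum>k<N. \<phi> (h * (real k - real j)) * cis (- (h * (real k - real j) * x))) / of_nat N"

text \<open>The mean has period 2 pi / h, so the density is cut off to one period; the factor
  \<open>h / (2 * pi)\<close> makes the total mass equal to \<open>\<phi> 0\<close>.\<close>

definition fejer_measure :: "(real => complex) => nat => real => real measure" where
 "fejer_measure \<phi> N h =
   density lborel (%x. ennreal (h / (2 * pi) * Re (fejer \<phi> N h x) * indicator {- (pi / h)..pi / h} x))"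

lemma fejer_nonneg:
 assumes "positive_definite \<phi>"
 shows "Re (fejer \<phi> N h x) >= 0" "cor (Re (fejer \<phi> N h x)) = fejer \<phi> N h x"
proof -
 obtain r where r: "r >= 0" "(\<Sum>j<N. \<Sum>k<N. cnj (cis (- (h * real j * x))) * cis (- (h * real k * x)) * \<phi> (h * real k - h * real j))
   = cor r" using assms unfolding positive_definite_def by meson
 have "cnj (cis (- (h * real j * x))) * cis (- (h * real k * x)) * \<phi> (h * real k - h * real j)
   = \<phi> (h * (real k - real j)) * cis (- (h * (real k - real j) * x))" for j k
 proof -
  have "cnj (cis (- (h * real j * x))) * cis (- (h * real k * x)) = cis (- (h * (real k - real j) * x))" by (simp add: cis_cnj cis_mult algebra_simps)
  then show ?thesis by (simp add: right_diff_distrib)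
 qed
 then have "fejer \<phi> N h x = cor (r / real N)" using r(2) by (simp add: fejer_def)
 then show "Re (fejer \<phi> N h x) >= 0" "cor (Re (fejer \<phi> N h x)) = fejer \<phi> N h x" using r(1) by simp_all
qed

lemma measurable_cis [measurable]: "cis \<in> borel_measurable borel" by (intro borel_measurable_continuous_onI continuous_intros)

lemma measurable_fejer [measurable]: "fejer \<phi> N h \<in> borel_measurable borel" unfolding fejer_def by measurable

lemma integrable_indicator_cis:
 "integrable lborel (%x. indicator {a..b::real} x *R cis (c * x))"
proof (rule lintegrable_bound)
 show "integrable lborel (indicator {a..b} :: real => real)" by (rule integrable_real_indicator) (auto simp: emeasure_lborel_Icc_eq)
qed (auto simp: indicator_def)

lemma integral_indicator_cis:
 assumes h: "h > 0"
 shows "(LINT x|lborel. indicator {- (pi / h)..pi / h} x *R cis (h * real_of_int n * x))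
  = (if n = 0 then cor (2 * pi / h) else 0)"
proof (cases "n = 0")
 case True
 have "(LINT x|lborel. indicator {- (pi / h)..pi / h} x *R (1::complex)) = cor (2 * pi / h)"
  using h by (simp add: measure_def emeasure_lborel_Icc_eq scaleR_conv_of_real)
 then show ?thesis using True by simp
next
 case False
 define c where "c = h * real_of_int n"
 have c: "c ~= 0" using h False by (simp add: c_def)
 have "(LINT x|lborel. indicator {- (pi / h)..pi / h} x *R cis (c * x))
   = Complex (sin (c * (pi / h)) / c) (- cos (c * (pi / h)) / c)
    - Complex (sin (c * (- (pi / h))) / c) (- cos (c * (- (pi / h))) / c)"
 proof (rule integral_FTC_Icc)
  show "- (pi / h) <= pi / h" using h by (simp add: order_trans[of _ 0])
  show "continuous_on {- (pi / h)..pi / h} (%x. cis (c * x))" by (intro continuous_intros)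
  fix x
  show "((%x. Complex (sin (c * x) / c) (- cos (c * x) / c)) has_vector_derivative cis (c * x)) (at x within {- (pi / h)..pi / h})"
   unfolding has_vector_derivative_complex_iff using c by (auto intro!: derivative_eq_intros)
 qed
 also have "... = 0"
 proof -
  have "c * (pi / h) = pi * real_of_int n" "c * (- (pi / h)) = - (pi * real_of_int n)" using h by (simp_all add: c_def)
  then show ?thesis by (simp add: complex_eq_iff)
 qed
 finally show ?thesis using False by (simp add: c_def)
qed

lemma count_differences:
 "(\<Sum>j<N. \<Sum>k<N. if int k - int j = l then (1::complex) else 0) = of_nat (N - nat \<bar>l\<bar>)"
proof -
 have inner: "(\<Sum>k<N. if int k - int j = l then (1::complex) else 0)
   = (if 0 <= int j + l & int j + l < int N then 1 else 0)" for j
 proof (cases "0 <= int j + l & int j + l < int N")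
  case True
  then have "(\<Sum>k<N. if int k - int j = l then (1::complex) else 0) = (\<Sum>k<N. if k = nat (int j + l) then 1 else 0)" by (intro sum.cong) auto
  then show ?thesis using True by (simp add: nat_less_iff)
 next
  case False
  then have "(\<Sum>k<N. if int k - int j = l then (1::complex) else 0) = 0" by (intro sum.neutral) auto
  then show ?thesis using False by simp
 qed
 have "{..<N} \<inter> {j. 0 <= int j + l & int j + l < int N} = (if l >= 0 then {..<N - nat l} else {nat (- l)..<N})" by auto
 then have "card ({..<N} \<inter> {j. 0 <= int j + l & int j + l < int N}) = N - nat \<bar>l\<bar>" by auto
 then show ?thesis unfolding inner by (simp add: sum.If_cases)
qed

text \<open>Orthogonality of the exponentials over one period keeps only the pairs with k - j = l,
  and \<open>count_differences\<close> counts them.\<close>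

lemma integral_fejer_measure:
 assumes pd: "positive_definite \<phi>" and h: "h > 0" and N: "N > 0"
 shows "(LINT x|fejer_measure \<phi> N h. cis (h * real_of_int l * x))
  = of_nat (N - nat \<bar>l\<bar>) / of_nat N * \<phi> (h * real_of_int l)"
proof -
 define I where "I = {- (pi / h)..pi / h}"
 have g0: "0 <= h / (2 * pi) * Re (fejer \<phi> N h x) * indicator I x" for x
  using h fejer_nonneg(1)[OF pd] by (auto simp: indicator_def)
 have "(LINT x|fejer_measure \<phi> N h. cis (h * real_of_int l * x))
   = (LINT x|lborel. (h / (2 * pi) * Re (fejer \<phi> N h x) * indicator I x) *R cis (h * real_of_int l * x))"
  unfolding fejer_measure_def I_def[symmetric]
 proof (rule integral_density)
  show "AE x in lborel. 0 <= h / (2 * pi) * Re (fejer \<phi> N h x) * indicator I x" by (rule AE_I2 g0)+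
  have [measurable]: "I \<in> sets lborel" by (simp add: I_def)
  show "(%x. h / (2 * pi) * Re (fejer \<phi> N h x) * indicator I x) \<in> borel_measurable lborel" by measurable
 qed simp
 also have "... = (LINT x|lborel. (\<Sum>j<N. \<Sum>k<N. (cor (h / (2 * pi)) * \<phi> (h * (real k - real j)) / of_nat N)
    * (indicator I x *R cis (h * real_of_int (l - (int k - int j)) * x))))"
 proof (rule lint_cong[OF refl])
  fix x
  have e: "cis (- (h * (real k - real j) * x)) * cis (h * real_of_int l * x) = cis (h * real_of_int (l - (int k - int j)) * x)" for j k
   by (simp add: cis_mult algebra_simps)
  have "(h / (2 * pi) * Re (fejer \<phi> N h x) * indicator I x) *R cis (h * real_of_int l * x)
    = cor (h / (2 * pi)) * cor (Re (fejer \<phi> N h x)) * (indicator I x *R cis (h * real_of_int l * x))"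
   by (simp add: scaleR_conv_of_real mult.assoc)
  also have "... = cor (h / (2 * pi)) * fejer \<phi> N h x * (indicator I x *R cis (h * real_of_int l * x))" by (simp only: fejer_nonneg(2)[OF pd])
  also have "... = (\<Sum>j<N. \<Sum>k<N. (cor (h / (2 * pi)) * \<phi> (h * (real k - real j)) / of_nat N)
    * (indicator I x *R (cis (- (h * (real k - real j) * x)) * cis (h * real_of_int l * x))))"
   by (simp add: fejer_def sum_distrib_left sum_distrib_right sum_divide_distrib scaleR_conv_of_real mult_ac)
  finally show "(h / (2 * pi) * Re (fejer \<phi> N h x) * indicator I x) *R cis (h * real_of_int l * x)
    = (\<Sum>j<N. \<Sum>k<N. (cor (h / (2 * pi)) * \<phi> (h * (real k - real j)) / of_nat N)
    * (indicator I x *R cis (h * real_of_int (l - (int k - int j)) * x)))" unfolding e .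
 qed
 also have "... = (\<Sum>j<N. \<Sum>k<N. (cor (h / (2 * pi)) * \<phi> (h * (real k - real j)) / of_nat N)
    * (LINT x|lborel. indicator I x *R cis (h * real_of_int (l - (int k - int j)) * x)))" unfolding I_def
  by (subst lint_sum,
    intro Bochner_Integration.integrable_sum integrable_mult_right integrable_indicator_cis,
    subst lint_sum,
    intro integrable_mult_right integrable_indicator_cis, simp only: integral_mult_right_zero)
 also have "... = (\<Sum>j<N. \<Sum>k<N. \<phi> (h * real_of_int l) / of_nat N * (if int k - int j = l then 1 else 0))"
 proof (intro sum.cong refl)
  fix j k
  show "(cor (h / (2 * pi)) * \<phi> (h * (real k - real j)) / of_nat N)
    * (LINT x|lborel. indicator I x *R cis (h * real_of_int (l - (int k - int j)) * x))
   = \<phi> (h * real_of_int l) / of_nat N * (if int k - int j = l then 1 else 0)"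
  proof (cases "int k - int j = l")
   case True
   have "real k - real j = real_of_int l" using True by linarith
   then show ?thesis using True h unfolding I_def integral_indicator_cis[OF h] \<open>real k - real j = real_of_int l\<close> by simp
  next
   case False
   then show ?thesis unfolding I_def integral_indicator_cis[OF h] by simp
  qed
 qed
 also have "... = \<phi> (h * real_of_int l) / of_nat N * of_nat (N - nat \<bar>l\<bar>)"
  unfolding count_differences[symmetric] by (simp only: sum_distrib_left)
 finally show ?thesis by simp
qed

lemma char_fejer_measure:
 assumes "positive_definite \<phi>" "h > 0" "N > 0" "s = h * real_of_int l"
 shows "char (fejer_measure \<phi> N h) s = of_nat (N - nat \<bar>l\<bar>) / of_nat N * \<phi> s"
 unfolding char_def cis_conv_exp[symmetric] assms(4) by (rule integral_fejer_measure[OF assms(1-3)])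

lemma real_distribution_fejer_measure:
 assumes pd: "positive_definite \<phi>" and h: "h > 0" and N: "N > 0" and one: "\<phi> 0 = 1"
 shows "real_distribution (fejer_measure \<phi> N h)"
proof -
 let ?g = "%x. h / (2 * pi) * Re (fejer \<phi> N h x) * indicator {- (pi / h)..pi / h} x"
 have g0: "0 <= ?g x" for x
  using h fejer_nonneg(1)[OF pd] by (auto simp: indicator_def)
 have "(LINT x|fejer_measure \<phi> N h. (1::complex)) = 1" using integral_fejer_measure[OF pd h N, of 0] one N by simp
 then have "measure (fejer_measure \<phi> N h) UNIV = 1" by (simp add: fejer_measure_def scaleR_conv_of_real)
 moreover have "emeasure (fejer_measure \<phi> N h) UNIV ~= \<infinity>" using calculation by (auto simp: measure_def)
 ultimately have "emeasure (fejer_measure \<phi> N h) UNIV = 1" by (simp add: emeasure_eq_ennreal_measure)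
 then show ?thesis
  unfolding real_distribution_def real_distribution_axioms_def
  by (auto intro!: prob_spaceI simp: fejer_measure_def)
qed

lemma AE_fejer_measure: "AE x in fejer_measure \<phi> N h. x \<in> {- (pi / h)..pi / h}"
 unfolding fejer_measure_def by (subst AE_density) (auto simp: indicator_def)

lemma sin_ge_half:
 fixes y :: real assumes "0 <= y" "y <= pi / 2" shows "y / 2 <= sin y"
proof -
 have "\<bar>sin y - (\<Sum>m<3. sin_coeff m * y ^ m)\<bar> <= inverse (fact 3) * \<bar>y\<bar> ^ 3" by (rule Maclaurin_sin_bound)
 also have "(\<Sum>m<3. sin_coeff m * y ^ m) = y" by (simp add: eval_nat_numeral sin_coeff_def)
 finally have "\<bar>sin y - y\<bar> <= y ^ 3 / 6" using assms by (simp add: fact_numeral)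
 then have "sin y >= y - y ^ 3 / 6" by linarith
 moreover have "y ^ 3 <= 3 * y"
 proof -
  have "y <= 1.7" using assms pi_less_4 pi_approx by simp
  then have "y * y <= 1.7 * 1.7" using assms by (intro mult_mono) auto
  then have "y * (y * y) <= y * 3" using assms by (intro mult_left_mono) auto
  then show ?thesis by (simp add: power3_eq_cube)
 qed
 ultimately show ?thesis by simp
qed

lemma norm_cis_diff_ge:
 fixes \<theta> :: real assumes "\<bar>\<theta>\<bar> <= pi" shows "\<bar>\<theta>\<bar> / 2 <= cmod (cis \<theta> - 1)"
proof -
 have "cmod (cis \<theta> - 1) = 2 * \<bar>sin (\<theta> / 2)\<bar>" unfolding cis_conv_exp by (rule dist_exp_i_1)
 also have "\<bar>sin (\<theta> / 2)\<bar> = \<bar>sin (\<bar>\<theta>\<bar> / 2)\<bar>" by (cases "\<theta> >= 0") auto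
 finally show ?thesis using sin_ge_half[of "\<bar>\<theta>\<bar> / 2"] assms by simp
qed

lemma norm_cis_sum_le:
 fixes \<theta> :: real assumes "\<bar>\<theta>\<bar> <= pi" "\<theta> ~= 0"
 shows "cmod (\<Sum>l<L. cis (real l * \<theta>)) <= 4 / \<bar>\<theta>\<bar>"
proof -
 have d: "cmod (cis \<theta> - 1) >= \<bar>\<theta>\<bar> / 2" by (rule norm_cis_diff_ge[OF assms(1)])
 then have ne: "cis \<theta> ~= 1" using assms(2) by auto
 have "(\<Sum>l<L. cis (real l * \<theta>)) = (\<Sum>l<L. cis \<theta> ^ l)" by (simp add: Complex.DeMoivre)
 also have "... = (cis \<theta> ^ L - 1) / (cis \<theta> - 1)" by (rule geometric_sum[OF ne])
 finally have "cmod (\<Sum>l<L. cis (real l * \<theta>)) = cmod (cis \<theta> ^ L - 1) / cmod (cis \<theta> - 1)" by (simp add: norm_divide)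
 also have "... <= 2 / (\<bar>\<theta>\<bar> / 2)"
 proof (rule frac_le)
  show "cmod (cis \<theta> ^ L - 1) <= 2" using norm_triangle_ineq4[of "cis \<theta> ^ L" 1] by (simp add: norm_power)
 qed (use d assms in auto)
 finally show ?thesis by simp
qed

text \<open>The truncation inequality, in discrete form: values of \<open>\<phi>\<close> near 0
  control the tails. One minus the real part of the average of \<open>cis (h * l * x)\<close> over l
  < L is nonnegative. Beyond \<open>K\<close> the geometric sum is at most L/2, so there it is at
  least 1/2. Its integral is at most \<open>\<epsilon> + L / N\<close>, where L/N is the loss caused
  by the Fejer weights.\<close>

lemma fejer_measure_tail:
 assumes pd: "positive_definite \<phi>" and h: "h > 0" and N: "N > 0" and one: "\<phi> 0 = 1"
  and L: "L > 0" "L <= N" and e: "!!l. l < L ==> cmod (1 - \<phi> (h * real l)) <= \<epsilon>" and K: "K >= 8 / (real L * h)"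
 shows "measure (fejer_measure \<phi> N h) {x. K < \<bar>x\<bar>} <= 2 * (\<epsilon> + real L / real N)"
proof -
 let ?\<mu> = "fejer_measure \<phi> N h"
 interpret \<mu>: real_distribution ?\<mu> by (rule real_distribution_fejer_measure[OF pd h N one])
 define g where "g x = 1 - Re ((\<Sum>l<L. cis (h * real l * x)) / of_nat L)" for x
 have nrm: "cmod ((\<Sum>l<L. cis (h * real l * x)) / of_nat L) <= 1" for x
 proof -
  have "cmod (\<Sum>l<L. cis (h * real l * x)) <= (\<Sum>l<L. cmod (cis (h * real l * x)))" by (rule norm_sum)
  then show ?thesis using L by (simp add: norm_divide)
 qed
 have g0: "g x >= 0" for x using nrm[of x] complex_Re_le_cmod[of "(\<Sum>l<L. cis (h * real l * x)) / of_nat L"] by (simp add: g_def)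
 have icis: "integrable ?\<mu> (%x. cis (c * x))" for c
  by (rule \<mu>.integrable_const_bound[of _ 1]) auto
 have igc: "integrable ?\<mu> (%x. (\<Sum>l<L. cis (h * real l * x)) / of_nat L)"
  by (intro integrable_divide_zero Bochner_Integration.integrable_sum impI) (rule icis)
 have ig: "integrable ?\<mu> g" unfolding g_def
  by (intro Bochner_Integration.integrable_diff integrable_Re igc) simp
 have intg: "(LINT x|?\<mu>. g x) <= \<epsilon> + real L / real N"
 proof -
  have "(LINT x|?\<mu>. g x) = 1 - Re (LINT x|?\<mu>. (\<Sum>l<L. cis (h * real l * x)) / of_nat L)"
  proof -
   have "(LINT x|?\<mu>. g x) = (LINT x|?\<mu>. 1) - (LINT x|?\<mu>. Re ((\<Sum>l<L. cis (h * real l * x)) / of_nat L))"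
    unfolding g_def by (rule lint_diff[OF _ integrable_Re[OF igc]]) simp
   also have "(LINT x|?\<mu>. (1::real)) = 1" using \<mu>.prob_space by simp
   also have "(LINT x|?\<mu>. Re ((\<Sum>l<L. cis (h * real l * x)) / of_nat L)) = Re (LINT x|?\<mu>. (\<Sum>l<L. cis (h * real l * x)) / of_nat L)"
    by (rule integral_Re[OF igc])
   finally show ?thesis .
  qed
  also have "(LINT x|?\<mu>. (\<Sum>l<L. cis (h * real l * x)) / of_nat L)
   = (\<Sum>l<L. of_nat (N - l) / of_nat N * \<phi> (h * real l)) / of_nat L"
  proof -
   have "(LINT x|?\<mu>. cis (h * real l * x)) = of_nat (N - l) / of_nat N * \<phi> (h * real l)" for l
    using integral_fejer_measure[OF pd h N, of "int l"] by simp
   then show ?thesis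
    by (simp only: integral_divide_zero, subst lint_sum) (auto intro: icis)
  qed
  also have "1 - Re ((\<Sum>l<L. of_nat (N - l) / of_nat N * \<phi> (h * real l)) / of_nat L)
    = (\<Sum>l<L. 1 - Re (of_nat (N - l) / of_nat N * \<phi> (h * real l))) / real L" using L by (simp add: sum_subtractf diff_divide_distrib)
  also have "... <= (\<Sum>l<L. \<epsilon> + real L / real N) / real L"
  proof (intro divide_right_mono sum_mono)
   fix l assume "l \<in> {..<L}"
   then have l: "l < L" by simp
   define w where "w = real (N - l) / real N"
   have w: "0 <= w" "w <= 1" "1 - w <= real L / real N" using l L N by (auto simp: w_def of_nat_diff field_simps)
   have "1 - Re (of_nat (N - l) / of_nat N * \<phi> (h * real l)) = (1 - w) + w * Re (1 - \<phi> (h * real l))"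
   proof -
    have "complex_of_nat (N - l) / of_nat N = cor w" by (simp add: w_def)
    then show ?thesis by (simp add: algebra_simps)
   qed
   also have "w * Re (1 - \<phi> (h * real l)) <= 1 * \<epsilon>"
   proof -
    have "w * Re (1 - \<phi> (h * real l)) <= w * cmod (1 - \<phi> (h * real l))" using w by (intro mult_left_mono complex_Re_le_cmod)
    also have "... <= 1 * \<epsilon>" using w e[OF l] by (intro mult_mono) auto
    finally show ?thesis .
   qed
   finally show "1 - Re (of_nat (N - l) / of_nat N * \<phi> (h * real l)) <= \<epsilon> + real L / real N" using w by simp
  qed simp
  also have "... = \<epsilon> + real L / real N" using L by simp
  finally show ?thesis .
 qed
 have "AE x in ?\<mu>. indicator {x. K < \<bar>x\<bar>} x <= 2 * g x" using AE_fejer_measure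
 proof eventually_elim
  case (elim x)
  show ?case
  proof (cases "K < \<bar>x\<bar>")
   case True
   have K0: "K > 0" using L h by (intro less_le_trans[OF _ K]) auto
   have \<theta>: "\<bar>h * x\<bar> <= pi" "h * x ~= 0" using elim h True K0 by (auto simp: abs_mult abs_le_iff field_simps)
   have "cmod (\<Sum>l<L. cis (real l * (h * x))) <= 4 / \<bar>h * x\<bar>" by (rule norm_cis_sum_le[OF \<theta>])
   also have "... <= real L / 2"
   proof -
    have "8 / (real L * h) <= \<bar>x\<bar>" using K True by simp
    then have "8 <= real L * h * \<bar>x\<bar>" using L h by (simp add: divide_le_eq mult.commute)
    then show ?thesis using \<theta>(2) h by (simp add: abs_mult divide_le_eq field_simps)
   qed
   finally have "cmod ((\<Sum>l<L. cis (h * real l * x)) / of_nat L) <= 1 / 2" using L by (simp add: norm_divide field_simps)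
   then have "g x >= 1 / 2" using complex_Re_le_cmod[of "(\<Sum>l<L. cis (h * real l * x)) / of_nat L"] unfolding g_def by linarith
   then show ?thesis using True by simp
  qed (use g0[of x] in simp)
 qed
 then have "(LINT x|?\<mu>. indicator {x. K < \<bar>x\<bar>} x) <= (LINT x|?\<mu>. 2 * g x)" by (intro integral_mono_AE integrable_mult_right ig)
    (auto intro!: integrable_real_indicator simp: \<mu>.emeasure_finite less_top[symmetric])
 also have "... <= 2 * (\<epsilon> + real L / real N)" using intg by simp
 finally show ?thesis by simp
qed

theorem bochner:
 assumes pd: "positive_definite \<phi>" and cont: "!!t. isCont \<phi> t" and one: "\<phi> 0 = 1"
 shows "\<exists>\<mu>. real_distribution \<mu> & (ALL t. char \<mu> t = \<phi> t)"
proof -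
 \<comment> \<open>With mesh 2^-m every dyadic time lies on all sufficiently fine grids. A fixed
   time has index of order 2^m there, negligible against the 4^m nodes, so its Fejer weight tends to
   1.\<close>
 define \<mu> where "\<mu> m = fejer_measure \<phi> (4 ^ m) (1 / 2 ^ m)" for m :: nat
 have rd: "real_distribution (\<mu> m)" for m
  unfolding \<mu>_def by (rule real_distribution_fejer_measure[OF pd _ _ one]) auto
 have "tight \<mu>" unfolding tight_def
 proof (intro conjI allI impI)
  fix \<epsilon> :: real assume \<epsilon>: "\<epsilon> > 0"
  have "(\<phi> ---> 1) (at 0)" using cont[of 0] one by (simp add: isCont_def)
  then have "eventually (%s. dist (\<phi> s) 1 < \<epsilon> / 8) (at 0)" using \<epsilon> by (intro tendstoD) auto
  then obtain d where d: "d > 0" "!!s. s ~= 0 ==> dist s 0 < d ==> dist (\<phi> s) 1 < \<epsilon> / 8" by (auto simp: eventually_at)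
  have small: "cmod (1 - \<phi> s) <= \<epsilon> / 8" if "0 <= s" "s < d" for s
   using d(2)[of s] that one \<epsilon> by (cases "s = 0") (auto simp: dist_norm norm_minus_commute less_imp_le)
  obtain q :: nat where q: "(1/2) ^ q < d" using real_arch_pow_inv[of d "1/2"] d(1) by auto
  obtain p :: nat where p: "(1/2) ^ p < \<epsilon> / 8" using real_arch_pow_inv[of "\<epsilon> / 8" "1/2"] \<epsilon> by auto
  define m0 where "m0 = max p q"
  \<comment> \<open>The tail inequality is used for \<open>m >= m0\<close> and asks for
    \<open>8 * 2 ^ q\<close>; the remaining finitely many measures live on the interval of radius
    \<open>pi * 2 ^ m0\<close>. The added 1 leaves room for the half-open interval.\<close>
  define K where "K = max (8 * 2 ^ q) (pi * 2 ^ m0) + 1"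
  show "EX a b. a < b & (ALL m. 1 - \<epsilon> < measure (\<mu> m) {a<..b})"
  proof (intro exI conjI allI)
   have "K > 0" unfolding K_def by (simp add: add_nonneg_pos max_def)
   then show "- K < K" by simp
   fix m
   interpret m: real_distribution "\<mu> m" by (rule rd)
   have "measure (\<mu> m) {x. K - 1 < \<bar>x\<bar>} < \<epsilon>"
   proof (cases "m >= m0")
    case True
    have qm: "q <= m" "p <= m" using True by (auto simp: m0_def)
    \<comment> \<open>The averaging window L 2^-m = 2^-q is the same for all \<open>m\<close> and
      shorter than \<open>d\<close>, the range in which \<open>\<phi>\<close> is close to 1.\<close>
    define L :: nat where "L = 2 ^ (m - q)"
    have Lq: "real L * (1 / 2 ^ m) = (1/2) ^ q"
    proof -
     have "2 ^ q * 2 ^ (m - q) = (2::real) ^ m" using qm by (simp flip: power_add)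
     then show ?thesis by (simp add: L_def power_divide field_simps)
    qed
    have L: "L > 0" "L <= 4 ^ m"
    proof -
     show "L > 0" by (simp add: L_def)
     have "L <= 2 ^ m" unfolding L_def by (rule power_increasing) auto
     also have "... <= (4::nat) ^ m" by (rule power_mono) auto
     finally show "L <= 4 ^ m" .
    qed
    have "measure (\<mu> m) {x. K - 1 < \<bar>x\<bar>} <= 2 * (\<epsilon> / 8 + real L / real (4 ^ m))" unfolding \<mu>_def
    proof (rule fejer_measure_tail[OF pd _ _ one L])
     fix l assume "l < L"
     then have "1 / 2 ^ m * real l <= real L * (1 / 2 ^ m)" by (simp add: divide_right_mono)
     also have "... < d" unfolding Lq by (rule q)
     finally show "cmod (1 - \<phi> (1 / 2 ^ m * real l)) <= \<epsilon> / 8" by (intro small) auto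
    next
     show "8 / (real L * (1 / 2 ^ m)) <= K - 1" unfolding Lq by (simp add: K_def power_divide)
    qed auto
    also have "real L / real (4 ^ m) <= \<epsilon> / 8"
    proof -
     have "real L <= 2 ^ m" unfolding L_def by (simp add: power_increasing)
     then have "real L / real (4 ^ m) <= 2 ^ m / 4 ^ m" by (simp add: divide_right_mono)
     also have "... = (1/2) ^ m" by (simp flip: power_divide)
     also have "... <= (1/2) ^ p" using qm by (intro power_decreasing) auto
     finally show ?thesis using p by linarith
    qed
    finally show ?thesis using \<epsilon> by simp
   next
    case False
    have "AE x in \<mu> m. ~ K - 1 < \<bar>x\<bar>"
     using AE_fejer_measure[where \<phi> = \<phi> and N = "4 ^ m" and h = "1 / 2 ^ m"] unfolding \<mu>_def[symmetric]
    proof eventually_elim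
     case (elim x)
     have "\<bar>x\<bar> <= pi * 2 ^ m" using elim by (auto simp: abs_le_iff)
     also have "... <= pi * 2 ^ m0" using False by (intro mult_left_mono power_increasing) auto
     also have "... <= K - 1" by (simp add: K_def)
     finally show ?case by simp
    qed
    then have "measure (\<mu> m) {x. K - 1 < \<bar>x\<bar>} = 0" by (subst m.prob_eq_0) auto
    then show ?thesis using \<epsilon> by simp
   qed
   moreover have "measure (\<mu> m) {-K<..K} >= 1 - measure (\<mu> m) {x. K - 1 < \<bar>x\<bar>}"
   proof -
    have "1 - measure (\<mu> m) {x. K - 1 < \<bar>x\<bar>} = measure (\<mu> m) (space (\<mu> m) - {x. K - 1 < \<bar>x\<bar>})"
     by (subst m.prob_compl) auto
    also have "... <= measure (\<mu> m) {-K<..K}" by (rule m.finite_measure_mono) auto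
    finally show ?thesis .
   qed
   ultimately show "1 - \<epsilon> < measure (\<mu> m) {-K<..K}" by simp
  qed
 qed (rule rd)
 then obtain r M where r: "strict_mono r" and M: "real_distribution M" and conv: "weak_conv_m (\<mu> \<circ> id \<circ> r) M"
  using tight_imp_convergent_subsubsequence[of \<mu> id] strict_mono_id by auto
 interpret M: real_distribution M by (rule M)
 \<comment> \<open>Levy's continuity theorem identifies the characteristic function of the limit at
   dyadic times only; continuity of both sides then extends the equality to all times.\<close>
 have dyadic: "char M (real_of_int a / 2 ^ b) = \<phi> (real_of_int a / 2 ^ b)" for a b
 proof -
  let ?s = "real_of_int a / 2 ^ b"
  have "(%m. char (\<mu> m) ?s) ----> \<phi> ?s"
  proof -
   have ev: "\<forall>\<^sub>F m in sequentially. cmod (char (\<mu> m) ?s - \<phi> ?s) <= (\<bar>real_of_int a\<bar> * cmod (\<phi> ?s)) * (1/2) ^ m"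
    using eventually_ge_at_top[of b]
   proof eventually_elim
    case (elim m)
    define l where "l = a * 2 ^ (m - b)"
    have s: "?s = 1 / 2 ^ m * real_of_int l"
    proof -
     have "2 ^ b * 2 ^ (m - b) = (2::real) ^ m" using elim by (simp flip: power_add)
     then show ?thesis by (simp add: l_def field_simps)
    qed
    define w where "w = real (4 ^ m - nat \<bar>l\<bar>) / real (4 ^ m)"
    have cw: "char (\<mu> m) ?s = cor w * \<phi> ?s" unfolding \<mu>_def by (subst char_fejer_measure[OF pd _ _ s]) (auto simp: w_def)
    have "\<bar>w - 1\<bar> <= real_of_int \<bar>l\<bar> / 4 ^ m"
    proof (cases "nat \<bar>l\<bar> <= 4 ^ m")
     case True
     have "w = (4 ^ m - real_of_int \<bar>l\<bar>) / 4 ^ m" unfolding w_def using True by (simp add: of_nat_diff)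
     then show ?thesis by (simp add: diff_divide_distrib)
    next
     case False
     then have "\<bar>l\<bar> >= 4 ^ m" by (simp add: not_le zless_nat_eq_int_zless less_imp_le)
     then have "real_of_int \<bar>l\<bar> >= real_of_int (4 ^ m)" by (simp only: of_int_le_iff)
     moreover have "w = 0" using False by (simp add: w_def)
     ultimately show ?thesis by simp
    qed
    also have "real_of_int \<bar>l\<bar> / 4 ^ m <= \<bar>real_of_int a\<bar> * (1/2) ^ m"
    proof -
     have "real_of_int \<bar>l\<bar> = \<bar>real_of_int a\<bar> * 2 ^ (m - b)" by (simp add: l_def abs_mult)
     also have "... <= \<bar>real_of_int a\<bar> * 2 ^ m" by (intro mult_left_mono power_increasing) auto
     finally have "real_of_int \<bar>l\<bar> / 4 ^ m <= \<bar>real_of_int a\<bar> * 2 ^ m / 4 ^ m" by (intro divide_right_mono) auto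
     also have "... = \<bar>real_of_int a\<bar> * (2 / 4) ^ m" by (simp only: power_divide times_divide_eq_right)
     finally show ?thesis by simp
    qed
    finally have w1: "\<bar>w - 1\<bar> <= \<bar>real_of_int a\<bar> * (1/2) ^ m" .
    have "cmod (char (\<mu> m) ?s - \<phi> ?s) = \<bar>w - 1\<bar> * cmod (\<phi> ?s)"
    proof -
     have "char (\<mu> m) ?s - \<phi> ?s = cor (w - 1) * \<phi> ?s" unfolding cw by (simp add: algebra_simps)
     then show ?thesis by (simp only: norm_mult norm_of_real)
    qed
    also have "... <= (\<bar>real_of_int a\<bar> * (1/2) ^ m) * cmod (\<phi> ?s)" by (intro mult_right_mono w1) auto
    finally show ?case by (simp add: mult_ac)
   qed
   have "(%m. (\<bar>real_of_int a\<bar> * cmod (\<phi> ?s)) * (1/2) ^ m) ----> 0" by (intro tendsto_mult_right_zero LIMSEQ_realpow_zero) auto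
   then have "(%m. char (\<mu> m) ?s - \<phi> ?s) ----> 0" by (rule Lim_null_comparison[OF ev])
   then show ?thesis by (simp add: LIM_zero_iff)
  qed
  then have "(%m. char (\<mu> (r m)) ?s) ----> \<phi> ?s" using LIMSEQ_subseq_LIMSEQ[OF _ r] by (fastforce simp: comp_def)
  moreover have "(%m. char ((\<mu> \<circ> id \<circ> r) m) ?s) ----> char M ?s" by (rule levy_continuity1[OF _ M conv]) (simp add: rd)
  ultimately show ?thesis by (simp add: LIMSEQ_unique)
 qed
 have "char M s = \<phi> s" for s
 proof -
  have lim: "(%b. real_of_int \<lfloor>s * 2 ^ b\<rfloor> / 2 ^ b) ----> s"
  proof -
   have "\<bar>real_of_int \<lfloor>s * 2 ^ b\<rfloor> / 2 ^ b - s\<bar> <= (1/2) ^ b" for b :: nat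
   proof -
    have "real_of_int \<lfloor>s * 2 ^ b\<rfloor> / 2 ^ b - s = (real_of_int \<lfloor>s * 2 ^ b\<rfloor> - s * 2 ^ b) / 2 ^ b"
     by (simp add: diff_divide_distrib)
    moreover have "\<bar>real_of_int \<lfloor>s * 2 ^ b\<rfloor> - s * 2 ^ b\<bar> <= 1" by linarith
    ultimately show ?thesis by (simp add: power_divide divide_right_mono)
   qed
   then have "(%b. real_of_int \<lfloor>s * 2 ^ b\<rfloor> / 2 ^ b - s) ----> 0"
    by (intro Lim_null_comparison[OF _ LIMSEQ_realpow_zero[of "1/2"]]) auto
   then show ?thesis by (simp add: LIM_zero_iff)
  qed
  have "(%b. char M (real_of_int \<lfloor>s * 2 ^ b\<rfloor> / 2 ^ b)) ----> char M s" by (rule isCont_tendsto_compose[OF M.isCont_char lim])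
  moreover have "(%b. \<phi> (real_of_int \<lfloor>s * 2 ^ b\<rfloor> / 2 ^ b)) ----> \<phi> s" by (rule isCont_tendsto_compose[OF cont lim])
  ultimately show ?thesis unfolding dyadic by (rule LIMSEQ_unique)
 qed
 then show ?thesis using M by blast
qed

section \<open>Spectral measures of unitary groups\<close>

definition add_measure :: "'a measure => 'a measure => 'a measure" where
 "add_measure M N = measure_of (space M) (sets M) (%A. emeasure M A + emeasure N A)"

lemma space_add_measure [simp]: "space (add_measure M N) = space M" by (simp add: add_measure_def)

lemma sets_add_measure [simp, measurable_cong]: "sets (add_measure M N) = sets M" by (simp add: add_measure_def)

lemma emeasure_add_measure:
 assumes "sets N = sets M" "A \<in> sets M"
 shows "emeasure (add_measure M N) A = emeasure M A + emeasure N A"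
proof (rule emeasure_measure_of[OF add_measure_def])
 show "sets M \<subseteq> Pow (space M)" by (rule sets.space_closed)
 show "countably_additive (sets (add_measure M N)) (%A. emeasure M A + emeasure N A)"
 proof (rule countably_additiveI)
  fix A :: "nat => _" assume A: "range A \<subseteq> sets (add_measure M N)" "disjoint_family A"
  have "(\<Sum>i. emeasure M (A i) + emeasure N (A i)) = (\<Sum>i. emeasure M (A i)) + (\<Sum>i. emeasure N (A i))"
   by (rule suminf_add[OF summableI summableI, symmetric])
  also have "(\<Sum>i. emeasure M (A i)) = emeasure M (\<Union>i. A i)" using A by (intro suminf_emeasure) auto
  also have "(\<Sum>i. emeasure N (A i)) = emeasure N (\<Union>i. A i)" using A assms(1) by (intro suminf_emeasure) auto
  finally show "(\<Sum>i. emeasure M (A i) + emeasure N (A i)) = emeasure M (\<Union>i. A i) + emeasure N (\<Union>i. A i)" .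
 qed
qed (use assms in "auto simp: positive_def")

lemma nn_integral_add_measure:
 assumes s: "sets N = sets M" and f: "f \<in> borel_measurable M"
 shows "nn_integral (add_measure M N) f = nn_integral M f + nn_integral N f" using f
proof (induction rule: borel_measurable_induct)
 case (cong f g)
 have "space N = space M" using s by (rule sets_eq_imp_space_eq)
 then have "nn_integral N f = nn_integral N g" "nn_integral M f = nn_integral M g"
  "nn_integral (add_measure M N) f = nn_integral (add_measure M N) g" using cong(3) by (auto intro!: nn_integral_cong)
 then show ?case using cong by simp
next
 case (set A)
 then show ?case using s by (simp add: emeasure_add_measure)
next
 case (mult u c)
 then have "u \<in> borel_measurable N" "u \<in> borel_measurable (add_measure M N)" using s by (simp_all cong: measurable_cong_sets)
 then show ?case using mult by (simp add: nn_integral_cmult distrib_left)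
next
 case (add u v)
 then have "u \<in> borel_measurable N" "u \<in> borel_measurable (add_measure M N)"
   "v \<in> borel_measurable N" "v \<in> borel_measurable (add_measure M N)" using s by (simp_all cong: measurable_cong_sets)
 then show ?case using add by (simp add: nn_integral_add add_ac)
next
 case (seq U)
 have m: "!!i. U i \<in> borel_measurable N" "!!i. U i \<in> borel_measurable (add_measure M N)" using s seq by (simp_all cong: measurable_cong_sets)
 have inc: "incseq (%i. nn_integral M (U i))" "incseq (%i. nn_integral N (U i))"
  using seq by (auto simp: incseq_def le_fun_def intro!: nn_integral_mono)
 have "nn_integral (add_measure M N) (SUP i. U i) = (SUP i. nn_integral (add_measure M N) (U i))"
  unfolding SUP_apply[abs_def] by (rule nn_integral_monotone_convergence_SUP) (use seq m in auto)
 also have "... = (SUP i. nn_integral M (U i) + nn_integral N (U i))" using seq by simp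
 also have "... = (SUP i. nn_integral M (U i)) + (SUP i. nn_integral N (U i))" by (rule ennreal_SUP_add[OF inc])
 also have "(SUP i. nn_integral M (U i)) = nn_integral M (SUP i. U i)"
  unfolding SUP_apply[abs_def] by (rule nn_integral_monotone_convergence_SUP[symmetric]) (use seq in auto)
 also have "(SUP i. nn_integral N (U i)) = nn_integral N (SUP i. U i)"
  unfolding SUP_apply[abs_def] by (rule nn_integral_monotone_convergence_SUP[symmetric]) (use seq m in auto)
 finally show ?case .
qed

lemma finite_measure_add_measure:
 assumes "finite_measure M" "finite_measure N" "sets N = sets M"
 shows "finite_measure (add_measure M N)"
proof (rule finite_measureI)
 have "space N = space M" using assms(3) by (rule sets_eq_imp_space_eq)
 then show "emeasure (add_measure M N) (space (add_measure M N)) ~= \<infinity>" using finite_measure.emeasure_finite[OF assms(1), of "space M"]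
   finite_measure.emeasure_finite[OF assms(2), of "space M"] assms(3) by (simp add: emeasure_add_measure)
qed

lemma integral_add_measure_nonneg:
 fixes f :: "'a => real"
 assumes M: "finite_measure M" and N: "finite_measure N" and s: "sets N = sets M"
  and f: "f \<in> borel_measurable M" "!!x. 0 <= f x" "!!x. f x <= B"
 shows "(LINT x|add_measure M N. f x) = (LINT x|M. f x) + (LINT x|N. f x)"
proof -
 have fN: "f \<in> borel_measurable N" and fA: "f \<in> borel_measurable (add_measure M N)" using f(1) s by (simp_all cong: measurable_cong_sets)
 have i: "integrable K f" if "finite_measure K" "f \<in> borel_measurable K" for K
  using that f by (intro finite_measure.integrable_const_bound[of K f B]) auto
 have e: "ennreal (LINT x|K. f x) = (\<integral>\<^sup>+ x. ennreal (f x) \<partial>K)" if "finite_measure K" "f \<in> borel_measurable K" for K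
  using f i[OF that] by (simp add: nn_integral_eq_integral)
 have "ennreal (LINT x|add_measure M N. f x) = ennreal (LINT x|M. f x) + ennreal (LINT x|N. f x)"
  using e[OF M f(1)] e[OF N fN] e[OF finite_measure_add_measure[OF M N s] fA] f(1) by (simp add: nn_integral_add_measure[OF s])
 also have "... = ennreal ((LINT x|M. f x) + (LINT x|N. f x))" using f by (intro ennreal_plus[symmetric] Bochner_Integration.integral_nonneg) auto
 finally show ?thesis
  using f by (subst (asm) ennreal_inj) (auto intro!: Bochner_Integration.integral_nonneg add_nonneg_nonneg)
qed

lemma sets_borel_space: "sets (\<mu>::real measure) = sets borel ==> space \<mu> = UNIV" using sets_eq_imp_space_eq[of \<mu> borel] by simp

text \<open>Adding 1 makes cosine and sine nonnegative, so that additivity in the measure can be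
  taken from integrals of nonnegative functions.\<close>

lemma finite_char_re_im:
 fixes \<mu> :: "real measure"
 assumes \<mu>: "finite_measure \<mu>" and s: "sets \<mu> = sets borel"
 shows "Re (char \<mu> t) = (LINT x|\<mu>. 1 + cos (t * x)) - (LINT x|\<mu>. 1)"
  "Im (char \<mu> t) = (LINT x|\<mu>. 1 + sin (t * x)) - (LINT x|\<mu>. 1)"
proof -
 interpret finite_measure \<mu> by (rule \<mu>)
 have m: "f \<in> borel_measurable \<mu>" if "f \<in> borel_measurable borel" for f :: "real => real"
  using that s by (simp cong: measurable_cong_sets)
 have mc: "(%x. iexp (t * x)) \<in> borel_measurable \<mu>" using s by (simp cong: measurable_cong_sets)
 have ii: "integrable \<mu> (%x. iexp (t * x))"
  by (rule integrable_const_bound[of _ 1]) (use mc in "auto simp: norm_exp_i_times simp del: of_real_mult")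
 have "Re (char \<mu> t) = (LINT x|\<mu>. Re (iexp (t * x)))" unfolding char_def by (rule integral_Re[OF ii, symmetric])
 also have "... = (LINT x|\<mu>. cos (t * x))" by (simp add: Re_exp)
 also have "... = (LINT x|\<mu>. 1 + cos (t * x)) - (LINT x|\<mu>. 1)" by (subst lint_add) (auto intro!: integrable_const_bound[of _ 1] m)
 finally show "Re (char \<mu> t) = (LINT x|\<mu>. 1 + cos (t * x)) - (LINT x|\<mu>. 1)" .
 have "Im (char \<mu> t) = (LINT x|\<mu>. Im (iexp (t * x)))" unfolding char_def by (rule integral_Im[OF ii, symmetric])
 also have "... = (LINT x|\<mu>. sin (t * x))" by (simp add: Im_exp)
 also have "... = (LINT x|\<mu>. 1 + sin (t * x)) - (LINT x|\<mu>. 1)" by (subst lint_add) (auto intro!: integrable_const_bound[of _ 1] m)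
 finally show "Im (char \<mu> t) = (LINT x|\<mu>. 1 + sin (t * x)) - (LINT x|\<mu>. 1)" .
qed

lemma char_add_measure:
 fixes \<mu> \<nu> :: "real measure"
 assumes \<mu>: "finite_measure \<mu>" "sets \<mu> = sets borel" and \<nu>: "finite_measure \<nu>" "sets \<nu> = sets borel"
 shows "char (add_measure \<mu> \<nu>) t = char \<mu> t + char \<nu> t"
proof -
 have s: "sets \<nu> = sets \<mu>" using assms by simp
 have m: "f \<in> borel_measurable \<mu>" if "f \<in> borel_measurable borel" for f :: "real => real"
  using that \<mu>(2) by (simp cong: measurable_cong_sets)
 note i = integral_add_measure_nonneg[OF \<mu>(1) \<nu>(1) s m]
 have 1: "(LINT x|add_measure \<mu> \<nu>. (1::real)) = (LINT x|\<mu>. 1) + (LINT x|\<nu>. 1)" by (rule i[of _ 1]) auto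
 have 2: "(LINT x|add_measure \<mu> \<nu>. 1 + cos (t * x)) = (LINT x|\<mu>. 1 + cos (t * x)) + (LINT x|\<nu>. 1 + cos (t * x))"
  by (rule i[of _ 2]) (auto simp: cos_ge_minus_one[of "t * x" for x] add_nonneg_nonneg intro: order_trans[OF _ add_left_mono[OF cos_ge_minus_one]])
 have 3: "(LINT x|add_measure \<mu> \<nu>. 1 + sin (t * x)) = (LINT x|\<mu>. 1 + sin (t * x)) + (LINT x|\<nu>. 1 + sin (t * x))"
  by (rule i[of _ 2]) (auto intro: order_trans[OF _ add_left_mono[OF sin_ge_minus_one]])
 have fm: "finite_measure (add_measure \<mu> \<nu>)" "sets (add_measure \<mu> \<nu>) = sets borel"
  using finite_measure_add_measure[OF \<mu>(1) \<nu>(1) s] \<mu> by auto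
 show ?thesis
  unfolding complex_eq_iff plus_complex.simps finite_char_re_im[OF fm] finite_char_re_im[OF \<mu>] finite_char_re_im[OF \<nu>] 1 2 3
  by simp
qed

lemma char_density_const:
 fixes \<mu> :: "real measure"
 assumes "sets \<mu> = sets borel" "c >= 0"
 shows "char (density \<mu> (%_. ennreal c)) t = cor c * char \<mu> t"
proof -
 have "(%x. iexp (t * x)) \<in> borel_measurable \<mu>" using assms by (simp cong: measurable_cong_sets)
 then show ?thesis
  unfolding char_def using assms(2) by (subst integral_density) (auto simp: scaleR_conv_of_real)
qed

lemma char_zero_finite:
 fixes \<mu> :: "real measure"
 assumes "sets \<mu> = sets borel"
 shows "char \<mu> 0 = cor (measure \<mu> UNIV)" using sets_borel_space[OF assms] by (simp add: char_def scaleR_conv_of_real)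

lemma finite_measure_density_const:
 assumes "finite_measure \<mu>" shows "finite_measure (density \<mu> (%_. ennreal c))"
proof (rule finite_measureI)
 show "emeasure (density \<mu> (%_. ennreal c)) (space (density \<mu> (%_. ennreal c))) ~= \<infinity>"
  using finite_measure.emeasure_finite[OF assms, of "space \<mu>"] by (simp add: emeasure_density_const ennreal_mult_eq_top_iff)
qed

text \<open>Reduction to probability measures: the common total mass is read off at
  \<open>t = 0\<close> and divided out, with mass 0 treated apart.\<close>

lemma char_unique:
 fixes \<mu> \<nu> :: "real measure"
 assumes \<mu>: "finite_measure \<mu>" "sets \<mu> = sets borel" and \<nu>: "finite_measure \<nu>" "sets \<nu> = sets borel"
  and eq: "!!t. char \<mu> t = char \<nu> t"
 shows "\<mu> = \<nu>"
proof -
 interpret \<mu>: finite_measure \<mu> by fact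
 interpret \<nu>: finite_measure \<nu> by fact
 define m where "m = measure \<mu> UNIV"
 have m: "measure \<nu> UNIV = m" using eq[of 0] unfolding char_zero_finite[OF \<mu>(2)] char_zero_finite[OF \<nu>(2)] m_def by simp
 show ?thesis
 proof (cases "m = 0")
  case True
  have z: "emeasure K A = 0" if "finite_measure K" "sets K = sets borel" "measure K UNIV = 0" for K :: "real measure" and A
  proof -
   have "emeasure K UNIV = 0" using that by (simp add: finite_measure.emeasure_eq_measure)
   moreover have "emeasure K A <= emeasure K UNIV" using that by (intro emeasure_mono) auto
   ultimately show ?thesis by simp
  qed
  show ?thesis
   by (rule measure_eqI) (use z[OF \<mu>] z[OF \<nu>] m True m_def \<mu> \<nu> in auto)
 next
  case False
  then have m0: "m > 0" by (simp add: m_def zero_less_measure_iff)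
  define c where "c = 1 / m"
  have rd: "real_distribution (density K (%_. ennreal c))" if "finite_measure K" "sets K = sets borel" "measure K UNIV = m" for K
  proof -
   have "emeasure (density K (%_. ennreal c)) UNIV = ennreal c * ennreal m"
    using that by (simp add: emeasure_density_const finite_measure.emeasure_eq_measure)
   also have "... = 1" using m0 by (simp add: c_def flip: ennreal_mult ennreal_1)
   finally show ?thesis
    unfolding real_distribution_def real_distribution_axioms_def
    using that sets_borel_space[OF that(2)] by (auto intro!: prob_spaceI)
  qed
  have "density \<mu> (%_. ennreal c) = density \<nu> (%_. ennreal c)" by (rule Levy_uniqueness[OF rd[OF \<mu>] rd[OF \<nu>]])
     (use m m0 in \<open>auto simp: m_def c_def fun_eq_iff char_density_const[OF \<mu>(2)] char_density_const[OF \<nu>(2)] eq\<close>)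
  then have "ennreal c * emeasure \<mu> A = ennreal c * emeasure \<nu> A" if "A \<in> sets borel" for A
   using that \<mu> \<nu> emeasure_density_const[of A \<mu> "ennreal c"] emeasure_density_const[of A \<nu> "ennreal c"] by simp
  then have e: "emeasure \<mu> A = emeasure \<nu> A" if "A \<in> sets borel" for A
   using that m0 by (auto simp: ennreal_mult_cancel_left c_def)
  show ?thesis by (rule measure_eqI) (use e \<mu> \<nu> in auto)
 qed
qed

section \<open>Measures attached to vectors by Bochner's theorem\<close>

locale unitary_on_l2 =
 fixes U :: "real => 'a::l2_space l2 => 'a l2"
 assumes isometry_group: "isometry_group U"
  and scaleC: "U s (c *C v) = c *C U s v"
begin

lemmas U_simps = isometry_groupD(2,3)[OF isometry_group]

lemma U_add: "U s (v + w) = U s v + U s w" by (rule linear_add[OF isometry_groupD(1)[OF isometry_group]])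

lemma U_diff: "U s (v - w) = U s v - U s w" by (rule linear_diff[OF isometry_groupD(1)[OF isometry_group]])

lemma U_sum: "U s (\<Sum>i\<in>I. f i) = (\<Sum>i\<in>I. U s (f i))" by (rule linear_sum[OF isometry_groupD(1)[OF isometry_group]])

lemma cinner_U: "cinner (U s v) (U s w) = cinner v w" unfolding cinner_eq using isometry_group_inner[OF isometry_group, of s] by (simp flip: scaleC)

lemma cinner_U_U: "cinner (U s v) (U t w) = cinner v (U (t - s) w)"
 using cinner_U[of s v "U (t - s) w"] isometry_groupD(4)[OF isometry_group, of s "t - s" w] by simp

definition spec :: "'a l2 => real measure" where
 "spec v = (THE \<mu>. finite_measure \<mu> & sets \<mu> = sets borel & (ALL s. cinner v (U s v) = char \<mu> s))"

lemma cinner_sum_sum: "cinner (\<Sum>i\<in>I. f i) (\<Sum>k\<in>K. g k) = (\<Sum>i\<in>I. \<Sum>k\<in>K. cinner (f i) (g k))"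
 unfolding cinner_sum_left by (rule sum.cong[OF refl cinner_sum_right])

lemma spec_normalized:
 assumes "v ~= 0"
 shows "\<exists>\<nu>. real_distribution \<nu> & (ALL s. char \<nu> s = cinner v (U s v) / cor ((norm v)\<^sup>2))"
proof (rule bochner)
 let ?\<phi> = "%s. cinner v (U s v) / cor ((norm v)\<^sup>2)"
 show "positive_definite ?\<phi>" unfolding positive_definite_def
 proof (intro allI)
  fix n :: nat and t :: "nat => real" and c :: "nat => complex"
  \<comment> \<open>The quadratic form to be shown nonnegative is the squared norm of this
    combination of orbit vectors, divided by that of \<open>v\<close>.\<close>
  define w where "w = (\<Sum>k<n. c k *C U (t k) v)"
  have "(\<Sum>j<n. \<Sum>k<n. cnj (c j) * c k * ?\<phi> (t k - t j))
    = (\<Sum>j<n. \<Sum>k<n. cnj (c j) * c k * cinner v (U (t k - t j) v)) / cor ((norm v)\<^sup>2)" by (simp add: sum_divide_distrib)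
  also have "(\<Sum>j<n. \<Sum>k<n. cnj (c j) * c k * cinner v (U (t k - t j) v)) = cinner w w"
   unfolding w_def cinner_sum_sum cinner_scaleC_left cinner_scaleC_right cinner_U_U
   by (simp add: mult_ac)
  also have "cinner w w / cor ((norm v)\<^sup>2) = cor ((norm w)\<^sup>2 / (norm v)\<^sup>2)" by (simp add: cinner_self)
  finally show "\<exists>r\<ge>0. (\<Sum>j<n. \<Sum>k<n. cnj (c j) * c k * ?\<phi> (t k - t j)) = cor r"
   by (intro exI[of _ "(norm w)\<^sup>2 / (norm v)\<^sup>2"]) auto
 qed
 show "?\<phi> 0 = 1" using assms by (simp add: U_simps cinner_self)
 fix t
 show "isCont ?\<phi> t" unfolding isCont_def
  by (intro tendsto_divide tendsto_cinner tendsto_const)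
    (use isometry_group_continuous[OF isometry_group, where f = v and t = t] assms in "auto simp: isCont_def")
qed

lemma spec_exists: "\<exists>\<mu>. finite_measure \<mu> & sets \<mu> = sets borel & (ALL s. cinner v (U s v) = char \<mu> s)"
proof (cases "v = 0")
 case True
 have "finite_measure (null_measure borel)" by (rule finite_measureI) simp
 moreover have "char (null_measure borel) s = 0" for s by (simp add: char_def)
 ultimately show ?thesis using True by (intro exI[of _ "null_measure borel"]) auto
next
 case False
 obtain \<nu> where \<nu>: "real_distribution \<nu>" "!!s. char \<nu> s = cinner v (U s v) / cor ((norm v)\<^sup>2)"
  using spec_normalized[OF False] by blast
 interpret \<nu>: real_distribution \<nu> by fact
 have "finite_measure (density \<nu> (%_. ennreal ((norm v)\<^sup>2)))" by (rule finite_measure_density_const) (rule \<nu>.finite_measure_axioms)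
 moreover have "char (density \<nu> (%_. ennreal ((norm v)\<^sup>2))) s = cinner v (U s v)" for s
  using False by (simp add: char_density_const \<nu>(2))
 ultimately show ?thesis by (intro exI[of _ "density \<nu> (%_. ennreal ((norm v)\<^sup>2))"]) auto
qed

lemma spec: "finite_measure (spec v)" "sets (spec v) = sets borel" "char (spec v) s = cinner v (U s v)"
proof -
 have "\<exists>!\<mu>. finite_measure \<mu> & sets \<mu> = sets borel & (ALL s. cinner v (U s v) = char \<mu> s)"
  using spec_exists[of v] char_unique by (metis (no_types, lifting))
 from theI'[OF this] have "finite_measure (spec v) & sets (spec v) = sets borel & (ALL s. cinner v (U s v) = char (spec v) s)" unfolding spec_def .
 then show "finite_measure (spec v)" "sets (spec v) = sets borel" "char (spec v) s = cinner v (U s v)" by simp_all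
qed

lemma spec_eqI:
 "finite_measure \<mu> ==> sets \<mu> = sets borel ==> (!!s. char \<mu> s = cinner v (U s v)) ==> spec v = \<mu>"
 by (rule char_unique) (auto simp: spec)

lemma measure_spec_UNIV: "measure (spec v) UNIV = (norm v)\<^sup>2"
 using char_zero_finite[OF spec(2), of v] unfolding spec(3) U_simps cinner_self of_real_eq_iff by simp

lemma emeasure_spec_UNIV: "emeasure (spec v) UNIV = ennreal ((norm v)\<^sup>2)"
 using spec(1)[of v] by (simp add: finite_measure.emeasure_eq_measure measure_spec_UNIV)

text \<open>The parallelogram law for vectors holds for the spectral measures, because it holds for their
 characteristic functions.\<close>

lemma spec_add_le:
 assumes A: "A \<in> sets borel"
 shows "emeasure (spec (v + w)) A <= 2 * emeasure (spec v) A + 2 * emeasure (spec w) A"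
proof -
 note f = finite_measure_add_measure and s = spec(1,2)
 have "add_measure (spec (v + w)) (spec (v - w))
   = add_measure (add_measure (spec v) (spec v)) (add_measure (spec w) (spec w))"
 proof (rule char_unique)
  fix t
  show "char (add_measure (spec (v + w)) (spec (v - w))) t
    = char (add_measure (add_measure (spec v) (spec v)) (add_measure (spec w) (spec w))) t" by (subst char_add_measure, simp_all add: s f)+
     (simp add: spec(3) U_add U_diff cinner_add_left cinner_add_right cinner_diff_left cinner_diff_right)
 qed (simp_all add: f s)
 then have "emeasure (spec (v + w)) A + emeasure (spec (v - w)) A
   = (emeasure (spec v) A + emeasure (spec v) A) + (emeasure (spec w) A + emeasure (spec w) A)"
  using A by (metis emeasure_add_measure s(2) sets_add_measure)
 then have "emeasure (spec (v + w)) A <= (emeasure (spec v) A + emeasure (spec v) A) + (emeasure (spec w) A + emeasure (spec w) A)"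
  by (metis le_iff_add)
 then show ?thesis by (simp add: mult_2)
qed

lemma spec_scaleC: "spec (c *C v) = density (spec v) (%_. ennreal ((cmod c)\<^sup>2))"
proof (rule spec_eqI)
 fix s
 have "c * cnj c = cor ((cmod c)\<^sup>2)" by (rule complex_norm_square[symmetric])
 then show "char (density (spec v) (%_. ennreal ((cmod c)\<^sup>2))) s = cinner (c *C v) (U s (c *C v))"
  unfolding scaleC cinner_scaleC_left cinner_scaleC_right
  by (simp add: char_density_const spec mult.assoc[symmetric] mult.commute)
qed (simp_all add: finite_measure_density_const spec)

section \<open>The closed subspace of vectors with singular spectral measure\<close>

definition singular_vectors :: "'a l2 set" where
 "singular_vectors = {v. \<exists>N\<in>null_sets lborel. emeasure (spec v) (- N) = 0}"

lemma singular_vectors_add: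
 assumes "v \<in> singular_vectors" "w \<in> singular_vectors" shows "v + w \<in> singular_vectors"
proof -
 obtain N N' where N: "N \<in> null_sets lborel" "emeasure (spec v) (- N) = 0"
  and N': "N' \<in> null_sets lborel" "emeasure (spec w) (- N') = 0" using assms by (auto simp: singular_vectors_def)
 have b: "N \<in> sets borel" "N' \<in> sets borel" using N N' by (auto simp: null_sets_def)
 have "emeasure (spec v) (- (N \<union> N')) <= emeasure (spec v) (- N)" "emeasure (spec w) (- (N \<union> N')) <= emeasure (spec w) (- N')"
  using b by (auto intro!: emeasure_mono simp: spec)
 then have "emeasure (spec (v + w)) (- (N \<union> N')) = 0" using spec_add_le[of "- (N \<union> N')" v w] b N N' by auto
 then show ?thesis using N N' by (auto simp: singular_vectors_def intro!: bexI[of _ "N \<union> N'"])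
qed

lemma singular_vectors_scaleC:
 assumes "v \<in> singular_vectors" shows "c *C v \<in> singular_vectors"
proof -
 obtain N where N: "N \<in> null_sets lborel" "emeasure (spec v) (- N) = 0" using assms by (auto simp: singular_vectors_def)
 then have "N \<in> sets borel" by (auto simp: null_sets_def)
 then have "emeasure (spec (c *C v)) (- N) = 0" unfolding spec_scaleC using N by (simp add: emeasure_density_const spec)
 then show ?thesis using N by (auto simp: singular_vectors_def)
qed

text \<open>One null set carries the measures of all \<open>X n\<close>. By
  \<open>spec_add_le\<close> the mass of \<open>v\<close> outside it is at most twice the total mass
  of \<open>v - X n\<close>, which tends to 0.\<close>

lemma closed_singular_vectors: "closed singular_vectors" unfolding closed_sequential_limits
proof (intro allI impI, elim conjE)
 fix X v assume X: "ALL n. X n \<in> singular_vectors" and lim: "X ----> v"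
 have "ALL n. EX N. N \<in> null_sets lborel & emeasure (spec (X n)) (- N) = 0" using X unfolding singular_vectors_def by blast
 then obtain N where N: "!!n. N n \<in> null_sets lborel" "!!n. emeasure (spec (X n)) (- N n) = 0" by metis
 define N' where "N' = (\<Union>n. N n)"
 have N': "N' \<in> null_sets lborel" unfolding N'_def by (rule null_sets_UN) (rule N)
 have b: "N' \<in> sets borel" "N n \<in> sets borel" for n using N N' by (auto simp: null_sets_def)
 have le: "emeasure (spec v) (- N') <= ennreal (2 * (norm (v - X n))\<^sup>2)" for n
 proof -
  have "emeasure (spec v) (- N') = emeasure (spec (X n + (v - X n))) (- N')" by simp
  also have "... <= 2 * emeasure (spec (X n)) (- N') + 2 * emeasure (spec (v - X n)) (- N')" using b by (intro spec_add_le) auto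
  also have "emeasure (spec (X n)) (- N') = 0"
  proof -
   have "emeasure (spec (X n)) (- N') <= emeasure (spec (X n)) (- N n)" using b by (intro emeasure_mono) (auto simp: spec N'_def)
   then show ?thesis using N by simp
  qed
  also have "2 * (0::ennreal) + 2 * emeasure (spec (v - X n)) (- N') <= 2 * emeasure (spec (v - X n)) UNIV"
   using b by (auto intro!: mult_left_mono emeasure_mono simp: spec)
  also have "... = ennreal (2 * (norm (v - X n))\<^sup>2)" by (simp add: emeasure_spec_UNIV ennreal_mult)
  finally show ?thesis .
 qed
 have "(%n. ennreal (2 * (norm (v - X n))\<^sup>2)) ----> ennreal (2 * (norm (v - v))\<^sup>2)" by (intro tendsto_intros lim)
 then have "emeasure (spec v) (- N') <= ennreal (2 * (norm (v - v))\<^sup>2)" using le by (intro tendsto_lowerbound) auto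
 then have "emeasure (spec v) (- N') = 0" by simp
 then show "v \<in> singular_vectors" using N' by (auto simp: singular_vectors_def)
qed

text \<open>The isometry between the cyclic subspace of \<open>v\<close> and L^2 of its spectral
  measure, on trigonometric polynomials: \<open>U t v\<close> corresponds to
  \<open>iexp (t * x)\<close>.\<close>

lemma cinner_combination:
 assumes "finite I" "finite K"
 shows "cinner (\<Sum>i\<in>I. c i *C U (t i) v) (\<Sum>k\<in>K. d k *C U (u k) v)
  = (LINT x|spec v. cnj (\<Sum>i\<in>I. c i * iexp (t i * x)) * (\<Sum>k\<in>K. d k * iexp (u k * x)))"
proof -
 interpret finite_measure "spec v" by (rule spec)
 have mc: "(%x. iexp (a * x)) \<in> borel_measurable (spec v)" for a
  using spec(2)[of v] by (simp cong: measurable_cong_sets)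
 have ii: "integrable (spec v) (%x. iexp (a * x))" for a
  by (rule integrable_const_bound[of _ 1]) (use mc in "auto simp: norm_exp_i_times simp del: of_real_mult")
 have e: "cnj (c i * iexp (t i * x)) * (d k * iexp (u k * x)) = (cnj (c i) * d k) * iexp ((u k - t i) * x)" for i k x
 proof -
  have "cnj (iexp (t i * x)) * iexp (u k * x) = iexp ((u k - t i) * x)"
   unfolding cis_conv_exp[symmetric] by (simp add: cis_cnj cis_mult algebra_simps)
  then show ?thesis by (simp add: mult_ac del: exp_cnj)
 qed
 have "(LINT x|spec v. cnj (\<Sum>i\<in>I. c i * iexp (t i * x)) * (\<Sum>k\<in>K. d k * iexp (u k * x)))
   = (LINT x|spec v. (\<Sum>i\<in>I. \<Sum>k\<in>K. (cnj (c i) * d k) * iexp ((u k - t i) * x)))" unfolding cnj_sum sum_product e ..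
 also have "... = (\<Sum>i\<in>I. \<Sum>k\<in>K. (cnj (c i) * d k) * (LINT x|spec v. iexp ((u k - t i) * x)))" by (subst lint_sum,
    intro Bochner_Integration.integrable_sum integrable_mult_right ii,
    subst lint_sum, intro integrable_mult_right ii, simp only: integral_mult_right_zero)
 also have "... = (\<Sum>i\<in>I. \<Sum>k\<in>K. (cnj (c i) * d k) * cinner v (U (u k - t i) v))" by (simp only: spec(3)[unfolded char_def])
 also have "... = cinner (\<Sum>i\<in>I. c i *C U (t i) v) (\<Sum>k\<in>K. d k *C U (u k) v)"
  unfolding cinner_sum_sum cinner_scaleC_left cinner_scaleC_right cinner_U_U
  by (simp add: mult_ac)
 finally show ?thesis by simp
qed

lemma norm_combination_diff:
 assumes fin: "finite I" "finite K"
 shows "(norm ((\<Sum>i\<in>I. c i *C U (t i) v) - (\<Sum>k\<in>K. d k *C U (u k) v)))\<^sup>2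
  = (LINT x|spec v. (cmod ((\<Sum>i\<in>I. c i * iexp (t i * x)) - (\<Sum>k\<in>K. d k * iexp (u k * x))))\<^sup>2)"
proof -
 interpret finite_measure "spec v" by (rule spec)
 define p where "p x = (\<Sum>i\<in>I. c i * iexp (t i * x))" for x :: real
 define q where "q x = (\<Sum>k\<in>K. d k * iexp (u k * x))" for x :: real
 define a where "a = (\<Sum>i\<in>I. c i *C U (t i) v)"
 define b where "b = (\<Sum>k\<in>K. d k *C U (u k) v)"
 have pm: "p \<in> borel_measurable (spec v)" "q \<in> borel_measurable (spec v)"
  unfolding p_def q_def using spec(2)[of v] by (simp_all cong: measurable_cong_sets)
 have pb: "cmod (p x) <= (\<Sum>i\<in>I. cmod (c i))" and qb: "cmod (q x) <= (\<Sum>k\<in>K. cmod (d k))" for x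
  unfolding p_def q_def
  by (rule order_trans[OF norm_sum], rule sum_mono, simp add: norm_mult norm_exp_i_times flip: of_real_mult)+
 have I: "integrable (spec v) (%x. cnj (f x) * g x)" if "f \<in> {p, q}" "g \<in> {p, q}" for f g
 proof (rule integrable_const_bound)
  define B where "B = (\<Sum>i\<in>I. cmod (c i)) + (\<Sum>k\<in>K. cmod (d k))"
  have s: "(\<Sum>i\<in>I. cmod (c i)) >= 0" "(\<Sum>k\<in>K. cmod (d k)) >= 0" by (auto intro: sum_nonneg)
  have "cmod (f x) <= B" "cmod (g x) <= B" for x
   using that pb[of x] qb[of x] s by (auto simp: B_def)
  then show "AE x in spec v. norm (cnj (f x) * g x) <= B * B" by (intro AE_I2) (simp add: norm_mult mult_mono')
  show "(%x. cnj (f x) * g x) \<in> borel_measurable (spec v)"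
   using that pm measurable_compose[OF pm(1) borel_measurable_cnj] measurable_compose[OF pm(2) borel_measurable_cnj]
   by (auto intro!: borel_measurable_times)
 qed
 have "cor ((norm (a - b))\<^sup>2) = cinner a a - cinner a b - cinner b a + cinner b b"
  unfolding cinner_self[symmetric] by (simp add: cinner_diff_left cinner_diff_right algebra_simps)
 also have "... = (LINT x|spec v. cnj (p x) * p x) - (LINT x|spec v. cnj (p x) * q x)
   - (LINT x|spec v. cnj (q x) * p x) + (LINT x|spec v. cnj (q x) * q x)" unfolding a_def b_def p_def q_def by (simp only: cinner_combination fin)
 also have "... = (LINT x|spec v. cnj (p x) * p x - cnj (p x) * q x - cnj (q x) * p x + cnj (q x) * q x)" by (subst lint_add lint_diff,
    (intro lintegrable_add Bochner_Integration.integrable_diff I; simp)+)+ simp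
 also have "... = (LINT x|spec v. cor ((cmod (p x - q x))\<^sup>2))"
  by (intro lint_cong refl) (simp only: complex_norm_square complex_cnj_diff, simp add: algebra_simps)
 also have "... = cor (LINT x|spec v. (cmod (p x - q x))\<^sup>2)" by (rule integral_complex_of_real)
 finally show ?thesis unfolding of_real_eq_iff a_def b_def p_def q_def .
qed

text \<open>With step \<open>h\<close> of order \<open>N\<close> to the power \<open>-1/2\<close> the averages of \<open>cis (j h (x - E))\<close> over
 \<open>j < N\<close> tend to the indicator function of \<open>{E}\<close>: the step tends to 0 and the range \<open>N h\<close> to infinity.\<close>

lemma average_cis_tendsto:
 "(%N. (\<Sum>j<Suc N. cis (real j * ((1 / sqrt (real (Suc N))) * y))) / of_nat (Suc N)) ----> (if y = 0 then 1 else 0)"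
proof (cases "y = 0")
 case True
 then show ?thesis by (simp del: of_nat_Suc sum.lessThan_Suc)
next
 case False
 define h where "h N = 1 / sqrt (real (Suc N))" for N
 have h0: "h ----> 0" unfolding h_def by real_asymp
 have "(%N. h N * y) ----> 0 * y" by (intro tendsto_intros h0)
 then have "\<forall>\<^sub>F N in sequentially. \<bar>h N * y\<bar> < pi" using tendstoD[of "%N. h N * y" 0 sequentially pi] by simp
 then have "\<forall>\<^sub>F N in sequentially. norm ((\<Sum>j<Suc N. cis (real j * (h N * y))) / of_nat (Suc N)) <= 4 / \<bar>y\<bar> * h N"
 proof eventually_elim
  case (elim N)
  have hp: "h N > 0" by (simp add: h_def)
  have "cmod (\<Sum>j<Suc N. cis (real j * (h N * y))) <= 4 / \<bar>h N * y\<bar>" using elim hp False by (intro norm_cis_sum_le) auto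
  then have "cmod (\<Sum>j<Suc N. cis (real j * (h N * y))) / real (Suc N) <= 4 / \<bar>h N * y\<bar> / real (Suc N)" by (rule divide_right_mono) simp
  also have "... = 4 / \<bar>y\<bar> * h N"
  proof -
   have "h N * h N * real (Suc N) = 1" by (simp add: h_def)
   then have "h N = 1 / (h N * real (Suc N))" using hp
    by (subst nonzero_eq_divide_eq) (simp_all add: mult.assoc del: of_nat_Suc)
   then have "4 / \<bar>y\<bar> * (1 / (h N * real (Suc N))) = 4 / \<bar>y\<bar> * h N" by simp
   then show ?thesis using hp by (simp add: abs_mult mult_ac del: of_nat_Suc)
  qed
  finally show ?case by (simp only: norm_divide norm_of_nat)
 qed
 moreover have "(%N. 4 / \<bar>y\<bar> * h N) ----> 0" by (intro tendsto_mult_right_zero h0)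
 ultimately show ?thesis using False unfolding h_def by (auto intro: Lim_null_comparison)
qed

text \<open>Time averages of cis (- E t) U t v correspond under the isometry to functions tending to
  the indicator of \<open>{E}\<close>. They converge to the spectral projection of \<open>v\<close>,
  whose squared norm is the mass of the atom.\<close>

lemma atom_eigenvector:
 assumes E: "measure (spec v) {E} ~= 0"
 shows "EX w. w ~= 0 & (ALL t. U t w = cis (t * E) *C w)"
proof -
 interpret finite_measure "spec v" by (rule spec)
 have [measurable_cong]: "sets (spec v) = sets borel" by (rule spec)
 have [measurable]: "(%x. iexp (a * x)) \<in> borel_measurable borel" for a
  by (intro borel_measurable_continuous_onI continuous_intros)
 define h where "h N = 1 / sqrt (real (Suc N))" for N
 define c where "c N j = cis (- (E * (real j * h N))) / of_nat (Suc N)" for N j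
 define V where "V N = (\<Sum>j<Suc N. c N j *C U (real j * h N) v)" for N
 define a where "a N x = (\<Sum>j<Suc N. c N j * iexp (real j * h N * x))" for N x
 define e where "e x = (if x = E then 1 else 0 :: complex)" for x
 have am [measurable]: "a N \<in> borel_measurable borel" for N unfolding a_def by measurable
 have em [measurable]: "e \<in> borel_measurable borel" unfolding e_def by measurable
 have a_eq: "a N x = (\<Sum>j<Suc N. cis (real j * (h N * (x - E)))) / of_nat (Suc N)" for N x
  unfolding a_def c_def cis_conv_exp[symmetric] sum_divide_distrib
  by (intro sum.cong refl) (simp add: cis_mult algebra_simps)
 have a1: "cmod (a N x) <= 1" for N x
 proof -
  have "cmod (\<Sum>j<Suc N. cis (real j * (h N * (x - E)))) <= real (Suc N)" by (rule order_trans[OF norm_sum]) simp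
  then show ?thesis unfolding a_eq norm_divide norm_of_nat by (simp del: of_nat_Suc sum.lessThan_Suc)
 qed
 have e1: "cmod (e x) <= 1" for x by (simp add: e_def)
 have alim: "(%N. a N x) ----> e x" for x
  using average_cis_tendsto[of "x - E"] unfolding a_eq h_def e_def by simp
 \<comment> \<open>One dominated convergence covers three limits: only \<open>k = 1\<close> gives
   the Cauchy property, only \<open>f = 1\<close> the norm of the limit, and \<open>f\<close>,
   \<open>g\<close> equal to \<open>cis (t * x)\<close>, \<open>cis (t * E)\<close> the eigenvalue
   equation. The bound 16 is the square of a sum of four terms of modulus at most 1.\<close>
 have dct: "(%N. LINT x|spec v. (cmod (f x * a N x - g x * a N x + k x * (a N x - e x)))\<^sup>2)
   ----> (LINT x|spec v. (cmod (f x * e x - g x * e x))\<^sup>2)"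
  if [measurable]: "f \<in> borel_measurable borel" "g \<in> borel_measurable borel" "k \<in> borel_measurable borel"
   and b: "!!x. cmod (f x) <= 1" "!!x. cmod (g x) <= 1" "!!x. cmod (k x) <= 1" for f g k
 proof (rule integral_dominated_convergence[where w = "%_. 16"])
  show "AE x in spec v. (%N. (cmod (f x * a N x - g x * a N x + k x * (a N x - e x)))\<^sup>2) ----> (cmod (f x * e x - g x * e x))\<^sup>2"
  proof (rule AE_I2)
   fix x
   have "(%N. (cmod (f x * a N x - g x * a N x + k x * (a N x - e x)))\<^sup>2)
    ----> (cmod (f x * e x - g x * e x + k x * (e x - e x)))\<^sup>2" by (intro tendsto_intros alim)
   then show "(%N. (cmod (f x * a N x - g x * a N x + k x * (a N x - e x)))\<^sup>2) ----> (cmod (f x * e x - g x * e x))\<^sup>2" by simp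
  qed
  fix N
  show "AE x in spec v. norm ((cmod (f x * a N x - g x * a N x + k x * (a N x - e x)))\<^sup>2) <= 16"
  proof (rule AE_I2)
   fix x
   have m: "cmod (p * q) <= 1" if "cmod p <= 1" "cmod q <= 1" for p q
    using mult_mono[OF that] by (simp add: norm_mult)
   have eq: "f x * a N x - g x * a N x + k x * (a N x - e x) = f x * a N x + (- (g x * a N x)) + k x * a N x + (- (k x * e x))"
    by (simp add: algebra_simps)
   have "cmod (f x * a N x - g x * a N x + k x * (a N x - e x))
     <= cmod (f x * a N x) + cmod (- (g x * a N x)) + cmod (k x * a N x) + cmod (- (k x * e x))"
    using norm_triangle_ineq[of "f x * a N x + (- (g x * a N x)) + k x * a N x" "- (k x * e x)"]
     norm_add3_le[of "f x * a N x" "- (g x * a N x)" "k x * a N x"] unfolding eq by linarith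
   then have "cmod (f x * a N x - g x * a N x + k x * (a N x - e x)) <= 4"
    using m[OF b(1) a1, of x N x] m[OF b(2) a1, of x N x] m[OF b(3) a1, of x N x] m[OF b(3) e1, of x x] unfolding norm_minus_cancel by linarith
   then have "(cmod (f x * a N x - g x * a N x + k x * (a N x - e x)))\<^sup>2 <= 4\<^sup>2" by (rule power_mono) simp
   then show "norm ((cmod (f x * a N x - g x * a N x + k x * (a N x - e x)))\<^sup>2) <= 16" by simp
  qed
 qed auto
 define B where "B N = (LINT x|spec v. (cmod (a N x - e x))\<^sup>2)" for N
 have B: "B ----> 0" using dct[of "%_. 0" "%_. 0" "%_. 1"] unfolding B_def by simp
 have i4: "integrable (spec v) (%x. (cmod (p x - q x))\<^sup>2)"
  if [measurable]: "p \<in> borel_measurable borel" "q \<in> borel_measurable borel" and b: "!!x. cmod (p x) <= 1" "!!x. cmod (q x) <= 1" for p q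
 proof (rule integrable_const_bound[of _ 4])
  show "AE x in spec v. norm ((cmod (p x - q x))\<^sup>2) <= 4"
  proof (rule AE_I2)
   fix x
   have "cmod (p x - q x) <= 2" using norm_triangle_ineq4[of "p x" "q x"] b[of x] by linarith
   then have "(cmod (p x - q x))\<^sup>2 <= 2\<^sup>2" by (rule power_mono) simp
   then show "norm ((cmod (p x - q x))\<^sup>2) <= 4" by simp
  qed
 qed measurable
 have VV: "(norm (V N - V M))\<^sup>2 <= 2 * B N + 2 * B M" for N M
 proof -
  have "(norm (V N - V M))\<^sup>2 = (LINT x|spec v. (cmod (a N x - a M x))\<^sup>2)" unfolding V_def a_def by (rule norm_combination_diff) auto
  also have "... <= (LINT x|spec v. 2 * (cmod (a N x - e x))\<^sup>2 + 2 * (cmod (a M x - e x))\<^sup>2)"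
  proof (rule integral_mono)
   fix x
   show "(cmod (a N x - a M x))\<^sup>2 <= 2 * (cmod (a N x - e x))\<^sup>2 + 2 * (cmod (a M x - e x))\<^sup>2"
    using cmod_add_sq_le[of "a N x - e x" "e x - a M x"] by (simp add: norm_minus_commute)
  qed (intro lintegrable_add integrable_mult_right i4 am em a1 e1)+
  also have "... = 2 * B N + 2 * B M" unfolding B_def by (subst lint_add) (intro integrable_mult_right i4 am em a1 e1, simp)+
  finally show ?thesis .
 qed
 have "Cauchy V"
 proof (rule metric_CauchyI)
  fix r :: real assume r: "r > 0"
  have "\<forall>\<^sub>F N in sequentially. B N < r\<^sup>2 / 4" using order_tendstoD(2)[OF B, of "r\<^sup>2 / 4"] r by simp
  then obtain N0 where N0: "!!N. N >= N0 ==> B N < r\<^sup>2 / 4" by (auto simp: eventually_sequentially)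
  have "dist (V m) (V n) < r" if "m >= N0" "n >= N0" for m n
  proof -
   have "(norm (V m - V n))\<^sup>2 < r\<^sup>2" using VV[of m n] N0[OF that(1)] N0[OF that(2)] by linarith
   then show ?thesis using r unfolding dist_norm by (intro power2_less_imp_less[of _ r]) auto
  qed
  then show "EX M. \<forall>m\<ge>M. \<forall>n\<ge>M. dist (V m) (V n) < r" by blast
 qed
 then obtain w where w: "V ----> w" using Cauchy_convergent convergent_def by blast
 have "w ~= 0"
 proof
  assume "w = 0"
  have "(norm (V N))\<^sup>2 = (LINT x|spec v. (cmod (1 * a N x - 0 * a N x + 0 * (a N x - e x)))\<^sup>2)" for N
   using norm_combination_diff[of "{..<Suc N}" "{}" "c N" "%j. real j * h N" v undefined undefined] unfolding V_def a_def by simp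
  then have "(%N. (norm (V N))\<^sup>2) ----> (LINT x|spec v. (cmod (1 * e x - 0 * e x))\<^sup>2)" using dct[of "%_. 1" "%_. 0" "%_. 0"] by simp
  moreover have "(%N. (norm (V N))\<^sup>2) ----> (norm w)\<^sup>2" by (intro tendsto_intros w)
  ultimately have "(LINT x|spec v. (cmod (1 * e x - 0 * e x))\<^sup>2) = (norm w)\<^sup>2" by (rule LIMSEQ_unique)
  moreover have "(%x. (cmod (1 * e x - 0 * e x))\<^sup>2) = indicator {E}" by (auto simp: e_def fun_eq_iff)
  moreover have "space (spec v) = UNIV" by (rule sets_borel_space) (rule spec)
  ultimately show False using E \<open>w = 0\<close> by simp
 qed
 moreover have "U t w = cis (t * E) *C w" for t
 proof -
  have "(norm (U t (V N) - cis (t * E) *C V N))\<^sup>2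
    = (LINT x|spec v. (cmod (cis (t * x) * a N x - cis (t * E) * a N x + 0 * (a N x - e x)))\<^sup>2)" for N
  proof -
   have 1: "U t (V N) = (\<Sum>j<Suc N. c N j *C U (t + real j * h N) v)" unfolding V_def U_sum scaleC isometry_groupD(4)[OF isometry_group] ..
   have 2: "cis (t * E) *C V N = (\<Sum>j<Suc N. (cis (t * E) * c N j) *C U (real j * h N) v)"
    unfolding V_def linear_sum[OF bounded_linear.linear[OF bounded_linear_scaleC]] scaleC_scaleC ..
   have 3: "(\<Sum>j<Suc N. c N j * iexp ((t + real j * h N) * x)) = cis (t * x) * a N x" for x
    unfolding a_def sum_distrib_left cis_conv_exp[symmetric]
    by (intro sum.cong refl) (simp add: mult.left_commute[of _ "c N j" for j] cis_mult algebra_simps)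
   have 4: "(\<Sum>j<Suc N. (cis (t * E) * c N j) * iexp (real j * h N * x)) = cis (t * E) * a N x" for x
    unfolding a_def sum_distrib_left mult.assoc ..
   show ?thesis
    unfolding 1 2 by (subst norm_combination_diff) (simp_all only: finite_lessThan 3 4 mult_zero_left add_0_right)
  qed
  moreover have "(%N. LINT x|spec v. (cmod (cis (t * x) * a N x - cis (t * E) * a N x + 0 * (a N x - e x)))\<^sup>2)
    ----> (LINT x|spec v. (cmod (cis (t * x) * e x - cis (t * E) * e x))\<^sup>2)" by (rule dct) auto
  moreover have "(%x. (cmod (cis (t * x) * e x - cis (t * E) * e x))\<^sup>2) = (%x. 0)" by (auto simp: e_def fun_eq_iff)
  ultimately have "(%N. (norm (U t (V N) - cis (t * E) *C V N))\<^sup>2) ----> 0" by simp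
  moreover have "bounded_linear (U t)"
   by (rule bounded_linear_intro[where K = 1]) (simp_all add: U_add U_simps linear_scale[OF isometry_groupD(1)[OF isometry_group]])
  then have "(%N. (norm (U t (V N) - cis (t * E) *C V N))\<^sup>2) ----> (norm (U t w - cis (t * E) *C w))\<^sup>2"
   by (intro tendsto_intros bounded_linear.tendsto[OF _ w] bounded_linear_scaleC)
  ultimately have "(norm (U t w - cis (t * E) *C w))\<^sup>2 = 0" using LIMSEQ_unique by blast
  then show ?thesis by simp
 qed
 ultimately show ?thesis by blast
qed

lemma eigenvector_generator:
 assumes "!!t. U t w = cis (t * E) *C w"
 shows "(w, \<i> *C (cor E *C w)) \<in> generator U"
proof -
 have "((%t. cis (t * E)) has_vector_derivative (\<i> * cor E)) (at 0)"
  unfolding has_vector_derivative_complex_iff by (auto intro!: derivative_eq_intros)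
 then have "((%t. norm (cis (t * E) - 1 - t *R (\<i> * cor E)) / norm t) ---> 0) (at 0)" unfolding has_vector_derivative_def has_derivative_at by simp
 then have "((%t. norm ((cis (t * E) - 1) /\<^sub>R t - \<i> * cor E)) ---> 0) (at 0)"
  by (rule Lim_transform_eventually) (simp add: eventually_at_filter norm_quotient_diff)
 then have "((%t. norm ((cis (t * E) - 1) /\<^sub>R t - \<i> * cor E) * norm w) ---> 0) (at 0)" by (rule tendsto_mult_left_zero)
 then have "((%t. norm (((cis (t * E) - 1) /\<^sub>R t - \<i> * cor E) *C w)) ---> 0) (at 0)" by (simp only: norm_scaleC)
 then have "((%t. ((cis (t * E) - 1) /\<^sub>R t - \<i> * cor E) *C w) ---> 0) (at 0)" by (rule tendsto_norm_zero_cancel)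
 moreover have "((cis (t * E) - 1) /\<^sub>R t - \<i> * cor E) *C w = (U t w - w) /\<^sub>R t - \<i> *C cor E *C w" for t
  unfolding assms scaleC_diff_left
  by (simp add: scaleC_diff_left scaleR_conv_of_real flip: scaleC_of_real scaleC_scaleC)
 ultimately show ?thesis by (simp add: generator_def LIM_zero_iff)
qed

end

text \<open>Strong convergence of the groups gives pointwise convergence of characteristic
  functions, and Levy's continuity theorem applies after division by the mass
  \<open>(norm v)\<^sup>2\<close>, which does not depend on \<open>n\<close>.\<close>

lemma spec_integral_tendsto:
 fixes f :: "real => real"
 assumes Us: "!!n::nat. unitary_on_l2 (Us n)" and U: "unitary_on_l2 U"
  and conv: "!!s. (%n. Us n s v) ----> U s v"
  and f: "!!x. isCont f x" "!!x. \<bar>f x\<bar> <= B"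
 shows "(%n. LINT x|unitary_on_l2.spec (Us n) v. f x) ----> (LINT x|unitary_on_l2.spec U v. f x)"
proof (cases "v = 0")
 case True
 have "(LINT x|unitary_on_l2.spec W v. f x) = 0" if W: "unitary_on_l2 W" for W
 proof -
  interpret unitary_on_l2 W by (rule W)
  have "space (spec v) = UNIV" by (rule sets_borel_space) (rule spec)
  then have "emeasure (spec v) (space (spec v)) = 0" using True by (simp add: emeasure_spec_UNIV)
  then have "AE x in spec v. f x = 0" by (intro AE_I[where N = "space (spec v)"]) auto
  then show ?thesis by (rule integral_eq_zero_AE)
 qed
 then show ?thesis using Us U by simp
next
 case False
 have nu: "\<exists>\<nu>. real_distribution \<nu> & (ALL s. char \<nu> s = cinner v (W s v) / cor ((norm v)\<^sup>2))
   & (LINT x|unitary_on_l2.spec W v. f x) = (norm v)\<^sup>2 * (LINT x|\<nu>. f x)" if W: "unitary_on_l2 W" for W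
 proof -
  interpret unitary_on_l2 W by (rule W)
  obtain \<nu> where \<nu>: "real_distribution \<nu>" "!!s. char \<nu> s = cinner v (W s v) / cor ((norm v)\<^sup>2)"
   using spec_normalized[OF False] by blast
  interpret \<nu>: real_distribution \<nu> by fact
  have "spec v = density \<nu> (%_. ennreal ((norm v)\<^sup>2))"
  proof (rule spec_eqI)
   show "finite_measure (density \<nu> (%_. ennreal ((norm v)\<^sup>2)))" by (rule finite_measure_density_const) (rule \<nu>.finite_measure_axioms)
   show "char (density \<nu> (%_. ennreal ((norm v)\<^sup>2))) s = cinner v (W s v)" for s
    using False by (simp add: char_density_const \<nu>(2))
  qed simp
  moreover have "f \<in> borel_measurable \<nu>"
   using f(1) by (intro \<nu>.measurable_finite_borel borel_measurable_continuous_onI continuous_at_imp_continuous_on) auto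
  ultimately have "(LINT x|spec v. f x) = (norm v)\<^sup>2 * (LINT x|\<nu>. f x)" by (simp add: integral_density)
  then show ?thesis using \<nu> by blast
 qed
 obtain \<nu> where \<nu>: "real_distribution \<nu>" "!!s. char \<nu> s = cinner v (U s v) / cor ((norm v)\<^sup>2)"
   "(LINT x|unitary_on_l2.spec U v. f x) = (norm v)\<^sup>2 * (LINT x|\<nu>. f x)" using nu[OF U] by blast
 have "ALL n. \<exists>\<nu>. real_distribution \<nu> & (ALL s. char \<nu> s = cinner v (Us n s v) / cor ((norm v)\<^sup>2))
   & (LINT x|unitary_on_l2.spec (Us n) v. f x) = (norm v)\<^sup>2 * (LINT x|\<nu>. f x)" using nu[OF Us] by blast
 then obtain \<nu>n where \<nu>n: "!!n. real_distribution (\<nu>n n)" "!!n s. char (\<nu>n n) s = cinner v (Us n s v) / cor ((norm v)\<^sup>2)"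
   "!!n. (LINT x|unitary_on_l2.spec (Us n) v. f x) = (norm v)\<^sup>2 * (LINT x|\<nu>n n. f x)" by metis
 have "weak_conv_m \<nu>n \<nu>"
 proof (rule levy_continuity[OF \<nu>n(1) \<nu>(1)])
  fix s
  show "(%n. char (\<nu>n n) s) ----> char \<nu> s"
   unfolding \<nu>n(2) \<nu>(2) using False by (intro tendsto_divide tendsto_cinner tendsto_const conv) auto
 qed
 then have "(%n. LINT x|\<nu>n n. f x) ----> (LINT x|\<nu>. f x)"
  using weak_conv_imp_integral_bdd_continuous_conv[OF \<nu>n(1) \<nu>(1), where f = f and B = B] f by simp
 then show ?thesis unfolding \<nu>n(3) \<nu>(3) by (intro tendsto_intros)
qed

subsection \<open>Operators given by graphs of representatives\<close>

definition ae_closed_operator :: "'a::l2_space operator => bool" where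
 "ae_closed_operator D \<longleftrightarrow> (\<forall>(f, g)\<in>D. f \<in> L2 vol & g \<in> L2 vol \<and>
   (\<forall>f'\<in>L2 vol. \<forall>g'\<in>L2 vol.
    (AE x in vol. f x = f' x) --> (AE x in vol. g x = g' x) --> (f', g') \<in> D))"

text \<open>The passage to classes, with a factor \<open>\<i>\<close> that turns the self-adjoint D
  into the skew generator of its group.\<close>

definition lift_graph :: "'a::l2_space operator => ('a l2 \<times> 'a l2) set" where
 "lift_graph D = {(abs_l2 f, \<i> *C abs_l2 g) | f g. (f, g) \<in> D}"

lemma scaleC_ii_cancel: "\<i> *C v = \<i> *C w \<longleftrightarrow> v = w"
proof
 assume "\<i> *C v = \<i> *C w"
 then have "(- \<i>) *C (\<i> *C v) = (- \<i>) *C (\<i> *C w)" by simp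
 then show "v = w" unfolding scaleC_scaleC by simp
qed simp

lemma lift_graph_iff:
 assumes D: "ae_closed_operator D" and f: "f \<in> L2 vol" and g: "g \<in> L2 vol"
 shows "(abs_l2 f, \<i> *C abs_l2 g) \<in> lift_graph D \<longleftrightarrow> (f, g) \<in> D"
proof
 assume "(abs_l2 f, \<i> *C abs_l2 g) \<in> lift_graph D"
 then obtain f' g' where fg: "(f', g') \<in> D" "abs_l2 f = abs_l2 f'" "abs_l2 g = abs_l2 g'" by (auto simp: lift_graph_def scaleC_ii_cancel)
 have fgL: "f' \<in> L2 vol" "g' \<in> L2 vol" using D fg(1) by (auto simp: ae_closed_operator_def)
 then have "AE x in vol. f' x = f x" "AE x in vol. g' x = g x" using fg(2,3) f g by (simp_all flip: abs_l2_eq_iff)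
 then show "(f, g) \<in> D" using D fg(1) f g unfolding ae_closed_operator_def by blast
qed (auto simp: lift_graph_def)

lemma norm_difference_quotient:
 assumes k: "k \<in> L2 vol" and f: "f \<in> L2 vol" and g: "g \<in> L2 vol"
 shows "norm ((abs_l2 k - abs_l2 f) /\<^sub>R s - \<i> *C abs_l2 g)
  = L2_norm vol (%x. (k x - f x) / cor s - \<i> * g x)"
proof -
 have "(abs_l2 k - abs_l2 f) /\<^sub>R s - \<i> *C abs_l2 g
  = abs_l2 (%x. cor (inverse s) * (k x - f x) - \<i> * g x)" using assms by (simp only: abs_l2_diff abs_l2_scaleR abs_l2_scaleC L2_diff L2_cmult)
 also have "norm ... = L2_norm vol (%x. cor (inverse s) * (k x - f x) - \<i> * g x)" using assms by (intro norm_abs_l2 L2_diff L2_cmult)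
 finally show ?thesis by (simp add: divide_inverse mult.commute)
qed

lemma abs_l2_lincomb:
 assumes "f \<in> L2 vol" "g \<in> L2 vol"
 shows "abs_l2 (%x. a * f x + b * g x) = a *C abs_l2 f + b *C abs_l2 g" using assms by (simp add: abs_l2_scaleC abs_l2_add L2_cmult)

text \<open>Existence: a group constructed on classes, read through representatives, meets the
  requirements of \<open>is_exp_group\<close>.\<close>

lemma is_exp_group_rep:
 assumes D: "ae_closed_operator D" and U: "unitary_on_l2 U" and gen: "generator U = lift_graph D"
 shows "is_exp_group vol D (%s f. rep_l2 (U s (abs_l2 f)))"
proof -
 interpret unitary_on_l2 U by (rule U)
 have "unitary_group vol (%s f. rep_l2 (U s (abs_l2 f)))" unfolding unitary_group_def
 proof (intro conjI allI ballI)
  fix s and f :: "'a => complex" assume f: "f \<in> L2 vol"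
  show "rep_l2 (U s (abs_l2 f)) \<in> L2 vol" by simp
  show "L2_norm vol (rep_l2 (U s (abs_l2 f))) = L2_norm vol f" by (simp add: norm_rep_l2 U_simps norm_abs_l2 f)
  fix g :: "'a => complex" and a b assume g: "g \<in> L2 vol"
  show "AE x in vol. rep_l2 (U s (abs_l2 (%y. a * f y + b * g y))) x
    = a * rep_l2 (U s (abs_l2 f)) x + b * rep_l2 (U s (abs_l2 g)) x"
   using rep_abs_l2[of "%x. a * rep_l2 (U s (abs_l2 f)) x + b * rep_l2 (U s (abs_l2 g)) x"]
   by (simp add: abs_l2_lincomb f g U_add scaleC L2_add L2_cmult)
 next
  fix f :: "'a => complex" assume f: "f \<in> L2 vol"
  show "AE x in vol. rep_l2 (U 0 (abs_l2 f)) x = f x" using rep_abs_l2[OF f] by (simp add: U_simps)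
  have "L2_norm vol (%x. rep_l2 (U s (abs_l2 f)) x - f x) = norm (U s (abs_l2 f) - abs_l2 f)" for s
   using norm_abs_l2[OF L2_diff[OF rep_L2[of "U s (abs_l2 f)"] f]] abs_l2_diff[OF rep_L2[of "U s (abs_l2 f)"] f] by simp
  then show "((%s. L2_norm vol (%x. rep_l2 (U s (abs_l2 f)) x - f x)) ---> 0) (at 0)"
   using isometry_groupD(5)[OF isometry_group, of "abs_l2 f"] by (auto intro!: tendsto_norm_zero simp: LIM_zero)
 next
  fix s t and f :: "'a => complex" assume f: "f \<in> L2 vol"
  show "AE x in vol. rep_l2 (U (s + t) (abs_l2 f)) x = rep_l2 (U s (abs_l2 (rep_l2 (U t (abs_l2 f))))) x"
   by (simp add: isometry_groupD(4)[OF isometry_group])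
 qed
 moreover have "(f, g) \<in> D \<longleftrightarrow> f \<in> L2 vol & g \<in> L2 vol \<and>
    ((%s. L2_norm vol (%x. (rep_l2 (U s (abs_l2 f)) x - f x) / cor s - \<i> * g x)) ---> 0) (at 0)" for f g
 proof (cases "f \<in> L2 vol & g \<in> L2 vol")
  case True
  then have "(f, g) \<in> D \<longleftrightarrow> (abs_l2 f, \<i> *C abs_l2 g) \<in> generator U" by (simp add: gen lift_graph_iff[OF D])
  also have "... \<longleftrightarrow> ((%s. norm ((U s (abs_l2 f) - abs_l2 f) /\<^sub>R s - \<i> *C abs_l2 g)) ---> 0) (at 0)"
   by (simp add: generator_def tendsto_norm_zero_iff LIM_zero_iff)
  also have "(%s. norm ((U s (abs_l2 f) - abs_l2 f) /\<^sub>R s - \<i> *C abs_l2 g))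
    = (%s. L2_norm vol (%x. (rep_l2 (U s (abs_l2 f)) x - f x) / cor s - \<i> * g x))"
   using True norm_difference_quotient[OF rep_L2[of "U s (abs_l2 f)" for s], of f g] by simp
  finally show ?thesis using True by simp
 next
  case False
  then show ?thesis using D by (auto simp: ae_closed_operator_def)
 qed
 ultimately show ?thesis unfolding is_exp_group_def by blast
qed

lemma is_exp_group_lift:
 assumes D: "ae_closed_operator D" and U: "is_exp_group vol D U"
 defines "W \<equiv> %s v. abs_l2 (U s (rep_l2 v))"
 shows "unitary_on_l2 W" "generator W = lift_graph D"
  "!!s f. f \<in> L2 vol ==> U s f \<in> L2 vol & abs_l2 (U s f) = W s (abs_l2 f)"
proof -
 have ug: "unitary_group vol U" using U by (simp add: is_exp_group_def)
 have UL: "U s f \<in> L2 vol" "L2_norm vol (U s f) = L2_norm vol f" if "f \<in> L2 vol" for s f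
  using ug that unfolding unitary_group_def by auto
 have lin: "AE x in vol. U s (%y. a * f y + b * g y) x = a * U s f x + b * U s g x"
  if "f \<in> L2 vol" "g \<in> L2 vol" for s f g a b
  using ug that unfolding unitary_group_def by auto
 \<comment> \<open>Compatibility with almost everywhere equality is not part of
   \<open>unitary_group\<close>. It follows because \<open>U s\<close> preserves the norm 0 of a
   difference and is linear up to null sets.\<close>
 have resp: "abs_l2 (U s f) = abs_l2 (U s g)"
  if f: "f \<in> L2 vol" and g: "g \<in> L2 vol" and fg: "abs_l2 f = abs_l2 g" for s f g
 proof -
  have L: "(%y. 1 * f y + (-1) * g y) \<in> L2 vol" by (intro L2_add L2_cmult f g)
  have "abs_l2 (%y. 1 * f y + (-1) * g y) = 0" using abs_l2_lincomb[OF f g, of 1 "-1"] fg by simp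
  then have "L2_norm vol (%y. 1 * f y + (-1) * g y) = 0" using norm_abs_l2[OF L] by simp
  then have z: "AE x in vol. U s (%y. 1 * f y + (-1) * g y) x = 0" using UL[OF L, of s] L2_norm_zero_iff[OF UL(1)[OF L]] by simp
  have "AE x in vol. U s f x = U s g x" using z lin[OF f g, of s 1 "-1"] by eventually_elim simp
  then show ?thesis using abs_l2_eq_iff[OF UL(1)[OF f] UL(1)[OF g]] by simp
 qed
 have W: "abs_l2 (U s f) = W s (abs_l2 f)" if "f \<in> L2 vol" for s f
  unfolding W_def by (rule resp) (use that in auto)
 show "U s f \<in> L2 vol & abs_l2 (U s f) = W s (abs_l2 f)" if "f \<in> L2 vol" for s f
  using W UL that by blast
 have Wlin: "W s (a *C v + b *C w) = a *C W s v + b *C W s w" for s a b v w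
 proof -
  obtain f g where f: "f \<in> L2 vol" "v = abs_l2 f" and g: "g \<in> L2 vol" "w = abs_l2 g" by (metis l2_cases)
  have L: "(%y. a * f y + b * g y) \<in> L2 vol" by (intro L2_add L2_cmult f g)
  have "W s (a *C v + b *C w) = abs_l2 (U s (%y. a * f y + b * g y))" using W[OF L, of s] by (simp add: abs_l2_lincomb f g)
  also have "... = abs_l2 (%x. a * U s f x + b * U s g x)"
   using lin[OF f(1) g(1), of s a b] by (subst abs_l2_eq_iff) (auto intro!: UL L L2_add L2_cmult f g)
  also have "... = a *C W s v + b *C W s w" by (simp add: abs_l2_lincomb UL f g W)
  finally show ?thesis .
 qed
 have ig: "isometry_group W" unfolding isometry_group_def
 proof (intro conjI allI)
  fix s t and v :: "'a l2"
  obtain f where f: "f \<in> L2 vol" "v = abs_l2 f" by (rule l2_cases)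
  show "linear (W s)"
  proof (rule linearI)
   show "W s (x + y) = W s x + W s y" for x y using Wlin[of s 1 x 1 y] by simp
   show "W s (c *R x) = c *R W s x" for c x
    using Wlin[of s "cor c" x 0 x] by (simp add: scaleC_of_real)
  qed
  show "norm (W s v) = norm v" using W[OF f(1), of s] norm_abs_l2[OF UL(1)[OF f(1)], of s] UL(2)[OF f(1), of s] norm_abs_l2[OF f(1)] f(2) by simp
  have "AE x in vol. U 0 f x = f x" using ug f(1) unfolding unitary_group_def by auto
  then show "W 0 v = v" using W[OF f(1), of 0] abs_l2_eq_iff[OF UL(1)[OF f(1)] f(1), of 0] f(2) by simp
  have "AE x in vol. U (s + t) f x = U s (U t f) x" using ug f(1) unfolding unitary_group_def by auto
  then show "W (s + t) v = W s (W t v)"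
   using W[OF f(1)] W[OF UL(1)[OF f(1)]] abs_l2_eq_iff[OF UL(1)[OF f(1)] UL(1)[OF UL(1)[OF f(1)]], of "s + t" s t] f(2) by simp
  have "((%s. L2_norm vol (%x. U s f x - f x)) ---> 0) (at 0)" using ug f(1) unfolding unitary_group_def by auto
  moreover have "L2_norm vol (%x. U s f x - f x) = norm (W s v - v)" for s
   using norm_abs_l2[OF L2_diff[OF UL(1)[OF f(1)] f(1)], of s] abs_l2_diff[OF UL(1)[OF f(1)] f(1), of s] W[OF f(1), of s] f(2) by simp
  ultimately show "((%s. W s v) ---> v) (at 0)" by (simp add: tendsto_norm_zero_iff LIM_zero_iff)
 qed
 show "unitary_on_l2 W" by unfold_locales (use ig Wlin[of _ _ _ 0 0] in auto)
 show "generator W = lift_graph D"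
 proof (rule set_eqI, clarify)
  fix v w :: "'a l2"
  obtain f where f: "f \<in> L2 vol" "v = abs_l2 f" by (rule l2_cases)
  obtain g where g: "g \<in> L2 vol" "(- \<i>) *C w = abs_l2 g" by (rule l2_cases)
  have w: "w = \<i> *C abs_l2 g" unfolding g(2)[symmetric] scaleC_scaleC by simp
  have "(v, w) \<in> generator W \<longleftrightarrow> ((%s. norm ((abs_l2 (U s f) - abs_l2 f) /\<^sub>R s - \<i> *C abs_l2 g)) ---> 0) (at 0)"
   unfolding W[OF f(1)] by (simp add: generator_def tendsto_norm_zero_iff LIM_zero_iff f w)
  also have "... \<longleftrightarrow> ((%s. L2_norm vol (%x. (U s f x - f x) / cor s - \<i> * g x)) ---> 0) (at 0)"
   by (simp only: norm_difference_quotient[OF UL(1)[OF f(1)] f(1) g(1)])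
  also have "... \<longleftrightarrow> (f, g) \<in> D" using U f(1) g(1) unfolding is_exp_group_def by blast
  also have "... \<longleftrightarrow> (v, w) \<in> lift_graph D" unfolding f(2) w by (rule lift_graph_iff[OF D f(1) g(1), symmetric])
  finally show "(v, w) \<in> generator W \<longleftrightarrow> (v, w) \<in> lift_graph D" .
 qed
qed

locale schroedinger_like =
 fixes D :: "'a::l2_space operator"
 assumes closed: "ae_closed_operator D" and skew: "skew_operator (lift_graph D)"
  and scaleC: "(v, w) \<in> lift_graph D ==> (c *C v, c *C w) \<in> lift_graph D"
begin

sublocale skew_operator "lift_graph D" by (rule skew)

sublocale unitary_on_l2 group
proof
 show "isometry_group group" by (rule isometry_group_group)
 show "group s (c *C v) = c *C group s v" for s c v
  by (rule group_commute[OF bounded_linear_scaleC scaleC])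
qed

text \<open>Whichever group the existential in \<open>spectral_measure\<close> provides, its lift
  has the same generator as \<open>group\<close> and so coincides with it. The defining predicate
  therefore reduces to that of \<open>spec\<close>.\<close>

lemma spectral_measure_eq:
 assumes \<psi>: "\<psi> \<in> L2 vol"
 shows "spectral_measure vol D \<psi> = spec (abs_l2 \<psi>)"
proof -
 have "(EX U. is_exp_group vol D U & (ALL s. L2_inner vol \<psi> (U s \<psi>) = char \<mu> s))
   \<longleftrightarrow> (ALL s. cinner (abs_l2 \<psi>) (group s (abs_l2 \<psi>)) = char \<mu> s)" for \<mu>
 proof
  assume "EX U. is_exp_group vol D U & (ALL s. L2_inner vol \<psi> (U s \<psi>) = char \<mu> s)"
  then obtain U where U: "is_exp_group vol D U" "!!s. L2_inner vol \<psi> (U s \<psi>) = char \<mu> s" by blast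
  define W where "W = (%s v. abs_l2 (U s (rep_l2 v)))"
  have W1: "unitary_on_l2 W" unfolding W_def by (rule is_exp_group_lift(1)[OF closed U(1)])
  have W2: "generator W = lift_graph D" unfolding W_def by (rule is_exp_group_lift(2)[OF closed U(1)])
  have W3: "U s \<psi> \<in> L2 vol" "abs_l2 (U s \<psi>) = W s (abs_l2 \<psi>)" for s
   unfolding W_def using is_exp_group_lift(3)[OF closed U(1) \<psi>, of s] by blast+
  have "W s v = group s v" for s v
  proof (rule isometry_group_unique[OF unitary_on_l2.isometry_group[OF W1] isometry_group])
   show "generator W = generator group" by (simp only: W2 generator_group)
   show "closure (fst ` generator W) = UNIV" by (simp only: W2 dense)
   show "g = g'" if "(f, g) \<in> generator W" "(f, g') \<in> generator W" for f g g'
    using that unfolding W2 by (rule graph_single)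
  qed
  then show "ALL s. cinner (abs_l2 \<psi>) (group s (abs_l2 \<psi>)) = char \<mu> s" using U(2) cinner_abs_l2[OF \<psi> W3(1)] by (simp add: W3(2))
 next
  assume *: "ALL s. cinner (abs_l2 \<psi>) (group s (abs_l2 \<psi>)) = char \<mu> s"
  have "L2_inner vol \<psi> (rep_l2 (group s (abs_l2 \<psi>))) = char \<mu> s" for s
   using * cinner_abs_l2[OF \<psi> rep_L2[of "group s (abs_l2 \<psi>)"]] by simp
  then show "EX U. is_exp_group vol D U & (ALL s. L2_inner vol \<psi> (U s \<psi>) = char \<mu> s)"
   using is_exp_group_rep[OF closed unitary_on_l2_axioms generator_group] by blast
 qed
 then show ?thesis unfolding spectral_measure_def spec_def by simp
qed

lemma no_atoms:
 assumes "no_point_spectrum vol D"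
 shows "measure (spec v) {E} = 0"
proof (rule ccontr)
 assume "measure (spec v) {E} ~= 0"
 then obtain w where w: "w ~= 0" "!!t. group t w = cis (t * E) *C w" using atom_eigenvector by blast
 obtain f where f: "f \<in> L2 vol" "w = abs_l2 f" by (rule l2_cases)
 have "(w, \<i> *C (cor E *C w)) \<in> lift_graph D" using eigenvector_generator[of w E] w(2) by (simp only: generator_group)
 then have "(abs_l2 f, \<i> *C abs_l2 (%x. cor E * f x)) \<in> lift_graph D" by (simp only: f(2) abs_l2_scaleC[OF f(1)])
 then have "(f, %x. cor E * f x) \<in> D" by (simp add: lift_graph_iff[OF closed f(1) L2_cmult[OF f(1)]])
 moreover have "~ (AE x in vol. f x = 0)" using w(1) f L2_norm_zero_iff[OF f(1)] norm_abs_l2[OF f(1)] by auto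
 ultimately show False using assms f(1) unfolding no_point_spectrum_def by blast
qed

end

section \<open>Singular measures\<close>

definition singular_measure :: "real measure => bool" where
 "singular_measure \<mu> \<longleftrightarrow> (\<exists>N\<in>null_sets lborel. emeasure \<mu> (- N) = 0)"

lemma singular_no_ac_part:
 assumes "singular_measure \<mu>" shows "~ has_ac_part \<mu>"
proof
 assume "has_ac_part \<mu>"
 then obtain ac sc pp where d: "lebesgue_decomposition \<mu> ac sc pp" "emeasure ac UNIV ~= 0" by (auto simp: has_ac_part_def)
 obtain N where N: "N \<in> null_sets lborel" "emeasure \<mu> (- N) = 0" using assms by (auto simp: singular_measure_def)
 have b: "N \<in> sets borel" using N by (auto simp: null_sets_def)
 have s: "sets ac = sets borel" using d by (simp add: lebesgue_decomposition_def)
 have "emeasure \<mu> (- N) = emeasure ac (- N) + emeasure sc (- N) + emeasure pp (- N)" using d b by (auto simp: lebesgue_decomposition_def)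
 then have "emeasure ac (- N) = 0" using N by simp
 moreover have "emeasure ac N = 0" using d N by (auto simp: lebesgue_decomposition_def absolutely_continuous_def)
 moreover have "emeasure ac UNIV <= emeasure ac N + emeasure ac (- N)" using emeasure_subadditive[of N ac "- N"] b s by simp
 ultimately show False using d by simp
qed

lemma no_atoms_no_pp_part:
 assumes "!!x. emeasure \<mu> {x} = 0" shows "~ has_pp_part \<mu>"
proof
 assume "has_pp_part \<mu>"
 then obtain ac sc pp where d: "lebesgue_decomposition \<mu> ac sc pp" "emeasure pp UNIV ~= 0" by (auto simp: has_pp_part_def)
 have s: "sets pp = sets borel" using d by (simp add: lebesgue_decomposition_def)
 obtain C where C: "countable C" "emeasure pp (- C) = 0" using d by (auto simp: lebesgue_decomposition_def)
 have bC: "C \<in> sets borel" by (rule sets.countable) (use C in auto)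
 have "emeasure pp {x} = 0" for x
 proof -
  have "emeasure \<mu> {x} = emeasure ac {x} + emeasure sc {x} + emeasure pp {x}"
   using d(1) unfolding lebesgue_decomposition_def by (elim conjE) (erule bspec, simp)
  then show ?thesis using assms[of x] by simp
 qed
 then have "emeasure pp C = 0" using emeasure_countable_singleton[of C pp] C s by simp
 moreover have "emeasure pp UNIV <= emeasure pp C + emeasure pp (- C)" using emeasure_subadditive[of C pp "- C"] bC s by simp
 ultimately show False using d C by simp
qed

text \<open>Since \<open>has_ac_part\<close> asks for some decomposition, one has to be constructed.
  A countable union \<open>N0\<close> of Lebesgue null sets attains the supremum of their
  \<open>\<mu>\<close>-masses, so no null set has mass outside \<open>N0\<close>, and the
  restriction to its complement is absolutely continuous. The atoms \<open>C\<close> then split the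
  rest.\<close>

lemma no_ac_part_singular:
 assumes \<mu>: "finite_measure \<mu>" "sets \<mu> = sets borel" and no: "~ has_ac_part \<mu>"
 shows "singular_measure \<mu>"
proof -
 interpret finite_measure \<mu> by fact
 have sp: "space \<mu> = UNIV" using sets_borel_space[OF \<mu>(2)] .
 define s where "s = (SUP N\<in>null_sets lborel. measure \<mu> N)"
 have bdd: "bdd_above (measure \<mu> ` null_sets lborel)" using bounded_measure by (intro bdd_aboveI2[of _ _ "measure \<mu> (space \<mu>)"]) auto
 have "\<exists>N\<in>null_sets lborel. s - 1 / real (Suc k) < measure \<mu> N" for k
 proof -
  have "s - 1 / real (Suc k) < (SUP N\<in>null_sets lborel. measure \<mu> N)" unfolding s_def by simp
  then show ?thesis by (subst (asm) less_cSUP_iff) (use bdd in auto)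
 qed
 then obtain N where N: "!!k. N k \<in> null_sets lborel" "!!k. s - 1 / real (Suc k) < measure \<mu> (N k)" by metis
 define N0 where "N0 = (\<Union>k. N k)"
 have N0: "N0 \<in> null_sets lborel" unfolding N0_def by (rule null_sets_UN) (rule N)
 have bN: "N k \<in> sets borel" "N0 \<in> sets borel" for k using N(1)[of k] N0 by (auto simp: null_sets_def)
 have le_s: "measure \<mu> A <= s" if "A \<in> null_sets lborel" for A
  unfolding s_def by (rule cSUP_upper[OF that bdd])
 have "s <= measure \<mu> N0"
 proof (rule field_le_epsilon)
  fix e :: real assume "e > 0"
  then obtain k where "1 / real (Suc k) < e" using nat_approx_posE by blast
  moreover have "measure \<mu> (N k) <= measure \<mu> N0" using bN \<mu> by (intro finite_measure_mono) (auto simp: N0_def)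
  ultimately show "s <= measure \<mu> N0 + e" using N(2)[of k] by simp
 qed
 have null: "emeasure \<mu> (A - N0) = 0" if A: "A \<in> null_sets lborel" for A
 proof -
  have bA: "A \<in> sets borel" using A by (auto simp: null_sets_def)
  have "measure \<mu> (N0 \<union> (A - N0)) = measure \<mu> N0 + measure \<mu> (A - N0)" using bA bN \<mu> by (intro finite_measure_Union) auto
  moreover have "measure \<mu> (N0 \<union> (A - N0)) <= s" using A N0 by (intro le_s) (metis Un_Diff_cancel null_sets.Un)
  ultimately have "measure \<mu> (A - N0) = 0" using \<open>s <= measure \<mu> N0\<close> measure_nonneg[of \<mu> "A - N0"] by linarith
  then show ?thesis by (simp add: emeasure_eq_measure)
 qed
 define C where "C = {x. measure \<mu> {x} ~= 0}"
 have C: "countable C" unfolding C_def by (rule countable_support)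
 have bC: "C \<in> sets borel" by (rule sets.countable) (use C in auto)
 define ac where "ac = density \<mu> (indicator (- N0))"
 define sc where "sc = density \<mu> (indicator (N0 - C))"
 define pp where "pp = density \<mu> (indicator (N0 \<inter> C))"
 have e: "emeasure (density \<mu> (indicator B)) A = emeasure \<mu> (A \<inter> B)"
  if "A \<in> sets borel" "B \<in> sets borel" for A B
 proof -
  have "emeasure (density \<mu> (indicator B)) A = (\<integral>\<^sup>+ x. indicator B x * indicator A x \<partial>\<mu>)"
   using that \<mu> by (intro emeasure_density) auto
  also have "... = (\<integral>\<^sup>+ x. indicator (A \<inter> B) x \<partial>\<mu>)" by (intro nn_integral_cong) (auto simp: indicator_def)
  also have "... = emeasure \<mu> (A \<inter> B)" using that \<mu> by (intro nn_integral_indicator) auto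
  finally show ?thesis .
 qed
 have dec: "lebesgue_decomposition \<mu> ac sc pp" unfolding lebesgue_decomposition_def
 proof (intro conjI ballI allI)
  show "sets ac = sets borel" "sets sc = sets borel" "sets pp = sets borel" using \<mu> by (simp_all add: ac_def sc_def pp_def)
  show "emeasure \<mu> A = emeasure ac A + emeasure sc A + emeasure pp A" if A: "A \<in> sets borel" for A
  proof -
   have "emeasure ac A + emeasure sc A + emeasure pp A
     = emeasure \<mu> (A \<inter> - N0) + (emeasure \<mu> (A \<inter> (N0 - C)) + emeasure \<mu> (A \<inter> (N0 \<inter> C)))"
    using A bN bC by (simp add: ac_def sc_def pp_def e add.assoc)
   also have "emeasure \<mu> (A \<inter> (N0 - C)) + emeasure \<mu> (A \<inter> (N0 \<inter> C)) = emeasure \<mu> (A \<inter> N0)"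
    using A bN bC \<mu> by (subst plus_emeasure) (auto intro!: arg_cong[where f = "emeasure \<mu>"])
   also have "emeasure \<mu> (A \<inter> - N0) + emeasure \<mu> (A \<inter> N0) = emeasure \<mu> A"
    using A bN \<mu> by (subst plus_emeasure) (auto intro!: arg_cong[where f = "emeasure \<mu>"])
   finally show ?thesis by simp
  qed
  show "absolutely_continuous lborel ac" unfolding absolutely_continuous_def
  proof
   fix A :: "real set" assume A: "A \<in> null_sets lborel"
   then have "A \<in> sets borel" by (auto simp: null_sets_def)
   then show "A \<in> null_sets ac" using null[OF A] bN \<mu> by (intro null_setsI) (auto simp: ac_def e Diff_eq)
  qed
  show "\<exists>N\<in>null_sets lborel. emeasure sc (- N) = 0"
  proof (intro bexI[OF _ N0])
   have "- N0 \<inter> (N0 - C) = {}" by auto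
   then show "emeasure sc (- N0) = 0" using bN bC by (simp add: sc_def e)
  qed
  show "emeasure sc {x} = 0" for x
  proof -
   have "emeasure sc {x} = emeasure \<mu> ({x} \<inter> (N0 - C))" unfolding sc_def using bN bC by (intro e) auto
   also have "... = 0"
   proof (cases "x \<in> C")
    case False
    have "emeasure \<mu> ({x} \<inter> (N0 - C)) <= emeasure \<mu> {x}" using \<mu> by (intro emeasure_mono) auto
    also have "... = 0" using False by (simp add: C_def emeasure_eq_measure)
    finally show ?thesis by simp
   next
    case True
    then have "{x} \<inter> (N0 - C) = {}" by auto
    then show ?thesis by simp
   qed
   finally show ?thesis .
  qed
  show "EX C. countable C & emeasure pp (- C) = 0"
  proof (intro exI conjI)
   have "- C \<inter> (N0 \<inter> C) = {}" by auto
   then show "emeasure pp (- C) = 0" using bN bC by (simp add: pp_def e)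
  qed (rule C)
 qed
 have "emeasure \<mu> (- N0) = 0"
 proof (rule ccontr)
  assume "emeasure \<mu> (- N0) ~= 0"
  then have "emeasure ac UNIV ~= 0" using bN by (simp add: ac_def e)
  then show False using no dec by (auto simp: has_ac_part_def)
 qed
 then show ?thesis using N0 by (auto simp: singular_measure_def)
qed

text \<open>Singularity as a countable conjunction of strict inequalities for integrals of
  continuous functions, the form in which weak continuity of the measure makes it a countable
  intersection of open conditions. The bounds \<open>(1/2) ^ n\<close> are summable for the
  Borel-Cantelli lemma.\<close>

lemma singular_measure_iff:
 assumes \<mu>: "finite_measure \<mu>" "sets \<mu> = sets borel"
 shows "singular_measure \<mu> \<longleftrightarrow> (ALL n. EX f. (ALL x. isCont f x) & (ALL x. 0 <= f x & f x <= 1) & integrable lborel f \<and>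
   (LINT x|lborel. f x) < (1/2) ^ n & measure \<mu> UNIV - (1/2) ^ n < (LINT x|\<mu>. f x))"
  (is "_ \<longleftrightarrow> (ALL n. EX f. ?P n f)")
proof -
 interpret finite_measure \<mu> by fact
 have sp: "space \<mu> = UNIV" using sets_borel_space[OF \<mu>(2)] .
 have meas: "g \<in> borel_measurable \<mu>" if "!!x. isCont g x" for g :: "real => real"
 proof -
  have "g \<in> borel_measurable borel" using that by (intro borel_measurable_continuous_onI continuous_at_imp_continuous_on) auto
  then show ?thesis using \<mu> by (simp cong: measurable_cong_sets)
 qed
 show ?thesis
 proof
  assume "singular_measure \<mu>"
  then obtain N where N: "N \<in> null_sets lborel" "emeasure \<mu> (- N) = 0" by (auto simp: singular_measure_def)
  have bN: "N \<in> sets borel" using N by (auto simp: null_sets_def)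
  show "ALL n. EX f. ?P n f"
  proof
   fix n
   obtain U where U: "open U" "N \<subseteq> U" "emeasure lborel (U - N) < ennreal ((1/2) ^ n)"
    using outer_regular_lborel[OF bN, of "(1/2) ^ n"] by auto
   have bU: "U \<in> sets borel" using U by auto
   have eU: "emeasure lborel U < ennreal ((1/2) ^ n)" using U N emeasure_Diff_null_set[of N lborel U] bU by simp
   \<comment> \<open>\<open>infdist\<close> from the empty set is 0 by convention, so for
     \<open>U = UNIV\<close> the functions \<open>f k\<close> below would all vanish.\<close>
   have "- U ~= {}"
   proof
    assume "- U = {}"
    then have "U = UNIV" by auto
    then show False using eU by simp
   qed
   have mU: "measure \<mu> U = measure \<mu> UNIV"
   proof -
    have "emeasure \<mu> (- U) <= emeasure \<mu> (- N)" using U bN \<mu> by (intro emeasure_mono) auto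
    then have "emeasure \<mu> (- U) = 0" using N by simp
    then have z: "measure \<mu> (- U) = 0" by (simp add: measure_def)
    have "measure \<mu> (U \<union> - U) = measure \<mu> U + measure \<mu> (- U)" using bU \<mu> by (intro finite_measure_Union) auto
    then show ?thesis using z by simp
   qed
   \<comment> \<open>Continuous functions that increase to the indicator of the open set
     \<open>U\<close>.\<close>
   define f where "f k x = min 1 (real k * infdist x (- U))" for k x
   have f01: "0 <= f k x" "f k x <= 1" for k x by (auto simp: f_def infdist_nonneg)
   have fU: "f k x <= indicator U x" for k x
    using f01[of k x] by (cases "x \<in> U") (auto simp: f_def)
   have fc: "isCont (f k) x" for k x
   proof -
    have "continuous_on UNIV (f k)" unfolding f_def by (intro continuous_intros)
    then show ?thesis by (simp add: continuous_on_eq_continuous_at)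
   qed
   have fb [measurable]: "f k \<in> borel_measurable borel" for k
    using fc by (intro borel_measurable_continuous_onI continuous_at_imp_continuous_on) auto
   have iU: "integrable lborel (indicator U :: real => real)"
    using bU eU by (intro integrable_real_indicator) (auto simp: less_top[symmetric] dest: less_trans)
   have fi: "integrable lborel (f k)" for k
    by (rule lintegrable_bound[OF iU]) (use fU f01 in auto)
   have lt: "(LINT x|lborel. f k x) < (1/2) ^ n" for k
   proof -
    have "(LINT x|lborel. f k x) <= (LINT x|lborel. indicator U x)" by (rule integral_mono[OF fi iU]) (rule fU)
    also have "... = measure lborel U" by simp
    also have "... < (1/2) ^ n"
    proof -
     have "emeasure lborel U = ennreal (measure lborel U)" using eU by (intro emeasure_eq_ennreal_measure) auto
     then show ?thesis using eU by (simp add: ennreal_less_iff)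
    qed
    finally show ?thesis .
   qed
   have "(%k. LINT x|\<mu>. f k x) ----> (LINT x|\<mu>. indicator U x)"
   proof (rule integral_dominated_convergence[where w = "%_. 1"])
    show "AE x in \<mu>. (%k. f k x) ----> indicator U x"
    proof (rule AE_I2)
     fix x
     show "(%k. f k x) ----> indicator U x"
     proof (cases "x \<in> U")
      case True
      have "infdist x (- U) > 0" using U(1) True \<open>- U ~= {}\<close> by (intro infdist_pos_not_in_closed) (simp_all add: closed_Compl)
      then obtain K :: nat where K: "real K * infdist x (- U) > 1" using reals_Archimedean3 by blast
      have "f k x = 1" if "k >= K" for k
      proof -
       have "1 < real K * infdist x (- U)" by (rule K)
       also have "... <= real k * infdist x (- U)" using that by (intro mult_right_mono infdist_nonneg) auto
       finally show ?thesis by (simp add: f_def)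
      qed
      then show ?thesis using True
       by (intro tendsto_eventually) (auto simp: eventually_sequentially)
     next
      case False
      then have "f k x = 0" for k by (simp add: f_def)
      then show ?thesis using False by simp
     qed
    qed
    show "AE x in \<mu>. norm (f k x) <= 1" for k using f01 by (intro AE_I2) auto
    show "f k \<in> borel_measurable \<mu>" for k by (rule meas[OF fc])
    show "(indicator U :: real => real) \<in> borel_measurable \<mu>" using bU \<mu> by simp
   qed auto
   also have "(LINT x|\<mu>. indicator U x) = measure \<mu> UNIV" using mU sp by simp
   finally have "\<forall>\<^sub>F k in sequentially. (LINT x|\<mu>. f k x) > measure \<mu> UNIV - (1/2) ^ n" by (rule order_tendstoD) simp
   then obtain k where "(LINT x|\<mu>. f k x) > measure \<mu> UNIV - (1/2) ^ n" by (auto simp: eventually_sequentially)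
   then show "EX f. ?P n f" using fc f01 fi lt by (intro exI[of _ "f k"]) auto
  qed
 next
  assume "ALL n. EX f. ?P n f"
  then obtain f where f: "!!n. ?P n (f n)" using choice[of ?P] by blast
  \<comment> \<open>By Markov's inequality the sets \<open>E n\<close> have summable Lebesgue
    measure and the sets \<open>A n\<close> summable \<open>\<mu>\<close>-measure. So
    \<open>limsup E\<close> is a Lebesgue null set. Almost every point for \<open>\<mu>\<close>
    eventually leaves the \<open>A n\<close> and, as \<open>E n\<close> and \<open>A n\<close> cover
    the line, lies in \<open>limsup E\<close>.\<close>
  define E where "E n = {x. f n x >= 1/2}" for n
  define A where "A n = {x. 1 - f n x >= 1/2}" for n
  have fb [measurable]: "f n \<in> borel_measurable borel" for n
   using f by (intro borel_measurable_continuous_onI continuous_at_imp_continuous_on) auto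
  have bE [measurable]: "E n \<in> sets borel" "A n \<in> sets borel" for n unfolding E_def A_def by measurable
  have fi: "integrable \<mu> (f n)" for n
   using f by (intro integrable_const_bound[of _ 1] meas) auto
  have lE: "emeasure lborel (E n) <= ennreal (2 * (1/2) ^ n)" for n
  proof -
   have "emeasure lborel {x \<in> space lborel. f n x >= 1/2} <= ennreal (1 / (1/2) * (LINT x|lborel. f n x))"
    by (rule integral_Markov_inequality) (use f in auto)
   also have "... <= ennreal (2 * (1/2) ^ n)" using f[of n] by (intro ennreal_leI) auto
   finally show ?thesis by (simp add: E_def)
  qed
  have lA: "emeasure \<mu> (A n) <= ennreal (2 * (1/2) ^ n)" for n
  proof -
   have "emeasure \<mu> {x \<in> space \<mu>. 1 - f n x >= 1/2} <= ennreal (1 / (1/2) * (LINT x|\<mu>. 1 - f n x))"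
    by (rule integral_Markov_inequality) (use f fi in auto)
   also have "(LINT x|\<mu>. 1 - f n x) = measure \<mu> UNIV - (LINT x|\<mu>. f n x)" using fi by (subst lint_diff) (auto simp: sp)
   also have "ennreal (1 / (1/2) * (measure \<mu> UNIV - (LINT x|\<mu>. f n x))) <= ennreal (2 * (1/2) ^ n)" using f[of n] by (intro ennreal_leI) auto
   finally show ?thesis by (simp add: A_def sp)
  qed
  have sm: "summable (%n. 2 * (1/2) ^ n :: real)" by (intro summable_mult summable_geometric) simp
  have sum_m: "summable (%n. measure K (X n))" if "!!n. emeasure K (X n) <= ennreal (2 * (1/2) ^ n)" for K :: "real measure" and X
  proof (rule summable_comparison_test'[OF sm])
   fix n
   have "measure K (X n) <= 2 * (1/2) ^ n" unfolding measure_def by (rule enn2real_leI) (use that in auto)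
   then show "norm (measure K (X n)) <= 2 * (1/2) ^ n" by simp
  qed
  have N: "limsup E \<in> null_sets lborel"
  proof (rule borel_cantelli_limsup1)
   show "emeasure lborel (E n) < \<infinity>" for n using lE[of n] by (rule le_less_trans) simp
   show "summable (%n. measure lborel (E n))" by (rule sum_m[OF lE])
  qed (simp add: bE)
  have "AE x in \<mu>. eventually (%n. x \<in> space \<mu> - A n) sequentially"
  proof (rule borel_cantelli_AE1)
   show "emeasure \<mu> (A n) < \<infinity>" for n using lA[of n] by (rule le_less_trans) simp
   show "summable (%n. measure \<mu> (A n))" by (rule sum_m[OF lA])
  qed (simp add: bE \<mu>)
  then have "AE x in \<mu>. x \<in> limsup E"
  proof eventually_elim
   case (elim x)
   then obtain n0 where n0: "!!n. n >= n0 ==> x \<notin> A n" by (auto simp: eventually_sequentially)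
   have "x \<in> E n" if "n >= n0" for n using n0[OF that] by (auto simp: A_def E_def)
   then have "x \<in> (\<Union>m\<in>{k..}. E m)" for k by (intro UN_I[of "max n0 k"]) auto
   then show ?case unfolding limsup_INF_SUP by blast
  qed
  moreover have "- limsup E \<in> sets \<mu>" using null_setsD2[OF N] \<mu>(2) by simp
  ultimately have "emeasure \<mu> (- limsup E) = 0" by (subst (asm) AE_iff_measurable[of "- limsup E"]) (auto simp: sp)
  then show "singular_measure \<mu>" using N by (auto simp: singular_measure_def)
 qed
qed

section \<open>Generic singular continuous spectrum\<close>

lemma completely_metrizable_compact:
 fixes \<Omega> :: "'b::metric_space set"
 assumes "compact \<Omega>" shows "completely_metrizable_space (top_of_set \<Omega>)"
proof (rule locally_compact_imp_completely_metrizable_space)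
 show "metrizable_space (top_of_set \<Omega>)" by (simp add: metrizable_space_subtopology metrizable_space_euclidean)
 have "compact_space (top_of_set \<Omega>)" using assms by (simp add: compact_space_subtopology)
 then show "locally_compact_space (top_of_set \<Omega>)" by (rule compact_imp_locally_compact_space)
qed

text \<open>Baire's theorem for two countable families of open sets taken together: each member is
  dense because it contains one of the two dense intersections.\<close>

lemma dense_gdelta_Int:
 fixes \<Omega> :: "'b::metric_space set"
 assumes \<Omega>: "compact \<Omega>" and G: "dense_gdelta_in (top_of_set \<Omega>) G" and H: "dense_gdelta_in (top_of_set \<Omega>) H"
 shows "dense_gdelta_in (top_of_set \<Omega>) (G \<inter> H)"
proof -
 let ?X = "top_of_set \<Omega>"
 have "completely_metrizable_space ?X" using \<Omega> by (rule completely_metrizable_compact)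
 have ex: "\<exists>\<U>. countable \<U> & (\<forall>T\<in>\<U>. openin ?X T & ?X closure_of T = topspace ?X) & \<Inter>\<U> \<inter> \<Omega> = K"
  if K: "dense_gdelta_in ?X K" for K
 proof -
  have g: "gdelta_in ?X K" and d: "?X closure_of K = topspace ?X" using K by (auto simp: dense_gdelta_in_def)
  obtain C :: "nat => 'b set" where C: "!!n. openin ?X (C n)" "\<Inter> (range C) = K" using g unfolding gdelta_in_descending by blast
  have "?X closure_of C n = topspace ?X" for n
  proof -
   have "?X closure_of K \<subseteq> ?X closure_of C n" using C(2) by (intro closure_of_mono) auto
   then show ?thesis using d closure_of_subset_topspace[of ?X "C n"] by blast
  qed
  moreover have "K \<subseteq> \<Omega>" using gdelta_in_subset[OF g] by simp
  ultimately show ?thesis using C by (intro exI[of _ "range C"]) auto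
 qed
 obtain \<U> \<V> where U: "countable \<U>" "\<forall>T\<in>\<U>. openin ?X T & ?X closure_of T = topspace ?X" "\<Inter>\<U> \<inter> \<Omega> = G"
  and V: "countable \<V>" "\<forall>T\<in>\<V>. openin ?X T & ?X closure_of T = topspace ?X" "\<Inter>\<V> \<inter> \<Omega> = H"
  using ex[OF G] ex[OF H] by metis
 have "?X closure_of \<Inter>(\<U> \<union> \<V>) = topspace ?X"
  by (rule Baire_category) (use U V \<open>completely_metrizable_space ?X\<close> in auto)
 moreover have "?X closure_of \<Inter>(\<U> \<union> \<V>) = ?X closure_of (topspace ?X \<inter> \<Inter>(\<U> \<union> \<V>))"
  by (rule closure_of_restrict)
 moreover have "topspace ?X \<inter> \<Inter>(\<U> \<union> \<V>) = G \<inter> H" using U V by auto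
 ultimately have "?X closure_of (G \<inter> H) = topspace ?X" by simp
 then show ?thesis using G H by (auto simp: dense_gdelta_in_def intro: gdelta_in_Int)
qed

lemma gdelta_dense_superset:
 fixes \<Omega> :: "'b::metric_space set"
 assumes "gdelta_in (top_of_set \<Omega>) G" "\<Omega>0 \<subseteq> G" "\<Omega> \<subseteq> closure \<Omega>0"
 shows "dense_gdelta_in (top_of_set \<Omega>) G"
proof -
 have "G \<subseteq> \<Omega>" using gdelta_in_subset[OF assms(1)] by simp
 have "top_of_set \<Omega> closure_of G = \<Omega> \<inter> closure (\<Omega> \<inter> G)" by (simp add: closure_of_subtopology)
 also have "\<Omega> \<inter> G = G" using \<open>G \<subseteq> \<Omega>\<close> by auto
 also have "\<Omega> \<inter> closure G = \<Omega>" using closure_mono[OF assms(2)] assms(3) by auto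
 finally show ?thesis using assms(1) by (simp add: dense_gdelta_in_def)
qed

text \<open>Totality is phrased through closed complex subspaces instead of spans. It is applied to
  the singular vectors, to an orthogonal complement, to the range of an operator and to the closure
  of a domain.\<close>

definition total_set :: "'a::l2_space l2 set => bool" where
 "total_set T \<longleftrightarrow> (ALL S. closed S & 0 \<in> S & (\<forall>v\<in>S. \<forall>w\<in>S. v + w \<in> S) & (ALL c. \<forall>v\<in>S. c *C v \<in> S) & T \<subseteq> S --> S = UNIV)"

lemma (in unitary_on_l2) singular_vectors_iff: "v \<in> singular_vectors \<longleftrightarrow> singular_measure (spec v)"
 by (simp add: singular_vectors_def singular_measure_def)

lemma (in unitary_on_l2) zero_singular_vectors: "0 \<in> singular_vectors"
proof -
 have "emeasure (spec 0) (- {}) = 0" using emeasure_spec_UNIV[of 0] by simp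
 then show ?thesis unfolding singular_vectors_def by blast
qed

text \<open>On the domain of the limit generator this is \<open>isometry_group_diff_bound\<close>
  with \<open>\<delta>\<close> the distance of the parameters; density does the rest.\<close>

lemma group_continuous_parameter:
 fixes D :: "'b::metric_space => 'a::l2_space operator"
 assumes sl: "!!\<omega>. \<omega> \<in> \<Omega> ==> schroedinger_like (D \<omega>)"
  and dom: "!!\<omega> \<omega>' v w. \<omega> \<in> \<Omega> ==> \<omega>' \<in> \<Omega> ==> (v, w) \<in> lift_graph (D \<omega>) ==>
    EX w'. (v, w') \<in> lift_graph (D \<omega>') & norm (w - w') <= dist \<omega> \<omega>' * norm v"
  and X: "!!n::nat. X n \<in> \<Omega>" and \<omega>: "\<omega> \<in> \<Omega>" and lim: "X ----> \<omega>"
 shows "(%n. skew_operator.group (lift_graph (D (X n))) s v) ----> skew_operator.group (lift_graph (D \<omega>)) s v"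
proof -
 interpret W: schroedinger_like "D \<omega>" by (rule sl[OF \<omega>])
 define U where "U n = skew_operator.group (lift_graph (D (X n)))" for n
 have Ug: "isometry_group (U n)" "generator (U n) = lift_graph (D (X n))" for n
 proof -
  interpret Y: schroedinger_like "D (X n)" by (rule sl[OF X])
  show "isometry_group (U n)" "generator (U n) = lift_graph (D (X n))" unfolding U_def by (rule Y.isometry_group_group, rule Y.generator_group)
 qed
 have single: "g = g'" if "(f, g) \<in> lift_graph (D (X n))" "(f, g') \<in> lift_graph (D (X n))" for n f g g'
 proof -
  interpret Y: schroedinger_like "D (X n)" by (rule sl[OF X])
  show ?thesis using Y.graph_single that by blast
 qed
 have "(%n. U n s v - W.group s v) ----> 0"
 proof (rule tendsto_zero_dense[where T = "%n v. U n s v - W.group s v" and B = 2, OF _ _ W.dense])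
  show "linear (%v. U n s v - W.group s v)" for n
   by (intro linear_compose_sub isometry_groupD(1) Ug W.isometry_group)
  show "norm (U n s x - W.group s x) <= 2 * norm x" for n x
   using norm_triangle_ineq4[of "U n s x" "W.group s x"] isometry_groupD(2)[OF Ug(1)] by (simp add: W.norm_group)
  fix f assume "f \<in> fst ` lift_graph (D \<omega>)"
  then obtain g where fg: "(f, g) \<in> lift_graph (D \<omega>)" by auto
  have bd: "(norm (U n s f - W.group s f))\<^sup>2 <= 4 * dist (X n) \<omega> * \<bar>s\<bar> * (norm f)\<^sup>2" for n
  proof (rule isometry_group_diff_bound[OF Ug(1) W.isometry_group_group])
   show "(f, g) \<in> generator W.group" using fg by (simp only: W.generator_group)
   show "EX g'. (f, g') \<in> generator (U n)" if "(f, g) \<in> generator W.group" for f g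
   proof -
    have "EX w'. (f, w') \<in> lift_graph (D (X n)) & norm (g - w') <= dist \<omega> (X n) * norm f"
     using that unfolding W.generator_group by (rule dom[OF \<omega> X])
    then show ?thesis unfolding Ug(2) by blast
   qed
   show "norm (g - g') <= dist (X n) \<omega> * norm f" if fg: "(f, g) \<in> generator W.group" "(f, g') \<in> generator (U n)" for f g g'
   proof -
    have "EX w'. (f, w') \<in> lift_graph (D (X n)) & norm (g - w') <= dist \<omega> (X n) * norm f"
     using fg(1) unfolding W.generator_group by (rule dom[OF \<omega> X])
    then obtain w' where w': "(f, w') \<in> lift_graph (D (X n))" "norm (g - w') <= dist \<omega> (X n) * norm f" by blast
    have "w' = g'" using w'(1) fg(2) unfolding Ug(2) by (rule single)
    then show ?thesis using w'(2) by (simp add: dist_commute)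
   qed
  qed
  have "(%n. 4 * dist (X n) \<omega> * \<bar>s\<bar> * (norm f)\<^sup>2) ----> 4 * dist \<omega> \<omega> * \<bar>s\<bar> * (norm f)\<^sup>2"
   by (intro tendsto_intros lim)
  then have "(%n. 4 * dist (X n) \<omega> * \<bar>s\<bar> * (norm f)\<^sup>2) ----> 0" by simp
  then have "(%n. (norm (U n s f - W.group s f))\<^sup>2) ----> 0" by (rule Lim_null_comparison[rotated]) (use bd in auto)
  then have "(%n. sqrt ((norm (U n s f - W.group s f))\<^sup>2)) ----> sqrt 0" by (intro tendsto_real_sqrt)
  then have "(%n. norm (U n s f - W.group s f)) ----> 0" by simp
  then show "(%n. U n s f - W.group s f) ----> 0" by (rule tendsto_norm_zero_cancel)
 qed
 then show ?thesis unfolding U_def by (simp add: LIM_zero_iff)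
qed

theorem generic_singular_continuous:
 fixes D :: "'b::metric_space => 'a::l2_space operator"
 assumes \<Omega>: "compact \<Omega>"
  and sl: "!!\<omega>. \<omega> \<in> \<Omega> ==> schroedinger_like (D \<omega>)"
  and dom: "!!\<omega> \<omega>' v w. \<omega> \<in> \<Omega> ==> \<omega>' \<in> \<Omega> ==> (v, w) \<in> lift_graph (D \<omega>) ==>
    EX w'. (v, w') \<in> lift_graph (D \<omega>') & norm (w - w') <= dist \<omega> \<omega>' * norm v"
  and T: "countable T" "total_set (T :: 'a l2 set)"
  and G0: "dense_gdelta_in (top_of_set \<Omega>) G0" "!!\<omega>. \<omega> \<in> G0 ==> no_point_spectrum vol (D \<omega>)"
  and \<Omega>0: "\<Omega>0 \<subseteq> \<Omega>" "\<Omega> \<subseteq> closure \<Omega>0" "!!\<omega>. \<omega> \<in> \<Omega>0 ==> no_ac_spectrum vol (D \<omega>)"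
 shows "EX G. dense_gdelta_in (top_of_set \<Omega>) G & (\<forall>\<omega>\<in>G. purely_sc_spectrum vol (D \<omega>))"
proof -
 define \<mu> where "\<mu> \<omega> v = unitary_on_l2.spec (skew_operator.group (lift_graph (D \<omega>))) v" for \<omega> v
 have uni: "unitary_on_l2 (skew_operator.group (lift_graph (D \<omega>)))" if "\<omega> \<in> \<Omega>" for \<omega>
 proof -
  interpret W: schroedinger_like "D \<omega>" by (rule sl[OF that])
  show ?thesis by (rule W.unitary_on_l2_axioms)
 qed
 note spec_facts = unitary_on_l2.spec[OF uni, folded \<mu>_def]
 have mass: "measure (\<mu> \<omega> v) UNIV = (norm v)\<^sup>2" if "\<omega> \<in> \<Omega>" for \<omega> v
  unfolding \<mu>_def by (rule unitary_on_l2.measure_spec_UNIV[OF uni[OF that]])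
 define S where "S v = {\<omega>\<in>\<Omega>. singular_measure (\<mu> \<omega> v)}" for v
 have gS: "gdelta_in (top_of_set \<Omega>) (S v)" for v
 proof -
  define F where "F n = {f :: real => real. (ALL x. isCont f x) & (ALL x. 0 <= f x & f x <= 1) & integrable lborel f \<and>
    (LINT x|lborel. f x) < (1/2) ^ n}" for n :: nat
  \<comment> \<open>The existential over \<open>f\<close> becomes a union. For fixed
    \<open>f\<close> the integral is continuous in \<open>\<omega>\<close>, so every member of the
    union is relatively open.\<close>
  define W where "W n = (\<Union>f\<in>F n. \<Omega> \<inter> (%\<omega>. LINT x|\<mu> \<omega> v. f x) -` {(norm v)\<^sup>2 - (1/2) ^ n <..})" for n
  have "openin (top_of_set \<Omega>) (W n)" for n
   unfolding W_def
  proof (intro openin_Union ballI, clarify)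
   fix f assume f: "f \<in> F n"
   have "continuous_on \<Omega> (%\<omega>. LINT x|\<mu> \<omega> v. f x)" unfolding continuous_on_sequentially
   proof (intro allI ballI impI, elim conjE)
    fix X \<omega> assume X: "\<omega> \<in> \<Omega>" "ALL n. X n \<in> \<Omega>" "X ----> \<omega>"
    have "(%n. LINT x|\<mu> (X n) v. f x) ----> (LINT x|\<mu> \<omega> v. f x)" unfolding \<mu>_def
    proof (rule spec_integral_tendsto[where B = 1])
     show "(%n. skew_operator.group (lift_graph (D (X n))) s v) ----> skew_operator.group (lift_graph (D \<omega>)) s v" for s
      by (rule group_continuous_parameter[OF sl dom]) (use X in auto)
    qed (use X uni f in "auto simp: F_def abs_le_iff intro: order_trans[of _ 0]")
    then show "((%\<omega>. LINT x|\<mu> \<omega> v. f x) \<circ> X) ----> (LINT x|\<mu> \<omega> v. f x)" by (simp add: comp_def)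
   qed
   then show "openin (top_of_set \<Omega>) (\<Omega> \<inter> (%\<omega>. LINT x|\<mu> \<omega> v. f x) -` {(norm v)\<^sup>2 - (1/2) ^ n <..})"
    by (rule continuous_openin_preimage_gen) simp
  qed
  moreover have "S v = \<Inter>(range W)"
  proof (rule set_eqI)
   fix \<omega>
   show "\<omega> \<in> S v \<longleftrightarrow> \<omega> \<in> \<Inter>(range W)"
   proof (cases "\<omega> \<in> \<Omega>")
    case True
    then show ?thesis
     unfolding S_def W_def F_def using singular_measure_iff[OF spec_facts(1,2)[OF True], of v] by (simp add: mass[OF True] conj_ac)
   qed (auto simp: S_def W_def)
  qed
  ultimately show ?thesis
   by (simp only:) (rule gdelta_in_Inter, auto intro: open_imp_gdelta_in)
 qed
 \<comment> \<open>The added 0 guarantees that the intersection is not over an empty index set, so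
   \<open>H\<close> is a subset of \<open>\<Omega>\<close> also when \<open>T\<close> is
   empty.\<close>
 define H where "H = (\<Inter>v\<in>insert 0 T. S v)"
 have gH: "gdelta_in (top_of_set \<Omega>) H" unfolding H_def using T gS by (intro gdelta_in_Inter) auto
 have "\<Omega>0 \<subseteq> H"
 proof
  fix \<omega> assume \<omega>: "\<omega> \<in> \<Omega>0"
  then have "\<omega> \<in> \<Omega>" using \<Omega>0 by auto
  interpret W: schroedinger_like "D \<omega>" by (rule sl[OF \<open>\<omega> \<in> \<Omega>\<close>])
  have "singular_measure (\<mu> \<omega> v)" for v
  proof (rule no_ac_part_singular)
   show "finite_measure (\<mu> \<omega> v)" "sets (\<mu> \<omega> v) = sets borel" by (rule spec_facts[OF \<open>\<omega> \<in> \<Omega>\<close>])+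
   have "spectral_measure vol (D \<omega>) (rep_l2 v) = \<mu> \<omega> v" using W.spectral_measure_eq[OF rep_L2[of v]] by (simp add: \<mu>_def)
   then show "~ has_ac_part (\<mu> \<omega> v)" using \<Omega>0(3)[OF \<omega>] rep_L2[of v] unfolding no_ac_spectrum_def by metis
  qed
  then show "\<omega> \<in> H" using \<open>\<omega> \<in> \<Omega>\<close> by (auto simp: H_def S_def)
 qed
 then have dH: "dense_gdelta_in (top_of_set \<Omega>) H" by (rule gdelta_dense_superset[OF gH _ \<Omega>0(2)])
 have "purely_sc_spectrum vol (D \<omega>)" if \<omega>: "\<omega> \<in> G0 \<inter> H" for \<omega>
 proof -
  have "\<omega> \<in> \<Omega>" using \<omega> by (auto simp: H_def S_def)
  interpret W: schroedinger_like "D \<omega>" by (rule sl[OF \<open>\<omega> \<in> \<Omega>\<close>])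
  have "T \<subseteq> W.singular_vectors" using \<omega> by (auto simp: H_def S_def \<mu>_def W.singular_vectors_iff)
  then have all: "W.singular_vectors = UNIV" using T(2)[unfolded total_set_def, rule_format, of W.singular_vectors] W.closed_singular_vectors
    W.zero_singular_vectors W.singular_vectors_add W.singular_vectors_scaleC by blast
  show ?thesis
   unfolding purely_sc_spectrum_def
  proof (intro ballI conjI)
   fix \<psi> :: "'a => complex" assume \<psi>: "\<psi> \<in> L2 vol"
   have eq: "spectral_measure vol (D \<omega>) \<psi> = W.spec (abs_l2 \<psi>)" by (rule W.spectral_measure_eq[OF \<psi>])
   have "singular_measure (W.spec (abs_l2 \<psi>))" using all W.singular_vectors_iff by blast
   then show "~ has_ac_part (spectral_measure vol (D \<omega>) \<psi>)" unfolding eq by (rule singular_no_ac_part)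
   interpret finite_measure "W.spec (abs_l2 \<psi>)" by (rule W.spec)
   have "measure (W.spec (abs_l2 \<psi>)) {x} = 0" for x by (rule W.no_atoms) (use G0 \<omega> in auto)
   then show "~ has_pp_part (spectral_measure vol (D \<omega>) \<psi>)" unfolding eq by (intro no_atoms_no_pp_part) (simp add: emeasure_eq_measure)
  qed
 qed
 then show ?thesis using dense_gdelta_Int[OF \<Omega> G0(1) dH] by blast
qed

text \<open>Simple functions approximate in L^2, and by Markov's inequality their level sets at
  nonzero values have finite measure.\<close>

lemma total_set_finite_indicators:
 fixes S :: "'a::l2_space l2 set"
 assumes S: "closed S" "0 \<in> S" "!!v w. v \<in> S ==> w \<in> S ==> v + w \<in> S" "!!c v. v \<in> S ==> c *C v \<in> S"
  and ind: "!!A. A \<in> sets vol ==> emeasure vol A < \<infinity> ==> abs_l2 (indicator A) \<in> S"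
 shows "S = UNIV"
proof -
 let ?M = "vol :: 'a measure"
 have sumS: "(\<Sum>i\<in>I. f i) \<in> S" if "!!i. i \<in> I ==> f i \<in> S" for I :: "complex set" and f
  using that by (induction I rule: infinite_finite_induct) (auto intro: S)
 have "v \<in> S" for v
 proof -
  obtain f where f: "f \<in> L2 ?M" "v = abs_l2 f" by (rule l2_cases)
  have [measurable]: "f \<in> borel_measurable ?M" using f by (simp add: L2_def)
  obtain F where F: "!!i. simple_function ?M (F i)" "!!x. x \<in> space ?M ==> (%i. F i x) ----> f x"
   "!!i x. x \<in> space ?M ==> norm (F i x) <= 2 * norm (f x)"
  proof -
   obtain F where "(ALL i. simple_function ?M (F i)) & (\<forall>x\<in>space ?M. (%i. F i x) ----> f x) \<and>
     (ALL i. \<forall>x\<in>space ?M. dist (F i x) 0 <= 2 * dist (f x) 0)" using borel_measurable_implies_sequence_metric[of f ?M 0] by auto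
   then show thesis by (intro that[of F]) simp_all
  qed
  have Fm [measurable]: "F i \<in> borel_measurable ?M" for i using F(1) by (rule borel_measurable_simple_function)
  have FL: "F i \<in> L2 ?M" for i
   by (rule L2_bound[OF f(1), where B = 2]) (use F(3) in "auto intro: AE_I2")
  have FS: "abs_l2 (F i) \<in> S" for i
  proof -
   define Y where "Y = F i ` space ?M - {0}"
   have finY: "finite Y" unfolding Y_def using F(1)[of i] by (auto simp: simple_function_def)
   define A where "A y = F i -` {y} \<inter> space ?M" for y
   have mA [measurable]: "A y \<in> sets ?M" for y unfolding A_def by measurable
   have fA: "emeasure ?M (A y) < \<infinity>" if "y \<in> Y" for y
   proof -
    have y: "y ~= 0" using that by (simp add: Y_def)
    have "emeasure ?M (A y) <= emeasure ?M {x \<in> space ?M. (cmod (F i x))\<^sup>2 >= (cmod y)\<^sup>2}" by (rule emeasure_mono) (auto simp: A_def)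
    also have "... <= ennreal (1 / (cmod y)\<^sup>2 * (LINT x|?M. (cmod (F i x))\<^sup>2))"
     by (rule integral_Markov_inequality) (use L2_integrable[OF FL] y in auto)
    also have "... < \<infinity>" by simp
    finally show ?thesis .
   qed
   have AL: "indicator (A y) \<in> L2 ?M" if "y \<in> Y" for y
   proof -
    have "(%x. (cmod (indicator (A y) x))\<^sup>2) = (indicator (A y) :: 'a => real)" by (auto simp: indicator_def fun_eq_iff)
    then show ?thesis unfolding L2_def using fA[OF that] by (auto intro: integrable_real_indicator)
   qed
   have ab: "abs_l2 (%x. \<Sum>y\<in>Z. y * indicator (A y) x) = (\<Sum>y\<in>Z. y *C abs_l2 (indicator (A y)))"
    if "finite Z" "Z \<subseteq> Y" for Z
    using that
   proof (induction Z)
    case (insert y Z)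
    have "(%x. \<Sum>y\<in>Z. y * indicator (A y) x) \<in> L2 ?M" using insert by (intro L2_sum L2_cmult AL) auto
    moreover have "(%x. y * indicator (A y) x) \<in> L2 ?M" using insert by (intro L2_cmult AL) auto
    ultimately have "abs_l2 (%x. y * indicator (A y) x + (\<Sum>y\<in>Z. y * indicator (A y) x))
      = abs_l2 (%x. y * indicator (A y) x) + abs_l2 (%x. \<Sum>y\<in>Z. y * indicator (A y) x)" by (intro abs_l2_add[symmetric])
    also have "abs_l2 (%x. y * indicator (A y) x) = y *C abs_l2 (indicator (A y))" using insert by (intro abs_l2_scaleC[symmetric] AL) auto
    finally show ?case using insert by (simp only: sum.insert insert_subset not_False_eq_True)
   qed (simp add: abs_l2_zero)
   have "abs_l2 (F i) = abs_l2 (%x. \<Sum>y\<in>Y. y * indicator (A y) x)"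
   proof (subst abs_l2_eq_iff[OF FL])
    show "(%x. \<Sum>y\<in>Y. y * indicator (A y) x) \<in> L2 ?M" by (intro L2_sum L2_cmult AL)
    show "AE x in ?M. F i x = (\<Sum>y\<in>Y. y * indicator (A y) x)"
    proof (rule AE_I2)
     fix x assume x: "x \<in> space ?M"
     have "(\<Sum>y\<in>Y. y * indicator (A y) x) = (\<Sum>y\<in>Y. if y = F i x then F i x else 0)"
      using x by (intro sum.cong) (auto simp: A_def indicator_def)
     also have "... = F i x" using finY x by (auto simp: Y_def)
     finally show "F i x = (\<Sum>y\<in>Y. y * indicator (A y) x)" by simp
    qed
   qed
   also have "... = (\<Sum>y\<in>Y. y *C abs_l2 (indicator (A y)))" by (rule ab[OF finY order_refl])
   also have "... \<in> S" by (intro sumS S(4) ind mA fA)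
   finally show ?thesis .
  qed
  have "(%i. LINT x|?M. (cmod (F i x - f x))\<^sup>2) ----> (LINT x|?M. 0)"
  proof (rule integral_dominated_convergence[where w = "%x. 9 * (cmod (f x))\<^sup>2"])
   show "integrable ?M (%x. 9 * (cmod (f x))\<^sup>2)" by (intro integrable_mult_right L2_integrable f)
   show "AE x in ?M. (%i. (cmod (F i x - f x))\<^sup>2) ----> 0"
   proof (rule AE_I2)
    fix x assume "x \<in> space ?M"
    then have "(%i. (cmod (F i x - f x))\<^sup>2) ----> (cmod (f x - f x))\<^sup>2" by (intro tendsto_intros F)
    then show "(%i. (cmod (F i x - f x))\<^sup>2) ----> 0" by simp
   qed
   show "AE x in ?M. norm ((cmod (F i x - f x))\<^sup>2) <= 9 * (cmod (f x))\<^sup>2" for i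
   proof (rule AE_I2)
    fix x assume "x \<in> space ?M"
    then have "cmod (F i x - f x) <= 3 * cmod (f x)" using norm_triangle_ineq4[of "F i x" "f x"] F(3)[of x i] by linarith
    then have "(cmod (F i x - f x))\<^sup>2 <= (3 * cmod (f x))\<^sup>2" by (rule power_mono) simp
    then show "norm ((cmod (F i x - f x))\<^sup>2) <= 9 * (cmod (f x))\<^sup>2" by (simp add: power_mult_distrib)
   qed
  qed auto
  then have "(%i. (norm (abs_l2 (F i) - v))\<^sup>2) ----> 0"
   using norm_abs_l2[OF L2_diff[OF FL f(1)]] abs_l2_diff[OF FL f(1)] f(2) by (simp add: L2_norm_power2)
  then have "(%i. sqrt ((norm (abs_l2 (F i) - v))\<^sup>2)) ----> sqrt 0" by (intro tendsto_real_sqrt)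
  then have "(%i. abs_l2 (F i)) ----> v" by (simp add: tendsto_norm_zero_iff LIM_zero_iff)
  then show "v \<in> S" by (rule closed_sequentially[OF S(1), rotated]) (simp add: FS)
 qed
 then show ?thesis by auto
qed

section \<open>Smooth functions of compact support\<close>

definition smooth :: "(real => real) => bool" where
 "smooth f \<longleftrightarrow> (ALL n x. (deriv ^^ n) f field_differentiable at x)"

lemma smooth_DERIV:
 assumes "smooth f" shows "(f has_real_derivative deriv f x) (at x)"
proof -
 have "(deriv ^^ 0) f field_differentiable at x" using assms unfolding smooth_def by blast
 then show ?thesis by (simp add: field_differentiable_derivI)
qed

lemma smooth_deriv: assumes "smooth f" shows "smooth (deriv f)" unfolding smooth_def
proof (intro allI)
 fix n x
 have "(deriv ^^ Suc n) f field_differentiable at x" using assms unfolding smooth_def by blast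
 then show "(deriv ^^ n) (deriv f) field_differentiable at x" by (simp only: funpow_Suc_right comp_def)
qed

lemma smooth_antiderivative:
 assumes "!!x. (f has_real_derivative g x) (at x)" "smooth g" shows "smooth f" unfolding smooth_def
proof (intro allI)
 fix n x
 have d: "deriv f = g" using assms(1) by (auto intro: DERIV_imp_deriv)
 show "(deriv ^^ n) f field_differentiable at x"
 proof (cases n)
  case 0
  then show ?thesis using assms(1) by (auto simp: field_differentiable_def)
 next
  case (Suc m)
  have "(deriv ^^ n) f = (deriv ^^ m) g" unfolding Suc funpow_Suc_right comp_def d ..
  then show ?thesis using assms(2) unfolding smooth_def by simp
 qed
qed

text \<open>A family closed under differentiation, with \<open>q\<close> the induced map on indices,
  consists of smooth functions. It reduces smoothness to one derivative formula.\<close>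

lemma smooth_family:
 assumes "!!p x. (F p has_real_derivative F (q p) x) (at x)" shows "smooth (F p)"
proof -
 have d: "deriv (F p) = F (q p)" for p using assms by (auto intro: DERIV_imp_deriv)
 have "(deriv ^^ n) (F p) = F ((q ^^ n) p)" for n
  by (induction n) (auto simp: d)
 then show ?thesis unfolding smooth_def using assms by (auto simp: field_differentiable_def)
qed

lemma smooth_affine:
 assumes "smooth f" shows "smooth (%x. f (a * x + b))"
proof -
 have "((%x. a ^ n * (deriv ^^ n) f (a * x + b)) has_real_derivative a ^ Suc n * (deriv ^^ Suc n) f (a * x + b)) (at x)" for n x
 proof -
  have "(deriv ^^ n) f field_differentiable at (a * x + b)" using assms unfolding smooth_def by blast
  then have "((deriv ^^ n) f has_real_derivative (deriv ^^ Suc n) f (a * x + b)) (at (a * x + b))" by (simp add: field_differentiable_derivI)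
  then have "((%x. (deriv ^^ n) f (a * x + b)) has_real_derivative (deriv ^^ Suc n) f (a * x + b) * a) (at x)"
   by (rule DERIV_chain2[where f = "(deriv ^^ n) f" and g = "%x. a * x + b"]) (auto intro!: derivative_eq_intros)
  from DERIV_cmult[OF this, of "a ^ n"] show ?thesis by (simp add: mult_ac)
 qed
 then have "smooth ((%n x. a ^ n * (deriv ^^ n) f (a * x + b)) 0)" by (intro smooth_family[where q = Suc]) auto
 then show ?thesis by simp
qed

lemma smooth_lincomb:
 assumes "smooth f" "smooth g" shows "smooth (%x. a * f x + b * g x)"
proof -
 have d: "((deriv ^^ n) h has_real_derivative (deriv ^^ Suc n) h x) (at x)" if "smooth h" for h n x
  using that unfolding smooth_def by (simp add: field_differentiable_derivI)
 have "((%x. a * (deriv ^^ n) f x + b * (deriv ^^ n) g x) has_real_derivative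
   a * (deriv ^^ Suc n) f x + b * (deriv ^^ Suc n) g x) (at x)" for n x
  by (intro DERIV_add DERIV_cmult d assms)
 then have "smooth ((%n x. a * (deriv ^^ n) f x + b * (deriv ^^ n) g x) 0)" by (intro smooth_family[where q = Suc]) auto
 then show ?thesis by simp
qed

subsection \<open>A smooth step\<close>

definition flat :: "real poly => real => real" where
 "flat p x = (if x <= 0 then 0 else poly p (1 / x) * exp (- (1 / x)))"

text \<open>With t = 1/x one has d/dx = - t^2 d/dt, which sends p(t) exp(-t) to t^2 (p - p')(t)
  exp(-t).\<close>

definition flat_deriv :: "real poly => real poly" where
 "flat_deriv p = [:0, 0, 1:] * (p - pderiv p)"

lemma poly_div_exp_tendsto: "((%t. poly p t * exp (- t)) ---> (0::real)) at_top"
proof -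
 have "((%t. \<Sum>i\<le>degree p. coeff p i * (t ^ i / exp t)) ---> (\<Sum>i\<le>degree p. coeff p i * 0)) at_top"
  by (intro tendsto_sum tendsto_mult tendsto_const tendsto_power_div_exp_0)
 moreover have "(\<Sum>i\<le>degree p. coeff p i * (t ^ i / exp t)) = poly p t * exp (- t)" for t
  by (simp add: poly_altdef sum_distrib_right exp_minus divide_inverse mult.assoc)
 ultimately show ?thesis by simp
qed

lemma DERIV_flat: "(flat p has_real_derivative flat (flat_deriv p) x) (at x)"
proof -
 consider "x < 0" | "x = 0" | "x > 0" by linarith
 then show ?thesis
 proof cases
  case 1
  have "((%x. 0) has_real_derivative 0) (at x)" by simp
  then have "(flat p has_real_derivative 0) (at x)"
   by (rule has_field_derivative_transform_within_open[of _ _ _ "{..<0}"]) (use 1 in "auto simp: flat_def")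
  then show ?thesis using 1 by (simp add: flat_def)
 next
  case 3
  have "((%x. poly p (1 / x) * exp (- (1 / x))) has_real_derivative
    poly (pderiv p) (1 / x) * (- 1 / x\<^sup>2) * exp (- (1 / x)) + poly p (1 / x) * (exp (- (1 / x)) * (1 / x\<^sup>2))) (at x)"
   using 3 by (auto intro!: derivative_eq_intros DERIV_chain2[OF poly_DERIV] simp: power2_eq_square)
  then have "(flat p has_real_derivative
    poly (pderiv p) (1 / x) * (- 1 / x\<^sup>2) * exp (- (1 / x)) + poly p (1 / x) * (exp (- (1 / x)) * (1 / x\<^sup>2))) (at x)"
   by (rule has_field_derivative_transform_within_open[of _ _ _ "{0<..}"]) (use 3 in "auto simp: flat_def")
  moreover have "poly (pderiv p) (1 / x) * (- 1 / x\<^sup>2) * exp (- (1 / x)) + poly p (1 / x) * (exp (- (1 / x)) * (1 / x\<^sup>2))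
    = flat (flat_deriv p) x" using 3 by (simp add: flat_def flat_deriv_def power2_eq_square field_simps)
  ultimately show ?thesis by simp
 next
  case 2
  have "((%h. (flat p (0 + h) - flat p 0) / h) ---> 0) (at 0)"
  proof (rule filterlim_split_at)
   have "\<forall>\<^sub>F h in at_left 0. 0 = (flat p (0 + h) - flat p 0) / h" by (auto simp: eventually_at_filter flat_def)
   then show "((%h. (flat p (0 + h) - flat p 0) / h) ---> 0) (at_left 0)" by (rule Lim_transform_eventually[OF tendsto_const])
   have "((%h. poly ([:0, 1:] * p) (inverse h) * exp (- inverse h)) ---> 0) (at_right (0::real))"
    by (rule filterlim_compose[OF poly_div_exp_tendsto filterlim_inverse_at_top_right])
   moreover have "\<forall>\<^sub>F h in at_right 0. poly ([:0, 1:] * p) (inverse h) * exp (- inverse h) = (flat p (0 + h) - flat p 0) / h"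
    by (auto simp: eventually_at_filter flat_def divide_inverse)
   ultimately show "((%h. (flat p (0 + h) - flat p 0) / h) ---> 0) (at_right 0)" by (rule Lim_transform_eventually)
  qed
  then show ?thesis using 2 by (simp add: DERIV_def flat_def)
 qed
qed

text \<open>Finite sums of products are what the Leibniz rule leaves invariant. The factor supported
  in x < 1 brings the sign of the inner derivative of 1 - x, which reappears as \<open>- c\<close>
  below.\<close>

definition flat_products :: "(real \<times> real poly \<times> real poly) list => real => real" where
 "flat_products ps x = sum_list (map (%(c, p, q). c * flat p x * flat q (1 - x)) ps)"

lemma smooth_flat_products: "smooth (flat_products ps)"
proof (rule smooth_family[where F = flat_products and
   q = "%ps. concat (map (%(c, p, q). [(c, flat_deriv p, q), (- c, p, flat_deriv q)]) ps)"])
 fix ps :: "(real \<times> real poly \<times> real poly) list" and x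
 show "(flat_products ps has_real_derivative
   flat_products (concat (map (%(c, p, q). [(c, flat_deriv p, q), (- c, p, flat_deriv q)]) ps)) x) (at x)"
 proof (induction ps)
  case Nil
  then show ?case by (simp add: flat_products_def[abs_def])
 next
  case (Cons t ps)
  obtain c p q where t: "t = (c, p, q)" by (cases t)
  have "((%x. flat q (1 - x)) has_real_derivative flat (flat_deriv q) (1 - x) * (- 1)) (at x)"
   by (rule DERIV_chain2[OF DERIV_flat]) (auto intro!: derivative_eq_intros)
  then have "((%x. c * flat p x * flat q (1 - x) + flat_products ps x) has_real_derivative
    (c * flat (flat_deriv p) x * flat q (1 - x) + c * flat p x * (flat (flat_deriv q) (1 - x) * (- 1)))
    + flat_products (concat (map (%(c, p, q). [(c, flat_deriv p, q), (- c, p, flat_deriv q)]) ps)) x) (at x)"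
   by (intro DERIV_add Cons DERIV_mult'[THEN DERIV_cong] DERIV_cmult DERIV_flat) (auto intro: DERIV_flat)
  then show ?case by (simp add: t flat_products_def[abs_def] algebra_simps)
 qed
qed

text \<open>The antiderivative of a bump that is positive exactly on the open unit interval,
  normalized to run from 0 to 1.\<close>

lemma ex_smooth_step:
 "EX S. smooth S & (\<forall>x\<le>0. S x = 0) & (\<forall>x\<ge>1. S x = 1) & (ALL x. 0 <= S x & S x <= 1)"
proof -
 define b where "b = flat_products [(1, 1, 1)]"
 have sb: "smooth b" unfolding b_def by (rule smooth_flat_products)
 have b: "b x = flat 1 x * flat 1 (1 - x)" for x by (simp add: b_def flat_products_def)
 have b0: "b x >= 0" for x by (simp add: b flat_def)
 have bout: "b x = 0" if "x <= 0 | x >= 1" for x using that by (auto simp: b flat_def)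
 have bpos: "b x > 0" if "0 < x" "x < 1" for x using that by (simp add: b flat_def)
 have "EX B. \<forall>x::real. - \<infinity> < ereal x --> ereal x < \<infinity> --> (B has_vector_derivative b x) (at x)"
  by (rule einterval_antiderivative) (auto intro: DERIV_isCont[OF smooth_DERIV[OF sb]])
 then obtain B where B: "!!x. (B has_real_derivative b x) (at x)" by (auto simp: has_real_derivative_iff_has_vector_derivative)
 have mono: "B x <= B y" if "x <= y" for x y
  using that by (rule DERIV_nonneg_imp_nondecreasing) (use B b0 in blast)
 have lt: "B 0 < B 1" by (rule DERIV_pos_imp_increasing_open) (use B bpos in "auto intro!: DERIV_continuous_on DERIV_subset[OF B]")
 have const: "B x = B y" if "x <= y" "!!z. x <= z ==> z <= y ==> b z = 0" for x y
 proof (rule antisym)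
  show "B x <= B y" by (rule mono) fact
  show "B y <= B x" using that(1) by (rule DERIV_nonpos_imp_nonincreasing) (use B that(2) in "metis order_refl")
 qed
 define c where "c = B 1 - B 0"
 have c: "c > 0" using lt by (simp add: c_def)
 define S where "S x = (B x - B 0) / c" for x
 have "(S has_real_derivative (1 / c * b x + 0 * b x)) (at x)" for x
  unfolding S_def using B[of x] c by (auto intro!: derivative_eq_intros)
 then have "smooth S" by (rule smooth_antiderivative[OF _ smooth_lincomb[OF sb sb]])
 moreover have "S x = 0" if "x <= 0" for x
  using const[of x 0] bout that by (simp add: S_def)
 moreover have "S x = 1" if "x >= 1" for x
  using const[of 1 x] bout that c by (simp add: S_def c_def)
 moreover have "0 <= S x & S x <= 1" for x
 proof -
  have "B 0 <= B x & B x <= B 1"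
  proof (cases "x <= 0")
   case True
   then have "B x = B 0" using const[of x 0] bout by auto
   then show ?thesis using lt by simp
  next
   case False
   show ?thesis
   proof (cases "x >= 1")
    case True
    then have "B x = B 1" using const[of 1 x] bout by auto
    then show ?thesis using lt by simp
   qed (use mono False in auto)
  qed
  then show ?thesis using c by (auto simp: S_def c_def)
 qed
 ultimately show ?thesis by blast
qed

definition smooth_step :: "real => real" where
 "smooth_step = (SOME S. smooth S & (\<forall>x\<le>0. S x = 0) & (\<forall>x\<ge>1. S x = 1) & (ALL x. 0 <= S x & S x <= 1))"

lemma smooth_step: "smooth smooth_step" "x <= 0 ==> smooth_step x = 0" "x >= 1 ==> smooth_step x = 1"
 "0 <= smooth_step x" "smooth_step x <= 1" using someI_ex[OF ex_smooth_step] unfolding smooth_step_def[symmetric] by blast+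

lemma smooth_step_tendsto: "(%n. smooth_step (real (Suc n) * x)) ----> indicator {0<..} x"
proof (cases "x > 0")
 case True
 obtain N :: nat where N: "real N * x > 1" using reals_Archimedean3[OF True] by blast
 have "smooth_step (real (Suc n) * x) = 1" if "n >= N" for n
 proof (rule smooth_step)
  have "1 < real N * x" by (rule N)
  also have "... <= real (Suc n) * x" using that True by (intro mult_right_mono) auto
  finally show "1 <= real (Suc n) * x" by simp
 qed
 then show ?thesis using True by (intro tendsto_eventually) (auto simp: eventually_sequentially)
next
 case False
 then have "smooth_step (real (Suc n) * x) = 0" for n by (intro smooth_step mult_nonneg_nonpos) auto
 then show ?thesis using False by simp
qed

lemma smooth_step_far:
 assumes "\<bar>y\<bar> + 1 <= \<bar>x\<bar>" shows "smooth_step (real (Suc n) * (x - y)) = (if x > 0 then 1 else 0)"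
proof (cases "x > 0")
 case True
 then have "1 <= x - y" using assms by linarith
 then have "1 * 1 <= real (Suc n) * (x - y)" by (intro mult_mono) auto
 then show ?thesis using True smooth_step(3) by simp
next
 case False
 then have "x - y <= 0" using assms by linarith
 then show ?thesis using False by (simp add: smooth_step(2) mult_nonneg_nonpos)
qed

lemma test_function_iff:
 "test_function \<phi> \<longleftrightarrow> smooth \<phi> & (EX R. ALL x. \<bar>x\<bar> > R --> \<phi> x = 0)"
proof -
 have "compact (closure {x. \<phi> x ~= 0}) \<longleftrightarrow> (EX R. ALL x. \<bar>x\<bar> > R --> \<phi> x = 0)"
 proof -
  have "compact (closure {x. \<phi> x ~= 0}) \<longleftrightarrow> bounded {x. \<phi> x ~= 0}" by (rule compact_closure)
  also have "... \<longleftrightarrow> (EX R. ALL x. \<bar>x\<bar> > R --> \<phi> x = 0)"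
   unfolding bounded_iff by (auto simp: not_less) (meson not_less)+
  finally show ?thesis .
 qed
 then show ?thesis by (simp add: test_function_def smooth_def)
qed

lemma test_function_step_diff:
 "test_function (%x. smooth_step (real (Suc n) * (x - a)) - smooth_step (real (Suc n) * (x - b)))" unfolding test_function_iff
proof
 have "smooth (%x. smooth_step (real (Suc n) * x + (- real (Suc n) * c)))" for c
  by (rule smooth_affine[OF smooth_step(1)])
 then have 1: "smooth (%x. smooth_step (real (Suc n) * (x - c)))" for c
  by (simp add: right_diff_distrib del: of_nat_Suc)
 show "smooth (%x. smooth_step (real (Suc n) * (x - a)) - smooth_step (real (Suc n) * (x - b)))" using smooth_lincomb[OF 1 1, of 1 a "-1" b] by simp
 show "EX R. ALL x. \<bar>x\<bar> > R --> smooth_step (real (Suc n) * (x - a)) - smooth_step (real (Suc n) * (x - b)) = 0"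
 proof (intro exI allI impI)
  fix x assume x: "\<bar>x\<bar> > \<bar>a\<bar> + \<bar>b\<bar> + 1"
  have "\<bar>a\<bar> + 1 <= \<bar>x\<bar>" "\<bar>b\<bar> + 1 <= \<bar>x\<bar>" using x by linarith+
  then show "smooth_step (real (Suc n) * (x - a)) - smooth_step (real (Suc n) * (x - b)) = 0" by (simp add: smooth_step_far del: of_nat_Suc)
 qed
qed

text \<open>Test functions whose derivatives approximate the difference of the indicators of
 \<open>{a<..a+c}\<close> and \<open>{b<..b+c}\<close>; their existence needs the two intervals to have equal length.\<close>

lemma ex_test_function_four_steps:
 fixes a b c :: real
 defines "\<psi> \<equiv> %n x. smooth_step (real (Suc n) * (x - a)) - smooth_step (real (Suc n) * (x - (a + c)))
   - smooth_step (real (Suc n) * (x - b)) + smooth_step (real (Suc n) * (x - (b + c)))"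
 shows "\<exists>\<phi>. test_function \<phi> & deriv \<phi> = \<psi> n"
proof -
 let ?N = "real (Suc n)"
 have "EX Q. \<forall>x::real. - \<infinity> < ereal x --> ereal x < \<infinity> --> (Q has_vector_derivative smooth_step x) (at x)"
  by (rule einterval_antiderivative) (auto intro: DERIV_isCont[OF smooth_DERIV[OF smooth_step(1)]])
 then obtain Q where Q: "!!x. (Q has_real_derivative smooth_step x) (at x)" by (auto simp: has_real_derivative_iff_has_vector_derivative)
 have sQ: "smooth Q" by (rule smooth_antiderivative[OF Q smooth_step(1)])
 have Q0: "Q x = Q 0" if "x <= 0" for x
 proof (rule antisym)
  show "Q x <= Q 0" using that by (rule DERIV_nonneg_imp_nondecreasing) (use Q smooth_step(4) in blast)
  show "Q 0 <= Q x" using that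
   by (rule DERIV_nonpos_imp_nonincreasing) (use Q smooth_step(2) in "metis order_refl")
 qed
 have Q1: "Q x = Q 1 + (x - 1)" if "x >= 1" for x
 proof -
  have "((%x. Q x - x) has_real_derivative smooth_step y - 1) (at y)" for y
   by (auto intro!: derivative_eq_intros Q)
  note d = this
  have "Q x - x <= Q 1 - 1" using that
   by (rule DERIV_nonpos_imp_nonincreasing) (use d smooth_step(5) in "metis diff_le_0_iff_le")
  moreover have "Q 1 - 1 <= Q x - x" using that
   by (rule DERIV_nonneg_imp_nondecreasing) (use d smooth_step(3) in "metis diff_self order_refl")
  ultimately show ?thesis by simp
 qed
 define R where "R y x = Q (?N * (x - y)) / ?N" for x y
 have sR: "smooth (R y)" for y
 proof -
  have "smooth (%x. Q (?N * x + (- ?N * y)))" by (rule smooth_affine[OF sQ])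
  from smooth_lincomb[OF this this, of "1 / ?N" 0] show ?thesis
   by (simp add: R_def[abs_def] right_diff_distrib del: of_nat_Suc)
 qed
 have dR: "(R y has_real_derivative smooth_step (?N * (x - y))) (at x)" for x y
 proof -
  have "((%x. Q (?N * (x - y))) has_real_derivative smooth_step (?N * (x - y)) * ?N) (at x)"
   by (rule DERIV_chain2[OF Q]) (auto intro!: derivative_eq_intros)
  from DERIV_cdivide[OF this, of ?N] show ?thesis by (simp add: R_def[abs_def] del: of_nat_Suc)
 qed
 define \<phi> where "\<phi> x = (R a x - R (a + c) x) - (R b x - R (b + c) x)" for x
 have "smooth (%x. 1 * R a x + (-1) * R (a + c) x)" "smooth (%x. 1 * R b x + (-1) * R (b + c) x)" by (intro smooth_lincomb sR)+
 from smooth_lincomb[OF this, of 1 "-1"] have s: "smooth \<phi>" by (simp add: \<phi>_def[abs_def] algebra_simps)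
 have d: "deriv \<phi> = \<psi> n"
 proof
  fix x
  have "(\<phi> has_real_derivative (smooth_step (?N * (x - a)) - smooth_step (?N * (x - (a + c))))
    - (smooth_step (?N * (x - b)) - smooth_step (?N * (x - (b + c))))) (at x)" unfolding \<phi>_def[abs_def] by (intro DERIV_diff dR)
  then show "deriv \<phi> x = \<psi> n x" by (simp add: \<psi>_def DERIV_imp_deriv)
 qed
 have "\<phi> x = 0" if x: "\<bar>x\<bar> > \<bar>a\<bar> + \<bar>b\<bar> + \<bar>c\<bar> + 1" for x
 proof (cases "x > 0")
  case True
  have r: "R y x = (Q 1 - 1) / ?N + (x - y)" if "\<bar>y\<bar> <= \<bar>a\<bar> + \<bar>b\<bar> + \<bar>c\<bar>" for y
  proof -
   have "1 <= x - y" using x that True by linarith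
   then have "1 * 1 <= ?N * (x - y)" by (intro mult_mono) auto
   then show ?thesis using Q1[of "?N * (x - y)"] by (simp add: R_def add_divide_distrib diff_divide_distrib del: of_nat_Suc)
  qed
  have "R a x = (Q 1 - 1) / ?N + (x - a)" "R (a + c) x = (Q 1 - 1) / ?N + (x - (a + c))"
   "R b x = (Q 1 - 1) / ?N + (x - b)" "R (b + c) x = (Q 1 - 1) / ?N + (x - (b + c))" by (intro r; linarith)+
  then show ?thesis by (simp add: \<phi>_def)
 next
  case False
  have r: "R y x = Q 0 / ?N" if "\<bar>y\<bar> <= \<bar>a\<bar> + \<bar>b\<bar> + \<bar>c\<bar>" for y
  proof -
   have "x - y <= 0" using x that False by linarith
   then have "?N * (x - y) <= 0" by (intro mult_nonneg_nonpos) auto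
   then show ?thesis using Q0[of "?N * (x - y)"] by (simp add: R_def del: of_nat_Suc)
  qed
  have "R a x = Q 0 / ?N" "R (a + c) x = Q 0 / ?N" "R b x = Q 0 / ?N" "R (b + c) x = Q 0 / ?N" by (intro r; linarith)+
  then show ?thesis by (simp add: \<phi>_def)
 qed
 then have "test_function \<phi>" unfolding test_function_iff using s by blast
 then show ?thesis using d by blast
qed

section \<open>Absolutely continuous functions on the line\<close>

definition locally_integrable :: "(real => complex) => bool" where
 "locally_integrable f \<longleftrightarrow> (ALL a b. set_integrable lborel {a<..b} f)"

definition ioc_integral :: "(real => complex) => real => real => complex" where
 "ioc_integral f a b = (LINT x:{a<..b}|lborel. f x)"

text \<open>\<open>F\<close> is locally absolutely continuous with derivative \<open>f\<close>
  almost everywhere. The integral formula replaces differentiation, and half-open intervals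
  concatenate without overlap.\<close>

definition primitive :: "(real => complex) => (real => complex) => bool" where
 "primitive F f \<longleftrightarrow> locally_integrable f & (ALL a b. a <= b --> F b - F a = ioc_integral f a b)"

lemma locally_integrableD: "locally_integrable f ==> integrable lborel (%x. indicator {a<..b} x *R f x)"
 by (simp add: locally_integrable_def set_integrable_def)

lemma ioc_integral_split:
 assumes "locally_integrable f" "a <= b" "b <= c"
 shows "ioc_integral f a c = ioc_integral f a b + ioc_integral f b c"
proof -
 have "(LINT x:{a<..b} \<union> {b<..c}|lborel. f x) = (LINT x:{a<..b}|lborel. f x) + (LINT x:{b<..c}|lborel. f x)"
  using assms by (intro set_integral_Un) (auto simp: locally_integrable_def)
 moreover have "{a<..b} \<union> {b<..c} = {a<..c}" using assms by auto
 ultimately show ?thesis by (simp add: ioc_integral_def)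
qed

lemma AE_not_point: "AE x in lborel. x ~= (c::real)" by (rule AE_lborel_singleton)

text \<open>Fubini over the half planes y <= x and x <= y, which cover the plane and overlap only in
  the null diagonal.\<close>

lemma integral_parts_half_line:
 fixes f g :: "real => complex"
 assumes f: "integrable lborel f" and g: "integrable lborel g"
 shows "(LINT x|lborel. f x * (LINT y|lborel. indicator {..x} y *R g y))
   + (LINT x|lborel. g x * (LINT y|lborel. indicator {..x} y *R f y)) = (LINT x|lborel. f x) * (LINT x|lborel. g x)"
proof -
 have [measurable]: "f \<in> borel_measurable borel" "g \<in> borel_measurable borel" using f g by auto
 have H: "integrable (lborel \<Otimes>\<^sub>M lborel) (%(x, y). f x * g y)"
 proof (rule lborel_pair.Fubini_integrable)
  show "integrable lborel (%x. LINT y|lborel. norm (case (x, y) of (x, y) => f x * g y))" using f by (simp add: norm_mult)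
  show "AE x in lborel. integrable lborel (%y. case (x, y) of (x, y) => f x * g y)" using g by simp
 qed measurable
 have K: "integrable (lborel \<Otimes>\<^sub>M lborel) (%(x, y). indicator {..x} y *R (f x * g y))"
 proof (rule lintegrable_bound[OF H])
  show "(%(x, y). indicator {..x} y *R (f x * g y)) \<in> borel_measurable (lborel \<Otimes>\<^sub>M lborel)"
   by (simp add: indicator_def[abs_def] split_beta')
 qed (auto simp: indicator_def norm_mult)
 have K': "integrable (lborel \<Otimes>\<^sub>M lborel) (%(x, y). indicator {..y} x *R (f x * g y))"
 proof (rule lintegrable_bound[OF H])
  show "(%(x, y). indicator {..y} x *R (f x * g y)) \<in> borel_measurable (lborel \<Otimes>\<^sub>M lborel)"
   by (simp add: indicator_def[abs_def] split_beta')
 qed (auto simp: indicator_def norm_mult)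
 have int: "integrable lborel (%y. indicator {..x} y *R (f x * g y))"
  "integrable lborel (%y. indicator {..y} x *R (f x * g y))" for x
 proof -
  show "integrable lborel (%y. indicator {..x} y *R (f x * g y))" using g by (intro integrable_mult_indicator) auto
  have "integrable lborel (%y. indicator {x..} y *R (f x * g y))" using g by (intro integrable_mult_indicator) auto
  then show "integrable lborel (%y. indicator {..y} x *R (f x * g y))" by (simp add: indicator_def)
 qed
 have 1: "(LINT x|lborel. g x * (LINT y|lborel. indicator {..x} y *R f y))
   = (LINT y|lborel. LINT x|lborel. indicator {..y} x *R (f x * g y))"
 proof (rule lint_cong[OF refl])
  fix y
  show "g y * (LINT x|lborel. indicator {..y} x *R f x) = (LINT x|lborel. indicator {..y} x *R (f x * g y))"
   by (subst integral_mult_right_zero[symmetric], rule lint_cong) (auto simp: mult_ac)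
 qed
 also have "... = (LINT x|lborel. LINT y|lborel. indicator {..y} x *R (f x * g y))" by (rule lborel_pair.Fubini_integral[OF K'])
 finally have 2: "(LINT x|lborel. g x * (LINT y|lborel. indicator {..x} y *R f y))
  = (LINT x|lborel. LINT y|lborel. indicator {..y} x *R (f x * g y))" .
 have 3: "(LINT x|lborel. f x * (LINT y|lborel. indicator {..x} y *R g y))
   = (LINT x|lborel. LINT y|lborel. indicator {..x} y *R (f x * g y))"
 proof (rule lint_cong[OF refl])
  fix x
  show "f x * (LINT y|lborel. indicator {..x} y *R g y) = (LINT y|lborel. indicator {..x} y *R (f x * g y))"
   by (subst integral_mult_right_zero[symmetric], rule lint_cong) auto
 qed
 have "(LINT x|lborel. LINT y|lborel. indicator {..x} y *R (f x * g y))
   + (LINT x|lborel. LINT y|lborel. indicator {..y} x *R (f x * g y))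
   = (LINT x|lborel. (LINT y|lborel. indicator {..x} y *R (f x * g y)) + (LINT y|lborel. indicator {..y} x *R (f x * g y)))"
  using lborel_pair.integrable_fst[OF K] lborel_pair.integrable_fst[OF K'] by (intro lint_add[symmetric]) auto
 also have "... = (LINT x|lborel. f x * (LINT y|lborel. g y))"
 proof (rule lint_cong[OF refl])
  fix x
  have "(LINT y|lborel. indicator {..x} y *R (f x * g y)) + (LINT y|lborel. indicator {..y} x *R (f x * g y))
   = (LINT y|lborel. indicator {..x} y *R (f x * g y) + indicator {..y} x *R (f x * g y))" by (rule lint_add[OF int, symmetric])
  also have "... = (LINT y|lborel. f x * g y)"
  proof (rule integral_cong_AE)
   show "(%y. indicator {..x} y *R (f x * g y) + indicator {..y} x *R (f x * g y)) \<in> borel_measurable lborel" using int[of x] by auto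
   show "AE y in lborel. indicator {..x} y *R (f x * g y) + indicator {..y} x *R (f x * g y) = f x * g y"
    using AE_not_point[of x] by eventually_elim (auto simp: indicator_def)
  qed auto
  finally show "(LINT y|lborel. indicator {..x} y *R (f x * g y)) + (LINT y|lborel. indicator {..y} x *R (f x * g y))
   = f x * (LINT y|lborel. g y)" by simp
 qed
 also have "... = (LINT x|lborel. f x) * (LINT x|lborel. g x)" by simp
 finally show ?thesis by (simp add: 2 3)
qed

lemma primitive_alt:
 assumes F: "primitive F f" and x: "a < x" "x <= b"
 shows "F x = F a + (LINT y|lborel. indicator {..x} y *R (indicator {a<..b} y *R f y))"
proof -
 have "F x - F a = (LINT y|lborel. indicator {a<..x} y *R f y)" using F x by (simp add: primitive_def ioc_integral_def set_lebesgue_integral_def)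
 also have "... = (LINT y|lborel. indicator {..x} y *R (indicator {a<..b} y *R f y))" using x by (intro lint_cong refl) (auto simp: indicator_def)
 finally show ?thesis by (simp add: algebra_simps)
qed

lemma primitive_isCont:
 assumes F: "primitive F f" shows "isCont F x"
proof -
 let ?a = "x - 1" and ?b = "x + 1"
 let ?f = "%y. indicator {?a<..?b} y *R f y"
 have int: "integrable lborel ?f" using F by (intro locally_integrableD) (simp add: primitive_def)
 have "((%z. LINT y|lborel. indicator {..z} y *R ?f y) ---> (LINT y|lborel. indicator {..x} y *R ?f y)) (at x)"
  unfolding tendsto_at_iff_sequentially comp_def
 proof (intro allI impI)
  fix X :: "nat => real" assume X: "ALL i. X i \<in> UNIV - {x}" "X ----> x"
  show "(%n. LINT y|lborel. indicator {..X n} y *R ?f y) ----> (LINT y|lborel. indicator {..x} y *R ?f y)"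
  proof (rule integral_dominated_convergence[where w = "%y. norm (?f y)"])
   show "AE y in lborel. (%i. indicator {..X i} y *R ?f y) ----> indicator {..x} y *R ?f y" using AE_not_point[of x]
   proof eventually_elim
    case (elim y)
    show ?case
    proof (cases "y < x")
     case True
     have "\<forall>\<^sub>F i in sequentially. y < X i" using order_tendstoD(1)[OF X(2) True] .
     then show ?thesis using True
      by (intro tendsto_eventually) (rule eventually_mono, assumption, simp)
    next
     case False
     then have "\<forall>\<^sub>F i in sequentially. X i < y" using order_tendstoD(2)[OF X(2), of y] elim by simp
     then show ?thesis using False elim
      by (intro tendsto_eventually) (rule eventually_mono, assumption, simp)
    qed
   qed
   show "AE y in lborel. norm (indicator {..X i} y *R ?f y) <= norm (?f y)" for i
    by (auto simp: indicator_def)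
   show "integrable lborel (%y. norm (?f y))" using int by (rule integrable_norm)
   have [measurable]: "?f \<in> borel_measurable borel" using int by simp
   show "(%y. indicator {..x} y *R ?f y) \<in> borel_measurable lborel" by measurable
   show "(%y. indicator {..X n} y *R ?f y) \<in> borel_measurable lborel" for n by measurable
  qed
 qed
 then have "((%z. F ?a + (LINT y|lborel. indicator {..z} y *R ?f y)) ---> F ?a + (LINT y|lborel. indicator {..x} y *R ?f y)) (at x)"
  by (intro tendsto_add tendsto_const)
 moreover have "\<forall>\<^sub>F z in at x. F ?a + (LINT y|lborel. indicator {..z} y *R ?f y) = F z"
 proof -
  have "\<forall>\<^sub>F z in at x. z \<in> {?a<..<?b}" by (intro eventually_at_in_open') auto
  then show ?thesis by eventually_elim (use primitive_alt[OF F, of ?a _ ?b] in auto)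
 qed
 ultimately have "(F ---> F ?a + (LINT y|lborel. indicator {..x} y *R ?f y)) (at x)" by (rule Lim_transform_eventually)
 then show ?thesis unfolding isCont_def using primitive_alt[OF F, of ?a x ?b] by simp
qed

lemma primitive_continuous: "primitive F f ==> continuous_on S F" using primitive_isCont by (auto intro: continuous_at_imp_continuous_on)

lemma primitive_measurable: "primitive F f ==> F \<in> borel_measurable borel" by (intro borel_measurable_continuous_onI primitive_continuous)

lemma locally_integrable_measurable:
 assumes "locally_integrable f" shows "f \<in> borel_measurable borel"
proof (rule borel_measurable_LIMSEQ_metric)
 show "(%x. indicator {- real n<..real n} x *R f x) \<in> borel_measurable borel" for n
  using locally_integrableD[OF assms, of "- real n" "real n"] by auto
 fix x
 obtain N :: nat where N: "real N > \<bar>x\<bar>" using reals_Archimedean2 by blast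
 have "indicator {- real n<..real n} x *R f x = f x" if "n >= N" for n
  using N that by (auto simp: indicator_def)
 then show "(%n. indicator {- real n<..real n} x *R f x) ----> f x" by (intro tendsto_eventually) (auto simp: eventually_sequentially)
qed

lemma continuous_bounded_Icc:
 fixes F :: "real => complex"
 assumes "continuous_on UNIV F" obtains B where "!!x. x \<in> {a..b} ==> norm (F x) <= B"
proof -
 have "compact (F ` {a..b})" using assms by (intro compact_continuous_image) (auto intro: continuous_on_subset)
 then have "bounded (F ` {a..b})" by (rule compact_imp_bounded)
 then obtain B where "\<forall>z\<in>F ` {a..b}. norm z <= B" unfolding bounded_iff by metis
 then show thesis using that by blast
qed

lemma locally_integrable_mult:
 assumes f: "locally_integrable f" and G: "continuous_on UNIV G"
 shows "locally_integrable (%x. f x * G x)" unfolding locally_integrable_def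
proof (intro allI)
 fix a b :: real
 obtain B where B: "!!x. x \<in> {a..b} ==> norm (G x) <= B" by (rule continuous_bounded_Icc[OF G, where a = a and b = b]) blast
 have [measurable]: "G \<in> borel_measurable borel" using G by (rule borel_measurable_continuous_onI)
 have [measurable]: "f \<in> borel_measurable borel" using f by (rule locally_integrable_measurable)
 have "integrable lborel (%x. B * norm (indicator {a<..b} x *R f x))" using locally_integrableD[OF f] by (intro integrable_mult_right integrable_norm)
 then show "set_integrable lborel {a<..b} (%x. f x * G x)" unfolding set_integrable_def
 proof (rule lintegrable_bound)
  show "AE x in lborel. norm (indicator {a<..b} x *R (f x * G x)) <= norm (B * norm (indicator {a<..b} x *R f x))"
  proof (intro always_eventually allI)
   fix x
   show "norm (indicator {a<..b} x *R (f x * G x)) <= norm (B * norm (indicator {a<..b} x *R f x))"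
   proof (cases "x \<in> {a<..b}")
    case True
    then have "norm (G x) <= \<bar>B\<bar>" using B[of x] by auto
    then show ?thesis using True by (simp add: norm_mult abs_mult mult.commute mult_right_mono)
   qed simp
  qed
 qed measurable
qed

lemma locally_integrable_add: "locally_integrable f ==> locally_integrable g ==> locally_integrable (%x. f x + g x)"
 unfolding locally_integrable_def by (auto intro: set_integral_add)

lemma primitive_mult:
 assumes F: "primitive F f" and G: "primitive G g"
 shows "primitive (%x. F x * G x) (%x. f x * G x + g x * F x)" unfolding primitive_def
proof (intro conjI allI impI)
 have loc: "locally_integrable (%x. f x * G x)" "locally_integrable (%x. g x * F x)"
  using F G by (auto intro!: locally_integrable_mult primitive_continuous simp: primitive_def)
 then show "locally_integrable (%x. f x * G x + g x * F x)" by (rule locally_integrable_add)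
 fix a b :: real assume ab: "a <= b"
 let ?f = "%y. indicator {a<..b} y *R f y" and ?g = "%y. indicator {a<..b} y *R g y"
 have int: "integrable lborel ?f" "integrable lborel ?g" using F G by (auto intro!: locally_integrableD simp: primitive_def)
 have Fb: "F b - F a = (LINT x|lborel. ?f x)" and Gb: "G b - G a = (LINT x|lborel. ?g x)"
  using F G ab by (auto simp: primitive_def ioc_integral_def set_lebesgue_integral_def)
 \<comment> \<open>Writing the undifferentiated factor as its value at \<open>a\<close> plus an
   integral from \<open>a\<close> leaves one of the two half-plane integrals; the two uses of this
   formula combine by \<open>integral_parts_half_line\<close>.\<close>
 have half: "(LINT x:{a<..b}|lborel. f x * G x) = (LINT x|lborel. indicator {a<..b} x *R f x) * G a
   + (LINT x|lborel. indicator {a<..b} x *R f x * (LINT y|lborel. indicator {..x} y *R (indicator {a<..b} y *R g y)))"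
  if G: "primitive G g" and f: "locally_integrable f" for G g f
 proof -
  let ?f = "%y. indicator {a<..b} y *R f y"
  have i: "integrable lborel ?f" using f by (rule locally_integrableD)
  have ar: "p = q + r" if "r = p - q" for p q r :: complex using that by simp
  define K where "K x = (LINT y|lborel. indicator {..x} y *R (indicator {a<..b} y *R g y))" for x
  have e: "?f x * K x = indicator {a<..b} x *R (f x * G x) - ?f x * G a" for x
   unfolding K_def using primitive_alt[OF G, of a x b] by (auto simp: indicator_def algebra_simps)
  have "integrable lborel (%x. indicator {a<..b} x *R (f x * G x))"
   using locally_integrable_mult[OF f primitive_continuous[OF G]] by (rule locally_integrableD)
  then have "(LINT x|lborel. indicator {a<..b} x *R (f x * G x) - ?f x * G a) = (LINT x|lborel. indicator {a<..b} x *R (f x * G x)) - (LINT x|lborel. ?f x * G a)"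
   using i by (intro lint_diff integrable_mult_left) auto
  moreover have "(LINT x|lborel. ?f x * G a) = (LINT x|lborel. ?f x) * G a" by (rule integral_mult_left_zero)
  ultimately have "(LINT x|lborel. ?f x * K x) = (LINT x|lborel. indicator {a<..b} x *R (f x * G x)) - (LINT x|lborel. ?f x) * G a"
   unfolding e by simp
  then show ?thesis unfolding K_def[symmetric] set_lebesgue_integral_def by (rule ar)
 qed
 have "ioc_integral (%x. f x * G x + g x * F x) a b = (LINT x:{a<..b}|lborel. f x * G x) + (LINT x:{a<..b}|lborel. g x * F x)"
  unfolding ioc_integral_def using loc by (intro set_integral_add) (auto simp: locally_integrable_def)
 also have "... = (LINT x|lborel. ?f x) * G a + (LINT x|lborel. ?g x) * F a + (LINT x|lborel. ?f x) * (LINT x|lborel. ?g x)"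
  using half[OF G, of f] half[OF F, of g] F G integral_parts_half_line[OF int] by (simp add: primitive_def)
 also have "... = F b * G b - F a * G a" unfolding Fb[symmetric] Gb[symmetric] by (simp add: algebra_simps)
 finally show "F b * G b - F a * G a = ioc_integral (%x. f x * G x + g x * F x) a b" by simp
qed

lemma primitive_C1:
 assumes d: "!!x. (F has_vector_derivative f x) (at x)" and c: "continuous_on UNIV f"
 shows "primitive F f" unfolding primitive_def
proof (intro conjI allI impI)
 have i: "set_integrable lborel {a..b} f" for a b
  using c by (intro borel_integrable_atLeastAtMost') (auto intro: continuous_on_subset)
 show "locally_integrable f" unfolding locally_integrable_def
  by (intro allI, rule set_integrable_subset[OF i]) (auto intro: order.strict_implies_order)
 fix a b :: real assume ab: "a <= b"
 have "(LINT x:{a..b}|lborel. f x) = F b - F a" unfolding set_lebesgue_integral_def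
  by (rule integral_FTC_Icc[OF ab]) (auto intro: has_vector_derivative_at_within d continuous_on_subset[OF c])
 moreover have "(LINT x:{a..b}|lborel. f x) = (LINT x:{a<..b}|lborel. f x)" unfolding set_lebesgue_integral_def
 proof (rule integral_cong_AE)
  show "AE x in lborel. indicator {a..b} x *R f x = indicator {a<..b} x *R f x" using AE_not_point[of a] by eventually_elim (auto simp: indicator_def)
  have [measurable]: "f \<in> borel_measurable borel" using c by (rule borel_measurable_continuous_onI)
  show "(%x. indicator {a..b} x *R f x) \<in> borel_measurable lborel" by measurable
  show "(%x. indicator {a<..b} x *R f x) \<in> borel_measurable lborel" by measurable
 qed
 ultimately show "F b - F a = ioc_integral f a b" by (simp add: ioc_integral_def)
qed

lemma primitive_has_derivative:
 assumes F: "primitive F f" and c: "continuous_on UNIV f"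
 shows "(F has_vector_derivative f x) (at x)"
proof -
 have "EX G. \<forall>x::real. - \<infinity> < ereal x --> ereal x < \<infinity> --> (G has_vector_derivative f x) (at x)"
  using c by (intro einterval_antiderivative) (auto simp: continuous_on_eq_continuous_at)
 then obtain G where G: "!!x. (G has_vector_derivative f x) (at x)" by auto
 have P: "primitive G f" by (rule primitive_C1[OF G c])
 have e: "F y - G y = F 0 - G 0" for y
 proof (cases "0 <= y")
  case True
  then have "F y - F 0 = G y - G 0" using F P unfolding primitive_def by simp
  then show ?thesis by (simp add: algebra_simps)
 next
  case False
  then have "F 0 - F y = G 0 - G y" using F P unfolding primitive_def by simp
  then show ?thesis by (simp add: algebra_simps)
 qed
 have "F = (%y. G y + (F 0 - G 0))" using e by (auto simp: algebra_simps)
 then show ?thesis using has_vector_derivative_add[OF G has_vector_derivative_const[of "F 0 - G 0"]] by simp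
qed

lemma ioc_integral_cong_AE:
 assumes "AE x in lborel. f x = g x" "f \<in> borel_measurable borel" "g \<in> borel_measurable borel"
 shows "ioc_integral f a b = ioc_integral g a b" unfolding ioc_integral_def by (rule set_lebesgue_integral_cong_AE) (use assms in auto)

lemma locally_integrable_cong_AE:
 assumes "AE x in lborel. f x = g x" "locally_integrable f" "g \<in> borel_measurable borel"
 shows "locally_integrable g" unfolding locally_integrable_def set_integrable_def
proof (intro allI)
 fix a b
 have [measurable]: "g \<in> borel_measurable borel" by fact
 show "integrable lborel (%x. indicator {a<..b} x *R g x)"
 proof (rule integrable_cong_AE_imp[OF locally_integrableD[OF assms(2), of a b]])
  show "AE x in lborel. indicator {a<..b} x *R f x = indicator {a<..b} x *R g x" using assms(1) by eventually_elim simp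
 qed measurable
qed

lemma primitive_cong_AE:
 assumes "primitive F f" "AE x in lborel. f x = g x" "g \<in> borel_measurable borel"
 shows "primitive F g" using assms locally_integrable_cong_AE[of f g] ioc_integral_cong_AE[of f g] locally_integrable_measurable[of f]
 unfolding primitive_def by metis

lemma primitive_base:
 assumes f: "locally_integrable f"
 shows "primitive (%x. if 0 <= x then ioc_integral f 0 x else - ioc_integral f x 0) f" unfolding primitive_def
proof (intro conjI allI impI f)
 fix a b :: real assume "a <= b"
 then consider "0 <= a" | "a < 0" "0 <= b" | "b < 0" by linarith
 then show "(if 0 <= b then ioc_integral f 0 b else - ioc_integral f b 0) -
   (if 0 <= a then ioc_integral f 0 a else - ioc_integral f a 0) = ioc_integral f a b"
 proof cases
  case 1
  then show ?thesis using \<open>a <= b\<close> ioc_integral_split[OF f, of 0 a b] by simp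
 next
  case 2
  then show ?thesis using ioc_integral_split[OF f, of a 0 b] by simp
 next
  case 3
  then show ?thesis using \<open>a <= b\<close> ioc_integral_split[OF f, of a b 0] by simp
 qed
qed

lemma L2_ioc: "(%x. indicator {a<..b::real} x) \<in> L2 lborel"
proof -
 have "integrable lborel (indicator {a<..b} :: real => real)" by (intro integrable_real_indicator; cases "a <= b") auto
 moreover have "(cmod (indicator {a<..b} x))\<^sup>2 = indicator {a<..b} x" for x by (auto simp: indicator_def)
 ultimately show ?thesis by (simp add: L2_def)
qed

lemma L2_locally_integrable: assumes "f \<in> L2 lborel" shows "locally_integrable f" unfolding locally_integrable_def set_integrable_def
proof (intro allI)
 fix a b
 show "integrable lborel (%x. indicator {a<..b} x *R f x)" using L2_mult_integrable[OF L2_ioc assms, of a b]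
  by (simp add: scaleR_conv_of_real indicator_def[abs_def] of_bool_def if_distrib[of cor] if_distribR cong: if_cong)
qed

section \<open>Weak derivatives in \<open>L\<^sup>2\<close>\<close>

instantiation real :: l2_space
begin
definition vol_real :: "real measure" where "vol_real = lborel"
instance ..
end

lemma vol_lborel [simp]: "vol = (lborel :: real measure)" by (rule vol_real_def)

text \<open>Dominated convergence with respect to the L^2 norm.\<close>

lemma abs_l2_dominated:
 fixes f :: "nat => 'a::l2_space => complex"
 assumes g: "g \<in> L2 vol" and f: "!!n. f n \<in> borel_measurable vol"
  and f': "f' \<in> borel_measurable vol"
  and bound: "!!n. AE x in vol. cmod (f n x) <= cmod (g x)"
  and lim: "AE x in vol. (%n. f n x) ----> f' x"
 shows "(%n. abs_l2 (f n)) ----> abs_l2 f'"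
proof -
 have fL: "f n \<in> L2 vol" for n
  using bound[of n] by (intro L2_bound[OF g f, where B = 1]) auto
 have b': "AE x in vol. cmod (f' x) <= cmod (g x)"
 proof -
  have "AE x in vol. ALL n. cmod (f n x) <= cmod (g x)" using bound by (simp add: AE_all_countable)
  with lim show ?thesis
  proof eventually_elim
   case (elim x)
   have "(%n. cmod (f n x)) ----> cmod (f' x)" using elim(1) by (rule tendsto_norm)
   then show ?case by (rule tendsto_upperbound) (use elim in auto)
  qed
 qed
 have f'L: "f' \<in> L2 vol" using b' by (intro L2_bound[OF g f', where B = 1]) auto
 have lim0: "(%n. LINT x|vol. (cmod (f n x - f' x))\<^sup>2) ----> (LINT x|(vol::'a measure). 0)"
 proof (rule integral_dominated_convergence[where w = "%x. 4 * (cmod (g x))\<^sup>2"])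
  show "AE x in vol. (%n. (cmod (f n x - f' x))\<^sup>2) ----> 0" using lim
  proof eventually_elim
   case (elim x)
   then have "(%n. f n x - f' x) ----> 0" by (rule LIM_zero)
   then have "(%n. (cmod (f n x - f' x))\<^sup>2) ----> (cmod 0)\<^sup>2" by (intro tendsto_intros)
   then show ?case by simp
  qed
  show "AE x in vol. norm ((cmod (f n x - f' x))\<^sup>2) <= 4 * (cmod (g x))\<^sup>2" for n
   using bound[of n] b'
  proof eventually_elim
   case (elim x)
   have "cmod (f n x - f' x) <= 2 * cmod (g x)" using norm_triangle_ineq4[of "f n x" "f' x"] elim by simp
   then have "(cmod (f n x - f' x))\<^sup>2 <= (2 * cmod (g x))\<^sup>2" by (intro power_mono) auto
   then show ?case by (simp add: power_mult_distrib)
  qed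
  show "integrable vol (%x. 4 * (cmod (g x))\<^sup>2)" using L2_integrable[OF g] by simp
 qed (use f f' in measurable)
 have "norm (abs_l2 (f n) - abs_l2 f') = sqrt (LINT x|vol. (cmod (f n x - f' x))\<^sup>2)" for n
  by (simp add: abs_l2_diff fL f'L norm_abs_l2 L2_diff L2_norm_def)
 then have "(%n. norm (abs_l2 (f n) - abs_l2 f')) ----> 0" using tendsto_real_sqrt[OF lim0] by simp
 then show ?thesis by (rule LIM_zero_cancel[OF tendsto_norm_zero_cancel])
qed

section \<open>A countable total set in L^2 of the line\<close>

definition rational_ioc :: "real l2 set" where
 "rational_ioc = (%(a, b). abs_l2 (indicator {a<..b})) ` (\<rat> \<times> \<rat>)"

lemma countable_rational_ioc: "countable rational_ioc" unfolding rational_ioc_def by (intro countable_image countable_SIGMA countable_rat)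

lemma indicator_L2: "A \<in> sets M ==> emeasure M A < \<infinity> ==> indicator A \<in> L2 M"
proof -
 assume A: "A \<in> sets M" "emeasure M A < \<infinity>"
 then have "integrable M (indicator A :: _ => real)" by (intro integrable_real_indicator) auto
 moreover have "(cmod (indicator A x))\<^sup>2 = indicator A x" for x :: 'a by (auto simp: indicator_def)
 ultimately show ?thesis using A by (simp add: L2_def borel_measurable_indicator)
qed

lemma ioc_L2: "indicator {a<..b} \<in> L2 (lborel :: real measure)" using L2_ioc[of a b] by (simp add: eta_contract_eq)

text \<open>A closed subspace containing the rational intervals contains the real ones by limits,
  then indicators of Borel subsets of a window by Dynkin's lemma, then of all sets of finite measure
  by exhausting the line.\<close>

lemma total_rational_ioc: "total_set rational_ioc" unfolding total_set_def
proof (intro allI impI, elim conjE)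
 fix S :: "real l2 set"
 assume S: "closed S" "0 \<in> S" "\<forall>v\<in>S. \<forall>w\<in>S. v + w \<in> S" "ALL c. \<forall>v\<in>S. c *C v \<in> S" and T: "rational_ioc \<subseteq> S"
 let ?v = "%A. abs_l2 (indicator A) :: real l2"
 have lim: "?v A \<in> S" if "!!n. ?v (B n) \<in> S" "!!n. B n \<in> sets borel" "A \<in> sets borel" "C \<in> sets borel"
   "emeasure lborel C < \<infinity>" "!!n. B n \<subseteq> C" "AE x in lborel. (%n. indicator (B n) x :: complex) ----> indicator A x" for A B C
 proof -
  have "(%n. ?v (B n)) ----> ?v A"
  proof (intro abs_l2_dominated[OF indicator_L2[of C]])
   show "AE x in vol. cmod (indicator (B n) x) <= cmod (indicator C x)" for n
    using that(6)[of n] by (intro always_eventually) (auto simp: indicator_def)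
   show "AE x in vol. (%n. indicator (B n) x :: complex) ----> indicator A x" using that(7) unfolding vol_lborel .
  qed (use that in auto)
  then show ?thesis by (rule closed_sequentially[OF S(1), rotated]) (rule that(1))
 qed
 have sumS: "(\<Sum>i<n. f i) \<in> S" if "!!i. f i \<in> S" for f and n :: nat
  using that S by (induction n) auto
 have ioc: "?v {a<..b} \<in> S" for a b :: real
 proof (cases "a < b")
  case False
  then have "{a<..b} = {}" by auto
  moreover have "?v {} = 0" using abs_l2_zero by (simp add: indicator_def[abs_def])
  ultimately show ?thesis using S(2) by simp
 next
  case ab: True
  \<comment> \<open>Both end points are approached strictly from the right, so the half-open
    indicators converge at every point, including \<open>a\<close> and \<open>b\<close>.\<close>
  have "\<exists>q\<in>\<rat>. x < q & q < x + 1 / real (Suc n)" for x n by (rule Rats_dense_in_real) simp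
  then obtain q where q: "!!x n. q x n \<in> \<rat>" "!!x n. x < q x n" "!!x n. q x n < x + 1 / real (Suc n)" by metis
  have qlim: "q x ----> x" for x
  proof (rule tendsto_sandwich[OF always_eventually always_eventually])
   show "ALL n. x <= q x n" "ALL n. q x n <= x + 1 / real (Suc n)" using q(2,3) by (auto intro: less_imp_le)
   have "(%n. x + 1 / real (Suc n)) ----> x + 0" by (intro tendsto_add tendsto_const lim_1_over_n[THEN LIMSEQ_Suc])
   then show "(%n. x + 1 / real (Suc n)) ----> x" by simp
  qed simp
  have q1: "q x n <= x + 1" for x n
  proof -
   have "1 / real (Suc n) <= 1" by simp
   then show ?thesis using q(3)[of x n] by linarith
  qed
  show ?thesis
  proof (rule lim[where B = "%n. {q a n<..q b n}" and C = "{a<..b + 1}"])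
   show "?v {q a n<..q b n} \<in> S" for n using T q(1) by (auto simp: rational_ioc_def)
   show "{q a n<..q b n} \<subseteq> {a<..b + 1}" for n using q(2)[of a n] q1[of b n] by auto
   show "AE x in lborel. (%n. indicator {q a n<..q b n} x :: complex) ----> indicator {a<..b} x"
   proof (intro always_eventually allI)
    fix x
    have 1: "\<forall>\<^sub>F n in sequentially. q a n < x \<longleftrightarrow> a < x"
    proof (cases "a < x")
     case True
     then show ?thesis using order_tendstoD(2)[OF qlim True] by simp
    next
     case False
     then show ?thesis using q(2)[of a] by (intro always_eventually) (auto intro: less_trans)
    qed
    have 2: "\<forall>\<^sub>F n in sequentially. x <= q b n \<longleftrightarrow> x <= b"
    proof (cases "x <= b")
     case True
     then show ?thesis using q(2)[of b] by (intro always_eventually) (auto intro: less_imp_le le_less_trans)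
    next
     case False
     then have "\<forall>\<^sub>F n in sequentially. q b n < x" using order_tendstoD(2)[OF qlim, of b x] by simp
     then show ?thesis by (rule eventually_mono) (use False in auto)
    qed
    have "\<forall>\<^sub>F n in sequentially. (indicator {q a n<..q b n} x :: complex) = indicator {a<..b} x"
     using 1 2 by eventually_elim (simp add: indicator_def)
    then show "(%n. indicator {q a n<..q b n} x :: complex) ----> indicator {a<..b} x" by (rule tendsto_eventually)
   qed
  qed (use ab in auto)
 qed
 have disj: "?v (A \<union> B) = ?v A + ?v B" if "A \<inter> B = {}" "A \<in> sets borel" "B \<in> sets borel"
   "emeasure lborel A < \<infinity>" "emeasure lborel B < \<infinity>" for A B :: "real set"
 proof -
  have "?v A + ?v B = abs_l2 (%x. indicator A x + indicator B x)" using that by (intro abs_l2_add indicator_L2) auto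
  also have "(%x. indicator A x + indicator B x) = (indicator (A \<union> B) :: real => complex)"
   using that(1) by (auto simp: indicator_def fun_eq_iff)
  finally show ?thesis by simp
 qed
 \<comment> \<open>Dynkin's lemma passes to complements, and only inside a bounded window do
   complements have finite measure.\<close>
 have bounded: "?v (A \<inter> {-r<..r}) \<in> S" if A: "A \<in> sets borel" and r: "r >= 0" for A r
 proof -
  have fin: "emeasure lborel (B \<inter> {-r<..r}) < \<infinity>" for B
  proof -
   have "emeasure lborel (B \<inter> {-r<..r}) <= emeasure lborel {-r<..r}" by (intro emeasure_mono) auto
   also have "... < \<infinity>" using r by simp
   finally show ?thesis .
  qed
  have st: "Int_stable (range (%(a, b). {a<..b::real}))"
  proof (rule Int_stableI_image)
   fix i j :: "real \<times> real"
   have "(case i of (a, b) => {a<..b}) \<inter> (case j of (a, b) => {a<..b}) = (case (max (fst i) (fst j), min (snd i) (snd j)) of (a, b) => {a<..b})"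
    by (cases i, cases j) auto
   then show "\<exists>k\<in>UNIV. (case i of (a, b) => {a<..b}) \<inter> (case j of (a, b) => {a<..b}) = (case k of (a, b) => {a<..b})" by blast
  qed
  have b: "sets borel = sigma_sets UNIV (range (%(a, b). {a<..b::real}))" unfolding borel_sigma_sets_Ioc by simp
  have pw: "range (%(a, b). {a<..b::real}) \<subseteq> Pow UNIV" by simp
  show ?thesis using A unfolding b
  proof (induction rule: sigma_sets_induct_disjoint[OF st pw, consumes 1, case_names basic empty compl union])
   case (basic A)
   then obtain a b where "A = {a<..b}" by auto
   then have "A \<inter> {-r<..r} = {max a (-r)<..min b r}" by auto
   then show ?case using ioc by simp
  next
   case empty
   show ?case using S(2) by (simp add: abs_l2_zero)
  next
   case (compl A)
   then have A: "A \<in> sets borel" by (simp add: b)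
   have "(- A \<inter> {-r<..r}) \<inter> (A \<inter> {-r<..r}) = {}" "(- A \<inter> {-r<..r}) \<union> (A \<inter> {-r<..r}) = {-r<..r}" by auto
   then have "?v {-r<..r} = ?v (- A \<inter> {-r<..r}) + ?v (A \<inter> {-r<..r})"
    using disj[of "- A \<inter> {-r<..r}" "A \<inter> {-r<..r}"] A fin by simp
   then have "?v (- A \<inter> {-r<..r}) = ?v {-r<..r} + (-1) *C ?v (A \<inter> {-r<..r})" by simp
   moreover have "?v {-r<..r} + (-1) *C ?v (A \<inter> {-r<..r}) \<in> S" using S(3,4) ioc compl(2) by blast
   ultimately show ?case by (simp only: Compl_eq_Diff_UNIV)
  next
   case (union A)
   then have A: "A i \<in> sets borel" for i by (auto simp: b)
   show ?case
   proof (rule lim[where B = "%n. (\<Union>i<n. A i) \<inter> {-r<..r}" and C = "{-r<..r}"])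
    show "?v ((\<Union>i<n. A i) \<inter> {-r<..r}) \<in> S" for n
    proof (induction n)
     case 0
     then show ?case using S(2) by (simp add: abs_l2_zero)
    next
     case (Suc n)
     have eq: "(\<Union>i<Suc n. A i) \<inter> {-r<..r} = ((\<Union>i<n. A i) \<inter> {-r<..r}) \<union> (A n \<inter> {-r<..r})"
      by (auto simp: lessThan_Suc)
     have dj: "((\<Union>i<n. A i) \<inter> {-r<..r}) \<inter> (A n \<inter> {-r<..r}) = {}"
     proof -
      have "A i \<inter> A n = {}" if "i < n" for i using union(1) that by (auto simp: disjoint_family_on_def)
      then show ?thesis by blast
     qed
     show ?case unfolding eq using disj[OF dj] fin A S(3) union(3) Suc by auto
    qed
    show "AE x in lborel. (%n. indicator ((\<Union>i<n. A i) \<inter> {-r<..r}) x :: complex) ----> indicator (\<Union> (range A) \<inter> {-r<..r}) x"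
    proof (rule always_eventually, rule allI)
     fix x
     have "(%n. indicator (\<Union>i<n. A i \<inter> {-r<..r}) x :: complex) ----> indicator (\<Union>i. A i \<inter> {-r<..r}) x"
      by (rule LIMSEQ_indicator_UN)
     then show "(%n. indicator ((\<Union>i<n. A i) \<inter> {-r<..r}) x :: complex) ----> indicator (\<Union> (range A) \<inter> {-r<..r}) x" by simp
    qed
   qed (use A r in auto)
  qed
 qed
 show "S = UNIV"
 proof (rule total_set_finite_indicators)
  fix A :: "real set" assume A: "A \<in> sets vol" "emeasure vol A < \<infinity>"
  show "?v A \<in> S"
  proof (rule lim[where B = "%n. A \<inter> {- real n<..real n}" and C = A])
   show "AE x in lborel. (%n. indicator (A \<inter> {- real n<..real n}) x :: complex) ----> indicator A x"
   proof (intro always_eventually allI)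
    fix x
    obtain N :: nat where N: "real N > \<bar>x\<bar>" using reals_Archimedean2 by blast
    have "(indicator (A \<inter> {- real n<..real n}) x :: complex) = indicator A x" if "n >= N" for n
     using N that by (auto simp: indicator_def)
    then show "(%n. indicator (A \<inter> {- real n<..real n}) x :: complex) ----> indicator A x"
     by (intro tendsto_eventually) (auto simp: eventually_sequentially)
   qed
  qed (use A bounded in auto)
 qed (use S in auto)
qed

lemma test_function_zero_outside:
 assumes "!!x. \<bar>x\<bar> > R ==> \<phi> x = 0" "\<bar>x\<bar> > R" shows "deriv \<phi> x = (0::real)"
proof -
 have "\<forall>\<^sub>F y in nhds x. y \<in> {y. \<bar>y\<bar> > R}"
  by (intro eventually_nhds_in_open open_Collect_less continuous_intros) (use assms in auto)
 then have "\<forall>\<^sub>F y in nhds x. \<phi> y = (%_. 0) y" by eventually_elim (use assms in auto)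
 then have "deriv \<phi> x = deriv (%_. 0) x" by (intro deriv_cong_ev refl)
 then show ?thesis by simp
qed

lemma test_function_deriv: "test_function \<phi> ==> test_function (deriv \<phi>)"
 unfolding test_function_iff using smooth_deriv test_function_zero_outside by metis

lemma test_function_continuous: "test_function \<phi> ==> continuous_on S \<phi>"
 unfolding test_function_iff using smooth_DERIV DERIV_isCont by (metis continuous_at_imp_continuous_on)

lemma test_function_has_vector_derivative:
 "test_function \<phi> ==> ((%x. cor (\<phi> x)) has_vector_derivative cor (deriv \<phi> x)) (at x)" unfolding test_function_iff
 by (intro has_vector_derivative_of_real) (simp add: smooth_DERIV flip: has_real_derivative_iff_has_vector_derivative)

lemma test_function_integrable:
 assumes f: "locally_integrable f" and \<phi>: "test_function \<phi>"
 shows "integrable lborel (%x. f x * cor (\<phi> x))"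
proof -
 obtain R where R: "!!x. \<bar>x\<bar> > R ==> \<phi> x = 0" using \<phi> unfolding test_function_iff by blast
 have "locally_integrable (%x. f x * cor (\<phi> x))" by (intro locally_integrable_mult f continuous_on_of_real test_function_continuous \<phi>)
 from locally_integrableD[OF this, of "- \<bar>R\<bar> - 1" "\<bar>R\<bar>"]
 show ?thesis
 proof (rule back_subst[where P = "integrable lborel"])
  show "(%x. indicator {- \<bar>R\<bar> - 1<..\<bar>R\<bar>} x *R (f x * cor (\<phi> x))) = (%x. f x * cor (\<phi> x))"
  proof
   fix x show "indicator {- \<bar>R\<bar> - 1<..\<bar>R\<bar>} x *R (f x * cor (\<phi> x)) = f x * cor (\<phi> x)"
     by (cases "\<bar>x\<bar> > R") (use R[of x] in "auto simp: indicator_def")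
  qed
 qed
qed

lemma locally_integrable_continuous:
 assumes "continuous_on UNIV F" shows "locally_integrable F" unfolding locally_integrable_def
proof (intro allI)
 fix a b :: real
 have "set_integrable lborel {a..b} F" using assms by (intro borel_integrable_atLeastAtMost') (auto intro: continuous_on_subset)
 then show "set_integrable lborel {a<..b} F" by (rule set_integrable_subset) auto
qed

text \<open>Integration by parts over an interval at whose ends the test function vanishes.\<close>

lemma primitive_weak_derivative:
 assumes F: "primitive F f" shows "weak_derivative F f" unfolding weak_derivative_def
proof (intro allI impI)
 fix \<phi> assume \<phi>: "test_function \<phi>"
 obtain R where R: "!!x. \<bar>x\<bar> > R ==> \<phi> x = 0" using \<phi> unfolding test_function_iff by blast
 define r where "r = \<bar>R\<bar> + 1"
 have P: "primitive (%x. cor (\<phi> x)) (%x. cor (deriv \<phi> x))"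
  by (intro primitive_C1 test_function_has_vector_derivative \<phi> continuous_on_of_real test_function_continuous test_function_deriv)
 have i: "integrable lborel (%x. f x * cor (\<phi> x))" "integrable lborel (%x. F x * cor (deriv \<phi> x))"
  using F by (auto intro!: test_function_integrable \<phi> test_function_deriv locally_integrable_continuous primitive_continuous[OF F] simp: primitive_def)
 have "0 = ioc_integral (%x. f x * cor (\<phi> x) + cor (deriv \<phi> x) * F x) (- r) r"
 proof -
  have "\<phi> r = 0" "\<phi> (- r) = 0" by (intro R; simp add: r_def)+
  moreover have "- r <= r" by (simp add: r_def)
  moreover from \<open>- r <= r\<close> have "F r * cor (\<phi> r) - F (- r) * cor (\<phi> (- r))
    = ioc_integral (%x. f x * cor (\<phi> x) + cor (deriv \<phi> x) * F x) (- r) r" using primitive_mult[OF F P] unfolding primitive_def by blast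
  ultimately show ?thesis by simp
 qed
 also have "... = (LINT x|lborel. f x * cor (\<phi> x) + F x * cor (deriv \<phi> x))" unfolding ioc_integral_def set_lebesgue_integral_def
 proof (rule lint_cong[OF refl])
  fix x
  show "indicator {- r<..r} x *R (f x * cor (\<phi> x) + cor (deriv \<phi> x) * F x)
   = f x * cor (\<phi> x) + F x * cor (deriv \<phi> x)"
   using R[of x] test_function_zero_outside[of R \<phi> x] R by (auto simp: indicator_def r_def mult.commute)
 qed
 also have "... = (LINT x|lborel. f x * cor (\<phi> x)) + (LINT x|lborel. F x * cor (deriv \<phi> x))" using i by (rule lint_add)
 finally show "(LINT x|lborel. F x * cor (deriv \<phi> x)) = - (LINT x|lborel. f x * cor (\<phi> x))" by (simp add: eq_neg_iff_add_eq_0 add.commute)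
qed


lemma weak_derivative_cong_AE:
 assumes "AE x in lborel. f x = g x" "AE x in lborel. f' x = g' x"
  "f \<in> borel_measurable borel" "g \<in> borel_measurable borel" "f' \<in> borel_measurable borel" "g' \<in> borel_measurable borel"
 shows "weak_derivative f f' \<longleftrightarrow> weak_derivative g g'"
proof -
 have "(LINT x|lborel. f x * cor (deriv \<phi> x)) = (LINT x|lborel. g x * cor (deriv \<phi> x))"
  "(LINT x|lborel. f' x * cor (\<phi> x)) = (LINT x|lborel. g' x * cor (\<phi> x))" if \<phi>: "test_function \<phi>" for \<phi>
 proof -
  have [measurable]: "\<phi> \<in> borel_measurable borel" "deriv \<phi> \<in> borel_measurable borel"
   using test_function_continuous test_function_deriv \<phi> by (blast intro: borel_measurable_continuous_onI)+
  show "(LINT x|lborel. f x * cor (deriv \<phi> x)) = (LINT x|lborel. g x * cor (deriv \<phi> x))"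
   by (rule integral_cong_AE) (use assms in "auto elim: eventually_mono")
  show "(LINT x|lborel. f' x * cor (\<phi> x)) = (LINT x|lborel. g' x * cor (\<phi> x))"
   by (rule integral_cong_AE) (use assms in "auto elim: eventually_mono")
 qed
 then show ?thesis unfolding weak_derivative_def by auto
qed

text \<open>Insert the four-step test functions and let the steps sharpen: by dominated convergence
  their derivatives become the difference of the two indicators.\<close>

lemma ioc_integral_translation_invariant:
 assumes w: "locally_integrable w"
  and 0: "!!\<phi>. test_function \<phi> ==> (LINT x|lborel. w x * cor (deriv \<phi> x)) = 0"
  and c: "c >= 0"
 shows "ioc_integral w a (a + c) = ioc_integral w b (b + c)"
proof -
 define \<psi> where "\<psi> = (%n x. smooth_step (real (Suc n) * (x - a)) - smooth_step (real (Suc n) * (x - (a + c)))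
   - smooth_step (real (Suc n) * (x - b)) + smooth_step (real (Suc n) * (x - (b + c))))"
 have ex: "\<exists>\<phi>. test_function \<phi> & deriv \<phi> = \<psi> n" for n
  unfolding \<psi>_def by (rule ex_test_function_four_steps)
 have int0: "(LINT x|lborel. w x * cor (\<psi> n x)) = 0" for n using ex[of n] 0 by metis
 have [measurable]: "w \<in> borel_measurable borel" using w by (rule locally_integrable_measurable)
 have [measurable]: "\<psi> n \<in> borel_measurable borel" for n
  using ex[of n] test_function_deriv test_function_continuous borel_measurable_continuous_onI by metis
 define r where "r = \<bar>a\<bar> + \<bar>b\<bar> + \<bar>c\<bar> + 2"
 have \<psi>0: "\<psi> n x = 0" if "x \<notin> {-r<..r}" for n x
 proof -
  have "\<bar>a\<bar> + 1 <= \<bar>x\<bar>" "\<bar>a + c\<bar> + 1 <= \<bar>x\<bar>" "\<bar>b\<bar> + 1 <= \<bar>x\<bar>" "\<bar>b + c\<bar> + 1 <= \<bar>x\<bar>"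
   using that unfolding r_def by auto
  then show ?thesis by (simp add: \<psi>_def smooth_step_far del: of_nat_Suc)
 qed
 have \<psi>b: "\<bar>\<psi> n x\<bar> <= 4" for n x
 proof -
  have "0 <= smooth_step y & smooth_step y <= 1" for y using smooth_step(4,5) by blast
  from this[of "real (Suc n) * (x - a)"] this[of "real (Suc n) * (x - (a + c))"] this[of "real (Suc n) * (x - b)"] this[of "real (Suc n) * (x - (b + c))"]
  show ?thesis unfolding \<psi>_def by linarith
 qed
 have "(%n. LINT x|lborel. w x * cor (\<psi> n x))
   ----> (LINT x|lborel. w x * cor (indicator {a<..a + c} x - indicator {b<..b + c} x))"
 proof (rule integral_dominated_convergence[where w = "%x. 4 * norm (indicator {-r<..r} x *R w x)"])
  show "integrable lborel (%x. 4 * norm (indicator {-r<..r} x *R w x))" by (intro integrable_mult_right integrable_norm locally_integrableD w)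
  show "AE x in lborel. norm (w x * cor (\<psi> n x)) <= 4 * norm (indicator {-r<..r} x *R w x)" for n
  proof (intro always_eventually allI)
   fix x
   show "norm (w x * cor (\<psi> n x)) <= 4 * norm (indicator {-r<..r} x *R w x)"
    using \<psi>0[of x n] mult_left_mono[OF \<psi>b[of n x], of "cmod (w x)"] by (cases "x \<in> {-r<..r}") (auto simp: norm_mult mult.commute)
  qed
  show "AE x in lborel. (%n. w x * cor (\<psi> n x)) ----> w x * cor (indicator {a<..a + c} x - indicator {b<..b + c} x)"
  proof (intro always_eventually allI)
   fix x
   have "(%n. \<psi> n x) ----> indicator {0<..} (x - a) - indicator {0<..} (x - (a + c)) - indicator {0<..} (x - b) + indicator {0<..} (x - (b + c))"
    unfolding \<psi>_def by (intro tendsto_add tendsto_diff smooth_step_tendsto)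
   also have "indicator {0<..} (x - a) - indicator {0<..} (x - (a + c)) - indicator {0<..} (x - b) + indicator {0<..} (x - (b + c))
     = (indicator {a<..a + c} x - indicator {b<..b + c} x :: real)" using c by (auto simp: indicator_def)
   finally show "(%n. w x * cor (\<psi> n x)) ----> w x * cor (indicator {a<..a + c} x - indicator {b<..b + c} x)" by (intro tendsto_intros)
  qed
 qed measurable
 then have "(LINT x|lborel. w x * cor (indicator {a<..a + c} x - indicator {b<..b + c} x)) = 0" unfolding int0 by (simp add: LIMSEQ_const_iff)
 moreover have "w x * cor (indicator {a<..a + c} x - indicator {b<..b + c} x) = indicator {a<..a + c} x *R w x - indicator {b<..b + c} x *R w x" for x
  by (simp add: scaleR_conv_of_real algebra_simps)
 ultimately show ?thesis
  using locally_integrableD[OF w] by (simp add: ioc_integral_def set_lebesgue_integral_def)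
qed

text \<open>The du Bois-Reymond lemma. Integrals of \<open>w\<close> depend only on the length of
  the interval, so they are linear in it for rational lengths, with slope \<open>\<kappa>\<close>.
  In every window \<open>w - \<kappa>\<close> is then orthogonal to a total set.\<close>

lemma zero_weak_derivative_const:
 assumes w: "!!a b. (%x. indicator {a<..b} x *R w x) \<in> L2 lborel" and loc: "locally_integrable w"
  and 0: "!!\<phi>. test_function \<phi> ==> (LINT x|lborel. w x * cor (deriv \<phi> x)) = 0"
 shows "\<exists>\<kappa>. AE x in lborel. w x = \<kappa>"
proof -
 have [measurable]: "w \<in> borel_measurable borel" using loc by (rule locally_integrable_measurable)
 have tr: "ioc_integral w a (a + c) = ioc_integral w 0 c" if "c >= 0" for a c
  using ioc_integral_translation_invariant[OF loc 0 that, of a 0] by simp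
 have mult: "ioc_integral w 0 (real n * c) = of_nat n * ioc_integral w 0 c" if "c >= 0" for n c
 proof (induction n)
  case (Suc n)
  have "ioc_integral w 0 (real (Suc n) * c) = ioc_integral w 0 (real n * c) + ioc_integral w (real n * c) (real n * c + c)"
   using ioc_integral_split[OF loc, of 0 "real n * c" "real n * c + c"] that by (simp add: algebra_simps)
  then show ?case using Suc tr[OF that, of "real n * c"] by (simp add: algebra_simps)
 qed (simp add: ioc_integral_def set_lebesgue_integral_def)
 define \<kappa> where "\<kappa> = ioc_integral w 0 1"
 have rat: "ioc_integral w a b = cor (b - a) * \<kappa>" if ab: "a \<in> \<rat>" "b \<in> \<rat>" "a <= b" for a b
 proof -
  obtain m n :: nat where n: "n ~= 0" "\<bar>b - a\<bar> = real m / real n" using Rats_abs_nat_div_natE[OF Rats_diff[OF ab(2,1)]] by blast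
  then have e: "b - a = real m * (1 / real n)" using ab by simp
  have "ioc_integral w a b = ioc_integral w 0 (b - a)" using tr[of "b - a" a] ab by simp
  also have "... = of_nat m * ioc_integral w 0 (1 / real n)" unfolding e by (rule mult) simp
  also have "ioc_integral w 0 (1 / real n) = \<kappa> / of_nat n" using mult[of "1 / real n" n] n by (simp add: \<kappa>_def)
  finally show ?thesis by (simp add: e)
 qed
 have zero: "AE x in lborel. indicator {-real N<..real N} x *R (w x - \<kappa>) = 0" for N :: nat
 proof -
  define h where "h x = indicator {-real N<..real N} x *R (w x - \<kappa>)" for x
  have "h = (%x. indicator {-real N<..real N} x *R w x - \<kappa> * indicator {-real N<..real N} x)" by (auto simp: h_def indicator_def fun_eq_iff)
  then have hL: "h \<in> L2 lborel" by (simp only:) (intro L2_diff L2_cmult L2_ioc w)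
  let ?S = "{v. cinner (abs_l2 h) v = 0}"
  have "?S = UNIV"
  proof (rule total_rational_ioc[unfolded total_set_def, rule_format], intro conjI)
   show "closed ?S" by (intro closed_Collect_eq continuous_on_const)
      (auto simp: continuous_on_def intro!: tendsto_cinner tendsto_intros)
   show "rational_ioc \<subseteq> ?S"
   proof
    fix v assume "v \<in> rational_ioc"
    then obtain a b where ab: "a \<in> \<rat>" "b \<in> \<rat>" "v = abs_l2 (indicator {a<..b})" by (auto simp: rational_ioc_def)
    let ?a = "max a (- real N)" and ?b = "min b (real N)"
    have "cinner (abs_l2 h) v = (LINT x|lborel. cnj (h x) * indicator {a<..b} x)"
     unfolding ab(3) using hL ioc_L2 by (subst cinner_abs_l2) (auto simp: L2_inner_def)
    also have "... = (LINT x|lborel. cnj (indicator {?a<..?b} x *R (w x - \<kappa>)))" by (intro lint_cong refl) (auto simp: h_def indicator_def)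
    also have "... = cnj (ioc_integral (%x. w x - \<kappa>) ?a ?b)" unfolding ioc_integral_def set_lebesgue_integral_def by (rule lint_cnj)
    also have "ioc_integral (%x. w x - \<kappa>) ?a ?b = 0"
    proof (cases "?a <= ?b")
     case True
     have "?a \<in> \<rat>" "?b \<in> \<rat>" using ab by (auto simp: max_def min_def)
     then have "ioc_integral w ?a ?b = cor (?b - ?a) * \<kappa>" using True by (rule rat)
     moreover have "ioc_integral (%x. w x - \<kappa>) ?a ?b = ioc_integral w ?a ?b - ioc_integral (%x. \<kappa>) ?a ?b" unfolding ioc_integral_def
      using loc locally_integrable_continuous[of "%_. \<kappa>"] by (intro set_integral_diff) (auto simp: locally_integrable_def)
     moreover have "ioc_integral (%x. \<kappa>) ?a ?b = cor (?b - ?a) * \<kappa>"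
     proof -
      have "primitive (%x. cor x * \<kappa>) (%_. 1 * \<kappa>)"
       by (intro primitive_C1 has_vector_derivative_mult_left has_vector_derivative_of_real) (auto intro!: derivative_eq_intros)
      then have "cor ?b * \<kappa> - cor ?a * \<kappa> = ioc_integral (%x. \<kappa>) ?a ?b" using True unfolding primitive_def mult_1 by blast
      then show ?thesis by (simp add: left_diff_distrib)
     qed
     ultimately show ?thesis by simp
    next
     case False
     then have "{?a<..?b} = {}" by auto
     then show ?thesis by (simp only: ioc_integral_def set_lebesgue_integral_def) simp
    qed
    finally show "v \<in> ?S" by simp
   qed
  qed (auto simp: cinner_add_right cinner_scaleC_right)
  then have "cinner (abs_l2 h) (abs_l2 h) = 0" by blast
  then have "norm (abs_l2 h) = 0" by (simp add: cinner_self)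
  then have "AE x in lborel. h x = 0" using L2_norm_zero_iff[OF hL] norm_abs_l2[of h] hL by simp
  then show ?thesis by (simp add: h_def)
 qed
 then have "AE x in lborel. \<forall>N::nat. indicator {-real N<..real N} x *R (w x - \<kappa>) = 0" using zero unfolding AE_all_countable by blast
 then have "AE x in lborel. w x = \<kappa>"
 proof eventually_elim
  case (elim x)
  obtain N :: nat where "real N > \<bar>x\<bar>" using reals_Archimedean2 by blast
  then show ?case using elim[rule_format, of N] by (auto simp: indicator_def split: if_splits)
 qed
 then show ?thesis by blast
qed

lemma L2_indicator_mult:
 assumes "f \<in> L2 lborel" shows "(%x. indicator {a<..b::real} x *R f x) \<in> L2 lborel"
 using assms by (intro L2_bound[OF assms, where B = 1]) (auto simp: indicator_def L2_def)

lemma L2_indicator_mult_continuous: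
 assumes F: "continuous_on UNIV F" shows "(%x. indicator {a<..b::real} x *R (F x :: complex)) \<in> L2 lborel"
proof -
 obtain B where B: "!!x. x \<in> {a..b} ==> norm (F x) <= B" by (rule continuous_bounded_Icc[OF F, where a = a and b = b]) blast
 have [measurable]: "F \<in> borel_measurable borel" using F by (rule borel_measurable_continuous_onI)
 have "cmod (indicator {a<..b} x *R F x) <= B * cmod (indicator {a<..b} x)" for x
  using B[of x] by (auto simp: indicator_def)
 then show ?thesis by (intro L2_bound[OF ioc_L2[of a b], where B = B]) auto
qed

text \<open>Any primitive of \<open>f'\<close> has the same weak derivative as \<open>f\<close>, so
  it differs from \<open>f\<close> by a constant, which can be absorbed.\<close>

lemma weak_derivative_primitive:
 assumes f: "f \<in> L2 lborel" and f': "f' \<in> L2 lborel" and wd: "weak_derivative f f'"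
 shows "EX F. primitive F f' & (AE x in lborel. f x = F x)"
proof -
 obtain F where F: "primitive F f'" using primitive_base[OF L2_locally_integrable[OF f']] by blast
 have lF: "locally_integrable F" using F by (intro locally_integrable_continuous primitive_continuous)
 have lf: "locally_integrable f" using f by (rule L2_locally_integrable)
 have "\<exists>\<kappa>. AE x in lborel. f x - F x = \<kappa>"
 proof (rule zero_weak_derivative_const)
  show "(%x. indicator {a<..b} x *R (f x - F x)) \<in> L2 lborel" for a b
   using L2_diff[OF L2_indicator_mult[OF f] L2_indicator_mult_continuous[OF primitive_continuous[OF F]], of a b a b]
   by (simp add: scaleR_right_diff_distrib)
  show "locally_integrable (%x. f x - F x)" using lf lF unfolding locally_integrable_def by (auto intro: set_integral_diff)
  fix \<phi> assume \<phi>: "test_function \<phi>"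
  have "(LINT x|lborel. f x * cor (deriv \<phi> x)) = (LINT x|lborel. F x * cor (deriv \<phi> x))"
   using wd primitive_weak_derivative[OF F] \<phi> unfolding weak_derivative_def by simp
  then show "(LINT x|lborel. (f x - F x) * cor (deriv \<phi> x)) = 0"
   using test_function_integrable[OF lf test_function_deriv[OF \<phi>]] test_function_integrable[OF lF test_function_deriv[OF \<phi>]]
   by (simp add: left_diff_distrib)
 qed
 then obtain \<kappa> where "AE x in lborel. f x - F x = \<kappa>" ..
 then have "AE x in lborel. f x = F x + \<kappa>" by eventually_elim (simp add: algebra_simps)
 moreover have "primitive (%x. F x + \<kappa>) f'" using F by (simp add: primitive_def)
 ultimately show ?thesis by blast
qed

section \<open>The momentum operator on the line\<close>

instance l2 :: (l2_space) banach ..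

lemma tendsto_integrable_zero:
 fixes q :: "real => complex"
 assumes q: "integrable lborel q" and lim: "(q ---> L) at_top"
 shows "L = 0"
proof (rule ccontr)
 assume "L ~= 0"
 define c where "c = cmod L / 2"
 have c: "c > 0" using \<open>L ~= 0\<close> by (simp add: c_def)
 have "((%x. cmod (q x)) ---> cmod L) at_top" using lim by (rule tendsto_norm)
 then have "\<forall>\<^sub>F x in at_top. c < cmod (q x)" by (rule order_tendstoD) (use c in "simp add: c_def")
 then obtain N where N: "!!x. x >= N ==> c < cmod (q x)" unfolding eventually_at_top_linorder by blast
 have "c * real m <= (LINT x|lborel. cmod (q x))" for m :: nat
 proof -
  have "c * real m = (LINT x|lborel. c * indicator {N<..N + real m} x)" by (simp add: measure_def)
  also have "... <= (LINT x|lborel. cmod (q x))"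
  proof (rule integral_mono)
   show "integrable lborel (%x. c * indicator {N<..N + real m} x)" by (intro integrable_mult_right integrable_real_indicator) auto
   show "c * indicator {N<..N + real m} x <= cmod (q x)" for x using N[of x] c by (auto simp: indicator_def less_imp_le)
  qed (use q in simp)
  finally show ?thesis .
 qed
 moreover obtain m :: nat where "real m * c > (LINT x|lborel. cmod (q x))" using reals_Archimedean3[OF c] by blast
 ultimately show False by (metis mult.commute not_less)
qed

lemma primitive_cnj:
 assumes "primitive F f" shows "primitive (%x. cnj (F x)) (%x. cnj (f x))"
proof -
 have "ioc_integral (%x. cnj (f x)) a b = cnj (ioc_integral f a b)" for a b
  unfolding ioc_integral_def set_lebesgue_integral_def
  using lint_cnj[of lborel "%x. indicator {a<..b} x *R f x"] by simp
 moreover have "locally_integrable (%x. cnj (f x))" unfolding locally_integrable_def set_integrable_def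
 proof (intro allI)
  fix a b
  have "integrable lborel (%x. cnj (indicator {a<..b} x *R f x))" using assms by (intro integrable_cnj locally_integrableD) (simp add: primitive_def)
  then show "integrable lborel (%x. indicator {a<..b} x *R cnj (f x))" by simp
 qed
 ultimately show ?thesis using assms unfolding primitive_def by (simp flip: complex_cnj_diff)
qed

text \<open>The limits at both ends exist because \<open>r\<close> is integrable, and they vanish
  because \<open>Q\<close> is.\<close>

lemma primitive_integrable_limits:
 assumes Q: "primitive Q r" and q: "integrable lborel Q" and r: "integrable lborel r"
 shows "(Q ---> 0) at_top" "(Q ---> 0) at_bot" "(LINT x|lborel. r x) = 0"
proof -
 have [measurable]: "r \<in> borel_measurable borel" using r by simp
 have dct: "((%t. LINT x|lborel. indicator (A t) x *R r x) ---> (LINT x|lborel. indicator B x *R r x)) at_top"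
  if "!!t. A t \<in> sets borel" "B \<in> sets borel" "!!x. \<forall>\<^sub>F t in at_top. x \<in> A t \<longleftrightarrow> x \<in> B" for A :: "real => real set" and B
 proof (rule integral_dominated_convergence_at_top[where w = "%x. norm (r x)"])
  show "AE x in lborel. ((%t. indicator (A t) x *R r x) ---> indicator B x *R r x) at_top"
  proof (rule always_eventually, rule allI, rule tendsto_eventually)
   fix x show "\<forall>\<^sub>F t in at_top. indicator (A t) x *R r x = indicator B x *R r x"
    using that(3)[of x] by eventually_elim (simp add: indicator_def)
  qed
  show "\<forall>\<^sub>F t in at_top. AE x in lborel. norm (indicator (A t) x *R r x) <= norm (r x)"
   by (intro always_eventually allI) (auto simp: indicator_def)
 qed (use that r in auto)
 have up: "((%t. Q 0 + (LINT x|lborel. indicator {0<..t} x *R r x)) ---> Q 0 + (LINT x|lborel. indicator {0<..} x *R r x)) at_top"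
 proof (intro tendsto_add tendsto_const dct)
  show "\<forall>\<^sub>F t in at_top. (x \<in> {0<..t}) = (x \<in> {0<..})" for x :: real
   using eventually_ge_at_top[of x] by eventually_elim auto
 qed auto
 have "(Q ---> Q 0 + (LINT x|lborel. indicator {0<..} x *R r x)) at_top"
 proof (rule Lim_transform_eventually[OF up])
  show "\<forall>\<^sub>F t in at_top. Q 0 + (LINT x|lborel. indicator {0<..t} x *R r x) = Q t" using eventually_ge_at_top[of 0]
  proof eventually_elim
   case (elim t)
   then have "Q t - Q 0 = (LINT x|lborel. indicator {0<..t} x *R r x)"
    using Q unfolding primitive_def ioc_integral_def set_lebesgue_integral_def by blast
   then show ?case by (simp add: algebra_simps)
  qed
 qed
 with tendsto_integrable_zero[OF q this] show 1: "(Q ---> 0) at_top" by simp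
 have down: "((%t. Q 0 - (LINT x|lborel. indicator {-t<..0} x *R r x)) ---> Q 0 - (LINT x|lborel. indicator {..0} x *R r x)) at_top"
 proof (intro tendsto_diff tendsto_const dct)
  show "\<forall>\<^sub>F t in at_top. (x \<in> {-t<..0}) = (x \<in> {..0})" for x :: real
   using eventually_gt_at_top[of "-x"] by eventually_elim auto
 qed auto
 have "((%t. Q (- t)) ---> Q 0 - (LINT x|lborel. indicator {..0} x *R r x)) at_top"
 proof (rule Lim_transform_eventually[OF down])
  show "\<forall>\<^sub>F t in at_top. Q 0 - (LINT x|lborel. indicator {-t<..0} x *R r x) = Q (- t)" using eventually_ge_at_top[of 0]
  proof eventually_elim
   case (elim t)
   then have "Q 0 - Q (- t) = (LINT x|lborel. indicator {-t<..0} x *R r x)"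
    using Q unfolding primitive_def ioc_integral_def set_lebesgue_integral_def by (meson neg_le_0_iff_le)
   then show ?case by (simp add: algebra_simps)
  qed
 qed
 moreover have "integrable lborel (%t. Q (- t))" using lborel_integrable_real_affine[OF q, of "-1" 0] by simp
 ultimately have 2: "((%t. Q (- t)) ---> 0) at_top" using tendsto_integrable_zero by metis
 then show "(Q ---> 0) at_bot" by (simp add: filterlim_at_bot_mirror)
 have "((%t. LINT x|lborel. indicator {-t<..t} x *R r x) ---> (LINT x|lborel. indicator UNIV x *R r x)) at_top"
 proof (rule dct)
  show "\<forall>\<^sub>F t in at_top. (x \<in> {-t<..t}) = (x \<in> UNIV)" for x :: real
   using eventually_gt_at_top[of "-x"] eventually_ge_at_top[of x] by eventually_elim auto
 qed auto
 moreover have "((%t. Q t - Q (- t)) ---> 0 - 0) at_top" by (intro tendsto_diff 1 2)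
 moreover have "\<forall>\<^sub>F t in at_top. Q t - Q (- t) = (LINT x|lborel. indicator {-t<..t} x *R r x)" using eventually_ge_at_top[of 0]
 proof eventually_elim
  case (elim t)
  then have "- t <= t" by simp
  then show ?case using Q unfolding primitive_def ioc_integral_def set_lebesgue_integral_def by blast
 qed
 ultimately have "((%t. LINT x|lborel. indicator {-t<..t} x *R r x) ---> 0) at_top" using Lim_transform_eventually by fastforce
 then show "(LINT x|lborel. r x) = 0"
  using tendsto_unique[OF _ _ \<open>((%t. LINT x|lborel. indicator {-t<..t} x *R r x) ---> (LINT x|lborel. indicator UNIV x *R r x)) at_top\<close>] by simp
qed

text \<open>The preceding lemma applied to |F|^2, whose derivative is twice the real part of
  \<open>cnj (F x) * f x\<close>.\<close>

lemma H1_facts: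
 assumes F: "primitive F f" and FL: "F \<in> L2 lborel" and fL: "f \<in> L2 lborel"
 shows "(F ---> 0) at_top" "(F ---> 0) at_bot" "Re (LINT x|lborel. cnj (F x) * f x) = 0"
proof -
 let ?Q = "%x. F x * cnj (F x)" and ?r = "%x. f x * cnj (F x) + cnj (f x) * F x"
 have i: "integrable lborel (%x. f x * cnj (F x))" "integrable lborel (%x. cnj (f x) * F x)" by (intro L2_mult_integrable L2_cnj FL fL)+
 have "primitive ?Q ?r" by (rule primitive_mult[OF F primitive_cnj[OF F]])
 moreover have "integrable lborel ?Q" by (intro L2_mult_integrable L2_cnj FL)
 moreover have "integrable lborel ?r" using i by (rule lintegrable_add)
 ultimately have l: "(?Q ---> 0) at_top" "(?Q ---> 0) at_bot" "(LINT x|lborel. ?r x) = 0" by (rule primitive_integrable_limits)+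
 have "(F ---> 0) G" if "(?Q ---> 0) G" for G
 proof -
  have "((%x. sqrt (cmod (?Q x))) ---> sqrt (cmod 0)) G" using that by (intro tendsto_real_sqrt tendsto_norm)
  then have "((%x. cmod (F x)) ---> 0) G" by (simp add: norm_mult)
  then show ?thesis by (rule tendsto_norm_zero_cancel)
 qed
 with l(1,2) show "(F ---> 0) at_top" "(F ---> 0) at_bot" by blast+
 have "0 = (LINT x|lborel. f x * cnj (F x)) + (LINT x|lborel. cnj (f x) * F x)" using l(3) lint_add[OF i] by simp
 also have "(LINT x|lborel. cnj (f x) * F x) = cnj (LINT x|lborel. f x * cnj (F x))" using lint_cnj[of lborel "%x. f x * cnj (F x)"] by simp
 finally have "Re (LINT x|lborel. f x * cnj (F x)) = 0" by (simp add: complex_eq_iff)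
 then show "Re (LINT x|lborel. cnj (F x) * f x) = 0" by (simp add: mult.commute)
qed

text \<open>The weak derivative d/dx itself, without a factor -i, so that it is skew. Defined by
  pairing with test functions it is visibly a closed graph.\<close>

definition momentum :: "(real l2 \<times> real l2) set" where
 "momentum = {(v, w). \<forall>\<phi>. test_function \<phi> -->
   cinner (abs_l2 (%x. cor (deriv \<phi> x))) v = - cinner (abs_l2 (%x. cor (\<phi> x))) w}"

lemma test_function_L2:
 assumes \<phi>: "test_function \<phi>" shows "(%x. cor (\<phi> x)) \<in> L2 lborel"
proof -
 obtain R where R: "!!x. \<bar>x\<bar> > R ==> \<phi> x = 0" using \<phi> unfolding test_function_iff by blast
 have "(%x. indicator {- \<bar>R\<bar> - 1<..\<bar>R\<bar>} x *R cor (\<phi> x)) \<in> L2 lborel"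
  by (intro L2_indicator_mult_continuous continuous_on_of_real test_function_continuous \<phi>)
 moreover have "(%x. indicator {- \<bar>R\<bar> - 1<..\<bar>R\<bar>} x *R cor (\<phi> x)) = (%x. cor (\<phi> x))"
 proof
  fix x show "indicator {- \<bar>R\<bar> - 1<..\<bar>R\<bar>} x *R cor (\<phi> x) = cor (\<phi> x)"
   by (cases "\<bar>x\<bar> > R") (use R[of x] in "auto simp: indicator_def")
 qed
 ultimately show ?thesis by simp
qed

lemma momentum_iff:
 assumes "f \<in> L2 lborel" "f' \<in> L2 lborel"
 shows "(abs_l2 f, abs_l2 f') \<in> momentum \<longleftrightarrow> weak_derivative f f'"
proof -
 have "cinner (abs_l2 (%x. cor (\<phi> x))) (abs_l2 g) = (LINT x|lborel. g x * cor (\<phi> x))"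
  if "test_function \<phi>" "g \<in> L2 lborel" for \<phi> g
  using that test_function_L2[OF that(1)] by (simp add: cinner_abs_l2 L2_inner_def mult.commute)
 then show ?thesis using assms test_function_deriv by (simp add: momentum_def weak_derivative_def)
qed

lemma momentum_primitiveI:
 assumes "primitive F f" "F \<in> L2 lborel" "f \<in> L2 lborel" shows "(abs_l2 F, abs_l2 f) \<in> momentum"
 using assms by (simp add: momentum_iff primitive_weak_derivative)

lemma momentum_primitiveE:
 assumes "(v, w) \<in> momentum"
 obtains F f where "primitive F f" "F \<in> L2 lborel" "f \<in> L2 lborel" "v = abs_l2 F" "w = abs_l2 f"
proof -
 obtain g g' where g: "g \<in> L2 lborel" "v = abs_l2 g" "g' \<in> L2 lborel" "w = abs_l2 g'" by (metis vol_lborel l2_cases)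
 have wd: "weak_derivative g g'" using assms g by (simp add: momentum_iff)
 obtain F where F: "primitive F g'" "AE x in lborel. g x = F x" using weak_derivative_primitive[OF g(1,3) wd] by blast
 have "F \<in> L2 lborel" using F g(1) primitive_measurable by (intro L2_AE_cong[OF g(1)]) auto
 moreover have "v = abs_l2 F" using calculation F g(1,2) abs_l2_eq_iff[of g F] unfolding vol_lborel by simp
 ultimately show thesis using that F g by blast
qed

lemma subspace_momentum: "subspace momentum" unfolding subspace_def momentum_def
 by (auto simp: zero_prod_def cinner_add_right cinner_scaleC_right simp flip: scaleC_of_real)

lemma momentum_add: "(v, w) \<in> momentum ==> (v', w') \<in> momentum ==> (v + v', w + w') \<in> momentum"
 using subspace_add[OF subspace_momentum, of "(v, w)" "(v', w')"] by simp

lemma momentum_scaleC: "(v, w) \<in> momentum ==> (c *C v, c *C w) \<in> momentum" by (auto simp: momentum_def cinner_scaleC_right)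

lemma momentum_diff: "(v, w) \<in> momentum ==> (v', w') \<in> momentum ==> (v - v', w - w') \<in> momentum"
 using subspace_diff[OF subspace_momentum, of "(v, w)" "(v', w')"] by simp

lemma closed_momentum: "closed momentum"
proof -
 have "momentum = (\<Inter>\<phi>\<in>Collect test_function. {p. cinner (abs_l2 (%x. cor (deriv \<phi> x))) (fst p) = - cinner (abs_l2 (%x. cor (\<phi> x))) (snd p)})"
  by (auto simp: momentum_def)
 moreover have "closed ..." by (intro closed_INT ballI closed_Collect_eq; simp only: continuous_on_def;
    intro ballI tendsto_cinner tendsto_minus tendsto_fst tendsto_snd tendsto_const tendsto_ident_at)
 ultimately show ?thesis by simp
qed

lemma momentum_skew: assumes "(v, w) \<in> momentum" shows "v \<bullet> w = 0"
proof -
 obtain F f where F: "primitive F f" "F \<in> L2 lborel" "f \<in> L2 lborel" "v = abs_l2 F" "w = abs_l2 f" using assms by (rule momentum_primitiveE)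
 have "Re (LINT x|lborel. cnj (F x) * f x) = 0" by (rule H1_facts(3)) fact+
 then show ?thesis using F by (simp add: inner_l2_def cinner_abs_l2 L2_inner_def)
qed

text \<open>A function whose sum with its derivative is the indicator of \<open>{a<..}\<close>. It
  tends to 1 at infinity, so only the difference for two end points is square integrable.\<close>

lemma right_exponential:
 "primitive (%x. cor (1 - exp (a - max x a))) (%x. cor (indicator {a<..} x * exp (a - x)))"
 "(%x. cor (indicator {a<..} x * exp (a - x))) \<in> L2 lborel"
proof -
 have int: "integrable lborel (%x. (cmod (cor (indicator {a<..} x * exp (a - x))))\<^sup>2)"
 proof -
  have "(\<integral>\<^sup>+x. ennreal (exp (2 * (a - x))) * indicator {a..} x \<partial>lborel) = ennreal (0 - (- exp (2 * (a - a)) / 2))"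
  proof (rule nn_integral_FTC_atLeast[where F = "%x. - exp (2 * (a - x)) / 2"])
   show "((%x. - exp (2 * (a - x)) / 2) ---> 0) at_top" by real_asymp
   show "((%x. - exp (2 * (a - x)) / 2) has_real_derivative exp (2 * (a - x))) (at x)" for x
    by (auto intro!: derivative_eq_intros)
  qed auto
  then have fin: "(\<integral>\<^sup>+x. ennreal (exp (2 * (a - x))) * indicator {a..} x \<partial>lborel) < \<infinity>"
   by (simp only: infinity_ennreal_def ennreal_less_top)
  have "(\<integral>\<^sup>+x. ennreal (norm ((cmod (cor (indicator {a<..} x * exp (a - x))))\<^sup>2)) \<partial>lborel)
    <= (\<integral>\<^sup>+x. ennreal (exp (2 * (a - x))) * indicator {a..} x \<partial>lborel)"
  proof (rule nn_integral_mono)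
   fix x
   have "(exp (a - x))\<^sup>2 = exp (2 * (a - x))" by (rule exp_double[symmetric])
   then show "ennreal (norm ((cmod (cor (indicator {a<..} x * exp (a - x))))\<^sup>2)) <= ennreal (exp (2 * (a - x))) * indicator {a..} x"
    by (auto simp: indicator_def)
  qed
  then show ?thesis using fin by (intro integrableI_bounded) auto
 qed
 then show "(%x. cor (indicator {a<..} x * exp (a - x))) \<in> L2 lborel" by (simp add: L2_def)
 then have loc: "locally_integrable (%x. cor (indicator {a<..} x * exp (a - x)))" by (rule L2_locally_integrable)
 have P: "primitive (%x. cor (1 - exp (a - x))) (%x. cor (exp (a - x)))" by (intro primitive_C1 has_vector_derivative_of_real continuous_intros)
   (auto intro!: derivative_eq_intros simp flip: has_real_derivative_iff_has_vector_derivative)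
 show "primitive (%x. cor (1 - exp (a - max x a))) (%x. cor (indicator {a<..} x * exp (a - x)))" unfolding primitive_def
 proof (intro conjI allI impI loc)
  fix s t :: real assume "s <= t"
  then have "max s a <= max t a" by auto
  then have "cor (1 - exp (a - max t a)) - cor (1 - exp (a - max s a)) = ioc_integral (%x. cor (exp (a - x))) (max s a) (max t a)"
   using P unfolding primitive_def by blast
  also have "... = ioc_integral (%x. cor (indicator {a<..} x * exp (a - x))) s t" unfolding ioc_integral_def set_lebesgue_integral_def
   by (intro lint_cong refl) (auto simp: indicator_def)
  finally show "cor (1 - exp (a - max t a)) - cor (1 - exp (a - max s a)) = ioc_integral (%x. cor (indicator {a<..} x * exp (a - x))) s t" .
 qed
qed

lemma L2_reflection: assumes "f \<in> L2 lborel" shows "(%x. f (c - x :: real)) \<in> L2 lborel"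
proof -
 have [measurable]: "f \<in> borel_measurable borel" using assms by (simp add: L2_def)
 have "(%x. f (c - x)) \<in> borel_measurable borel" by measurable
 then show ?thesis using lborel_integrable_real_affine[OF L2_integrable[OF assms], of "-1" c] by (simp add: L2_def)
qed

lemma left_exponential:
 "primitive (%x. cor (exp (min x b - b) - 1)) (%x. cor (indicator {..b} x * exp (x - b)))"
 "(%x. cor (indicator {..b} x * exp (x - b))) \<in> L2 lborel"
proof -
 have "(%x. cor (indicator {..<b} x * exp (x - b))) \<in> L2 lborel"
 proof -
  have "(%x. cor (indicator {- b<..} (- x) * exp (- b - (- x)))) = (%x. cor (indicator {..<b} x * exp (x - b)))"
   by (auto simp: indicator_def fun_eq_iff)
  then show ?thesis using L2_reflection[OF right_exponential(2)[of "- b"], of 0] by simp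
 qed
 then show L: "(%x. cor (indicator {..b} x * exp (x - b))) \<in> L2 lborel"
 proof (rule L2_AE_cong)
  show "AE x in lborel. cor (indicator {..<b} x * exp (x - b)) = cor (indicator {..b} x * exp (x - b))"
   using AE_not_point[of b] by eventually_elim (auto simp: indicator_def)
 qed measurable
 then have loc: "locally_integrable (%x. cor (indicator {..b} x * exp (x - b)))" by (rule L2_locally_integrable)
 have P: "primitive (%x. cor (exp (x - b) - 1)) (%x. cor (exp (x - b)))" by (intro primitive_C1 has_vector_derivative_of_real continuous_intros)
   (auto intro!: derivative_eq_intros simp flip: has_real_derivative_iff_has_vector_derivative)
 show "primitive (%x. cor (exp (min x b - b) - 1)) (%x. cor (indicator {..b} x * exp (x - b)))" unfolding primitive_def
 proof (intro conjI allI impI loc)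
  fix s t :: real assume "s <= t"
  then have "min s b <= min t b" by auto
  then have "cor (exp (min t b - b) - 1) - cor (exp (min s b - b) - 1) = ioc_integral (%x. cor (exp (x - b))) (min s b) (min t b)"
   using P unfolding primitive_def by blast
  also have "... = ioc_integral (%x. cor (indicator {..b} x * exp (x - b))) s t" unfolding ioc_integral_def set_lebesgue_integral_def
   by (intro lint_cong refl) (auto simp: indicator_def)
  finally show "cor (exp (min t b - b) - 1) - cor (exp (min s b - b) - 1) = ioc_integral (%x. cor (indicator {..b} x * exp (x - b))) s t" .
 qed
qed

lemma primitive_diff: "primitive F f ==> primitive G g ==> primitive (%x. F x - G x) (%x. f x - g x)"
proof -
 assume F: "primitive F f" and G: "primitive G g"
 then have i: "set_integrable lborel {a<..b} f" "set_integrable lborel {a<..b} g" for a b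
  by (auto simp: primitive_def locally_integrable_def)
 have "ioc_integral (%x. f x - g x) a b = ioc_integral f a b - ioc_integral g a b" for a b
  unfolding ioc_integral_def by (rule set_integral_diff(2)[OF i])
 moreover have "locally_integrable (%x. f x - g x)" using set_integral_diff(1)[OF i] by (simp add: locally_integrable_def)
 ultimately show ?thesis using F G unfolding primitive_def by (simp add: algebra_simps)
qed

text \<open>The resolvent of d/dx convolves with a one-sided exponential: left exponentials solve F
  - F' = 1 on the interval and 0 outside, right exponentials solve the equation with a plus
  sign.\<close>

lemma momentum_surj_ioc:
 assumes ab: "a <= b" and h: "h = 1 | h = -1"
 shows "EX f g. (f, g) \<in> momentum & abs_l2 (indicator {a<..b}) = f - h *R g"
proof -
 have case_sub: ?thesis if P: "primitive F f" and f: "f \<in> L2 lborel" and eq: "!!x. indicator {a<..b} x = F x - cor h * f x" for F f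
 proof -
  have "F = (%x. indicator {a<..b} x + cor h * f x)" using eq by (auto simp: fun_eq_iff)
  then have F: "F \<in> L2 lborel" by (simp only:) (intro L2_add L2_cmult f ioc_L2)
  have "abs_l2 (indicator {a<..b}) = abs_l2 (%x. F x - cor h * f x)" using eq by (intro arg_cong[where f = abs_l2]) auto
  also have "... = abs_l2 F - h *R abs_l2 f" using F f by (simp add: abs_l2_scaleR abs_l2_diff L2_cmult)
  finally show ?thesis using momentum_primitiveI[OF P F f] by blast
 qed
 show ?thesis using h
 proof
  assume h: "h = 1"
  show ?thesis
  proof (rule case_sub[OF primitive_diff[OF left_exponential(1)[of a] left_exponential(1)[of b]] L2_diff[OF left_exponential(2)[of a] left_exponential(2)[of b]]])
   fix x show "indicator {a<..b} x = cor (exp (min x a - a) - 1) - cor (exp (min x b - b) - 1)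
     - cor h * (cor (indicator {..a} x * exp (x - a)) - cor (indicator {..b} x * exp (x - b)))"
    using h ab by (cases "x <= a"; cases "x <= b") (auto simp: indicator_def)
  qed
 next
  assume h: "h = -1"
  show ?thesis
  proof (rule case_sub[OF primitive_diff[OF right_exponential(1)[of a] right_exponential(1)[of b]] L2_diff[OF right_exponential(2)[of a] right_exponential(2)[of b]]])
   fix x show "indicator {a<..b} x = cor (1 - exp (a - max x a)) - cor (1 - exp (b - max x b))
     - cor h * (cor (indicator {a<..} x * exp (a - x)) - cor (indicator {b<..} x * exp (b - x)))"
    using h ab by (cases "x <= a"; cases "x <= b") (auto simp: indicator_def max_def)
  qed
 qed
qed

lemma abs_l2_indicator_empty: "abs_l2 (indicator {}) = 0" using abs_l2_zero by (simp add: indicator_def[abs_def])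

text \<open>For h of modulus 1 the map (f, g) to f - h g is isometric on the closed graph, so its
  range is a closed subspace; it contains a total set.\<close>

lemma momentum_surj:
 assumes h: "h = 1 | h = -1"
 shows "EX f g. (f, g) \<in> momentum & v = f - h *R g"
proof -
 define L where "L = (%p :: real l2 \<times> real l2. fst p - h *R snd p)"
 have bl: "bounded_linear L" unfolding L_def
  by (intro bounded_linear_sub bounded_linear_fst bounded_linear_const_scaleR bounded_linear_snd)
 have "uniform_space_class.complete (L ` momentum)"
 proof (rule complete_isometric_image[where e = 1])
  show "\<forall>p\<in>momentum. 1 * norm p <= norm (L p)"
  proof
   fix p assume p: "p \<in> momentum"
   obtain f g where fg: "p = (f, g)" by (cases p)
   have "f \<bullet> g = 0" using momentum_skew p fg by simp
   then have "(norm (L p))\<^sup>2 = (norm f)\<^sup>2 + (norm g)\<^sup>2"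
    using h by (auto simp: L_def fg power2_norm_eq_inner algebra_simps inner_commute)
   then show "1 * norm p <= norm (L p)" by (simp add: fg norm_Pair real_sqrt_le_iff real_le_lsqrt)
  qed
  show "uniform_space_class.complete momentum" using closed_momentum by (simp add: complete_eq_closed)
 qed (use bl subspace_momentum in auto)
 then have cl: "closed (L ` momentum)" by (rule complete_imp_closed)
 have "L ` momentum = UNIV"
 proof (rule total_rational_ioc[unfolded total_set_def, rule_format], intro conjI)
  show "0 \<in> L ` momentum" using subspace_0[OF subspace_momentum] by (auto simp: L_def intro!: image_eqI[of _ _ 0])
  show "\<forall>v\<in>L ` momentum. \<forall>w\<in>L ` momentum. v + w \<in> L ` momentum"
   using subspace_add[OF subspace_momentum] linear_add[OF bounded_linear.linear[OF bl]] by (metis (no_types, lifting) imageE imageI)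
  show "ALL c. \<forall>v\<in>L ` momentum. c *C v \<in> L ` momentum"
  proof clarify
   fix c f g assume "(f, g) \<in> momentum"
   moreover have "c *C L (f, g) = L (c *C f, c *C g)" by (simp add: L_def scaleC_diff_right scaleC_scaleR)
   ultimately show "c *C L (f, g) \<in> L ` momentum" using momentum_scaleC by (metis imageI)
  qed
  show "rational_ioc \<subseteq> L ` momentum"
  proof
   fix v assume "v \<in> rational_ioc"
   then obtain a b where v: "v = abs_l2 (indicator {a<..b})" by (auto simp: rational_ioc_def)
   show "v \<in> L ` momentum"
   proof (cases "a <= b")
    case True
    obtain f g where "(f, g) \<in> momentum" "v = f - h *R g" using momentum_surj_ioc[OF True h] unfolding v by blast
    then show ?thesis by (auto simp: L_def intro!: image_eqI[of _ _ "(f, g)"])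
   next
    case False
    then have "{a<..b} = {}" by auto
    then have "v = 0" by (simp only: v abs_l2_indicator_empty)
    then show ?thesis using subspace_0[OF subspace_momentum] by (auto simp: L_def intro!: image_eqI[of _ _ 0])
   qed
  qed
 qed (use cl in auto)
 then obtain p where "p \<in> momentum" "v = L p" by (metis UNIV_I imageE)
 then show ?thesis by (cases p) (auto simp: L_def)
qed

lemma test_function_momentum:
 assumes "test_function \<phi>"
 shows "(abs_l2 (%x. cor (\<phi> x)), abs_l2 (%x. cor (deriv \<phi> x))) \<in> momentum"
 using assms by (intro momentum_primitiveI primitive_C1 test_function_has_vector_derivative continuous_on_of_real
   test_function_continuous test_function_deriv test_function_L2)

text \<open>Differences of two smooth steps converge in L^2 to the indicators of intervals, which
  are total.\<close>

lemma dense_test_functions: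
 assumes D: "subspace D" "!!c v. v \<in> D ==> c *C v \<in> D"
  and t: "!!\<phi>. test_function \<phi> ==> abs_l2 (%x. cor (\<phi> x)) \<in> D"
 shows "closure D = UNIV"
proof (rule total_rational_ioc[unfolded total_set_def, rule_format], intro conjI)
 show "0 \<in> closure D" using subspace_0[OF D(1)] closure_subset by blast
 show "\<forall>v\<in>closure D. \<forall>w\<in>closure D. v + w \<in> closure D"
 proof (intro ballI)
  fix v w assume "v \<in> closure D" "w \<in> closure D"
  then obtain f g where "ALL n. f n \<in> D" "f ----> v" "ALL n. g n \<in> D" "g ----> w" by (auto simp: closure_sequential)
  then show "v + w \<in> closure D" unfolding closure_sequential
   by (intro exI[of _ "%n. f n + g n"]) (auto intro: tendsto_add subspace_add[OF D(1)])
 qed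
 show "ALL c. \<forall>v\<in>closure D. c *C v \<in> closure D"
 proof (intro allI ballI)
  fix c v assume "v \<in> closure D"
  then obtain f where "ALL n. f n \<in> D" "f ----> v" by (auto simp: closure_sequential)
  then show "c *C v \<in> closure D" unfolding closure_sequential
   by (intro exI[of _ "%n. c *C f n"]) (auto intro: bounded_linear.tendsto[OF bounded_linear_scaleC] D(2))
 qed
 show "rational_ioc \<subseteq> closure D"
 proof
  fix v assume "v \<in> rational_ioc"
  then obtain a b where v: "v = abs_l2 (indicator {a<..b})" by (auto simp: rational_ioc_def)
  show "v \<in> closure D"
  proof (cases "a <= b")
   case False
   then have "{a<..b} = {}" by auto
   then have "v = 0" by (simp only: v abs_l2_indicator_empty)
   then show ?thesis using subspace_0[OF D(1)] closure_subset by blast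
  next
   case True
   define \<phi> where "\<phi> n x = smooth_step (real (Suc n) * (x - a)) - smooth_step (real (Suc n) * (x - b))" for n x
   have \<phi>: "test_function (\<phi> n)" for n unfolding \<phi>_def by (rule test_function_step_diff)
   define r where "r = \<bar>a\<bar> + \<bar>b\<bar> + 2"
   have \<phi>0: "\<phi> n x = 0" if "x \<notin> {-r<..r}" for n x
   proof -
    have "\<bar>a\<bar> + 1 <= \<bar>x\<bar>" "\<bar>b\<bar> + 1 <= \<bar>x\<bar>" using that unfolding r_def by auto
    then show ?thesis by (simp add: \<phi>_def smooth_step_far del: of_nat_Suc)
   qed
   have \<phi>b: "\<bar>\<phi> n x\<bar> <= 1" for n x
   proof -
    have "0 <= smooth_step y & smooth_step y <= 1" for y using smooth_step(4,5) by blast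
    from this[of "real (Suc n) * (x - a)"] this[of "real (Suc n) * (x - b)"]
    show ?thesis unfolding \<phi>_def by linarith
   qed
   have "(%n. abs_l2 (%x. cor (\<phi> n x))) ----> abs_l2 (indicator {a<..b})"
   proof (rule abs_l2_dominated)
    show "indicator {-r<..r} \<in> L2 (vol :: real measure)" by (simp add: ioc_L2)
    show "(%x. cor (\<phi> n x)) \<in> borel_measurable vol" for n
     using test_function_continuous[OF \<phi>] by (simp add: borel_measurable_continuous_onI)
    show "AE x in vol. cmod (cor (\<phi> n x)) <= cmod (indicator {-r<..r} x)" for n
     using \<phi>0 \<phi>b by (intro always_eventually) (auto simp: indicator_def)
    show "AE x in vol. (%n. cor (\<phi> n x)) ----> indicator {a<..b} x"
    proof (intro always_eventually allI)
     fix x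
     have "(%n. cor (\<phi> n x)) ----> cor (indicator {0<..} (x - a) - indicator {0<..} (x - b))"
      unfolding \<phi>_def by (intro tendsto_of_real tendsto_diff smooth_step_tendsto)
     also have "cor (indicator {0<..} (x - a) - indicator {0<..} (x - b)) = indicator {a<..b} x" using True by (auto simp: indicator_def)
     finally show "(%n. cor (\<phi> n x)) ----> indicator {a<..b} x" .
    qed
   qed simp
   then show ?thesis unfolding v closure_sequential using t[OF \<phi>] by (intro exI[of _ "%n. abs_l2 (%x. cor (\<phi> n x))"]) auto
  qed
 qed
qed simp

lemma subspace_fst_image: "subspace (A :: ('a::real_vector \<times> 'b::real_vector) set) ==> subspace (fst ` A)"
 by (intro linear_subspace_image bounded_linear.linear linear_fst)

lemma skew_operator_momentum: "skew_operator momentum"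
proof (rule skew_operatorI[OF subspace_momentum momentum_skew])
 show "closure (fst ` momentum) = UNIV"
 proof (rule dense_test_functions)
  show "subspace (fst ` momentum)" by (rule subspace_fst_image[OF subspace_momentum])
  show "c *C v \<in> fst ` momentum" if "v \<in> fst ` momentum" for c v
   using that momentum_scaleC by force
  show "abs_l2 (%x. cor (\<phi> x)) \<in> fst ` momentum" if "test_function \<phi>" for \<phi>
   using test_function_momentum[OF that] by force
 qed
 show "EX f g. (f, g) \<in> momentum & v = f - 1 *R g" "EX f g. (f, g) \<in> momentum & v = f - (- 1) *R g" for v
  by (intro momentum_surj; simp)+
qed simp_all


section \<open>The second derivative through two first-order resolvents\<close>

lemma momentum_cinner_skew:
 assumes "(v, v') \<in> momentum" "(w, w') \<in> momentum"
 shows "cinner v w' = - cinner v' w"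
proof -
 have re: "Re (cinner v w') = - Re (cinner v' w)" if m: "(v, v') \<in> momentum" "(w, w') \<in> momentum" for v v' w w'
 proof -
  have "(v + w) \<bullet> (v' + w') = 0" using momentum_skew[OF momentum_add[OF m]] .
  then have "v \<bullet> w' + w \<bullet> v' = 0" using momentum_skew[OF m(1)] momentum_skew[OF m(2)] by (simp add: inner_add_left inner_add_right)
  then show ?thesis by (simp add: inner_l2_def) (simp add: cinner_commute[of v' w])
 qed
 have "Re (cinner v (\<i> *C w')) = - Re (cinner v' (\<i> *C w))" using re[OF assms(1) momentum_scaleC[OF assms(2), of \<i>]] .
 then show ?thesis using re[OF assms] by (simp add: complex_eq_iff cinner_scaleC_right)
qed

text \<open>The imaginary part of \<open>k\<close> is a bounded skew perturbation of d/dx, and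
  dividing by the real part turns the equation into surjectivity at the parameter -1 / Re k.\<close>

lemma momentum_resolvent:
 assumes k: "Re k ~= 0"
 shows "EX f g. (f, g) \<in> momentum & z = g + k *C f"
proof -
 define B :: "real l2 => real l2" where "B f = (\<i> * cor (Im k)) *C f" for f
 have "skew_operator ((%(f, g). (f, g + B f)) ` momentum)"
 proof (rule skew_operator_perturb[OF skew_operator_momentum])
  show "linear B" unfolding B_def by (intro bounded_linear.linear bounded_linear_scaleC)
  show "f \<bullet> B f = 0" for f by (simp add: B_def inner_l2_def cinner_scaleC_right cinner_self)
  show "norm (B f) <= \<bar>Im k\<bar> * norm f" for f by (simp add: B_def norm_mult)
 qed
 then interpret skew_operator "(%(f, g). (f, g + B f)) ` momentum" .
 have "- (1 / Re k) ~= 0" using k by simp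
 from surj[OF this, of "(1 / Re k) *R z"] obtain f g where fg: "(f, g) \<in> momentum" "(1 / Re k) *R z = f - (- (1 / Re k)) *R (g + B f)" by auto
 have "z = Re k *R ((1 / Re k) *R z)" using k by simp
 also have "... = Re k *R f + (g + B f)" unfolding fg(2) using k by (simp add: scaleR_right_diff_distrib scaleR_right_distrib)
 also have "... = g + (cor (Re k) + \<i> * cor (Im k)) *C f" by (simp add: B_def scaleC_add_left scaleC_of_real)
 also have "cor (Re k) + \<i> * cor (Im k) = k" by (simp add: complex_eq_iff)
 finally show ?thesis using fg(1) by blast
qed

text \<open>\<open>kinetic\<close> is \<open>\<i>\<close> times \<open>- d\<^sup>2/dx\<^sup>2\<close>.\<close>

definition kinetic :: "(real l2 \<times> real l2) set" where
 "kinetic = {(v, (- \<i>) *C w) | v u w. (v, u) \<in> momentum & (u, w) \<in> momentum}"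

lemma skew_operator_kinetic: "skew_operator kinetic"
proof
 show "subspace kinetic" unfolding subspace_def
 proof (intro conjI ballI allI)
  have "(0, 0) \<in> momentum" using subspace_0[OF subspace_momentum] by (simp add: zero_prod_def)
  moreover have "(0 :: real l2) = (- \<i>) *C 0" by simp
  ultimately show "0 \<in> kinetic" unfolding kinetic_def zero_prod_def by blast
 next
  fix x y assume "x \<in> kinetic" "y \<in> kinetic"
  then obtain v u w v' u' w' where m: "x = (v, (- \<i>) *C w)" "(v, u) \<in> momentum" "(u, w) \<in> momentum"
   "y = (v', (- \<i>) *C w')" "(v', u') \<in> momentum" "(u', w') \<in> momentum" unfolding kinetic_def by blast
  have "x + y = (v + v', (- \<i>) *C (w + w'))" by (simp add: m scaleC_add_right)
  then show "x + y \<in> kinetic" unfolding kinetic_def using momentum_add m by blast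
 next
  fix c x assume "x \<in> kinetic"
  then obtain v u w where m: "x = (v, (- \<i>) *C w)" "(v, u) \<in> momentum" "(u, w) \<in> momentum" unfolding kinetic_def by blast
  have "c *R x = (cor c *C v, (- \<i>) *C (cor c *C w))" by (simp add: m scaleC_of_real[symmetric] mult.commute)
  then show "c *R x \<in> kinetic" unfolding kinetic_def using momentum_scaleC[of _ _ "cor c"] m by blast
 qed
next
 fix f g assume "(f, g) \<in> kinetic"
 then obtain u w where m: "g = (- \<i>) *C w" "(f, u) \<in> momentum" "(u, w) \<in> momentum" unfolding kinetic_def by blast
 have "cinner f w = - cinner u u" by (rule momentum_cinner_skew[OF m(2,3)])
 then show "f \<bullet> g = 0" unfolding m(1) inner_l2_def cinner_scaleC_right by (simp add: cinner_self)
next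
 fix h :: real and v :: "real l2" assume h: "h ~= 0"
 \<comment> \<open>Solving for f'' the equation reads f'' - (i/h) f = -(i/h) v, that is (d/dx -
   k)(d/dx + k) f = z with k^2 = i/h. As k^2 is not real, Re k is nonzero and both factors can be
   inverted.\<close>
 define k where "k = csqrt (\<i> / cor h)"
 have k2: "k * k = \<i> / cor h" unfolding k_def by (simp flip: power2_eq_square)
 have k0: "Re k ~= 0"
 proof
  assume "Re k = 0"
  then have "Im (k * k) = 0" by simp
  then show False using h unfolding k2 by (simp add: Im_divide)
 qed
 define z where "z = (- (\<i> / cor h)) *C v"
 have "Re (- k) ~= 0" using k0 by simp
 from momentum_resolvent[OF this, of z] obtain y y' where y: "(y, y') \<in> momentum" "z = y' + (- k) *C y" by blast
 from momentum_resolvent[OF k0, of y] obtain f u where f: "(f, u) \<in> momentum" "y = u + k *C f" by blast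
 have "(y - k *C f, y' - k *C u) \<in> momentum" by (rule momentum_diff[OF y(1) momentum_scaleC[OF f(1)]])
 then have u: "(u, y' - k *C u) \<in> momentum" using f(2) by simp
 define w where "w = y' - k *C u"
 have "w = z + (k * k) *C f"
 proof -
  have "y' = z + k *C y" using y(2) by simp
  then show ?thesis by (simp add: w_def f(2) scaleC_add_right)
 qed
 then have w: "w = z + (\<i> / cor h) *C f" by (simp add: k2)
 have e1: "(\<i> * cor h) *C z = v" unfolding z_def scaleC_scaleC using h by simp
 have e2: "(\<i> * cor h) *C ((\<i> / cor h) *C f) = - f" unfolding scaleC_scaleC using h by simp
 have "f - h *R ((- \<i>) *C w) = f + (\<i> * cor h) *C w" by (simp add: scaleC_of_real[symmetric] mult.commute)
 also have "... = v" unfolding w scaleC_add_right e1 e2 by simp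
 finally have "v = f - h *R ((- \<i>) *C w)" by simp
 moreover have "(f, (- \<i>) *C w) \<in> kinetic" unfolding kinetic_def w_def using f(1) u by blast
 ultimately show "EX f g. (f, g) \<in> kinetic & v = f - h *R g" by blast
next
 have D: "fst ` kinetic = {v. EX u w. (v, u) \<in> momentum & (u, w) \<in> momentum}" unfolding kinetic_def by force
 show "closure (fst ` kinetic) = UNIV" unfolding D
 proof (rule dense_test_functions)
  show "subspace {v. EX u w. (v, u) \<in> momentum & (u, w) \<in> momentum}" unfolding subspace_def
  proof (intro conjI ballI allI; clarsimp)
   show "EX u. (0, u) \<in> momentum & (EX w. (u, w) \<in> momentum)" using subspace_0[OF subspace_momentum] by (auto simp: zero_prod_def)
  next
   fix v v' u w u' w' assume "(v, u) \<in> momentum" "(u, w) \<in> momentum" "(v', u') \<in> momentum" "(u', w') \<in> momentum"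
   then show "EX u. (v + v', u) \<in> momentum & (EX w. (u, w) \<in> momentum)" using momentum_add by blast
  next
   fix c v u w assume "(v, u) \<in> momentum" "(u, w) \<in> momentum"
   then show "EX u. (c *R v, u) \<in> momentum & (EX w. (u, w) \<in> momentum)"
    using momentum_scaleC[of _ _ "cor c"] unfolding scaleC_of_real by blast
  qed
  show "c *C v \<in> {v. EX u w. (v, u) \<in> momentum & (u, w) \<in> momentum}" if "v \<in> {v. EX u w. (v, u) \<in> momentum & (u, w) \<in> momentum}" for c v
   using that momentum_scaleC[of _ _ c] by blast
  show "abs_l2 (%x. cor (\<phi> x)) \<in> {v. EX u w. (v, u) \<in> momentum & (u, w) \<in> momentum}" if "test_function \<phi>" for \<phi>
   using test_function_momentum[OF that] test_function_momentum[OF test_function_deriv[OF that]] by blast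
 qed
qed

lemma kinetic_scaleC: "(v, w) \<in> kinetic ==> (c *C v, c *C w) \<in> kinetic"
proof -
 assume "(v, w) \<in> kinetic"
 then obtain u w' where m: "w = (- \<i>) *C w'" "(v, u) \<in> momentum" "(u, w') \<in> momentum" unfolding kinetic_def by blast
 have "c *C w = (- \<i>) *C (c *C w')" by (simp add: m mult.commute)
 then show ?thesis unfolding kinetic_def using momentum_scaleC[of _ _ c] m(2,3) by blast
qed

section \<open>Multiplication by a bounded potential\<close>

definition bounded_symmetric :: "('a::l2_space l2 => 'a l2) => bool" where
 "bounded_symmetric B \<longleftrightarrow> (ALL c v w. B (v + w) = B v + B w & B (c *C v) = c *C B v) \<and>
   (ALL v. Im (cinner v (B v)) = 0) & (EX b. ALL v. norm (B v) <= b * norm v)"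

lemma skew_operator_symmetric_perturb:
 assumes A: "skew_operator A" and B: "bounded_symmetric B"
 shows "skew_operator ((%(v, w). (v, w + \<i> *C B v)) ` A)"
proof -
 obtain b where b: "!!v. norm (B v) <= b * norm v" using B unfolding bounded_symmetric_def by blast
 have add: "B (v + w) = B v + B w" and sc: "B (c *C v) = c *C B v" for c v w
  using B unfolding bounded_symmetric_def by blast+
 show ?thesis
 proof (rule skew_operator_perturb[OF A])
  show "linear (%v. \<i> *C B v)"
  proof (rule linearI)
   show "\<i> *C B (v + w) = \<i> *C B v + \<i> *C B w" for v w by (simp add: add scaleC_add_right)
   show "\<i> *C B (c *R v) = c *R (\<i> *C B v)" for c v
    by (simp add: scaleC_of_real[symmetric] sc mult.commute)
  qed
  show "v \<bullet> (\<i> *C B v) = 0" for v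
   using B by (simp add: inner_scaleC_ii bounded_symmetric_def)
  show "norm (\<i> *C B v) <= b * norm v" for v using b by simp
 qed
qed

definition potential :: "('a::{l2_space, topological_space} \<Rightarrow>\<^sub>C real) => 'a l2 => 'a l2" where
 "potential V v = abs_l2 (%x. cor (V x) * rep_l2 v x)"

text \<open>Continuous potentials have to be measurable for \<open>vol\<close>; both Lebesgue and
  counting measure meet these conditions.\<close>

context
 assumes borel_le: "sets borel \<subseteq> sets (vol :: 'a::{l2_space, topological_space} measure)"
  and space_UNIV: "space (vol :: 'a::{l2_space, topological_space} measure) = UNIV"
begin

lemma bcontfun_measurable: "(%x::'a. cor (V x)) \<in> borel_measurable vol" for V :: "'a \<Rightarrow>\<^sub>C real"
proof -
 have "apply_bcontfun V \<in> borel_measurable borel" by (intro borel_measurable_continuous_onI continuous_on_apply_bcontfun)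
 then have "(%x. cor (V x)) \<in> borel_measurable borel" by measurable
 then show ?thesis using borel_le space_UNIV unfolding measurable_def by (auto simp: space_borel)
qed

lemma bcontfun_mult_bound: "cmod (cor (V x) * z) <= norm V * cmod z" for V :: "'a \<Rightarrow>\<^sub>C real"
proof -
 have "\<bar>V x\<bar> * cmod z <= norm V * cmod z" by (rule mult_right_mono) (use norm_bounded[of V x] in simp_all)
 then show ?thesis unfolding norm_mult norm_of_real .
qed

lemma potential_L2: "f \<in> L2 vol ==> (%x. cor (V x) * f x) \<in> L2 vol" for V :: "'a \<Rightarrow>\<^sub>C real"
proof (rule L2_bound[where f = f and B = "norm V"])
 assume "f \<in> L2 vol"
 then show "(%x. cor (V x) * f x) \<in> borel_measurable vol" using bcontfun_measurable[of V] by (intro borel_measurable_times) (simp_all add: L2_def)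
qed (auto intro: bcontfun_mult_bound)

lemma potential_abs_l2:
 fixes V :: "'a \<Rightarrow>\<^sub>C real"
 assumes f: "f \<in> L2 vol" shows "potential V (abs_l2 f) = abs_l2 (%x. cor (V x) * f x)"
proof -
 have "AE x in vol. cor (V x) * rep_l2 (abs_l2 f) x = cor (V x) * f x" using rep_abs_l2[OF f] by eventually_elim simp
 then show ?thesis unfolding potential_def using f by (subst abs_l2_eq_iff) (auto intro: potential_L2)
qed

lemma norm_potential: fixes V :: "'a \<Rightarrow>\<^sub>C real" shows "norm (potential V v) <= norm V * norm v"
proof -
 obtain f where f: "f \<in> L2 vol" "v = abs_l2 f" by (rule l2_cases)
 have "(norm (potential V v))\<^sup>2 = (LINT x|vol. (cmod (cor (V x) * f x))\<^sup>2)"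
  using f by (simp add: potential_abs_l2 norm_abs_l2 potential_L2 L2_norm_power2)
 also have "... <= (LINT x|vol. (norm V)\<^sup>2 * (cmod (f x))\<^sup>2)"
 proof (rule integral_mono)
  show "integrable vol (%x. (cmod (cor (V x) * f x))\<^sup>2)" by (intro L2_integrable potential_L2 f)
  show "integrable vol (%x. (norm V)\<^sup>2 * (cmod (f x))\<^sup>2)" by (intro integrable_mult_right L2_integrable f)
  show "(cmod (cor (V x) * f x))\<^sup>2 <= (norm V)\<^sup>2 * (cmod (f x))\<^sup>2" for x
   using power_mono[OF bcontfun_mult_bound[of V x "f x"], of 2] by (simp add: power_mult_distrib)
 qed
 also have "... = (norm V * norm v)\<^sup>2" using f by (simp add: norm_abs_l2 power_mult_distrib L2_norm_power2)
 finally show ?thesis by (rule power2_le_imp_le) simp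
qed

lemma potential_diff: fixes V W :: "'a \<Rightarrow>\<^sub>C real" shows "potential V v - potential W v = potential (V - W) v"
proof -
 obtain f where f: "f \<in> L2 vol" "v = abs_l2 f" by (rule l2_cases)
 show ?thesis using f by (simp add: potential_abs_l2 abs_l2_diff potential_L2 left_diff_distrib)
qed

lemma bounded_symmetric_potential: fixes V :: "'a \<Rightarrow>\<^sub>C real" shows "bounded_symmetric (potential V)" unfolding bounded_symmetric_def
proof (intro conjI allI)
 fix v w :: "'a l2" and c
 obtain f where f: "f \<in> L2 vol" "v = abs_l2 f" by (rule l2_cases)
 obtain g where g: "g \<in> L2 vol" "w = abs_l2 g" by (rule l2_cases)
 show "potential V (v + w) = potential V v + potential V w" using f g by (simp add: potential_abs_l2 abs_l2_add L2_add potential_L2 distrib_left)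
 show "potential V (c *C v) = c *C potential V v" using f by (simp add: potential_abs_l2 abs_l2_scaleC L2_cmult potential_L2 mult.left_commute)
next
 fix v :: "'a l2"
 obtain f where f: "f \<in> L2 vol" "v = abs_l2 f" by (rule l2_cases)
 have "cinner v (potential V v) = (LINT x|vol. cnj (f x) * (cor (V x) * f x))"
  using f by (simp add: potential_abs_l2 cinner_abs_l2 potential_L2 L2_inner_def)
 also have "... = (LINT x|vol. cor (V x * (cmod (f x))\<^sup>2))"
 proof (intro lint_cong refl)
  fix x
  have "cnj (f x) * f x = cor ((cmod (f x))\<^sup>2)" using complex_norm_square[of "f x"] by (simp only: mult.commute)
  then show "cnj (f x) * (cor (V x) * f x) = cor (V x * (cmod (f x))\<^sup>2)" by (simp add: mult.left_commute)
 qed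
 also have "... = cor (LINT x|vol. V x * (cmod (f x))\<^sup>2)" by (rule integral_complex_of_real)
 finally show "Im (cinner v (potential V v)) = 0" by simp
next
 show "EX b. ALL v. norm (potential V v) <= b * norm v" using norm_potential by blast
qed

end

lemma schroedinger_likeI:
 fixes D :: "'a::{l2_space, topological_space} operator"
 assumes "ae_closed_operator D" "skew_operator A" "bounded_symmetric B"
  and "!!v w c. (v, w) \<in> A ==> (c *C v, c *C w) \<in> A"
  and eq: "lift_graph D = (%(v, w). (v, w + \<i> *C B v)) ` A"
 shows "schroedinger_like D"
proof (rule schroedinger_like.intro)
 show "skew_operator (lift_graph D)" unfolding eq by (rule skew_operator_symmetric_perturb) fact+
 show "(c *C v, c *C w) \<in> lift_graph D" if vw: "(v, w) \<in> lift_graph D" for v w c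
 proof -
  obtain w' where w': "(v, w') \<in> A" "w = w' + \<i> *C B v" using vw unfolding eq by auto
  have "B (c *C v) = c *C B v" using assms(3) unfolding bounded_symmetric_def by blast
  then have "c *C w = c *C w' + \<i> *C B (c *C v)" by (simp add: w'(2) scaleC_add_right mult.commute)
  then show ?thesis unfolding eq using assms(4)[OF w'(1)] by (auto intro!: image_eqI[of _ _ "(c *C v, c *C w')"])
 qed
qed fact

text \<open>All graphs come from the same \<open>A\<close>, so the domain does not depend on
  \<open>\<omega>\<close> and images of a vector differ by the difference of the potentials.\<close>

lemma lift_graph_dominated:
 assumes eq: "!!\<omega>. lift_graph (D \<omega>) = (%(v, w). (v, w + \<i> *C potential \<omega> v)) ` A"
  and diff: "!!v. norm (potential \<omega> v - potential \<omega>' v) <= dist \<omega> \<omega>' * norm v"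
  and vw: "(v, w) \<in> lift_graph (D \<omega>)"
 shows "EX w'. (v, w') \<in> lift_graph (D \<omega>') & norm (w - w') <= dist \<omega> \<omega>' * norm v"
proof -
 obtain w0 where w0: "(v, w0) \<in> A" "w = w0 + \<i> *C potential \<omega> v" using vw unfolding eq by auto
 have "norm (w - (w0 + \<i> *C potential \<omega>' v)) <= dist \<omega> \<omega>' * norm v"
  using diff[of v] by (simp add: w0(2) flip: scaleC_diff_right)
 moreover have "(v, w0 + \<i> *C potential \<omega>' v) \<in> lift_graph (D \<omega>')" unfolding eq using w0(1) by (auto intro!: image_eqI[of _ _ "(v, w0)"])
 ultimately show ?thesis by blast
qed

section \<open>Schroedinger operators as skew graphs\<close>

lemma borel_le_lborel: "sets borel \<subseteq> sets (vol :: real measure)" "space (vol :: real measure) = UNIV" by simp_all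

lemma ae_closed_schroedinger_real: "ae_closed_operator (schroedinger_real V)" unfolding ae_closed_operator_def vol_lborel
proof clarify
 fix f g assume "(f, g) \<in> schroedinger_real V"
 then obtain f' f'' where fg: "f \<in> L2 lborel" "g \<in> L2 lborel" "f' \<in> L2 lborel" "f'' \<in> L2 lborel" "weak_derivative f f'" "weak_derivative f' f''"
  "AE x in lborel. g x = - f'' x + cor (V x) * f x" unfolding schroedinger_real_def by blast
 show "f \<in> L2 lborel & g \<in> L2 lborel & (\<forall>f1\<in>L2 lborel. \<forall>g1\<in>L2 lborel. (AE x in lborel. f x = f1 x) --> (AE x in lborel. g x = g1 x) --> (f1, g1) \<in> schroedinger_real V)"
 proof (intro conjI ballI impI fg)
  fix f1 g1 assume 1: "f1 \<in> L2 lborel" "g1 \<in> L2 lborel" "AE x in lborel. f x = f1 x" "AE x in lborel. g x = g1 x"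
  have "weak_derivative f1 f'" using weak_derivative_cong_AE[OF 1(3), of f' f'] fg 1 by (simp add: L2_def)
  moreover have "AE x in lborel. g1 x = - f'' x + cor (V x) * f1 x" using fg(7) 1(3,4) by eventually_elim simp
  ultimately show "(f1, g1) \<in> schroedinger_real V" unfolding schroedinger_real_def using fg 1 by blast
 qed
qed

lemma lift_graph_schroedinger_real:
 "lift_graph (schroedinger_real V) = (%(v, w). (v, w + \<i> *C potential V v)) ` kinetic"
proof (intro set_eqI iffI)
 fix p assume "p \<in> lift_graph (schroedinger_real V)"
 then obtain f g where p: "p = (abs_l2 f, \<i> *C abs_l2 g)" and "(f, g) \<in> schroedinger_real V" unfolding lift_graph_def by blast
 then obtain f' f'' where fg: "f \<in> L2 lborel" "g \<in> L2 lborel" "f' \<in> L2 lborel" "f'' \<in> L2 lborel" "weak_derivative f f'" "weak_derivative f' f''"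
  "AE x in lborel. g x = - f'' x + cor (V x) * f x" unfolding schroedinger_real_def by blast
 have k: "(abs_l2 f, (- \<i>) *C abs_l2 f'') \<in> kinetic" unfolding kinetic_def using fg momentum_iff by blast
 have pL: "(%x. cor (V x) * f x) \<in> L2 lborel" using potential_L2[OF borel_le_lborel, of f V] fg by simp
 have "abs_l2 g = abs_l2 (%x. - f'' x + cor (V x) * f x)"
  using fg pL abs_l2_eq_iff[of g "%x. - f'' x + cor (V x) * f x"] L2_add[OF L2_uminus[OF fg(4)] pL] unfolding vol_lborel by simp
 also have "... = - abs_l2 f'' + potential V (abs_l2 f)"
  using fg pL potential_abs_l2[OF borel_le_lborel, of f V] by (simp add: abs_l2_uminus abs_l2_add L2_uminus)
 finally have "\<i> *C abs_l2 g = (- \<i>) *C abs_l2 f'' + \<i> *C potential V (abs_l2 f)" by (simp add: scaleC_add_right scaleC_diff_right)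
 then show "p \<in> (%(v, w). (v, w + \<i> *C potential V v)) ` kinetic" unfolding p
  using k by (intro image_eqI[of _ _ "(abs_l2 f, (- \<i>) *C abs_l2 f'')"]) auto
next
 fix p assume "p \<in> (%(v, w). (v, w + \<i> *C potential V v)) ` kinetic"
 then obtain v u w where p: "p = (v, (- \<i>) *C w + \<i> *C potential V v)" "(v, u) \<in> momentum" "(u, w) \<in> momentum"
  unfolding kinetic_def by auto
 obtain f where f: "f \<in> L2 lborel" "v = abs_l2 f" by (metis vol_lborel l2_cases)
 obtain f' where f': "f' \<in> L2 lborel" "u = abs_l2 f'" by (metis vol_lborel l2_cases)
 obtain f'' where f'': "f'' \<in> L2 lborel" "w = abs_l2 f''" by (metis vol_lborel l2_cases)
 have pL: "(%x. cor (V x) * f x) \<in> L2 lborel" using potential_L2[OF borel_le_lborel, of f V] f by simp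
 define g where "g = (%x. - f'' x + cor (V x) * f x)"
 have gL: "g \<in> L2 lborel" unfolding g_def by (rule L2_add[OF L2_uminus[OF f''(1)] pL])
 have "weak_derivative f f'" "weak_derivative f' f''" using f f' f'' p momentum_iff by auto
 moreover have "AE x in lborel. g x = - f'' x + cor (V x) * f x" by (simp add: g_def)
 ultimately have "(f, g) \<in> schroedinger_real V" unfolding schroedinger_real_def using f f' f'' gL by blast
 moreover have "abs_l2 g = - w + potential V v" unfolding g_def
  using f f'' pL potential_abs_l2[OF borel_le_lborel, of f V] by (simp add: abs_l2_uminus abs_l2_add L2_uminus)
 then have "p = (abs_l2 f, \<i> *C abs_l2 g)" using p f by (simp add: scaleC_add_right scaleC_diff_right)
 ultimately show "p \<in> lift_graph (schroedinger_real V)" unfolding lift_graph_def by blast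
qed

lemma schroedinger_like_real: "schroedinger_like (schroedinger_real V)"
 by (rule schroedinger_likeI[OF ae_closed_schroedinger_real skew_operator_kinetic
    bounded_symmetric_potential[OF borel_le_lborel] kinetic_scaleC lift_graph_schroedinger_real])

section \<open>The operator on the lattice\<close>

instantiation int :: l2_space
begin
definition vol_int :: "int measure" where "vol_int = count_space UNIV"
instance ..
end

lemma vol_count [simp]: "vol = (count_space UNIV :: int measure)" by (rule vol_int_def)

lemma borel_le_count: "sets borel \<subseteq> sets (vol :: int measure)" "space (vol :: int measure) = UNIV" by simp_all

lemma L2_shift: "f \<in> L2 (count_space UNIV) ==> (%n. f (n + k)) \<in> L2 (count_space (UNIV :: int set))"
proof -
 assume "f \<in> L2 (count_space UNIV)"
 then have "integrable (count_space UNIV) (%n. (cmod (f n))\<^sup>2)" by (simp add: L2_def)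
 then have "integrable (count_space UNIV) (%n. (cmod (f (n + k)))\<^sup>2)"
  using integrable_bij_count_space[of "%n. n + k" UNIV UNIV "%n. (cmod (f n))\<^sup>2"] bij_plus_right[of k] by simp
 then show ?thesis by (simp add: L2_def)
qed

definition hopping :: "int l2 => int l2" where
 "hopping v = abs_l2 (%n. rep_l2 v (n + 1) + rep_l2 v (n - 1))"

lemma rep_abs_int: "f \<in> L2 (count_space UNIV) ==> rep_l2 (abs_l2 f) = (f :: int => complex)"
 using rep_abs_l2[of f] unfolding vol_count by (auto simp: AE_count_space)

lemma int_l2_cases: obtains f where "f \<in> L2 (count_space UNIV)" "(v :: int l2) = abs_l2 f" using l2_cases[of v] unfolding vol_count by blast

lemma L2_hop: "f \<in> L2 (count_space UNIV) ==> (%n::int. f (n + 1) + f (n - 1)) \<in> L2 (count_space UNIV)"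
 using L2_add[OF L2_shift[of f 1] L2_shift[of f "-1"]] by simp

lemma bounded_symmetric_hopping: "bounded_symmetric hopping" unfolding bounded_symmetric_def
proof (intro conjI allI)
 fix v w :: "int l2" and c
 obtain f where f: "f \<in> L2 (count_space UNIV)" "v = abs_l2 f" by (rule int_l2_cases)
 obtain g where g: "g \<in> L2 (count_space UNIV)" "w = abs_l2 g" by (rule int_l2_cases)
 show "hopping (v + w) = hopping v + hopping w"
 proof -
  have "(%n. (f (n + 1) + g (n + 1)) + (f (n - 1) + g (n - 1))) = (%n. (f (n + 1) + f (n - 1)) + (g (n + 1) + g (n - 1)))"
   by (simp add: algebra_simps)
  then show ?thesis using f g by (simp add: hopping_def abs_l2_add L2_add L2_hop rep_abs_int)
 qed
 show "hopping (c *C v) = c *C hopping v" using f by (simp add: hopping_def abs_l2_scaleC L2_cmult L2_hop rep_abs_int flip: distrib_left)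
next
 fix v :: "int l2"
 obtain f where f: "f \<in> L2 (count_space UNIV)" "v = abs_l2 f" by (rule int_l2_cases)
 have i: "integrable (count_space UNIV) (%n. cnj (f n) * f (n + k))" for k :: int
  by (rule L2_inner_integrable[OF f(1) L2_shift[OF f(1)]])
 have "cinner v (hopping v) = (LINT n|count_space UNIV. cnj (f n) * (f (n + 1) + f (n - 1)))"
  using f by (simp add: hopping_def rep_abs_int cinner_abs_l2 L2_hop L2_inner_def)
 also have "... = (LINT n|count_space UNIV. cnj (f n) * f (n + 1)) + (LINT n|count_space UNIV. cnj (f n) * f (n - 1))"
  using i[of 1] i[of "-1"] by (simp add: distrib_left)
 also have "(LINT n|count_space UNIV. cnj (f n) * f (n - 1)) = (LINT n|count_space UNIV. cnj (f (n + 1)) * f n)"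
  using integral_bij_count_space[of "%n::int. n + 1" UNIV UNIV "%n. cnj (f n) * f (n - 1)"] bij_plus_right[of "1::int"] by simp
 also have "... = cnj (LINT n|count_space UNIV. cnj (f n) * f (n + 1))" unfolding lint_cnj[symmetric] by (simp add: mult.commute)
 finally show "Im (cinner v (hopping v)) = 0" by simp
next
 have "norm (hopping v) <= 2 * norm v" for v
 proof -
  obtain f where f: "f \<in> L2 (count_space UNIV)" "v = abs_l2 f" by (rule int_l2_cases)
  have n: "norm (abs_l2 (%n. f (n + k))) = norm v" for k :: int
  proof -
   have "(LINT n|count_space UNIV. (cmod (f (n + k)))\<^sup>2) = (LINT n|count_space UNIV. (cmod (f n))\<^sup>2)"
    using integral_bij_count_space[of "%n::int. n + k" UNIV UNIV "%n. (cmod (f n))\<^sup>2"] bij_plus_right[of k] by simp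
   then show ?thesis using f L2_shift[OF f(1), of k] by (simp add: norm_abs_l2 L2_norm_def)
  qed
  have "hopping v = abs_l2 (%n. f (n + 1)) + abs_l2 (%n. f (n + (-1)))"
   using f L2_shift[OF f(1), of 1] L2_shift[OF f(1), of "-1"] by (simp add: hopping_def rep_abs_int abs_l2_add)
  then show ?thesis using norm_triangle_ineq[of "abs_l2 (%n. f (n + 1))" "abs_l2 (%n. f (n + (-1)))"] unfolding n by simp
 qed
 then show "EX b. ALL v. norm (hopping v) <= b * norm v" by blast
qed

lemma ae_closed_schroedinger_int: "ae_closed_operator (schroedinger_int V)"
proof -
 have pL: "(%n. cor (V n) * f n) \<in> L2 (count_space UNIV)" if "f \<in> L2 (count_space UNIV)" for f
  using potential_L2[OF borel_le_count, of f V] that by simp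
 show ?thesis unfolding ae_closed_operator_def vol_count schroedinger_int_def
  by (auto simp: AE_count_space intro!: L2_add[OF L2_hop pL])
qed

text \<open>Written as a perturbation of the zero graph, so that skew-adjointness is an instance of
  \<open>skew_operator_symmetric_perturb\<close>.\<close>

definition kinetic_int :: "(int l2 \<times> int l2) set" where
 "kinetic_int = (%(v, w). (v, w + \<i> *C hopping v)) ` range (%v. (v, 0))"

lemma kinetic_int_eq: "kinetic_int = range (%v. (v, \<i> *C hopping v))" by (auto simp: kinetic_int_def image_image)

lemma lift_graph_schroedinger_int:
 "lift_graph (schroedinger_int V) = (%(v, w). (v, w + \<i> *C potential V v)) ` kinetic_int"
proof -
 have eq: "abs_l2 (%n. f (n + 1) + f (n - 1) + cor (V n) * f n) = hopping (abs_l2 f) + potential V (abs_l2 f)"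
  if f: "f \<in> L2 (count_space UNIV)" for f
  using f potential_abs_l2[OF borel_le_count, of f V] potential_L2[OF borel_le_count, of f V] L2_hop[OF f]
  by (simp add: hopping_def rep_abs_int abs_l2_add)
 show ?thesis
 proof (intro set_eqI iffI)
  fix p assume "p \<in> lift_graph (schroedinger_int V)"
  then obtain f where f: "f \<in> L2 (count_space UNIV)" "p = (abs_l2 f, \<i> *C abs_l2 (%n. f (n + 1) + f (n - 1) + cor (V n) * f n))"
   unfolding lift_graph_def schroedinger_int_def by blast
  then show "p \<in> (%(v, w). (v, w + \<i> *C potential V v)) ` kinetic_int" unfolding kinetic_int_eq image_image by (auto simp: eq scaleC_add_right)
 next
  fix p assume "p \<in> (%(v, w). (v, w + \<i> *C potential V v)) ` kinetic_int"
  then obtain v where p: "p = (v, \<i> *C hopping v + \<i> *C potential V v)" unfolding kinetic_int_eq by auto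
  obtain f where f: "f \<in> L2 (count_space UNIV)" "v = abs_l2 f" by (rule int_l2_cases)
  have "p = (abs_l2 f, \<i> *C abs_l2 (%n. f (n + 1) + f (n - 1) + cor (V n) * f n))" unfolding eq[OF f(1)] p f(2) by (simp add: scaleC_add_right)
  then show "p \<in> lift_graph (schroedinger_int V)" unfolding lift_graph_def schroedinger_int_def using f(1) by blast
 qed
qed

lemma schroedinger_like_int: "schroedinger_like (schroedinger_int V)"
proof (rule schroedinger_likeI[OF ae_closed_schroedinger_int _ bounded_symmetric_potential[OF borel_le_count] _ lift_graph_schroedinger_int])
 show "skew_operator kinetic_int" unfolding kinetic_int_def
  by (rule skew_operator_symmetric_perturb[OF skew_operator_zero bounded_symmetric_hopping])
 show "(c *C v, c *C w) \<in> kinetic_int" if "(v, w) \<in> kinetic_int" for v w c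
 proof -
  have "hopping (c *C v) = c *C hopping v" using bounded_symmetric_hopping unfolding bounded_symmetric_def by blast
  then show ?thesis using that unfolding kinetic_int_eq by (auto simp: mult.commute intro!: image_eqI[of _ _ "c *C v"])
 qed
qed

section \<open>Potentials that are nearly symmetric about far away points\<close>

definition reflect :: "'a::{ring_1,topological_monoid_add} => ('a \<Rightarrow>\<^sub>C real) => ('a \<Rightarrow>\<^sub>C real)" where
 "reflect c \<omega> = Bcontfun (%x. \<omega> (c - x))"

text \<open>\<open>reflect (t + t)\<close> is the reflection about \<open>t\<close>; on the lattice
  the centers are therefore lattice points.\<close>

definition nearly_symmetric :: "('a => real) => ('a::{ring_1,topological_monoid_add} \<Rightarrow>\<^sub>C real) => bool" where
 "nearly_symmetric len \<omega> \<longleftrightarrow> (\<forall>n::nat. EX t. real n <= len t & dist (reflect (t + t) \<omega>) \<omega> < exp (- (len t)\<^sup>2))"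

text \<open>What the line and the lattice share, with \<open>len\<close> the absolute value.
  \<open>len_of_nat\<close> supplies translations of any length.\<close>

locale translation_ring =
 fixes len :: "'a::{ring_1,topological_monoid_add} => real"
 assumes len_of_nat: "len (of_nat n) = real n" and len_minus: "len (- x) = len x"
  and len_add: "len (x + y) <= len x + len y"
  and continuous_reflection: "continuous_on UNIV (%x :: 'a. c - x)"
begin

lemma reflect_apply [simp]: "apply_bcontfun (reflect c \<omega>) x = \<omega> (c - x)" for c x :: 'a
proof -
 have "continuous_on UNIV (%x. \<omega> (c - x))"
  by (rule continuous_on_compose2[OF continuous_on_apply_bcontfun[of UNIV \<omega>] continuous_reflection]) simp
 moreover have "bounded (range (%x. \<omega> (c - x)))" by (rule bounded_subset[OF bounded_apply_bcontfun[of \<omega>]]) auto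
 ultimately have "(%x. \<omega> (c - x)) \<in> bcontfun" by (simp add: bcontfun_def)
 then show ?thesis by (simp add: reflect_def Bcontfun_inverse)
qed

lemma dist_reflect: "dist (reflect c \<omega>) (reflect c \<omega>') <= dist \<omega> \<omega>'" for c :: 'a
 by (rule dist_bound) (simp add: dist_bounded)

lemma dist_translate: "dist (translate s \<omega>) (translate s \<omega>') <= dist \<omega> \<omega>'" for s :: 'a
 by (rule dist_bound) (simp add: dist_bounded)

lemma translate_translate: "translate s (translate t V) = translate (s + t) V" for s :: 'a
 by (rule bcontfun_eqI) (simp add: add.assoc)

lemma translate_0 [simp]: "translate 0 V = (V :: 'a \<Rightarrow>\<^sub>C real)" by (rule bcontfun_eqI) simp

lemma translate_hull: "translate s V \<in> bohr_hull V" unfolding bohr_hull_def by (rule subsetD[OF closure_subset rangeI])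

text \<open>Among the translates by multiples of \<open>M\<close> compactness provides two that are
  close. As translation is nonexpansive, their difference \<open>p\<close>, of length at least
  \<open>M\<close>, almost fixes every translate, and \<open>s\<^sub>0 + p\<close> is far out
  because \<open>M\<close> exceeds \<open>r + len s\<^sub>0\<close>.\<close>

lemma almost_periodic_recurrent:
 fixes V :: "'a \<Rightarrow>\<^sub>C real"
 assumes ap: "almost_periodic V" and e: "e > 0"
 shows "EX s. r <= len s & dist (translate s V) (translate s\<^sub>0 V) < e"
proof -
 obtain M :: nat where M: "r + len s\<^sub>0 < real M" using reals_Archimedean2[of "r + len s\<^sub>0"] by auto
 define m where "m k = (of_nat (k * M) :: 'a)" for k
 let ?f = "%k. translate (m k) V"
 have "ALL k. ?f k \<in> bohr_hull V" by (intro allI translate_hull)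
 moreover have "seq_compact (bohr_hull V)" using ap unfolding almost_periodic_def bohr_hull_def by (simp add: compact_eq_seq_compact_metric)
 ultimately obtain q :: "nat => nat" and L where q: "strict_mono q" "(?f \<circ> q) ----> L" by (rule_tac seq_compactE[of "bohr_hull V" ?f]) auto
 then have "Cauchy (?f \<circ> q)" by (intro LIMSEQ_imp_Cauchy)
 then obtain N where N: "!!i j. i >= N ==> j >= N ==> dist (?f (q i)) (?f (q j)) < e" using e unfolding Cauchy_def comp_def by blast
 define d where "d = q (Suc N) - q N"
 have d: "q (Suc N) = q N + d" "d >= 1" using strict_monoD[OF q(1), of N "Suc N"] by (auto simp: d_def)
 define p where "p = (of_nat (d * M) :: 'a)"
 have mp: "m (q (Suc N)) = p + m (q N)" by (simp add: m_def p_def d(1) distrib_right)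
 have "dist (translate (s\<^sub>0 + p) V) (translate s\<^sub>0 V) <= dist (?f (q (Suc N))) (?f (q N))"
 proof -
  have "translate (s\<^sub>0 + p) V = translate (s\<^sub>0 - m (q N)) (?f (q (Suc N)))" unfolding translate_translate mp by (simp add: add.commute)
  moreover have "translate s\<^sub>0 V = translate (s\<^sub>0 - m (q N)) (?f (q N))" by (simp add: translate_translate)
  ultimately show ?thesis using dist_translate by metis
 qed
 also have "... < e" by (rule N) auto
 finally have "dist (translate (s\<^sub>0 + p) V) (translate s\<^sub>0 V) < e" .
 moreover have "r <= len (s\<^sub>0 + p)"
 proof -
  have "real M <= len p" unfolding p_def len_of_nat using d(2) by (cases d) auto
  moreover have "len p <= len (- s\<^sub>0) + len (s\<^sub>0 + p)" using len_add[of "- s\<^sub>0" "s\<^sub>0 + p"] by simp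
  ultimately show ?thesis using M len_minus[of s\<^sub>0] by linarith
 qed
 ultimately show ?thesis by blast
qed

lemma dense_gdelta_nearly_symmetric:
 fixes V :: "'a \<Rightarrow>\<^sub>C real"
 assumes ap: "almost_periodic V" and even: "!!x. V (- x) = V x"
 shows "dense_gdelta_in (top_of_set (bohr_hull V)) {\<omega> \<in> bohr_hull V. nearly_symmetric len \<omega>}"
proof -
 let ?\<Omega> = "bohr_hull V"
 \<comment> \<open>Open because reflection is nonexpansive for the sup distance; near symmetry means
   membership in all of these sets.\<close>
 define O' where "O' n = (\<Union>t\<in>{t. real n <= len t}. {\<omega>. dist (reflect (t + t) \<omega>) \<omega> < exp (- (len t)\<^sup>2)})" for n :: nat
 have c: "continuous_on UNIV (reflect c)" for c :: 'a
  unfolding continuous_on_iff using dist_reflect by (meson le_less_trans)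
 have op: "open (O' n)" for n unfolding O'_def
  by (intro open_UN ballI open_Collect_less continuous_on_dist c continuous_on_id continuous_on_const)
 have eq: "{\<omega> \<in> ?\<Omega>. nearly_symmetric len \<omega>} = (\<Inter>n. ?\<Omega> \<inter> O' n)"
  unfolding nearly_symmetric_def O'_def by auto
 have cm: "completely_metrizable_space (top_of_set ?\<Omega>)"
  using ap unfolding almost_periodic_def bohr_hull_def by (rule completely_metrizable_compact)
 have oi: "openin (top_of_set ?\<Omega>) (?\<Omega> \<inter> O' n)" for n using op by (simp add: openin_open_Int)
 have "?\<Omega> \<subseteq> closure (?\<Omega> \<inter> O' n)" for n
 proof
  fix \<omega> assume "\<omega> \<in> ?\<Omega>"
  show "\<omega> \<in> closure (?\<Omega> \<inter> O' n)" unfolding closure_approachable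
  proof (intro allI impI)
   fix e :: real assume e: "e > 0"
   obtain s0 where s0: "dist (translate s0 V) \<omega> < e / 2"
    using \<open>\<omega> \<in> ?\<Omega>\<close> e unfolding bohr_hull_def closure_approachable by (metis half_gt_zero imageE)
   obtain s where s: "real n <= len s" "dist (translate s V) (translate s0 V) < e / 2"
    using almost_periodic_recurrent[OF ap, of "e / 2"] e by (meson half_gt_zero)
   have "dist (translate s V) \<omega> < e" using dist_triangle_half_l[OF s(2), of \<omega>] s0 by (simp add: dist_commute)
   moreover have "translate s V \<in> O' n"
   proof -
    have "reflect (- s + - s) (translate s V) = translate s V"
    proof (rule bcontfun_eqI)
     fix x show "apply_bcontfun (reflect (- s + - s) (translate s V)) x = translate s V x" using even[of "x + s"] by (simp add: algebra_simps)
    qed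
    moreover have "len (- s) = len s" by (rule len_minus)
    ultimately have "real n <= len (- s)" "dist (reflect (- s + - s) (translate s V)) (translate s V) < exp (- (len (- s))\<^sup>2)"
     using s(1) by simp_all
    then show ?thesis unfolding O'_def by blast
   qed
   moreover have "translate s V \<in> ?\<Omega>" by (rule translate_hull)
   ultimately show "\<exists>y\<in>?\<Omega> \<inter> O' n. dist y \<omega> < e" by blast
  qed
 qed
 then have cl: "top_of_set ?\<Omega> closure_of (?\<Omega> \<inter> O' n) = ?\<Omega>" for n
  by (auto simp: closure_of_subtopology)
 have "top_of_set ?\<Omega> closure_of \<Inter>(range (%n. ?\<Omega> \<inter> O' n)) = topspace (top_of_set ?\<Omega>)"
  by (rule Baire_category) (use cm oi cl in auto)
 moreover have "gdelta_in (top_of_set ?\<Omega>) (\<Inter>(range (%n. ?\<Omega> \<inter> O' n)))"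
  by (rule gdelta_in_Inter) (use oi in "auto intro: open_imp_gdelta_in")
 ultimately show ?thesis unfolding eq dense_gdelta_in_def by blast
qed

text \<open>Every orbit in the hull is dense: if the translate of \<open>V\<close> by
  \<open>s\<close> is close to \<open>\<omega>\<close>, then shifting both by \<open>t - s\<close>
  brings the translate of \<open>V\<close> by \<open>t\<close> just as close to the orbit of
  \<open>\<omega>\<close>.\<close>

lemma translates_dense:
 fixes V :: "'a \<Rightarrow>\<^sub>C real"
 assumes "\<omega> \<in> bohr_hull V"
 shows "range (%s. translate s \<omega>) \<subseteq> bohr_hull V" "bohr_hull V \<subseteq> closure (range (%s. translate s \<omega>))"
proof -
 have near: "EX s. dist (translate s V) \<omega> < e" if "e > 0" for e
  using assms that unfolding bohr_hull_def closure_approachable by auto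
 show "range (%s. translate s \<omega>) \<subseteq> bohr_hull V"
 proof clarify
  fix s
  show "translate s \<omega> \<in> bohr_hull V" unfolding bohr_hull_def closure_approachable
  proof (intro allI impI)
   fix e :: real assume "e > 0"
   then obtain t where "dist (translate t V) \<omega> < e" using near by blast
   then have "dist (translate (s + t) V) (translate s \<omega>) < e"
    using dist_translate[of s "translate t V" \<omega>] unfolding translate_translate by linarith
   then show "\<exists>y\<in>range (%t. translate t V). dist y (translate s \<omega>) < e" by blast
  qed
 qed
 have "range (%t. translate t V) \<subseteq> closure (range (%s. translate s \<omega>))"
 proof clarify
  fix t
  show "translate t V \<in> closure (range (%s. translate s \<omega>))" unfolding closure_approachable
  proof (intro allI impI)
   fix e :: real assume "e > 0"
   then obtain s where s: "dist (translate s V) \<omega> < e" using near by blast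
   have "translate (t - s) (translate s V) = translate t V" by (simp add: translate_translate)
   then have "dist (translate (t - s) \<omega>) (translate t V) < e"
    using dist_translate[of "t - s" \<omega> "translate s V"] s by (simp add: dist_commute)
   then show "\<exists>y\<in>range (%s. translate s \<omega>). dist y (translate t V) < e" by blast
  qed
 qed
 then show "bohr_hull V \<subseteq> closure (range (%s. translate s \<omega>))" unfolding bohr_hull_def by (rule closure_minimal) simp
qed

end

lemma translation_ring_real: "translation_ring (abs :: real => real)" by standard (auto intro: continuous_intros)

lemma translation_ring_int: "translation_ring (%k :: int. real_of_int \<bar>k\<bar>)" by standard (auto simp del: of_int_abs)

text \<open>The common end of both absence proofs: \<open>C\<close> depends on the energy, yet the
  Gaussian wins for every \<open>C\<close>, while \<open>d n\<close>, the reflected value, tends to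
  0.\<close>

lemma gaussian_decay:
 fixes a :: complex
 assumes b: "!!n. cmod a <= sqrt (M * exp (- (T n)\<^sup>2) * exp (C * (T n + S))) + d n"
  and T: "!!n. real n <= T n" and d: "d ----> 0" and M: "M >= 0"
 shows "a = 0"
proof -
 define K where "K = M * exp ((C + 1)\<^sup>2 / 4 + C * S)"
 have "M * exp (- (T n)\<^sup>2) * exp (C * (T n + S)) <= K * exp (- real n)" for n
 proof -
  \<comment> \<open>Completing the square for the rate \<open>C + 1\<close> instead of
    \<open>C\<close> leaves a factor exp(- T n), which decays because
    \<open>T n >= n\<close>.\<close>
  have "0 <= (T n - (C + 1) / 2)\<^sup>2" by simp
  then have "- (T n)\<^sup>2 + C * (T n + S) <= ((C + 1)\<^sup>2 / 4 + C * S) + - T n" by (simp add: power2_eq_square field_simps)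
  also have "... <= ((C + 1)\<^sup>2 / 4 + C * S) + - real n" using T[of n] by simp
  finally have "exp (- (T n)\<^sup>2 + C * (T n + S)) <= exp ((C + 1)\<^sup>2 / 4 + C * S) * exp (- real n)"
   by (simp only: exp_add[symmetric] exp_le_cancel_iff)
  then have "M * exp (- (T n)\<^sup>2 + C * (T n + S)) <= M * (exp ((C + 1)\<^sup>2 / 4 + C * S) * exp (- real n))" using M by (rule mult_left_mono)
  then show ?thesis unfolding K_def mult.assoc exp_add[of "- (T n)\<^sup>2"] .
 qed
 note sq = this
 have le: "ALL n. cmod a <= sqrt (K * exp (- real n)) + d n" proof
  fix n show "cmod a <= sqrt (K * exp (- real n)) + d n" using b[of n] real_sqrt_le_mono[OF sq[of n]] by linarith
 qed
 have "(%n. sqrt (K * exp (- real n)) + d n) ----> sqrt (K * 0) + 0" by (intro tendsto_add d tendsto_real_sqrt tendsto_mult tendsto_const) real_asymp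
 from tendsto_lowerbound[OF this always_eventually[OF le]] have "cmod a <= sqrt (K * 0) + 0" by simp
 then show ?thesis by simp
qed

section \<open>Absence of eigenvalues\<close>

text \<open>Adding D/C makes the inequality homogeneous; then multiplication by exp(- C x) or exp(C
  x) gives a monotone function, one for each direction.\<close>

lemma gronwall_two_sided:
 fixes y y' :: "real => real"
 assumes d: "!!x. (y has_real_derivative y' x) (at x)" and b: "!!x. \<bar>y' x\<bar> <= C * y x + D"
  and C: "C > 0" and D: "D >= 0"
 shows "y s <= (y t + D / C) * exp (C * \<bar>s - t\<bar>)"
proof -
 define E where "E = D / C"
 have C0: "D = C * E" using C by (simp add: E_def)
 have "y s + E <= (y t + E) * exp (C * \<bar>s - t\<bar>)"
 proof (cases "t <= s")
  case True
  have "(y s + E) * exp (- C * s) <= (y t + E) * exp (- C * t)"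
  proof (rule DERIV_nonpos_imp_nonincreasing[OF True])
   fix x
   have "((%x. (y x + E) * exp (- C * x)) has_real_derivative y' x * exp (- C * x) + (- C * exp (- C * x)) * (y x + E)) (at x)"
    by (auto intro!: derivative_eq_intros d)
   moreover have "y' x * exp (- C * x) + (- C * exp (- C * x)) * (y x + E) = (y' x - (C * y x + D)) * exp (- C * x)"
    unfolding C0 by (simp add: algebra_simps)
   moreover have "... <= 0" using b[of x] by (intro mult_nonpos_nonneg) auto
   ultimately show "EX z. ((%x. (y x + E) * exp (- C * x)) has_real_derivative z) (at x) & z <= 0" by metis
  qed
  then have "(y s + E) * exp (- C * s) * exp (C * s) <= (y t + E) * exp (- C * t) * exp (C * s)" by (rule mult_right_mono) simp
  then show ?thesis using True by (simp add: mult.assoc flip: exp_add) (simp add: algebra_simps)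
 next
  case False
  then have st: "s <= t" by simp
  have "(y s + E) * exp (C * s) <= (y t + E) * exp (C * t)"
  proof (rule DERIV_nonneg_imp_nondecreasing[OF st])
   fix x
   have "((%x. (y x + E) * exp (C * x)) has_real_derivative y' x * exp (C * x) + (C * exp (C * x)) * (y x + E)) (at x)"
    by (auto intro!: derivative_eq_intros d)
   moreover have "y' x * exp (C * x) + (C * exp (C * x)) * (y x + E) = (y' x + (C * y x + D)) * exp (C * x)" unfolding C0 by (simp add: algebra_simps)
   moreover have "0 <= ..." using b[of x] by (intro mult_nonneg_nonneg) auto
   ultimately show "EX z. ((%x. (y x + E) * exp (C * x)) has_real_derivative z) (at x) & z >= 0" by metis
  qed
  then have "(y s + E) * exp (C * s) * exp (- C * s) <= (y t + E) * exp (C * t) * exp (- C * s)" by (rule mult_right_mono) simp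
  then show ?thesis using st by (simp add: mult.assoc flip: exp_add) (simp add: algebra_simps)
 qed
 moreover have "0 <= E" using C D by (simp add: E_def)
 ultimately show ?thesis unfolding E_def[symmetric] by linarith
qed

text \<open>Gronwall for the energy |w|^2 + |w'|^2. In the rate \<open>A + 2\<close>, the part 1 + A
  bounds the mixed products and one more unit absorbs the product of |w'| with
  \<open>e\<close>.\<close>

lemma gronwall_second_order:
 fixes w w' w'' :: "real => complex"
 assumes dw: "!!x. (w has_vector_derivative w' x) (at x)" and dw': "!!x. (w' has_vector_derivative w'' x) (at x)"
  and b: "!!x. cmod (w'' x) <= A * cmod (w x) + e" and A: "A >= 0" and e: "e >= 0"
 shows "(cmod (w s))\<^sup>2 <= ((cmod (w t))\<^sup>2 + (cmod (w' t))\<^sup>2 + e\<^sup>2 / (A + 2)) * exp ((A + 2) * \<bar>s - t\<bar>)"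
proof -
 define y where "y x = (cmod (w x))\<^sup>2 + (cmod (w' x))\<^sup>2" for x
 define y' where "y' x = 2 * (w x \<bullet> w' x) + 2 * (w' x \<bullet> w'' x)" for x
 have d: "(y has_real_derivative y' x) (at x)" for x
 proof -
  have "((%x. w x \<bullet> w x + w' x \<bullet> w' x) has_vector_derivative (w x \<bullet> w' x + w' x \<bullet> w x) + (w' x \<bullet> w'' x + w'' x \<bullet> w' x)) (at x)"
   by (intro has_vector_derivative_add bounded_bilinear.has_vector_derivative[OF bounded_bilinear_inner] dw dw')
  moreover have "y = (%x. w x \<bullet> w x + w' x \<bullet> w' x)" by (simp add: y_def[abs_def] power2_norm_eq_inner)
  moreover have "(w x \<bullet> w' x + w' x \<bullet> w x) + (w' x \<bullet> w'' x + w'' x \<bullet> w' x) = y' x" by (simp add: y'_def inner_commute)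
  ultimately show ?thesis by (simp add: has_real_derivative_iff_has_vector_derivative)
 qed
 have "\<bar>y' x\<bar> <= (A + 2) * y x + e\<^sup>2" for x
 proof -
  let ?a = "cmod (w x)" and ?b = "cmod (w' x)"
  have "\<bar>w x \<bullet> w' x\<bar> <= ?a * ?b" by (rule Cauchy_Schwarz_ineq2)
  moreover have "\<bar>w' x \<bullet> w'' x\<bar> <= ?b * (A * ?a + e)"
   using Cauchy_Schwarz_ineq2[of "w' x" "w'' x"] mult_left_mono[OF b[of x] norm_ge_zero[of "w' x"]] by linarith
  ultimately have "\<bar>y' x\<bar> <= 2 * (?a * ?b) + 2 * (?b * (A * ?a + e))" unfolding y'_def by linarith
  also have "... = (1 + A) * (2 * ?a * ?b) + 2 * ?b * e" by (simp add: algebra_simps)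
  also have "... <= (1 + A) * (?a\<^sup>2 + ?b\<^sup>2) + (?b\<^sup>2 + e\<^sup>2)"
   using A sum_squares_bound[of ?a ?b] sum_squares_bound[of ?b e] by (intro add_mono mult_left_mono) auto
  also have "... <= (A + 2) * y x + e\<^sup>2" by (simp add: y_def algebra_simps)
  finally show ?thesis .
 qed
 from gronwall_two_sided[OF d this, of s t] have "y s <= (y t + e\<^sup>2 / (A + 2)) * exp ((A + 2) * \<bar>s - t\<bar>)" using A by simp
 moreover have "(cmod (w s))\<^sup>2 <= y s" by (simp add: y_def)
 ultimately show ?thesis unfolding y_def by linarith
qed

lemma cmod_mult_le_squares: "cmod (a * b) <= ((cmod a)\<^sup>2 + (cmod b)\<^sup>2) / 2"
 using sum_squares_bound[of "cmod a" "cmod b"] by (simp add: norm_mult)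

lemma min_of_product:
 assumes "a * b <= m\<^sup>2" "0 <= a" "0 <= b" "(0::real) <= m" shows "a <= m | b <= m"
proof (rule ccontr)
 assume "~ (a <= m | b <= m)"
 then have "m * m < a * b" using assms by (intro mult_strict_mono) auto
 then show False using assms(1) by (simp add: power2_eq_square)
qed

lemma has_vector_derivative_reflection:
 assumes "!!x. (f has_vector_derivative f' x) (at x)"
 shows "((%x. f (c - x)) has_vector_derivative - f' (c - x)) (at (x::real))"
proof -
 have "((%x. c - x) has_vector_derivative - 1) (at x)" by (auto intro!: derivative_eq_intros)
 from vector_diff_chain_at[OF this assms] show ?thesis by (simp add: comp_def)
qed

lemma almost_symmetric_bound_real:
 fixes \<omega> :: "real \<Rightarrow>\<^sub>C real" and u v :: "real => complex"
 assumes c: "c = t + t" and du: "!!x. (u has_vector_derivative v x) (at x)"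
  and dv: "!!x. (v has_vector_derivative (cor (\<omega> x) - E) * u x) (at x)"
  and uL: "u \<in> L2 lborel" and vL: "v \<in> L2 lborel" and B: "!!x. cmod (u x) <= B"
  and \<delta>: "dist (reflect c \<omega>) \<omega> < \<delta>" "\<delta> <= 1"
 defines "K \<equiv> LINT x|lborel. (cmod (u x))\<^sup>2" and "A \<equiv> norm \<omega> + cmod E"
 shows "cmod (u s) <= sqrt ((2 * K + B\<^sup>2) * \<delta> * exp ((A + 2) * (\<bar>t\<bar> + \<bar>s\<bar>))) + cmod (u (c - s))"
proof -
 have \<delta>0: "0 < \<delta>" using \<delta>(1) zero_le_dist le_less_trans by blast
 have K0: "0 <= K" by (simp add: K_def)
 have A0: "0 <= A" by (simp add: A_def)
 have B0: "0 <= B" using B[of 0] norm_ge_zero order_trans by blast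
 have sym: "\<bar>\<omega> (c - x) - \<omega> x\<bar> <= \<delta>" for x
  using dist_bounded[of "reflect c \<omega>" x \<omega>] \<delta>(1) by (simp add: dist_real_def c translation_ring.reflect_apply[OF translation_ring_real])
 have cu: "continuous_on UNIV u" and cv: "continuous_on UNIV v"
  by (intro continuous_at_imp_continuous_on ballI has_vector_derivative_continuous[OF du] has_vector_derivative_continuous[OF dv])+
 have cr: "continuous_on UNIV (%x. f (c - x))" if "continuous_on UNIV f" for f :: "real => complex"
  by (rule continuous_on_compose2[OF that]) (auto intro: continuous_intros)
 \<comment> \<open>\<open>W\<close> is the Wronskian of \<open>u\<close> and its reflection, taken
   without conjugation so that a complex \<open>E\<close> is allowed. In its derivative
   \<open>r\<close> everything cancels except the asymmetry of the potential.\<close>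
 define r where "r x = cor (\<omega> (c - x) - \<omega> x) * (u x * u (c - x))" for x
 define W where "W x = u x * - v (c - x) - v x * u (c - x)" for x
 have "(W has_vector_derivative r x) (at x)" for x
 proof -
  have "((%x. - v (c - x)) has_vector_derivative - (- ((cor (\<omega> (c - x)) - E) * u (c - x)))) (at x)"
   by (intro has_vector_derivative_minus has_vector_derivative_reflection[where f = v and f' = "%x. (cor (\<omega> x) - E) * u x"] dv)
  from has_vector_derivative_diff[OF has_vector_derivative_mult[OF du this] has_vector_derivative_mult[OF dv has_vector_derivative_reflection[OF du]], of c]
  have "(W has_vector_derivative u x * - (- ((cor (\<omega> (c - x)) - E) * u (c - x))) + v x * - v (c - x)
    - (v x * - v (c - x) + (cor (\<omega> x) - E) * u x * u (c - x))) (at x)" unfolding W_def[abs_def] .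
  then show ?thesis by (rule back_subst[where P = "%d. (W has_vector_derivative d) (at x)"]) (simp add: r_def algebra_simps)
 qed
 moreover have "continuous_on UNIV r" unfolding r_def
  by (intro continuous_on_mult continuous_on_of_real continuous_on_diff cu cr continuous_on_compose2[OF continuous_on_apply_bcontfun[of UNIV \<omega>]]
    continuous_on_id continuous_on_const) auto
 ultimately have P: "primitive W r" by (rule primitive_C1)
 have uu: "integrable lborel (%x. u x * u (c - x))" by (intro L2_mult_integrable uL L2_reflection)
 have [measurable]: "r \<in> borel_measurable borel" using \<open>continuous_on UNIV r\<close> by (rule borel_measurable_continuous_onI)
 have rb: "cmod (r x) <= \<delta> * cmod (u x * u (c - x))" for x
  unfolding r_def norm_mult[of "cor _"] norm_of_real by (rule mult_right_mono[OF sym norm_ge_zero])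
 have ri: "integrable lborel r" by (rule lintegrable_bound[OF integrable_mult_right[OF integrable_norm[OF uu], of \<delta>]])
   (use rb \<delta>0 in "auto simp: abs_mult")
 have Wi: "integrable lborel W" unfolding W_def
  by (intro Bochner_Integration.integrable_diff L2_mult_integrable uL vL L2_uminus L2_reflection)
 have lim: "(W ---> 0) at_top" by (rule primitive_integrable_limits(1)[OF P Wi ri])
 have K': "(LINT x|lborel. (cmod (u (c - x)))\<^sup>2) = K"
  using lborel_integral_real_affine[of "-1" "%x. (cmod (u x))\<^sup>2" c] by (simp add: K_def)
 have ii: "integrable lborel (%x. (cmod (u x))\<^sup>2)" "integrable lborel (%x. (cmod (u (c - x)))\<^sup>2)"
  by (intro L2_integrable uL L2_reflection)+
 \<comment> \<open>\<open>W\<close> and its derivative are integrable, so \<open>W\<close> vanishes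
   at infinity and its value at the center is bounded by the integral of |r|, hence by
   \<open>\<delta>\<close> times the squared norm of \<open>u\<close>.\<close>
 have Wt: "cmod (W t) <= \<delta> * K"
 proof -
  have "cmod (W b - W t) <= \<delta> * K" if "t <= b" for b
  proof -
   have "W b - W t = (LINT x|lborel. indicator {t<..b} x *R r x)" using P that by (simp add: primitive_def ioc_integral_def set_lebesgue_integral_def)
   then have "cmod (W b - W t) <= (LINT x|lborel. norm (indicator {t<..b} x *R r x))" by (simp only: integral_norm_bound)
   also have "... <= (LINT x|lborel. \<delta> * (((cmod (u x))\<^sup>2 + (cmod (u (c - x)))\<^sup>2) / 2))"
   proof (rule integral_mono)
    show "integrable lborel (%x. norm (indicator {t<..b} x *R r x))" by (intro integrable_norm integrable_mult_indicator ri) auto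
    show "integrable lborel (%x. \<delta> * (((cmod (u x))\<^sup>2 + (cmod (u (c - x)))\<^sup>2) / 2))"
     using ii by (intro integrable_mult_right integrable_divide lintegrable_add)
    show "norm (indicator {t<..b} x *R r x) <= \<delta> * (((cmod (u x))\<^sup>2 + (cmod (u (c - x)))\<^sup>2) / 2)" for x
     using order_trans[OF rb[of x] mult_left_mono[OF cmod_mult_le_squares[of "u x" "u (c - x)"] less_imp_le[OF \<delta>0]]] \<delta>0
     by (auto simp: indicator_def)
   qed
   also have "... = \<delta> * K" using ii by (simp add: K' K_def[symmetric])
   finally show ?thesis .
  qed
  then have ev: "\<forall>\<^sub>F b in at_top. cmod (W b - W t) <= \<delta> * K" by (intro eventually_mono[OF eventually_ge_at_top[of t]])
  have "((%b. cmod (W b - W t)) ---> cmod (0 - W t)) at_top" by (intro tendsto_intros lim)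
  from tendsto_upperbound[OF this ev] show ?thesis by simp
 qed
 have "W t = - (2 * (u t * v t))" by (simp add: W_def c)
 then have "cmod (u t) * cmod (v t) <= (sqrt (\<delta> * K / 2))\<^sup>2" using Wt \<delta>0 K0 by (simp add: norm_mult)
 then have cases: "cmod (u t) <= sqrt (\<delta> * K / 2) | cmod (v t) <= sqrt (\<delta> * K / 2)" using \<delta>0 K0 by (intro min_of_product) auto
 \<comment> \<open>The sign is \<open>\<sigma> = 1\<close> when \<open>u t\<close> is small and
   \<open>\<sigma> = -1\<close> when \<open>v t\<close> is small. At the center one of the two
   initial values of w = u + \<open>\<sigma>\<close> u(c - x) then vanishes and the other is twice
   the small number.\<close>
 have step: ?thesis
  if \<sigma>: "cmod \<sigma> = 1" and init: "(cmod (u t + \<sigma> * u t))\<^sup>2 + (cmod (v t - \<sigma> * v t))\<^sup>2 <= 2 * \<delta> * K" for \<sigma>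
 proof -
  define w where "w x = u x + \<sigma> * u (c - x)" for x
  define w' where "w' x = v x + \<sigma> * - v (c - x)" for x
  define w'' where "w'' x = (cor (\<omega> x) - E) * u x + \<sigma> * - (- ((cor (\<omega> (c - x)) - E) * u (c - x)))" for x
  have dw: "(w has_vector_derivative w' x) (at x)" for x unfolding w_def w'_def
   by (intro has_vector_derivative_add has_vector_derivative_mult_right has_vector_derivative_reflection du)
  have dw': "(w' has_vector_derivative w'' x) (at x)" for x unfolding w'_def w''_def
   by (intro has_vector_derivative_add has_vector_derivative_mult_right has_vector_derivative_minus dv
     has_vector_derivative_reflection[where f = v and f' = "%x. (cor (\<omega> x) - E) * u x"])
  have bd: "cmod (w'' x) <= A * cmod (w x) + \<delta> * B" for x
  proof -
   have "w'' x = (cor (\<omega> x) - E) * w x + \<sigma> * (cor (\<omega> (c - x) - \<omega> x) * u (c - x))"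
    by (simp add: w''_def w_def algebra_simps)
   then have "cmod (w'' x) <= cmod (cor (\<omega> x) - E) * cmod (w x) + \<bar>\<omega> (c - x) - \<omega> x\<bar> * cmod (u (c - x))"
    using norm_triangle_ineq[of "(cor (\<omega> x) - E) * w x" "\<sigma> * (cor (\<omega> (c - x) - \<omega> x) * u (c - x))"]
    by (simp only: norm_mult \<sigma> norm_of_real mult_1)
   also have "... <= A * cmod (w x) + \<delta> * B"
   proof (intro add_mono mult_mono)
    show "cmod (cor (\<omega> x) - E) <= A" using norm_triangle_ineq4[of "cor (\<omega> x)" E] norm_bounded[of \<omega> x] by (simp add: A_def)
   qed (use sym B A0 \<delta>0 in auto)
   finally show ?thesis .
  qed
  have "(cmod (w s))\<^sup>2 <= ((cmod (w t))\<^sup>2 + (cmod (w' t))\<^sup>2 + (\<delta> * B)\<^sup>2 / (A + 2)) * exp ((A + 2) * \<bar>s - t\<bar>)"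
   using \<delta>0 B0 by (intro gronwall_second_order[OF dw dw' bd A0]) simp
  also have "... <= ((2 * K + B\<^sup>2) * \<delta>) * exp ((A + 2) * (\<bar>t\<bar> + \<bar>s\<bar>))"
  proof (intro mult_mono)
   \<comment> \<open>Since \<open>\<delta> <= 1\<close>, the quadratic error of the inhomogeneity is
     bounded linearly in \<open>\<delta>\<close>, like the contribution of the initial
     values.\<close>
   have "(\<delta> * B)\<^sup>2 / (A + 2) <= (\<delta> * B)\<^sup>2" using A0 by (simp add: divide_le_eq mult_left_mono algebra_simps)
   also have "... = (\<delta> * \<delta>) * B\<^sup>2" by (simp add: power2_eq_square)
   also have "... <= \<delta> * B\<^sup>2" using \<delta>0 \<delta>(2) by (intro mult_right_mono mult_left_le) auto
   finally show "(cmod (w t))\<^sup>2 + (cmod (w' t))\<^sup>2 + (\<delta> * B)\<^sup>2 / (A + 2) <= (2 * K + B\<^sup>2) * \<delta>"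
    using init by (simp add: w_def w'_def c algebra_simps)
   have "\<bar>s - t\<bar> <= \<bar>t\<bar> + \<bar>s\<bar>" by linarith
   then show "exp ((A + 2) * \<bar>s - t\<bar>) <= exp ((A + 2) * (\<bar>t\<bar> + \<bar>s\<bar>))" using A0 by (simp add: mult_left_mono)
   show "0 <= (2 * K + B\<^sup>2) * \<delta>" using K0 \<delta>0 by simp
  qed simp
  finally have "cmod (w s) <= sqrt ((2 * K + B\<^sup>2) * \<delta> * exp ((A + 2) * (\<bar>t\<bar> + \<bar>s\<bar>)))" by (rule real_le_rsqrt)
  moreover have "cmod (u s) <= cmod (w s) + cmod (u (c - s))"
   using norm_triangle_ineq4[of "w s" "\<sigma> * u (c - s)"] \<sigma> by (simp add: w_def norm_mult)
  ultimately show ?thesis by linarith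
 qed
 have sq: "(2 * a)\<^sup>2 <= 2 * \<delta> * K" if "a <= sqrt (\<delta> * K / 2)" "0 <= a" for a
 proof -
  have "a\<^sup>2 <= (sqrt (\<delta> * K / 2))\<^sup>2" using that by (rule power_mono)
  then show ?thesis using \<delta>0 K0 by (simp add: power_mult_distrib mult_ac)
 qed
 from cases show ?thesis
 proof
  assume "cmod (u t) <= sqrt (\<delta> * K / 2)"
  then have "(2 * cmod (u t))\<^sup>2 <= 2 * \<delta> * K" by (rule sq) simp
  then show ?thesis by (intro step[of 1]) (simp_all add: norm_mult flip: mult_2)
 next
  assume "cmod (v t) <= sqrt (\<delta> * K / 2)"
  then have "(2 * cmod (v t))\<^sup>2 <= 2 * \<delta> * K" by (rule sq) simp
  then show ?thesis by (intro step[of "- 1"]) (simp_all add: norm_mult flip: mult_2)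
 qed
qed

lemma no_eigenvalue_real:
 fixes \<omega> :: "real \<Rightarrow>\<^sub>C real"
 assumes sym: "nearly_symmetric abs \<omega>"
 shows "no_point_spectrum lborel (schroedinger_real \<omega>)" unfolding no_point_spectrum_def
proof clarify
 fix E \<psi> assume \<psi>: "\<psi> \<in> L2 lborel" and nz: "~ (AE x in lborel. \<psi> x = 0)" and ev: "(\<psi>, %x. E * \<psi> x) \<in> schroedinger_real \<omega>"
 obtain f' f'' where f: "f' \<in> L2 lborel" "f'' \<in> L2 lborel" "weak_derivative \<psi> f'" "weak_derivative f' f''"
  "AE x in lborel. E * \<psi> x = - f'' x + cor (\<omega> x) * \<psi> x" using ev unfolding schroedinger_real_def by blast
 \<comment> \<open>The eigenfunction and its weak derivative are replaced by absolutely continuous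
   representatives. The equation then makes them continuously differentiable, so that it holds in
   the classical sense.\<close>
 obtain u where u: "primitive u f'" "AE x in lborel. \<psi> x = u x" using weak_derivative_primitive[OF \<psi> f(1,3)] by blast
 obtain v where v: "primitive v f''" "AE x in lborel. f' x = v x" using weak_derivative_primitive[OF f(1,2,4)] by blast
 have uc: "continuous_on UNIV u" and vc: "continuous_on UNIV v" using u v by (auto intro: primitive_continuous)
 have [measurable]: "u \<in> borel_measurable borel" "v \<in> borel_measurable borel" using u v by (auto intro: primitive_measurable)
 have uL: "u \<in> L2 lborel" by (rule L2_AE_cong[OF \<psi> _ u(2)]) measurable
 have vL: "v \<in> L2 lborel" by (rule L2_AE_cong[OF f(1) _ v(2)]) measurable
 have cw: "continuous_on UNIV (%x. (cor (\<omega> x) - E) * u x)"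
  by (intro continuous_on_mult continuous_on_diff continuous_on_of_real continuous_on_apply_bcontfun continuous_on_const uc continuous_on_id)
 have P1: "primitive u v" by (rule primitive_cong_AE[OF u(1) v(2)]) measurable
 have P2: "primitive v (%x. (cor (\<omega> x) - E) * u x)"
 proof (rule primitive_cong_AE[OF v(1)])
  show "AE x in lborel. f'' x = (cor (\<omega> x) - E) * u x" using f(5) u(2) by eventually_elim (simp add: algebra_simps)
  show "(%x. (cor (\<omega> x) - E) * u x) \<in> borel_measurable borel" using cw by (rule borel_measurable_continuous_onI)
 qed
 have du: "(u has_vector_derivative v x) (at x)" for x by (rule primitive_has_derivative[OF P1 vc])
 have dv: "(v has_vector_derivative (cor (\<omega> x) - E) * u x) (at x)" for x by (rule primitive_has_derivative[OF P2 cw])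
 have lim: "(u ---> 0) at_infinity" unfolding at_infinity_eq_at_top_bot
  using H1_facts(1,2)[OF P1 uL vL] by (rule filterlim_sup)
 have "bounded (range u)"
 proof -
  have "\<forall>\<^sub>F x in at_infinity. cmod (u x) < 1" using tendstoD[OF lim, of 1] by simp
  then obtain R where R: "!!x. R <= \<bar>x\<bar> ==> cmod (u x) < 1" unfolding eventually_at_infinity by auto
  have "compact (u ` {- R..R})" using uc by (intro compact_continuous_image) (auto intro: continuous_on_subset)
  then have "bounded (u ` {- R..R} \<union> cball 0 1)" by (simp add: compact_imp_bounded)
  moreover have "range u \<subseteq> u ` {- R..R} \<union> cball 0 1"
  proof clarify
   fix x assume "u x \<notin> cball 0 1"
   then have "~ R <= \<bar>x\<bar>" using R[of x] by auto
   then show "u x \<in> u ` {- R..R}" by (intro imageI) auto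
  qed
  ultimately show ?thesis by (rule bounded_subset)
 qed
 then obtain B where B: "!!x. cmod (u x) <= B" unfolding bounded_iff by blast
 obtain T where T: "!!n::nat. real n <= \<bar>T n\<bar>" "!!n. dist (reflect (T n + T n) \<omega>) \<omega> < exp (- \<bar>T n\<bar>\<^sup>2)"
  using sym unfolding nearly_symmetric_def by metis
 have "u s = 0" for s
 proof (rule gaussian_decay)
  show "cmod (u s) <= sqrt ((2 * (LINT x|lborel. (cmod (u x))\<^sup>2) + B\<^sup>2) * exp (- \<bar>T n\<bar>\<^sup>2) * exp ((norm \<omega> + cmod E + 2) * (\<bar>T n\<bar> + \<bar>s\<bar>))) + cmod (u (T n + T n - s))" for n
   by (rule almost_symmetric_bound_real[OF refl du dv uL vL B T(2)[of n]]) simp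
  show "real n <= \<bar>T n\<bar>" for n by (rule T)
  have "filterlim (%n. T n + T n - s) at_infinity sequentially" unfolding filterlim_at_infinity[OF order_refl] eventually_sequentially
  proof (intro allI impI)
   fix r :: real assume "r > 0"
   obtain N :: nat where "r + \<bar>s\<bar> < real N" using reals_Archimedean2 by blast
   moreover have "real n <= norm (T n + T n - s) + \<bar>s\<bar>" for n using T(1)[of n] unfolding real_norm_def by linarith
   ultimately show "EX N. \<forall>n\<ge>N. r <= norm (T n + T n - s)" by (intro exI[of _ N]) (smt (verit) of_nat_mono)
  qed
  from tendsto_norm_zero[OF filterlim_compose[OF lim this]] show "(%n. cmod (u (T n + T n - s))) ----> 0" .
 qed simp
 then show False using u(2) nz by (auto elim: eventually_mono)
qed

subsection \<open>The discrete case\<close>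

lemma sum_le_count_integral:
 fixes g :: "int => real"
 assumes g: "integrable (count_space UNIV) g" and g0: "!!k. 0 <= g k" and F: "finite F"
 shows "sum g F <= (LINT k|count_space UNIV. g k)"
proof -
 have "sum g F = (LINT k|count_space UNIV. g k * indicator F k)"
 proof -
  have "(LINT k|count_space UNIV. g k * indicator F k) = (\<Sum>k | k \<in> UNIV & g k * indicator F k ~= 0. g k * indicator F k)"
   by (rule lebesgue_integral_count_space_finite_support) (auto intro: finite_subset[OF _ F] simp: indicator_def)
  also have "... = (\<Sum>k\<in>F. g k * indicator F k)" by (rule sum.mono_neutral_left) (use F in "auto simp: indicator_def")
  finally show ?thesis by simp
 qed
 also have "... <= (LINT k|count_space UNIV. g k)"
  by (rule integral_mono[OF _ g]) (use g g0 in "auto simp: indicator_def intro: lintegrable_bound[OF g]")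
 finally show ?thesis .
qed

text \<open>Only finitely many entries of a square summable sequence exceed \<open>e\<close>, so any
  sequence of indices that escapes to infinity leaves them behind.\<close>

lemma l2_int_tendsto:
 assumes u: "u \<in> L2 (count_space UNIV)" and x: "!!n. real n <= real_of_int \<bar>x n\<bar> + C"
 shows "(%n. u (x n)) ----> 0"
proof (rule LIMSEQ_I)
 fix e :: real assume e: "e > 0"
 define K where "K = (LINT k|count_space UNIV. (cmod (u k))\<^sup>2)"
 let ?S = "{k. e <= cmod (u k)}"
 have "finite ?S"
 proof (rule ccontr)
  assume inf: "infinite ?S"
  obtain m :: nat where m: "K < real m * e\<^sup>2" using reals_Archimedean3[of "e\<^sup>2"] e by auto
  obtain F where F: "finite F" "card F = m" "F \<subseteq> ?S" using infinite_arbitrarily_large[OF inf] by blast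
  have "real m * e\<^sup>2 <= (\<Sum>k\<in>F. (cmod (u k))\<^sup>2)"
   using F e sum_mono[of F "%_. e\<^sup>2" "%k. (cmod (u k))\<^sup>2"] by (auto intro: power_mono)
  also have "... <= K" unfolding K_def by (rule sum_le_count_integral[OF L2_integrable[OF u] _ F(1)]) simp
  finally show False using m by simp
 qed
 then obtain R where R: "!!k. k \<in> ?S ==> real_of_int \<bar>k\<bar> <= R"
  using finite_imp_bounded[of "real_of_int ` ?S"] unfolding bounded_iff by auto
 obtain N :: nat where N: "R + C < real N" using reals_Archimedean2 by blast
 have "cmod (u (x n)) < e" if "n >= N" for n
 proof (rule ccontr)
  assume "~ cmod (u (x n)) < e"
  then have "real_of_int \<bar>x n\<bar> <= R" using R[of "x n"] by simp
  then show False using x[of n] N that by linarith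
 qed
 then show "EX N. \<forall>n\<ge>N. norm (u (x n) - 0) < e" by auto
qed

lemma discrete_gronwall:
 fixes q :: "int => real"
 assumes "!!m. q (m + 1) <= C * q m" "!!m. q (m - 1) <= C * q m" "C >= 0"
 shows "q s <= C ^ nat \<bar>s - t\<bar> * q t"
proof -
 have 1: "q (t + int n) <= C ^ n * q t" for n
 proof (induction n)
  case (Suc n)
  have "q (t + int (Suc n)) <= C * q (t + int n)" using assms(1)[of "t + int n"] by (simp add: algebra_simps)
  then show ?case using mult_left_mono[OF Suc assms(3)] by simp
 qed simp
 have 2: "q (t - int n) <= C ^ n * q t" for n
 proof (induction n)
  case (Suc n)
  have "q (t - int (Suc n)) <= C * q (t - int n)" using assms(2)[of "t - int n"] by (simp add: algebra_simps)
  then show ?case using mult_left_mono[OF Suc assms(3)] by simp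
 qed simp
 show ?thesis
 proof (cases "t <= s")
  case True
  then show ?thesis using 1[of "nat (s - t)"] by simp
 next
  case False
  then show ?thesis using 2[of "nat (t - s)"] by simp
 qed
qed

lemma almost_symmetric_bound_int:
 fixes \<omega> :: "int \<Rightarrow>\<^sub>C real" and u :: "int => complex"
 assumes c: "c = t + t" and eq: "!!m. u (m + 1) + u (m - 1) = (E - cor (\<omega> m)) * u m"
  and uL: "u \<in> L2 (count_space UNIV)"
  and \<delta>: "dist (reflect c \<omega>) \<omega> < \<delta>" "\<delta> <= 1"
 defines "K \<equiv> LINT k|count_space UNIV. (cmod (u k))\<^sup>2" and "C \<equiv> norm \<omega> + cmod E + 2"
 shows "cmod (u s) <= sqrt (((C + 1) * sqrt K)\<^sup>2 * \<delta> * exp (2 * ln C * (real_of_int \<bar>t\<bar> + real_of_int \<bar>s\<bar>))) + cmod (u (c - s))"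
  (is "_ <= sqrt ?R + _")
proof -
 define A where "A = norm \<omega> + cmod E"
 have C: "C = A + 2" by (simp add: C_def A_def)
 have \<delta>0: "0 < \<delta>" using \<delta>(1) zero_le_dist le_less_trans by blast
 have K0: "0 <= K" by (simp add: K_def)
 have A0: "0 <= A" by (simp add: A_def)
 have sym: "\<bar>\<omega> (c - m) - \<omega> m\<bar> <= \<delta>" for m
  using dist_bounded[of "reflect c \<omega>" m \<omega>] \<delta>(1) by (simp add: dist_real_def c translation_ring.reflect_apply[OF translation_ring_int])
 have sumK: "(\<Sum>k\<in>F. (cmod (u k))\<^sup>2) <= K" if "finite F" for F
  unfolding K_def by (rule sum_le_count_integral[OF L2_integrable[OF uL] _ that]) simp
 have B: "cmod (u k) <= sqrt K" for k using sumK[of "{k}"] by (simp add: real_le_rsqrt)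
 \<comment> \<open>The discrete Wronskian of \<open>u\<close> and its reflection. At the center it
   is \<open>u t * (u (t + 1) - u (t - 1))\<close>, with the symmetric difference in the role of the
   derivative.\<close>
 define W where "W m = u (m + 1) * u (c - m) - u m * u (c - m - 1)" for m
 have dW: "W (m + 1) - W m = cor (\<omega> (c - (m + 1)) - \<omega> (m + 1)) * (u (m + 1) * u (c - (m + 1)))" for m
 proof -
  have 1: "u (m + 1 + 1) = (E - cor (\<omega> (m + 1))) * u (m + 1) - u m" using eq[of "m + 1"] by (simp add: algebra_simps)
  have 2: "u (c - m) = (E - cor (\<omega> (c - (m + 1)))) * u (c - (m + 1)) - u (c - (m + 1) - 1)"
   using eq[of "c - (m + 1)"] by (simp add: algebra_simps)
  have 3: "c - m - 1 = c - (m + 1)" by simp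
  show ?thesis unfolding W_def 1 2 3 by (simp add: algebra_simps)
 qed
 \<comment> \<open>The increments of \<open>W\<close> are summed from the center outward;
   \<open>W (t + n)\<close> tends to 0 and the sums stay below the squared norm of
   \<open>u\<close>.\<close>
 have Wsum: "cmod (W t) <= cmod (W (t + int n)) + \<delta> * (\<Sum>j<n. ((cmod (u (t + 1 + int j)))\<^sup>2 + (cmod (u (t - 1 - int j)))\<^sup>2) / 2)" for n
 proof (induction n)
  case (Suc n)
  define m where "m = t + int n"
  have m1: "m + 1 = t + 1 + int n" "c - (m + 1) = t - 1 - int n" by (auto simp: m_def c)
  have "cmod (W (m + 1) - W m) <= \<delta> * (((cmod (u (m + 1)))\<^sup>2 + (cmod (u (c - (m + 1))))\<^sup>2) / 2)"
  proof -
   have "cmod (W (m + 1) - W m) = \<bar>\<omega> (c - (m + 1)) - \<omega> (m + 1)\<bar> * cmod (u (m + 1) * u (c - (m + 1)))"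
    unfolding dW norm_mult norm_of_real ..
   also have "... <= \<delta> * (((cmod (u (m + 1)))\<^sup>2 + (cmod (u (c - (m + 1))))\<^sup>2) / 2)"
    by (intro mult_mono sym cmod_mult_le_squares) (use \<delta>0 in auto)
   finally show ?thesis .
  qed
  moreover have "cmod (W m) <= cmod (W (m + 1)) + cmod (W (m + 1) - W m)" using norm_triangle_ineq4[of "W (m + 1)" "W (m + 1) - W m"] by simp
  moreover have "t + int (Suc n) = m + 1" by (simp add: m_def)
  ultimately show ?case using Suc unfolding sum.lessThan_Suc distrib_left m1(1)[symmetric] m1(2)[symmetric] m_def[symmetric]
   unfolding \<open>t + int (Suc n) = m + 1\<close> by linarith
 qed simp
 have Wt: "cmod (W t) <= \<delta> * K"
 proof -
  have s: "(\<Sum>j<n. ((cmod (u (t + 1 + int j)))\<^sup>2 + (cmod (u (t - 1 - int j)))\<^sup>2) / 2) <= K" for n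
  proof -
   have "(\<Sum>j<n. (cmod (u (t + 1 + int j)))\<^sup>2) = (\<Sum>k\<in>(%j. t + 1 + int j) ` {..<n}. (cmod (u k))\<^sup>2)"
    by (subst sum.reindex) (auto simp: inj_on_def)
   also have "... <= K" by (rule sumK) simp
   finally have 1: "(\<Sum>j<n. (cmod (u (t + 1 + int j)))\<^sup>2) <= K" .
   have "(\<Sum>j<n. (cmod (u (t - 1 - int j)))\<^sup>2) = (\<Sum>k\<in>(%j. t - 1 - int j) ` {..<n}. (cmod (u k))\<^sup>2)"
    by (subst sum.reindex) (auto simp: inj_on_def)
   also have "... <= K" by (rule sumK) simp
   finally show ?thesis using 1 by (simp add: sum.distrib flip: sum_divide_distrib)
  qed
  have le: "ALL n. cmod (W t) <= cmod (W (t + int n)) + \<delta> * K"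
  proof
   fix n show "cmod (W t) <= cmod (W (t + int n)) + \<delta> * K" using Wsum[of n] mult_left_mono[OF s[of n] less_imp_le[OF \<delta>0]] by linarith
  qed
  have "(%n. W (t + int n)) ----> 0 * 0 - 0 * 0" unfolding W_def
   by (intro tendsto_diff tendsto_mult l2_int_tendsto[OF uL, where C = "real_of_int \<bar>t\<bar> + real_of_int \<bar>c\<bar> + 1"]) auto
  then have "(%n. cmod (W (t + int n)) + \<delta> * K) ----> cmod 0 + \<delta> * K" by (intro tendsto_intros) simp
  from tendsto_lowerbound[OF this always_eventually[OF le]] show ?thesis by simp
 qed
 define \<eta> where "\<eta> = sqrt (\<delta> * K)"
 have \<eta>0: "0 <= \<eta>" using \<delta>0 K0 by (simp add: \<eta>_def)
 have "W t = u t * (u (t + 1) - u (t - 1))" by (simp add: W_def c algebra_simps)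
 then have "cmod (u t) * cmod (u (t + 1) - u (t - 1)) <= \<eta>\<^sup>2" using Wt \<delta>0 K0 by (simp add: norm_mult \<eta>_def)
 then have cases: "cmod (u t) <= \<eta> | cmod (u (t + 1) - u (t - 1)) <= \<eta>" using \<eta>0 by (intro min_of_product) auto
 have EA: "cmod (E - cor (\<omega> m)) <= A" for m
  using norm_triangle_ineq4[of E "cor (\<omega> m)"] norm_bounded[of \<omega> m] by (simp add: A_def)
 have step: ?thesis
  if \<sigma>: "cmod \<sigma> = 1" and init: "cmod (u t + \<sigma> * u t) + cmod (u (t + 1) + \<sigma> * u (t - 1)) <= C * \<eta>" for \<sigma>
 proof -
  define w where "w m = u m + \<sigma> * u (c - m)" for m
  define d where "d = \<delta> * sqrt K"
  have d0: "0 <= d" using \<delta>0 K0 by (simp add: d_def)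
  have rec: "cmod (w (m + 1) + w (m - 1)) <= A * cmod (w m) + d" for m
  proof -
   have "w (m + 1) + w (m - 1) = (u (m + 1) + u (m - 1)) + \<sigma> * (u (c - m + 1) + u (c - m - 1))" by (simp add: w_def algebra_simps)
   also have "... = (E - cor (\<omega> m)) * w m + \<sigma> * (cor (\<omega> m - \<omega> (c - m)) * u (c - m))"
    unfolding eq by (simp add: w_def algebra_simps)
   finally have "cmod (w (m + 1) + w (m - 1)) <= cmod (E - cor (\<omega> m)) * cmod (w m) + \<bar>\<omega> m - \<omega> (c - m)\<bar> * cmod (u (c - m))"
    using norm_triangle_ineq[of "(E - cor (\<omega> m)) * w m" "\<sigma> * (cor (\<omega> m - \<omega> (c - m)) * u (c - m))"]
    by (simp only: norm_mult \<sigma> norm_of_real mult_1)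
   also have "... <= A * cmod (w m) + d" unfolding d_def
    by (intro add_mono mult_mono EA B) (use sym[of m] A0 \<delta>0 in "auto simp: abs_minus_commute")
   finally show ?thesis .
  qed
  \<comment> \<open>Two consecutive values replace value and derivative. The summand
    \<open>d\<close> absorbs the inhomogeneous term, so that one step in either direction multiplies
    \<open>q\<close> by at most \<open>C = A + 2\<close>.\<close>
  define q where "q m = cmod (w m) + cmod (w (m + 1)) + d" for m
  have "q s <= C ^ nat \<bar>s - t\<bar> * q t"
  proof (rule discrete_gronwall)
   show "C >= 0" using A0 by (simp add: C)
   fix m
   have "cmod (w (m + 1 + 1)) <= cmod (w (m + 1 + 1) + w m) + cmod (w m)" using norm_triangle_ineq4[of "w (m + 1 + 1) + w m" "w m"] by simp
   moreover have "cmod (w (m + 1 + 1) + w m) <= A * cmod (w (m + 1)) + d" using rec[of "m + 1"] by simp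
   moreover have "0 <= A * cmod (w m)" "0 <= A * d" using A0 d0 by simp_all
   ultimately show "q (m + 1) <= C * q m" unfolding q_def C distrib_left distrib_right
    using d0 norm_ge_zero[of "w m"] norm_ge_zero[of "w (m + 1)"] by linarith
   have "cmod (w (m - 1)) <= cmod (w (m + 1) + w (m - 1)) + cmod (w (m + 1))" using norm_triangle_ineq4[of "w (m + 1) + w (m - 1)" "w (m + 1)"] by simp
   moreover have "0 <= A * cmod (w (m + 1))" using A0 by simp
   ultimately show "q (m - 1) <= C * q m" using rec[of m] \<open>0 <= A * d\<close> unfolding q_def C distrib_left distrib_right diff_add_cancel
    using d0 norm_ge_zero[of "w m"] norm_ge_zero[of "w (m + 1)"] by linarith
  qed
  moreover have "cmod (w s) <= q s" using d0 by (simp add: q_def)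
  moreover have "q t <= (C + 1) * sqrt K * sqrt \<delta>"
  proof -
   have "q t <= C * \<eta> + d" using init by (simp add: q_def w_def c algebra_simps)
   moreover have "\<delta> <= sqrt \<delta>" using \<delta>0 \<delta>(2) by (intro real_le_rsqrt) (simp add: power2_eq_square mult_left_le)
   then have "d <= sqrt \<delta> * sqrt K" unfolding d_def using K0 by (intro mult_right_mono) auto
   ultimately show ?thesis by (simp add: \<eta>_def real_sqrt_mult algebra_simps)
  qed
  moreover have "C ^ nat \<bar>s - t\<bar> * q t <= C ^ nat \<bar>s - t\<bar> * ((C + 1) * sqrt K * sqrt \<delta>)"
   using calculation(3) A0 by (intro mult_left_mono) (simp_all add: C)
  ultimately have ws: "cmod (w s) <= C ^ nat \<bar>s - t\<bar> * ((C + 1) * sqrt K * sqrt \<delta>)" by linarith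
  have "(cmod (w s))\<^sup>2 <= ?R"
  proof -
   have C1: "C > 0" "ln C >= 0" using A0 by (auto simp: C)
   have "(C ^ nat \<bar>s - t\<bar>)\<^sup>2 = exp (real (2 * nat \<bar>s - t\<bar>) * ln C)"
    unfolding exp_of_nat_mult using C1 by (simp add: mult.commute flip: power_mult)
   also have "... <= exp (2 * ln C * (real_of_int \<bar>t\<bar> + real_of_int \<bar>s\<bar>))"
   proof -
    have "real_of_int \<bar>s - t\<bar> <= real_of_int \<bar>t\<bar> + real_of_int \<bar>s\<bar>" by linarith
    then have "real_of_int \<bar>s - t\<bar> * (2 * ln C) <= (real_of_int \<bar>t\<bar> + real_of_int \<bar>s\<bar>) * (2 * ln C)" using C1 by (intro mult_right_mono) auto
    then show ?thesis by (simp add: mult_ac)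
   qed
   finally have p: "(C ^ nat \<bar>s - t\<bar>)\<^sup>2 <= exp (2 * ln C * (real_of_int \<bar>t\<bar> + real_of_int \<bar>s\<bar>))" .
   have "(cmod (w s))\<^sup>2 <= (C ^ nat \<bar>s - t\<bar> * ((C + 1) * sqrt K * sqrt \<delta>))\<^sup>2" using ws by (rule power_mono) simp
   also have "... = (C ^ nat \<bar>s - t\<bar>)\<^sup>2 * (((C + 1) * sqrt K)\<^sup>2 * \<delta>)" using \<delta>0 by (simp add: power_mult_distrib)
   also have "... <= exp (2 * ln C * (real_of_int \<bar>t\<bar> + real_of_int \<bar>s\<bar>)) * (((C + 1) * sqrt K)\<^sup>2 * \<delta>)"
    using p \<delta>0 by (intro mult_right_mono) auto
   finally show ?thesis by (simp only: mult.commute)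
  qed
  then have "cmod (w s) <= sqrt ?R" by (rule real_le_rsqrt)
  moreover have "cmod (u s) <= cmod (w s) + cmod (u (c - s))"
   using norm_triangle_ineq4[of "w s" "\<sigma> * u (c - s)"] \<sigma> by (simp add: w_def norm_mult)
  ultimately show ?thesis by linarith
 qed
 from cases show ?thesis
 proof
  assume ut: "cmod (u t) <= \<eta>"
  \<comment> \<open>In the odd case the second initial value is controlled by the eigenvalue
    equation at the center itself.\<close>
  have "cmod (u (t + 1) + u (t - 1)) <= A * \<eta>" unfolding eq norm_mult by (intro mult_mono EA ut) (use A0 in auto)
  then show ?thesis using ut by (intro step[of 1]) (simp_all add: C norm_mult algebra_simps flip: mult_2)
 next
  assume "cmod (u (t + 1) - u (t - 1)) <= \<eta>"
  moreover have "\<eta> <= C * \<eta>" using mult_right_mono[of 1 C \<eta>] A0 \<eta>0 by (simp add: C)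
  ultimately show ?thesis by (intro step[of "- 1"]) simp_all
 qed
qed

lemma no_eigenvalue_int:
 fixes \<omega> :: "int \<Rightarrow>\<^sub>C real"
 assumes sym: "nearly_symmetric (%k. real_of_int \<bar>k\<bar>) \<omega>"
 shows "no_point_spectrum (count_space UNIV) (schroedinger_int \<omega>)" unfolding no_point_spectrum_def
proof clarify
 fix E u assume uL: "u \<in> L2 (count_space UNIV)" and nz: "~ (AE x in count_space UNIV. u x = 0)" and ev: "(u, %x. E * u x) \<in> schroedinger_int \<omega>"
 have eq: "u (m + 1) + u (m - 1) = (E - cor (\<omega> m)) * u m" for m
 proof -
  have "(%n. E * u n) = (%n. u (n + 1) + u (n - 1) + cor (\<omega> n) * u n)" using ev by (simp add: schroedinger_int_def)
  from fun_cong[OF this, of m] show ?thesis by (simp add: algebra_simps)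
 qed
 obtain T where T: "!!n::nat. real n <= real_of_int \<bar>T n\<bar>" "!!n. dist (reflect (T n + T n) \<omega>) \<omega> < exp (- (real_of_int \<bar>T n\<bar>)\<^sup>2)"
  using sym unfolding nearly_symmetric_def by metis
 have "u s = 0" for s
 proof (rule gaussian_decay[where T = "%n. real_of_int \<bar>T n\<bar>" and d = "%n. cmod (u (T n + T n - s))"])
  show "cmod (u s) <= sqrt (((norm \<omega> + cmod E + 2 + 1) * sqrt (LINT k|count_space UNIV. (cmod (u k))\<^sup>2))\<^sup>2 * exp (- (real_of_int \<bar>T n\<bar>)\<^sup>2)
   * exp (2 * ln (norm \<omega> + cmod E + 2) * (real_of_int \<bar>T n\<bar> + real_of_int \<bar>s\<bar>))) + cmod (u (T n + T n - s))" for n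
   by (rule almost_symmetric_bound_int[OF refl eq uL T(2)[of n]]) simp
  show "real n <= real_of_int \<bar>T n\<bar>" for n by (rule T)
  have "real n <= real_of_int \<bar>T n + T n - s\<bar> + real_of_int \<bar>s\<bar>" for n using T(1)[of n] by linarith
  from tendsto_norm_zero[OF l2_int_tendsto[OF uL this]] show "(%n. cmod (u (T n + T n - s))) ----> 0" .
 qed simp
 then show False using nz by simp
qed


section \<open>Translation invariance of the spectral measures\<close>

text \<open>Measure preserving bijections with measurable inverse, here the translations. The
  symmetric assumptions let every fact be used for the inverse as well.\<close>

locale measure_isomorphism =
 fixes M :: "'a measure" and T T' :: "'a => 'a"
 assumes T: "T \<in> measurable M M" "distr M M T = M" and T': "T' \<in> measurable M M" "distr M M T' = M"
  and inverse: "!!x. T (T' x) = x" "!!x. T' (T x) = x"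
begin

lemma L2_comp: "f \<in> L2 M ==> (%x. f (T x)) \<in> L2 M"
proof -
 assume f: "f \<in> L2 M"
 then have m: "(%x. f (T x)) \<in> borel_measurable M" using T(1) by (auto simp: L2_def intro: measurable_compose)
 have "integrable (distr M M T) (%x. (cmod (f x))\<^sup>2)" using f by (simp add: T(2) L2_def)
 then have "integrable M (%x. (cmod (f (T x)))\<^sup>2)" by (rule integrable_distr[OF T(1)])
 then show ?thesis using m by (simp add: L2_def)
qed

lemma integral_comp: "f \<in> borel_measurable M ==> (LINT x|M. f (T x)) = (LINT x|M. f x)"
 for f :: "'a => 'b::{banach, second_countable_topology}" using integral_distr[OF T(1), of f] by (simp add: T(2))

lemma norm_comp: "f \<in> borel_measurable M ==> L2_norm M (%x. f (T x)) = L2_norm M f"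
 using integral_comp[of "%x. (cmod (f x))\<^sup>2"] by (simp add: L2_norm_def)

lemma inner_comp: "f \<in> L2 M ==> g \<in> L2 M ==> L2_inner M (%x. f (T x)) (%x. g (T x)) = L2_inner M f g"
 using integral_comp[of "%x. cnj (f x) * g x"] by (simp add: L2_inner_def L2_inner_integrable borel_measurable_integrable)

lemma AE_comp: "AE x in M. P x ==> AE x in M. P (T x)" using AE_distrD[OF T(1), of P] unfolding T(2) .

end

lemma (in measure_isomorphism) measure_isomorphism_inverse: "measure_isomorphism M T' T" using T T' inverse by unfold_locales

text \<open>The group is conjugated by the unitary map f to f o T', and its generator is conjugated
  along with it.\<close>

lemma (in measure_isomorphism) is_exp_group_comp:
 assumes U: "is_exp_group M D U" and D: "!!f g. (f, g) \<in> D' \<longleftrightarrow> ((%x. f (T' x)), (%x. g (T' x))) \<in> D"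
 shows "is_exp_group M D' (%s f x. U s (%y. f (T' y)) (T x))"
proof -
 interpret inv: measure_isomorphism M T' T by (rule measure_isomorphism_inverse)
 have ug: "unitary_group M U" and gen: "!!f g. (f, g) \<in> D \<longleftrightarrow> f \<in> L2 M & g \<in> L2 M \<and>
    ((%s. L2_norm M (%x. (U s f x - f x) / cor s - \<i> * g x)) ---> 0) (at 0)" using U unfolding is_exp_group_def by blast+
 have UL: "U s f \<in> L2 M" and Un: "L2_norm M (U s f) = L2_norm M f" if "f \<in> L2 M" for s f
  using ug that unfolding unitary_group_def by blast+
 have lin: "AE x in M. U s (%y. a * f y + b * g y) x = a * U s f x + b * U s g x" if "f \<in> L2 M" "g \<in> L2 M" for s f g a b
  using ug that unfolding unitary_group_def by blast
 have L2_iff: "(%x. f (T' x)) \<in> L2 M \<longleftrightarrow> f \<in> L2 M" for f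
  using L2_comp[of "%x. f (T' x)"] inv.L2_comp[of f] by (auto simp: inverse)
 have meas: "f \<in> borel_measurable M" if "f \<in> L2 M" for f using that by (simp add: L2_def)
 have nrm: "L2_norm M (%x. F (U s (%y. f (T' y)) (T x)) (f x) (g x)) = L2_norm M (%x. F (U s (%y. f (T' y)) x) (f (T' x)) (g (T' x)))"
  if "(%x. F (U s (%y. f (T' y)) x) (f (T' x)) (g (T' x))) \<in> borel_measurable M" for F :: "complex => complex => complex => complex" and s f g
  using norm_comp[OF that] by (simp add: inverse)
 show ?thesis unfolding is_exp_group_def unitary_group_def
 proof (intro conjI allI ballI)
  fix s f assume f: "f \<in> L2 M"
  have f': "(%y. f (T' y)) \<in> L2 M" using f by (rule inv.L2_comp)
  show "(%x. U s (%y. f (T' y)) (T x)) \<in> L2 M" by (rule L2_comp[OF UL[OF f']])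
  show "L2_norm M (%x. U s (%y. f (T' y)) (T x)) = L2_norm M f" using norm_comp[OF meas[OF UL[OF f']]] Un[OF f'] inv.norm_comp[OF meas[OF f]] by simp
 next
  fix s f g a b assume fg: "f \<in> L2 M" "g \<in> L2 M"
  have "AE x in M. U s (%y. a * f (T' y) + b * g (T' y)) x = a * U s (%y. f (T' y)) x + b * U s (%y. g (T' y)) x"
   by (rule lin[OF inv.L2_comp[OF fg(1)] inv.L2_comp[OF fg(2)]])
  from AE_comp[OF this] show "AE x in M. U s (%y. a * f (T' y) + b * g (T' y)) (T x) = a * U s (%y. f (T' y)) (T x) + b * U s (%y. g (T' y)) (T x)" .
 next
  fix f assume "f \<in> L2 M"
  then have "AE x in M. U 0 (%y. f (T' y)) x = f (T' x)" using ug inv.L2_comp unfolding unitary_group_def by blast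
  from AE_comp[OF this] show "AE x in M. U 0 (%y. f (T' y)) (T x) = f x" by (simp add: inverse)
 next
  fix s t f assume "f \<in> L2 M"
  then have "AE x in M. U (s + t) (%y. f (T' y)) x = U s (U t (%y. f (T' y))) x" using ug inv.L2_comp unfolding unitary_group_def by blast
  from AE_comp[OF this] show "AE x in M. U (s + t) (%y. f (T' y)) (T x) = U s (%y. U t (%y. f (T' y)) (T (T' y))) (T x)" by (simp add: inverse)
 next
  fix f assume f: "f \<in> L2 M"
  have f': "(%y. f (T' y)) \<in> L2 M" using f by (rule inv.L2_comp)
  have "((%s. L2_norm M (%x. U s (%y. f (T' y)) x - f (T' x))) ---> 0) (at 0)" using ug f' unfolding unitary_group_def by blast
  moreover have "L2_norm M (%x. U s (%y. f (T' y)) (T x) - f x) = L2_norm M (%x. U s (%y. f (T' y)) x - f (T' x))" for s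
   by (rule nrm[of "%a b c. a - b" s f f]) (intro borel_measurable_diff meas UL f')
  ultimately show "((%s. L2_norm M (%x. U s (%y. f (T' y)) (T x) - f x)) ---> 0) (at 0)" by simp
 next
  fix f g
  have "((%s. L2_norm M (%x. (U s (%y. f (T' y)) x - f (T' x)) / cor s - \<i> * g (T' x))) ---> 0) (at 0)
    \<longleftrightarrow> ((%s. L2_norm M (%x. (U s (%y. f (T' y)) (T x) - f x) / cor s - \<i> * g x)) ---> 0) (at 0)"
   if fg: "f \<in> L2 M" "g \<in> L2 M"
  proof -
   have "L2_norm M (%x. (U s (%y. f (T' y)) (T x) - f x) / cor s - \<i> * g x) = L2_norm M (%x. (U s (%y. f (T' y)) x - f (T' x)) / cor s - \<i> * g (T' x))" for s
    by (rule nrm[of "%a b c. (a - b) / cor s - \<i> * c" s f g])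
     (intro borel_measurable_diff borel_measurable_divide borel_measurable_times borel_measurable_const meas UL inv.L2_comp fg)
   then show ?thesis by simp
  qed
  then show "(f, g) \<in> D' \<longleftrightarrow> f \<in> L2 M & g \<in> L2 M & ((%s. L2_norm M (%x. (U s (%y. f (T' y)) (T x) - f x) / cor s - \<i> * g x)) ---> 0) (at 0)"
   unfolding D gen L2_iff by blast
 qed
qed

text \<open>Conjugating groups in both directions shows that the two definite descriptions have the
  same predicate in \<open>\<mu>\<close>, so they agree without an appeal to existence or
  uniqueness.\<close>

lemma (in measure_isomorphism) spectral_measure_comp:
 assumes D: "!!f g. (f, g) \<in> D' \<longleftrightarrow> ((%x. f (T' x)), (%x. g (T' x))) \<in> D" and \<psi>: "\<psi> \<in> L2 M"
 shows "spectral_measure M D' \<psi> = spectral_measure M D (%x. \<psi> (T' x))"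
proof -
 interpret inv: measure_isomorphism M T' T by (rule measure_isomorphism_inverse)
 let ?\<psi> = "%x. \<psi> (T' x)"
 have \<psi>': "?\<psi> \<in> L2 M" using \<psi> by (rule inv.L2_comp)
 have UL: "U s f \<in> L2 M" if "is_exp_group M D U" "f \<in> L2 M" for U s f and D :: "'a operator"
  using that unfolding is_exp_group_def unitary_group_def by blast
 have "(EX U. is_exp_group M D' U & (ALL s. L2_inner M \<psi> (U s \<psi>) = char \<mu> s))
   \<longleftrightarrow> (EX U. is_exp_group M D U & (ALL s. L2_inner M ?\<psi> (U s ?\<psi>) = char \<mu> s))" for \<mu>
 proof
  assume "EX U. is_exp_group M D' U & (ALL s. L2_inner M \<psi> (U s \<psi>) = char \<mu> s)"
  then obtain U where U: "is_exp_group M D' U" "!!s. L2_inner M \<psi> (U s \<psi>) = char \<mu> s" by blast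
  have "is_exp_group M D (%s f x. U s (%y. f (T y)) (T' x))" by (rule inv.is_exp_group_comp[OF U(1)]) (simp add: D inverse)
  moreover have "L2_inner M ?\<psi> (%x. U s (%y. ?\<psi> (T y)) (T' x)) = char \<mu> s" for s
   using inv.inner_comp[OF \<psi> UL[OF U(1) \<psi>], of s] U(2)[of s] by (simp add: inverse)
  ultimately show "EX U. is_exp_group M D U & (ALL s. L2_inner M ?\<psi> (U s ?\<psi>) = char \<mu> s)" by blast
 next
  assume "EX U. is_exp_group M D U & (ALL s. L2_inner M ?\<psi> (U s ?\<psi>) = char \<mu> s)"
  then obtain U where U: "is_exp_group M D U" "!!s. L2_inner M ?\<psi> (U s ?\<psi>) = char \<mu> s" by blast
  have "is_exp_group M D' (%s f x. U s (%y. f (T' y)) (T x))" by (rule is_exp_group_comp[OF U(1) D])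
  moreover have "L2_inner M \<psi> (%x. U s ?\<psi> (T x)) = char \<mu> s" for s
   using inner_comp[OF \<psi>' UL[OF U(1) \<psi>'], of s] U(2)[of s] by (simp add: inverse)
  ultimately show "EX U. is_exp_group M D' U & (ALL s. L2_inner M \<psi> (U s \<psi>) = char \<mu> s)" by blast
 qed
 then show ?thesis unfolding spectral_measure_def by simp
qed

lemma (in measure_isomorphism) no_ac_spectrum_comp:
 assumes "!!f g. (f, g) \<in> D' \<longleftrightarrow> ((%x. f (T' x)), (%x. g (T' x))) \<in> D" and "no_ac_spectrum M D"
 shows "no_ac_spectrum M D'"
proof -
 interpret inv: measure_isomorphism M T' T by (rule measure_isomorphism_inverse)
 show ?thesis using assms(2) spectral_measure_comp[OF assms(1)] inv.L2_comp unfolding no_ac_spectrum_def by auto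
qed

lemma measure_isomorphism_lborel: "measure_isomorphism lborel (%x. x + s) (%x. x - s :: real)"
proof
 have "distr lborel lborel (%x. x + t) = lborel" for t :: real
  using lborel_distr_plus[of t] by (simp add: add.commute[of t] cong: distr_cong)
 from this[of s] this[of "- s"] show "distr lborel lborel (%x. x + s) = lborel" "distr lborel lborel (%x. x - s) = lborel" by simp_all
qed auto

lemma measure_isomorphism_count: "measure_isomorphism (count_space UNIV) (%x. x + s) (%x. x - s :: int)"
proof
 have "distr (count_space UNIV) (count_space UNIV) (%x. x + t) = count_space UNIV" for t :: int
  by (rule distr_bij_count_space[OF bij_plus_right])
 from this[of s] this[of "- s"] show "distr (count_space UNIV) (count_space UNIV) (%x. x + s) = count_space UNIV"
  "distr (count_space UNIV) (count_space UNIV) (%x. x - s) = count_space UNIV" by simp_all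
qed auto

section \<open>Covariance of the two operators under translation\<close>

lemma test_function_shift:
 assumes \<phi>: "test_function \<phi>"
 shows "test_function (%x. \<phi> (x + a))" "deriv (%x. \<phi> (x + a)) = (%x. deriv \<phi> (x + a))"
proof -
 obtain R where R: "!!x. \<bar>x\<bar> > R ==> \<phi> x = 0" and s: "smooth \<phi>" using \<phi> unfolding test_function_iff by blast
 have "\<phi> (x + a) = 0" if "\<bar>x\<bar> > R + \<bar>a\<bar>" for x using that by (intro R) linarith
 then show "test_function (%x. \<phi> (x + a))" using smooth_affine[OF s, of 1 a] unfolding test_function_iff by auto
 show "deriv (%x. \<phi> (x + a)) = (%x. deriv \<phi> (x + a))" using smooth_DERIV[OF s] by (intro ext DERIV_imp_deriv) (simp flip: DERIV_shift)
qed

lemma weak_derivative_shift: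
 assumes "weak_derivative f f'" shows "weak_derivative (%x. f (x + a)) (%x. f' (x + a))" unfolding weak_derivative_def
proof (intro allI impI)
 fix \<phi> assume \<phi>: "test_function \<phi>"
 have "(LINT x|lborel. f x * cor (deriv \<phi> (x - a))) = - (LINT x|lborel. f' x * cor (\<phi> (x - a)))"
  using assms[unfolded weak_derivative_def, rule_format, OF test_function_shift(1)[OF \<phi>, of "- a"]]
  unfolding test_function_shift(2)[OF \<phi>] by simp
 moreover have "(LINT x|lborel. g x) = (LINT x|lborel. g (x + a))" for g :: "real => complex"
  using lborel_integral_real_affine[of 1 g a] by (simp add: add.commute)
 ultimately show "(LINT x|lborel. f (x + a) * cor (deriv \<phi> x)) = - (LINT x|lborel. f' (x + a) * cor (\<phi> x))"
  by (metis (mono_tags, lifting) lint_cong add_diff_cancel_right')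
qed

lemma schroedinger_real_translate:
 "(f, g) \<in> schroedinger_real (translate s \<omega>) \<longleftrightarrow> ((%x. f (x - s)), (%x. g (x - s))) \<in> schroedinger_real \<omega>"
proof -
 have shift: "((%x. f (x + a)), (%x. g (x + a))) \<in> schroedinger_real \<omega>'"
  if fg: "(f, g) \<in> schroedinger_real \<omega>" and \<omega>': "!!x. \<omega>' x = \<omega> (x + a)" for f g a and \<omega> \<omega>' :: "real \<Rightarrow>\<^sub>C real"
 proof -
  interpret measure_isomorphism lborel "%x. x + a" "%x. x - a" by (rule measure_isomorphism_lborel)
  obtain f' f'' where f: "f \<in> L2 lborel" "g \<in> L2 lborel" "f' \<in> L2 lborel" "f'' \<in> L2 lborel" "weak_derivative f f'" "weak_derivative f' f''"
   "AE x in lborel. g x = - f'' x + cor (\<omega> x) * f x" using fg unfolding schroedinger_real_def by blast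
  show ?thesis unfolding schroedinger_real_def
   using L2_comp[OF f(1)] L2_comp[OF f(2)] L2_comp[OF f(3)] L2_comp[OF f(4)] weak_derivative_shift[OF f(5), of a]
    weak_derivative_shift[OF f(6), of a] AE_comp[OF f(7)] by (auto simp: \<omega>')
 qed
 show ?thesis
  using shift[of f g "translate s \<omega>" \<omega> "- s"] shift[of "%x. f (x - s)" "%x. g (x - s)" \<omega> "translate s \<omega>" s] by auto
qed

lemma schroedinger_int_translate:
 "(f, g) \<in> schroedinger_int (translate s \<omega>) \<longleftrightarrow> ((%x. f (x - s)), (%x. g (x - s))) \<in> schroedinger_int \<omega>"
proof -
 have "f \<in> L2 (count_space UNIV) \<longleftrightarrow> (%x. f (x - s)) \<in> L2 (count_space UNIV)"
  using L2_shift[of f "- s"] L2_shift[of "%x. f (x - s)" s] by auto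
 moreover have "g = (%n. f (n + 1) + f (n - 1) + cor (translate s \<omega> n) * f n)
   \<longleftrightarrow> (%x. g (x - s)) = (%n. f (n + 1 - s) + f (n - 1 - s) + cor (\<omega> n) * f (n - s))" (is "?l \<longleftrightarrow> ?r")
 proof
  assume ?l then show ?r by (simp add: algebra_simps)
 next
  assume r: ?r
  show ?l
  proof
   fix n show "g n = f (n + 1) + f (n - 1) + cor (translate s \<omega> n) * f n" using fun_cong[OF r, of "n + s"] by simp
  qed
 qed
 ultimately show ?thesis unfolding schroedinger_int_def by simp
qed

section \<open>Generic spectrum\<close>

text \<open>For counting measure the sets of finite measure are finite, so their indicators are
  finite sums of those of points.\<close>

lemma total_points: "total_set (range (%n::int. abs_l2 (indicator {n})))" unfolding total_set_def
proof (intro allI impI, elim conjE)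
 fix S :: "int l2 set"
 assume S: "closed S" "0 \<in> S" "\<forall>v\<in>S. \<forall>w\<in>S. v + w \<in> S" "ALL c. \<forall>v\<in>S. c *C v \<in> S" and T: "range (%n. abs_l2 (indicator {n})) \<subseteq> S"
 show "S = UNIV"
 proof (rule total_set_finite_indicators)
  fix A :: "int set" assume "A \<in> sets vol" "emeasure vol A < \<infinity>"
  then have "finite A" by (auto simp: emeasure_count_space split: if_splits)
  then show "abs_l2 (indicator A) \<in> S"
  proof (induction A rule: finite_induct)
   case empty
   then show ?case using S(2) by (simp add: abs_l2_zero)
  next
   case (insert a A)
   have L: "indicator B \<in> L2 (vol :: int measure)" if "finite B" for B
    using that by (intro indicator_L2) (auto simp: emeasure_count_space of_nat_less_top)
   have "(indicator (insert a A) :: int => complex) = (%x. indicator {a} x + indicator A x)" using insert(2) by (auto simp: indicator_def fun_eq_iff)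
   then have "abs_l2 (indicator (insert a A)) = abs_l2 (indicator {a}) + abs_l2 (indicator A)"
    using L[of "{a}"] L[OF insert(1)] by (simp only:) (simp add: abs_l2_add)
   then show ?case using S(3) T insert(3) by auto
  qed
 qed (use S in auto)
qed

lemma norm_potential_diff:
 assumes "sets borel \<subseteq> sets (vol :: 'a::{l2_space, topological_space} measure)" "space (vol :: 'a measure) = UNIV"
 shows "norm (potential V v - potential W v) <= dist V W * norm (v :: 'a l2)"
 using norm_potential[OF assms, of "V - W" v] by (simp add: potential_diff[OF assms] dist_norm)

text \<open>The argument common to line and lattice. In the second part the dense set without
  absolutely continuous spectrum is the orbit of \<open>\<omega>\<^sub>0\<close>, along which
  \<open>tr\<close> transports the hypothesis.\<close>

lemma generic_spectrum:
 fixes V :: "'a::{ring_1,topological_monoid_add,l2_space} \<Rightarrow>\<^sub>C real" and D :: "('a \<Rightarrow>\<^sub>C real) => 'a operator"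
 assumes len: "translation_ring len"
  and base: "sets borel \<subseteq> sets (vol :: 'a measure)" "space (vol :: 'a measure) = UNIV"
  and D: "!!\<omega>. schroedinger_like (D \<omega>)" "!!\<omega>. lift_graph (D \<omega>) = (%(v, w). (v, w + \<i> *C potential \<omega> v)) ` A"
  and np: "!!\<omega>. nearly_symmetric len \<omega> ==> no_point_spectrum vol (D \<omega>)"
  and tr: "!!s \<omega>. no_ac_spectrum vol (D \<omega>) ==> no_ac_spectrum vol (D (translate s \<omega>))"
  and T: "countable T" "total_set (T :: 'a l2 set)"
  and V: "almost_periodic V" "ALL x. V (- x) = V x"
 shows "(EX G. dense_gdelta_in (top_of_set (bohr_hull V)) G & (\<forall>\<omega>\<in>G. no_point_spectrum vol (D \<omega>))) \<and>
  ((\<exists>\<omega>\<^sub>0\<in>bohr_hull V. no_ac_spectrum vol (D \<omega>\<^sub>0)) -->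
   (EX G. dense_gdelta_in (top_of_set (bohr_hull V)) G & (\<forall>\<omega>\<in>G. purely_sc_spectrum vol (D \<omega>))))"
proof -
 interpret translation_ring len by (rule len)
 let ?G = "{\<omega> \<in> bohr_hull V. nearly_symmetric len \<omega>}"
 have G: "dense_gdelta_in (top_of_set (bohr_hull V)) ?G" using V by (intro dense_gdelta_nearly_symmetric) auto
 have "EX G. dense_gdelta_in (top_of_set (bohr_hull V)) G & (\<forall>\<omega>\<in>G. purely_sc_spectrum vol (D \<omega>))"
  if \<omega>\<^sub>0: "\<omega>\<^sub>0 \<in> bohr_hull V" and ac: "no_ac_spectrum vol (D \<omega>\<^sub>0)" for \<omega>\<^sub>0
 proof (rule generic_singular_continuous)
  show "compact (bohr_hull V)" using V by (simp add: almost_periodic_def bohr_hull_def)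
  show "EX w'. (v, w') \<in> lift_graph (D \<omega>') & norm (w - w') <= dist \<omega> \<omega>' * norm v"
   if vw: "(v, w) \<in> lift_graph (D \<omega>)" for \<omega> \<omega>' v w
   by (rule lift_graph_dominated[OF D(2) norm_potential_diff[OF base] vw])
  show "range (%s. translate s \<omega>\<^sub>0) \<subseteq> bohr_hull V" "bohr_hull V \<subseteq> closure (range (%s. translate s \<omega>\<^sub>0))"
   by (rule translates_dense[OF \<omega>\<^sub>0])+
 qed (use G np D T tr[OF ac] in auto)
 then show ?thesis using G np by blast
qed

theorem theorem6:
  shows
    "(\<forall>V :: real \<Rightarrow>\<^sub>C real.
        almost_periodic V \<and> (\<forall>x. V (- x) = V x) \<longrightarrow>
          (\<exists>G. dense_gdelta_in (top_of_set (bohr_hull V)) G \<and>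
             (\<forall>\<omega>\<in>G. no_point_spectrum lborel (schroedinger_real \<omega>))) \<and>
          ((\<exists>\<omega>\<^sub>0\<in>bohr_hull V. no_ac_spectrum lborel (schroedinger_real \<omega>\<^sub>0)) \<longrightarrow>
             (\<exists>G. dense_gdelta_in (top_of_set (bohr_hull V)) G \<and>
                (\<forall>\<omega>\<in>G. purely_sc_spectrum lborel (schroedinger_real \<omega>))))) \<and>
     (\<forall>V :: int \<Rightarrow>\<^sub>C real.
        almost_periodic V \<and> (\<forall>n. V (- n) = V n) \<longrightarrow>
          (\<exists>G. dense_gdelta_in (top_of_set (bohr_hull V)) G \<and>
             (\<forall>\<omega>\<in>G. no_point_spectrum (count_space UNIV) (schroedinger_int \<omega>))) \<and>
          ((\<exists>\<omega>\<^sub>0\<in>bohr_hull V. no_ac_spectrum (count_space UNIV) (schroedinger_int \<omega>\<^sub>0)) \<longrightarrow>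
             (\<exists>G. dense_gdelta_in (top_of_set (bohr_hull V)) G \<and>
                (\<forall>\<omega>\<in>G. purely_sc_spectrum (count_space UNIV) (schroedinger_int \<omega>)))))"
proof (intro conjI allI impI; elim conjE)
  fix V :: "real \<Rightarrow>\<^sub>C real"
  assume V: "almost_periodic V" "\<forall>x. V (- x) = V x"
  note g = generic_spectrum[OF translation_ring_real borel_le_lborel schroedinger_like_real lift_graph_schroedinger_real _ _
      countable_rational_ioc total_rational_ioc V, unfolded vol_lborel, OF no_eigenvalue_real
      measure_isomorphism.no_ac_spectrum_comp[OF measure_isomorphism_lborel schroedinger_real_translate]]
  show "\<exists>G. dense_gdelta_in (top_of_set (bohr_hull V)) G \<and> (\<forall>\<omega>\<in>G. no_point_spectrum lborel (schroedinger_real \<omega>))"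
    using g by blast
  assume "\<exists>\<omega>\<^sub>0\<in>bohr_hull V. no_ac_spectrum lborel (schroedinger_real \<omega>\<^sub>0)"
  then show "\<exists>G. dense_gdelta_in (top_of_set (bohr_hull V)) G \<and> (\<forall>\<omega>\<in>G. purely_sc_spectrum lborel (schroedinger_real \<omega>))"
    using g by blast
next
  fix V :: "int \<Rightarrow>\<^sub>C real"
  assume V: "almost_periodic V" "\<forall>n. V (- n) = V n"
  note g = generic_spectrum[OF translation_ring_int borel_le_count schroedinger_like_int lift_graph_schroedinger_int _ _
      _ total_points V, unfolded vol_count, OF no_eigenvalue_int
      measure_isomorphism.no_ac_spectrum_comp[OF measure_isomorphism_count schroedinger_int_translate] countableI_type[THEN countable_image]]
  show "\<exists>G. dense_gdelta_in (top_of_set (bohr_hull V)) G \<and> (\<forall>\<omega>\<in>G. no_point_spectrum (count_space UNIV) (schroedinger_int \<omega>))"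
    using g by blast
  assume "\<exists>\<omega>\<^sub>0\<in>bohr_hull V. no_ac_spectrum (count_space UNIV) (schroedinger_int \<omega>\<^sub>0)"
  then show "\<exists>G. dense_gdelta_in (top_of_set (bohr_hull V)) G \<and> (\<forall>\<omega>\<in>G. purely_sc_spectrum (count_space UNIV) (schroedinger_int \<omega>))"
    using g by blast
qed

end
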